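(* In the setting described in the context, let $\mathcal C$ be the class of (isomorphic copies of) the schemes $(Z_I,\mathcal O_{Z_I})$, $I\subseteq\mathbb Z_{>0}$, regarded as unions of subspaces of $(Z,\mathcal O_Z)$. Then for every Turing degree $\mathbf d$ there is a member of $\mathcal C$ whose isomorphism type has Turing degree $\mathbf d$, and there is a member of $\mathcal C$ whose isomorphism type has no Turing degree.
   Context: Let $k$ be an algebraically closed computable field, $n\ge1$, $\bar x=(x_1,\dots,x_n)$. Let $V\subseteq\mathbb A^{n+1}_k$ be either $\mathbb A^n_k$ or the zero set of $F(x_1,\dots,x_n,z)=\sum_{j=0}^{m}f_j(\bar x)z^j$ with $f_j\in k[\bar x]$, $f_m=1$, such that for every $c\in k$ and every $j$ the polynomial obtained by substituting $c$ for $x_j$ is irreducible in the polynomial ring over $k$ in $z$ and the remaining variables. Let $K$ be the fraction field of the coordinate ring of $V$, and $\phi:\mathbb Z_{>0}\to k$ a computable listing of $k$. For $I_1,\dots,I_n\subseteq\mathbb Z_{>0}$: $P_{I_1,\dots,I_n}=\{h\in k[\bar x]:\forall j\ \forall a\in\phi(I_j)\ h\not\equiv0\bmod(x_j-a)\}$; $R_{I_1,\dots,I_n}=\{g_1/g_2:g_1,g_2\in k[\bar x],g_2\in P_{I_1,\dots,I_n}\}$; $\bar R_{I_1,\dots,I_n}$ its integral closure in $K$. For $I\subseteq\mathbb Z_{>0}$ put $R_I=R_{I_1,\dots,I_n}$ with $I_1=I$ and $I_j=\mathbb Z_{>0}$ for $j=2,\dots,n$, and define $\bar R_I$ and $Z_I=\operatorname{Spec}\bar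 R_I$ likewise (Zariski topology, structure sheaf $\mathcal F(O)=\bigcap_{\mathfrak p\in O}(\bar R_I)_{\mathfrak p}$). Let $Z=\operatorname{Spec}\bar R_{\mathbb Z_{>0}}$. Schemes are regarded as structures in a language with predicates for open sets, ring languages for the rings, membership predicates for the rings $\mathcal F(O)$ and relations for restriction maps; the Turing degree of a structure is that of its atomic diagram; the Turing degree of an isomorphism type, if it exists, is the least Turing degree of a structure isomorphic to it. *)

theory Defs
  imports
    "HOL-Library.Nat_Bijection"
    "HOL-Library.Poly_Mapping"
    "HOL-Library.FuncSet"
    "HOL-Computational_Algebra.Polynomial"
    "HOL-Algebra.QuotRing"
    "HOL-Algebra.Ring_Divisibility"
begin

section \<open>Relative computability and Turing degrees\<close>

text \<open>
  Programs for the partial recursive functions relative to an oracle, which is queried about the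
  first argument.  \<open>run A e xs y\<close> means that the program \<open>e\<close>, with oracle \<open>A\<close> and input \<open>xs\<close>,
  halts with output \<open>y\<close>.  Arities are not tracked: where an argument is missing, the program
  has no output.
\<close>

datatype prog = Zr | Sc | Proj nat | Query | Comp prog "prog list" | PrimRec prog prog | Mu prog

inductive run :: "nat set \<Rightarrow> prog \<Rightarrow> nat list \<Rightarrow> nat \<Rightarrow> bool" for A :: "nat set" where
  run_Zr: "run A Zr xs 0"
| run_Sc: "run A Sc (x # xs) (Suc x)"
| run_Proj: "i < length xs \<Longrightarrow> run A (Proj i) xs (xs ! i)"
| run_Query: "run A Query (x # xs) (of_bool (x \<in> A))"
| run_Comp: "list_all2 (\<lambda>g y. run A g xs y) gs ys \<Longrightarrow> run A e ys z \<Longrightarrow> run A (Comp e gs) xs z"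
| run_PrimRec_0: "run A e xs z \<Longrightarrow> run A (PrimRec e g) (0 # xs) z"
| run_PrimRec_Suc: "run A (PrimRec e g) (t # xs) y \<Longrightarrow> run A g (t # y # xs) z
    \<Longrightarrow> run A (PrimRec e g) (Suc t # xs) z"
| run_Mu: "run A e (t # xs) 0 \<Longrightarrow> \<forall>s<t. \<exists>y. run A e (s # xs) (Suc y) \<Longrightarrow> run A (Mu e) xs t"

definition turing_le :: "nat set \<Rightarrow> nat set \<Rightarrow> bool" where
  "turing_le B A \<longleftrightarrow> (\<exists>e. \<forall>x. run A e [x] (of_bool (x \<in> B)))"

definition turing_equiv :: "(nat set \<times> nat set) set" where
  "turing_equiv = {(A, B). turing_le A B \<and> turing_le B A}"

definition turing_degrees :: "nat set set set" where
  "turing_degrees = UNIV // turing_equiv"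

definition turing_degree :: "nat set \<Rightarrow> nat set set" where
  "turing_degree A = turing_equiv `` {A}"

definition degree_le :: "nat set set \<Rightarrow> nat set set \<Rightarrow> bool" where
  "degree_le d e \<longleftrightarrow> (\<exists>A\<in>d. \<exists>B\<in>e. turing_le A B)"

lemma run_deterministic: "run A e xs y \<Longrightarrow> run A e xs z \<Longrightarrow> y = z"
proof (induction arbitrary: z rule: run.induct)
  case (run_Comp xs gs ys e y)
  from run_Comp.prems obtain ys' where *: "list_all2 (\<lambda>g y. run A g xs y) gs ys'" "run A e ys' z"
    by (cases rule: run.cases) auto
  have "ys = ys'"
    using run_Comp(1) *(1) by (auto simp: list_all2_conv_all_nth intro!: nth_equalityI)
  then show ?case using run_Comp.IH *(2) by auto
next
  case (run_Mu e t xs)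
  from run_Mu.prems have *: "run A e (z # xs) 0" "\<forall>s<z. \<exists>y. run A e (s # xs) (Suc y)"
    by (cases rule: run.cases; auto)+
  show ?case
    using run_Mu.IH * by (metis nat.distinct(1) nat_neq_iff)
next
  case (run_PrimRec_0 e xs z g z')
  from run_PrimRec_0.prems have "run A e xs z'"
    by (cases rule: run.cases) auto
  then show ?case by (rule run_PrimRec_0.IH)
next
  case (run_PrimRec_Suc e g t xs y z z')
  from run_PrimRec_Suc.prems obtain y' where "run A (PrimRec e g) (t # xs) y'"
    "run A g (t # y' # xs) z'"
    by (cases rule: run.cases) auto
  then show ?case using run_PrimRec_Suc.IH by metis
qed (erule run.cases; simp)+

lemma turing_le_refl: "turing_le A A"
  unfolding turing_le_def using run_Query by blast

primrec answer_with :: "prog \<Rightarrow> prog \<Rightarrow> prog" where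
  "answer_with q Zr = Zr"
| "answer_with q Sc = Sc"
| "answer_with q (Proj i) = Proj i"
| "answer_with q Query = Comp q [Proj 0]"
| "answer_with q (Comp e gs) = Comp (answer_with q e) (map (answer_with q) gs)"
| "answer_with q (PrimRec e g) = PrimRec (answer_with q e) (answer_with q g)"
| "answer_with q (Mu e) = Mu (answer_with q e)"

lemma run_answer_with:
  assumes q: "\<forall>x. run A q [x] (of_bool (x \<in> B))" and "run B e xs y"
  shows "run A (answer_with q e) xs y"
  using assms(2)
proof (induction rule: run.induct)
  case (run_Query x xs)
  have "list_all2 (\<lambda>g y. run A g (x # xs) y) [Proj 0] [x]"
    using run.run_Proj[of 0 "x # xs" A] by simp
  from run.run_Comp[OF this q[rule_format]] show ?case by simp
next
  case (run_Comp xs gs ys e z)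
  then show ?case
    by (auto intro!: run.run_Comp simp: list_all2_conv_all_nth)
next
  case (run_Mu e t xs)
  then show ?case by (auto intro!: run.run_Mu)
qed (auto intro: run.intros)

lemma turing_le_trans: "turing_le C B \<Longrightarrow> turing_le B A \<Longrightarrow> turing_le C A"
  unfolding turing_le_def using run_answer_with by meson

lemma equiv_turing_equiv: "equiv UNIV turing_equiv"
  by (rule equivI)
     (auto simp: turing_equiv_def refl_on_def sym_def trans_def
       intro: turing_le_refl turing_le_trans)

lemma degree_le_iff: "degree_le (turing_degree A) (turing_degree B) \<longleftrightarrow> turing_le A B"
  unfolding degree_le_def turing_degree_def turing_equiv_def
  by (auto intro: turing_le_trans turing_le_refl)

section \<open>Structures on sets of natural numbers and their degrees\<close>

text \<open>
  The language of ringed spaces, with sorts for points, open sets and sections.  A section belongs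
  to the ring of exactly one open set; the rings of different open sets are disjoint and are
  connected only by the restriction maps.  The ring operations are given by their graphs, each
  relating sections over one and the same open set.
\<close>

datatype rs_symbol = IsPoint | IsOpen | PointIn | SectionOver | SumIs | ProdIs | IsZero | IsOne
  | RestrictsTo

primrec arity :: "rs_symbol \<Rightarrow> nat" where
  "arity IsPoint = 1"
| "arity IsOpen = 1"
| "arity PointIn = 2"
| "arity SectionOver = 2"
| "arity SumIs = 3"
| "arity ProdIs = 3"
| "arity IsZero = 1"
| "arity IsOne = 1"
| "arity RestrictsTo = 2"

text \<open>Code 0 is reserved for equality.\<close>

primrec symbol_code :: "rs_symbol \<Rightarrow> nat" where
  "symbol_code IsPoint = 1"
| "symbol_code IsOpen = 2"
| "symbol_code PointIn = 3"
| "symbol_code SectionOver = 4"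
| "symbol_code SumIs = 5"
| "symbol_code ProdIs = 6"
| "symbol_code IsZero = 7"
| "symbol_code IsOne = 8"
| "symbol_code RestrictsTo = 9"

record 'a rs_structure =
  universe :: "'a set"
  holds :: "rs_symbol \<Rightarrow> 'a list \<Rightarrow> bool"

definition isomorphic :: "'a rs_structure \<Rightarrow> 'b rs_structure \<Rightarrow> bool" where
  "isomorphic M N \<longleftrightarrow> (\<exists>h. bij_betw h (universe M) (universe N) \<and>
     (\<forall>r xs. set xs \<subseteq> universe M \<longrightarrow> length xs = arity r \<longrightarrow>
        (holds M r xs \<longleftrightarrow> holds N r (map h xs))))"

text \<open>
  The atomic and negated atomic sentences, with constants for the elements, that are true in the
  structure; the first entry of a code is 1 for an atomic sentence and 0 for a negated one.
\<close>

definition atomic_diagram :: "nat rs_structure \<Rightarrow> nat set" where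
  "atomic_diagram M =
     {list_encode [of_bool (x = y), 0, x, y] | x y. x \<in> universe M \<and> y \<in> universe M} \<union>
     {list_encode (of_bool (holds M r xs) # symbol_code r # xs) | r xs.
        set xs \<subseteq> universe M \<and> length xs = arity r}"

definition structure_degree :: "nat rs_structure \<Rightarrow> nat set set" where
  "structure_degree M = turing_degree (atomic_diagram M)"

definition iso_type_has_degree :: "nat rs_structure \<Rightarrow> nat set set \<Rightarrow> bool" where
  "iso_type_has_degree M d \<longleftrightarrow>
     (\<exists>N :: nat rs_structure. isomorphic N M \<and> structure_degree N = d) \<and>
     (\<forall>N :: nat rs_structure. isomorphic N M \<longrightarrow> degree_le d (structure_degree N))"

section \<open>Computable fields\<close>

text \<open>A presentation of a field on a computable set of natural numbers.\<close>

definition computable_field :: "('k::field \<Rightarrow> nat) \<Rightarrow> bool" where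
  "computable_field \<nu> \<longleftrightarrow> inj \<nu> \<and> turing_le (range \<nu>) {} \<and>
     (\<exists>e. \<forall>a b. run {} e [\<nu> a, \<nu> b] (\<nu> (a + b))) \<and>
     (\<exists>e. \<forall>a b. run {} e [\<nu> a, \<nu> b] (\<nu> (a * b)))"

definition computable_listing :: "('k \<Rightarrow> nat) \<Rightarrow> (nat \<Rightarrow> 'k) \<Rightarrow> bool" where
  "computable_listing \<nu> \<phi> \<longleftrightarrow> \<phi> ` {0<..} = UNIV \<and> (\<exists>e. \<forall>i>0. run {} e [i] (\<nu> (\<phi> i)))"

section \<open>Polynomials, the variety and its function field\<close>

text \<open>
  Polynomials in variables indexed by the natural numbers: the variable \<open>z\<close> has index \<open>0\<close>, and
  \<open>x\<^sub>1, \<dots>, x\<^sub>n\<close> have the indices \<open>1, \<dots>, n\<close>.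
\<close>

type_synonym 'k mpoly = "(nat \<Rightarrow>\<^sub>0 nat) \<Rightarrow>\<^sub>0 'k"

definition Var :: "nat \<Rightarrow> 'k::field mpoly" where
  "Var i = Poly_Mapping.single (Poly_Mapping.single i 1) 1"

definition Const :: "'k::field \<Rightarrow> 'k mpoly" where
  "Const c = Poly_Mapping.single 0 c"

definition polys_in :: "nat set \<Rightarrow> 'k::field mpoly set" where
  "polys_in S = {p. \<forall>m\<in>Poly_Mapping.keys p. Poly_Mapping.keys m \<subseteq> S}"

definition meval :: "(nat \<Rightarrow> 'k::field) \<Rightarrow> 'k mpoly \<Rightarrow> 'k" where
  "meval a p = (\<Sum>m\<in>Poly_Mapping.keys p. Poly_Mapping.lookup p m *
     (\<Prod>i\<in>Poly_Mapping.keys m. a i ^ Poly_Mapping.lookup m i))"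

definition msubst :: "nat \<Rightarrow> 'k::field \<Rightarrow> 'k mpoly \<Rightarrow> 'k mpoly" where
  "msubst j c p = (\<Sum>m\<in>Poly_Mapping.keys p.
     Poly_Mapping.single (m - Poly_Mapping.single j (Poly_Mapping.lookup m j))
       (Poly_Mapping.lookup p m * c ^ Poly_Mapping.lookup m j))"

definition ring_on :: "'a::comm_ring_1 set \<Rightarrow> 'a ring" where
  "ring_on A = \<lparr>carrier = A, monoid.mult = (*), one = 1, zero = 0, add = (+)\<rparr>"

definition zero_set :: "nat \<Rightarrow> 'k::field mpoly \<Rightarrow> (nat \<Rightarrow> 'k) set" where
  "zero_set n p = {a \<in> {0..n} \<rightarrow>\<^sub>E UNIV. meval a p = 0}"

text \<open>Affine \<open>n\<close>-space is placed in affine \<open>(n+1)\<close>-space as the hyperplane \<open>z = 0\<close>.\<close>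

definition affine_hyperplane :: "nat \<Rightarrow> (nat \<Rightarrow> 'k::field) set" where
  "affine_hyperplane n = {a \<in> {0..n} \<rightarrow>\<^sub>E UNIV. a 0 = 0}"

definition admissible_variety :: "nat \<Rightarrow> (nat \<Rightarrow> 'k::field) set \<Rightarrow> bool" where
  "admissible_variety n V \<longleftrightarrow> V = affine_hyperplane n \<or>
     (\<exists>m f F. (\<forall>i\<le>m. f i \<in> polys_in {1..n}) \<and> f m = 1 \<and> F = (\<Sum>i\<le>m. f i * Var 0 ^ i) \<and>
        (\<forall>c. \<forall>j\<in>{1..n}. ring_irreducible\<^bsub>ring_on (polys_in ({0..n} - {j}))\<^esub> (msubst j c F)) \<and>
        V = zero_set n F)"

definition vanishing_ideal :: "nat \<Rightarrow> (nat \<Rightarrow> 'k::field) set \<Rightarrow> 'k mpoly set" where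
  "vanishing_ideal n V = {p \<in> polys_in {0..n}. \<forall>a\<in>V. meval a p = 0}"

definition coordinate_ring :: "nat \<Rightarrow> (nat \<Rightarrow> 'k::field) set \<Rightarrow> 'k mpoly set ring" where
  "coordinate_ring n V = ring_on (polys_in {0..n}) Quot vanishing_ideal n V"

text \<open>The field \<open>'f\<close> is a fraction field of the ring \<open>A\<close> via the embedding \<open>\<iota>\<close>.\<close>

definition fraction_field_of :: "'a ring \<Rightarrow> ('a \<Rightarrow> 'f::field) \<Rightarrow> bool" where
  "fraction_field_of A \<iota> \<longleftrightarrow> \<iota> \<in> ring_hom A (ring_on UNIV) \<and> inj_on \<iota> (carrier A) \<and>
     (\<forall>y. \<exists>a\<in>carrier A. \<exists>b\<in>carrier A. \<iota> b \<noteq> 0 \<and> y = \<iota> a / \<iota> b)"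

definition poly_to_field ::
  "nat \<Rightarrow> (nat \<Rightarrow> 'k::field) set \<Rightarrow> ('k mpoly set \<Rightarrow> 'f::field) \<Rightarrow> 'k mpoly \<Rightarrow> 'f" where
  "poly_to_field n V \<iota> g = \<iota> (vanishing_ideal n V +>\<^bsub>ring_on (polys_in {0..n})\<^esub> g)"

section \<open>The rings and their spectra\<close>

definition P_set :: "nat \<Rightarrow> (nat \<Rightarrow> 'k::field) \<Rightarrow> (nat \<Rightarrow> nat set) \<Rightarrow> 'k mpoly set" where
  "P_set n \<phi> J = {h \<in> polys_in {1..n}. \<forall>j\<in>{1..n}. \<forall>a\<in>\<phi> ` J j.
     \<not> (Var j - Const a) divides\<^bsub>ring_on (polys_in {1..n})\<^esub> h}"

text \<open>
  The condition \<open>g2 \<noteq> 0\<close> only matters when all the sets \<open>J j\<close> are empty, since otherwise it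
  follows from \<open>g2 \<in> P_set n \<phi> J\<close>.
\<close>

definition R_ring :: "nat \<Rightarrow> (nat \<Rightarrow> 'k::field) set \<Rightarrow> ('k mpoly set \<Rightarrow> 'f::field) \<Rightarrow>
    (nat \<Rightarrow> 'k) \<Rightarrow> (nat \<Rightarrow> nat set) \<Rightarrow> 'f set" where
  "R_ring n V \<iota> \<phi> J = {poly_to_field n V \<iota> g1 / poly_to_field n V \<iota> g2 | g1 g2.
     g1 \<in> polys_in {1..n} \<and> g2 \<in> P_set n \<phi> J \<and> g2 \<noteq> 0}"

definition integral_closure :: "'f::field set \<Rightarrow> 'f set" where
  "integral_closure R = {y. \<exists>p :: 'f poly. Polynomial.lead_coeff p = 1 \<and>
     (\<forall>i. Polynomial.coeff p i \<in> R) \<and> poly p y = 0}"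

definition index_sets :: "nat set \<Rightarrow> nat \<Rightarrow> nat set" where
  "index_sets I j = (if j = 1 then I else {0<..})"

definition R_bar :: "nat \<Rightarrow> (nat \<Rightarrow> 'k::field) set \<Rightarrow> ('k mpoly set \<Rightarrow> 'f::field) \<Rightarrow>
    (nat \<Rightarrow> 'k) \<Rightarrow> nat set \<Rightarrow> 'f set" where
  "R_bar n V \<iota> \<phi> I = integral_closure (R_ring n V \<iota> \<phi> (index_sets I))"

definition Spec :: "'f::field set \<Rightarrow> 'f set set" where
  "Spec A = {\<pp>. primeideal \<pp> (ring_on A)}"

definition zariski_open :: "'f::field set \<Rightarrow> 'f set set \<Rightarrow> bool" where
  "zariski_open A U \<longleftrightarrow> (\<exists>S\<subseteq>A. U = {\<pp> \<in> Spec A. \<not> S \<subseteq> \<pp>})"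

definition localization_at :: "'f::field set \<Rightarrow> 'f set \<Rightarrow> 'f set" where
  "localization_at A \<pp> = {a / b | a b. a \<in> A \<and> b \<in> A - \<pp>}"

text \<open>
  As for every sheaf of rings, the ring over the empty set is the zero ring; its only element
  is represented by \<open>0\<close>, which is then also its unit and the restriction of every section.
\<close>

definition sections :: "'f::field set \<Rightarrow> 'f set set \<Rightarrow> 'f set" where
  "sections A U = (if U = {} then {0} else (\<Inter>\<pp>\<in>U. localization_at A \<pp>))"

definition unit_section :: "'f::field set set \<Rightarrow> 'f" where
  "unit_section U = (if U = {} then 0 else 1)"

definition restrict_section :: "'f::field set set \<Rightarrow> 'f \<Rightarrow> 'f" where
  "restrict_section U s = (if U = {} then 0 else s)"

datatype 'f rs_element = Pt "'f set" | Op "'f set set" | Sect "'f set set" 'f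

primrec scheme_holds :: "rs_symbol \<Rightarrow> 'f::field rs_element list \<Rightarrow> bool" where
  "scheme_holds IsPoint xs = (\<exists>p. xs = [Pt p])"
| "scheme_holds IsOpen xs = (\<exists>U. xs = [Op U])"
| "scheme_holds PointIn xs = (\<exists>p U. xs = [Pt p, Op U] \<and> p \<in> U)"
| "scheme_holds SectionOver xs = (\<exists>U s. xs = [Sect U s, Op U])"
| "scheme_holds SumIs xs = (\<exists>U s t. xs = [Sect U s, Sect U t, Sect U (s + t)])"
| "scheme_holds ProdIs xs = (\<exists>U s t. xs = [Sect U s, Sect U t, Sect U (s * t)])"
| "scheme_holds IsZero xs = (\<exists>U. xs = [Sect U 0])"
| "scheme_holds IsOne xs = (\<exists>U. xs = [Sect U (unit_section U)])"
| "scheme_holds RestrictsTo xs =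
     (\<exists>U W s. W \<subseteq> U \<and> xs = [Sect U s, Sect W (restrict_section W s)])"

definition spec_structure :: "'f::field set \<Rightarrow> 'f rs_element rs_structure" where
  "spec_structure A = \<lparr>universe = Pt ` Spec A \<union> Op ` {U. zariski_open A U} \<union>
       {Sect U s | U s. zariski_open A U \<and> s \<in> sections A U},
     holds = scheme_holds\<rparr>"

definition scheme_class :: "nat \<Rightarrow> (nat \<Rightarrow> 'k::field) set \<Rightarrow> ('k mpoly set \<Rightarrow> 'f::field) \<Rightarrow>
    (nat \<Rightarrow> 'k) \<Rightarrow> nat rs_structure set" where
  "scheme_class n V \<iota> \<phi> =
     {M. \<exists>I\<subseteq>{0<..}. isomorphic M (spec_structure (R_bar n V \<iota> \<phi> I))}"

end

theory Submission
  imports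
    Defs
    "HOL-Library.Countable_Set"
    "Jordan_Normal_Form.Char_Poly"
    "Subresultants.More_Homomorphisms"
begin

text \<open>
  Specializing a variable \<open>x\<^sub>j\<close> to a constant keeps the defining polynomial irreducible.  Hence the
  elements \<open>x\<^sub>j - a\<close> are prime in the coordinate ring, the points of \<open>Z\<^sub>I\<close> are the generic point and
  one closed point for each \<open>x\<^sub>j - a\<close> with \<open>j \<ge> 2\<close> or \<open>a \<in> \<phi>(I)\<close>, and the nonempty open sets are the
  complements of finite sets of closed points.

  Let \<open>q\<^sub>0 = x\<close> and \<open>q\<^bsub>e+1\<^esub> = q\<^sub>e (q\<^sub>e + 1)\<close>, so that the polynomials \<open>q\<^sub>e + 1\<close> have pairwise disjoint
  nonempty sets of roots.  A set \<open>X\<close> of natural numbers is coded by omitting the points \<open>x\<^sub>1 = a\<close> for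
  the roots \<open>a\<close> of \<open>q\<^bsub>2e+1\<^esub> + 1\<close>, \<open>e \<in> X\<close>.  Then \<open>e \<in> X\<close> if and only if \<open>q\<^bsub>2e+1\<^esub>(x\<^sub>1) + 1\<close> is an invertible
  global section, and so every copy of the scheme enumerates \<open>X\<close>.  Conversely, an enumeration of \<open>X\<close>
  computes a copy: a point that turns out to be omitted is reinterpreted as a root of some \<open>q\<^bsub>2e\<^esub> + 1\<close>
  that was kept in reserve.

  So the isomorphism type has a degree if and only if there is a least degree among the sets that
  enumerate \<open>X\<close>.  For the join of a set with its complement this is the degree of the set.  A
  finite-extension construction yields an \<open>X\<close> with two enumerations such that no set computable
  from both of them enumerates \<open>X\<close>.
\<close>

text \<open>In a copy, sections are reachable only through the ring operations from finitely many
  parameters, and a given constant of \<open>k\<close> need not be reachable in this way. Therefore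
  a number is coded by all roots of one polynomial built from \<open>x_1\<close> and
  \<open>1\<close>, not by a single point; the recursion for \<open>q_e\<close> works in every
  characteristic. Odd indices carry the code and even ones are left alone, so the reserve is
  infinite for every \<open>X\<close>, even if \<open>n = 1\<close> and there are no points with
  \<open>j \<ge> 2\<close>.

  No factorization algorithm for \<open>k\<close> is assumed. Membership in the kernel of the
  evaluation is decided by certificates on both sides: a multiple of the defining polynomial, or a
  Bezout identity. Absence of linear divisors is certified only positively, by a factored
  specialization; this suffices because codes of sections carry their evidence.

  On the algebraic side, complete integral closedness of polynomial rings gives Gauss's lemma.
  Bezout identities over the fraction field, cleared of denominators, then yield the kernel, the
  function field and the maximality of the primes.\<close>

hide_const (open) UnivPoly.up_ring.coeff UnivPoly.up_ring.monom Module.module.smult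
  Divisibility.irreducible Divisibility.prime

section \<open>Computable functions between coded types\<close>

text \<open>Bijections instead of injections: every number decodes to an element, so
  \<open>dec\<close> is total and a search through all numbers is a search through the type.\<close>

class coded =
  fixes enc :: "'a \<Rightarrow> nat"
  assumes bij_enc: "bij enc"

instantiation nat :: coded begin
definition "enc (n::nat) = n"
instance by standard (simp add: enc_nat_def bij_def inj_def surj_def)
end

instantiation prod :: (coded, coded) coded begin
definition "enc p = prod_encode (enc (fst p), enc (snd p))"
instance proof
  have "bij (map_prod enc enc :: 'a \<times> 'b \<Rightarrow> nat \<times> nat)"
    using bij_enc[where 'a='a] bij_enc[where 'a='b]
    by (auto simp: bij_def prod.inj_map map_prod_surj)
  then have "bij (prod_encode \<circ> (map_prod enc enc :: 'a \<times> 'b \<Rightarrow> nat \<times> nat))"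
    by (rule bij_comp) (rule bij_prod_encode)
  moreover have "enc = prod_encode \<circ> (map_prod enc enc :: 'a \<times> 'b \<Rightarrow> nat \<times> nat)"
    by (auto simp: enc_prod_def fun_eq_iff)
  ultimately show "bij (enc :: 'a \<times> 'b \<Rightarrow> nat)" by simp
qed
end

instantiation list :: (coded) coded begin
definition "enc xs = list_encode (map enc xs)"
instance proof
  have "bij (map enc :: 'a list \<Rightarrow> nat list)"
    using bij_enc[where 'a='a] unfolding bij_def surj_def
    by (metis ex_map_conv list.inj_map surj_def)
  then have "bij (list_encode \<circ> (map enc :: 'a list \<Rightarrow> nat list))"
    by (rule bij_comp) (rule bij_list_encode)
  moreover have "enc = list_encode \<circ> (map enc :: 'a list \<Rightarrow> nat list)"
    by (auto simp: enc_list_def fun_eq_iff)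
  ultimately show "bij (enc :: 'a list \<Rightarrow> nat)" by simp
qed
end

definition dec :: "nat \<Rightarrow> 'a::coded" where "dec = inv_into UNIV enc"

lemma dec_enc [simp]: "dec (enc x) = x"
  unfolding dec_def by (rule inv_f_f) (rule bij_is_inj[OF bij_enc])

lemma enc_dec [simp]: "enc (dec n :: 'a::coded) = n"
  unfolding dec_def by (rule surj_f_inv_f) (rule bij_is_surj[OF bij_enc])

lemma enc_eq_iff [simp]: "enc x = enc y \<longleftrightarrow> x = y"
  by (metis dec_enc)

lemma enc_nat [simp]: "enc (n::nat) = n" by (simp add: enc_nat_def)
lemma dec_nat [simp]: "dec n = (n::nat)" by (metis dec_enc enc_nat)
lemma enc_Pair: "enc (x, y) = prod_encode (enc x, enc y)" by (simp add: enc_prod_def)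
lemma enc_Nil: "enc [] = 0" by (simp add: enc_list_def)
lemma enc_Cons: "enc (x # xs) = Suc (enc (x, xs))" by (simp add: enc_list_def enc_prod_def)
lemma enc_nat_list: "enc (xs :: nat list) = list_encode xs"
proof -
  have "(enc :: nat \<Rightarrow> nat) = id" by auto
  then show ?thesis by (simp add: enc_list_def)
qed

definition computable :: "nat set \<Rightarrow> ('a::coded \<Rightarrow> 'b::coded) \<Rightarrow> bool" where
  "computable D f \<longleftrightarrow> (\<exists>e. \<forall>x. run D e [enc x] (enc (f x)))"

definition decidable :: "nat set \<Rightarrow> ('a::coded \<Rightarrow> bool) \<Rightarrow> bool" where
  "decidable D P \<longleftrightarrow> computable D (\<lambda>x. of_bool (P x) :: nat)"

text \<open>\<open>PrimRec\<close> and \<open>Mu\<close> act on several arguments with the recursion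
  or search variable in front, whereas \<open>computable\<close> has one coded argument;
  \<open>calc\<close> mediates between the two.\<close>

definition calc :: "nat set \<Rightarrow> nat \<Rightarrow> (nat list \<Rightarrow> nat) \<Rightarrow> bool" where
  "calc D k f \<longleftrightarrow> (\<exists>e. \<forall>xs. length xs = k \<longrightarrow> run D e xs (f xs))"

lemma calc_cong: "calc D k f \<Longrightarrow> (\<And>xs. length xs = k \<Longrightarrow> f xs = g xs) \<Longrightarrow> calc D k g"
  unfolding calc_def by metis

lemma calc_nth: "i < k \<Longrightarrow> calc D k (\<lambda>xs. xs ! i)"
  unfolding calc_def using run_Proj by metis

lemma calc_zero: "calc D k (\<lambda>xs. 0)"
  unfolding calc_def using run_Zr by metis

lemma calc_comp:
  assumes f: "calc D (length gs) f" and g: "\<forall>g\<in>set gs. calc D k g"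
  shows "calc D k (\<lambda>xs. f (map (\<lambda>g. g xs) gs))"
proof -
  from f obtain e where e: "\<And>xs. length xs = length gs \<Longrightarrow> run D e xs (f xs)"
    unfolding calc_def by blast
  from g have "\<forall>g\<in>set gs. \<exists>p. \<forall>xs. length xs = k \<longrightarrow> run D p xs (g xs)"
    unfolding calc_def by blast
  then obtain p where p: "\<And>g xs. g \<in> set gs \<Longrightarrow> length xs = k \<Longrightarrow> run D (p g) xs (g xs)"
    by metis
  have "run D (Comp e (map p gs)) xs (f (map (\<lambda>g. g xs) gs))" if "length xs = k" for xs
    by (rule run_Comp[where ys = "map (\<lambda>g. g xs) gs"])
       (auto simp: list_all2_conv_all_nth intro!: p e that)
  then show ?thesis unfolding calc_def by blast
qed

lemma calc_comp1: "calc D 1 (\<lambda>ys. f (ys ! 0)) \<Longrightarrow> calc D k g \<Longrightarrow> calc D k (\<lambda>xs. f (g xs))"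
  using calc_comp[of D "[g]" "\<lambda>ys. f (ys ! 0)" k] by simp

lemma calc_comp2:
  assumes "calc D 2 (\<lambda>ys. f (ys ! 0) (ys ! 1))" "calc D k g" "calc D k h"
  shows "calc D k (\<lambda>xs. f (g xs) (h xs))"
  using calc_comp[of D "[g, h]" "\<lambda>ys. f (ys ! 0) (ys ! 1)" k] assms by (simp add: numeral_2_eq_2)

lemma calc_Suc1: "calc D 1 (\<lambda>ys. Suc (ys ! 0))"
  unfolding calc_def by (metis run_Sc length_Suc_conv One_nat_def nth_Cons_0)

lemmas calc_Suc = calc_comp1[OF calc_Suc1]

lemma calc_const: "calc D k (\<lambda>xs. c)"
  by (induction c) (auto intro: calc_zero calc_Suc)

lemma calc_rec:
  assumes "calc D k f" and "calc D (Suc (Suc k)) g"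
  shows "calc D (Suc k) (\<lambda>xs. rec_nat (f (tl xs)) (\<lambda>t y. g (t # y # tl xs)) (hd xs))"
proof -
  from assms obtain e p where e: "\<And>xs. length xs = k \<Longrightarrow> run D e xs (f xs)"
    and p: "\<And>xs. length xs = Suc (Suc k) \<Longrightarrow> run D p xs (g xs)"
    unfolding calc_def by blast
  have "run D (PrimRec e p) (t # xs) (rec_nat (f xs) (\<lambda>t y. g (t # y # xs)) t)"
    if "length xs = k" for t xs
    by (induction t) (auto intro!: run_PrimRec_0 run_PrimRec_Suc e p that)
  then have "\<forall>xs. length xs = Suc k \<longrightarrow> run D (PrimRec e p) xs
      (rec_nat (f (tl xs)) (\<lambda>t y. g (t # y # tl xs)) (hd xs))"
    by (metis length_Suc_conv list.sel(1,3))
  then show ?thesis unfolding calc_def by blast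
qed

lemma calc_add2: "calc D 2 (\<lambda>ys. ys ! 0 + ys ! 1)"
proof -
  have *: "calc D (Suc (Suc 0)) (\<lambda>xs. rec_nat ((tl xs) ! 0) (\<lambda>t y. Suc ((t # y # tl xs) ! 1)) (hd xs))"
    by (rule calc_rec) (auto intro!: calc_Suc calc_nth)
  have r: "rec_nat b (\<lambda>t y. Suc y) a = a + b" for a b :: nat by (induction a) auto
  show ?thesis unfolding numeral_2_eq_2
    by (rule calc_cong[OF *]) (auto simp: length_Suc_conv r)
qed

lemma calc_pred1: "calc D 1 (\<lambda>ys. ys ! 0 - 1)"
proof -
  have *: "calc D (Suc 0) (\<lambda>xs. rec_nat 0 (\<lambda>t y. (t # y # tl xs) ! 0) (hd xs))"
    by (rule calc_rec[where f = "\<lambda>_. 0"]) (auto intro!: calc_zero calc_nth)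
  have r: "rec_nat 0 (\<lambda>t y. t) a = a - 1" for a :: nat by (cases a) auto
  show ?thesis unfolding One_nat_def by (rule calc_cong[OF *]) (auto simp: length_Suc_conv r)
qed

lemmas calc_pred = calc_comp1[OF calc_pred1]

text \<open>The arguments are swapped because recursion runs on the first one: the subtrahend counts
  the applications of the predecessor.\<close>

lemma calc_diff2: "calc D 2 (\<lambda>ys. ys ! 1 - ys ! 0)"
proof -
  have *: "calc D (Suc (Suc 0)) (\<lambda>xs. rec_nat ((tl xs) ! 0) (\<lambda>t y. (t # y # tl xs) ! 1 - 1) (hd xs))"
    by (rule calc_rec) (rule calc_nth calc_pred, simp)+
  have r: "rec_nat b (\<lambda>t y. y - Suc 0) a = b - a" for a b :: nat by (induction a) auto
  show ?thesis unfolding numeral_2_eq_2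
    by (rule calc_cong[OF *]) (auto simp: length_Suc_conv r)
qed

lemma calc_add: "calc D k f \<Longrightarrow> calc D k g \<Longrightarrow> calc D k (\<lambda>xs. f xs + g xs)"
  by (rule calc_comp2[OF calc_add2])

lemma calc_diff: "calc D k f \<Longrightarrow> calc D k g \<Longrightarrow> calc D k (\<lambda>xs. f xs - g xs)"
  by (rule calc_comp2[where f = "\<lambda>a b. b - a", OF calc_diff2])

lemma calc_triangle1: "calc D 1 (\<lambda>ys. triangle (ys ! 0))"
proof -
  have *: "calc D (Suc 0) (\<lambda>xs. rec_nat 0 (\<lambda>t y. (t # y # tl xs) ! 1 + Suc ((t # y # tl xs) ! 0)) (hd xs))"
    by (rule calc_rec[where f = "\<lambda>_. 0"]) (auto intro!: calc_zero calc_nth calc_add calc_Suc)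
  have r: "rec_nat 0 (\<lambda>t y. Suc (y + t)) a = triangle a" for a :: nat by (induction a) auto
  show ?thesis unfolding One_nat_def by (rule calc_cong[OF *]) (auto simp: length_Suc_conv r)
qed

lemmas calc_triangle = calc_comp1[OF calc_triangle1]

lemma calc_Least:
  assumes "calc D (Suc k) f" and "\<And>xs. length xs = k \<Longrightarrow> \<exists>t. f (t # xs) = 0"
  shows "calc D k (\<lambda>xs. LEAST t. f (t # xs) = 0)"
proof -
  from assms obtain e where e: "\<And>xs. length xs = Suc k \<Longrightarrow> run D e xs (f xs)"
    unfolding calc_def by blast
  have "run D (Mu e) xs (LEAST t. f (t # xs) = 0)" if l: "length xs = k" for xs
  proof (rule run_Mu)
    show "run D e ((LEAST t. f (t # xs) = 0) # xs) 0"
      using e[of "(LEAST t. f (t # xs) = 0) # xs"] LeastI_ex[OF assms(2)[OF l]] l by simp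
    show "\<forall>s<LEAST t. f (t # xs) = 0. \<exists>y. run D e (s # xs) (Suc y)"
    proof (intro allI impI)
      fix s assume "s < (LEAST t. f (t # xs) = 0)"
      then have "f (s # xs) \<noteq> 0" using not_less_Least by blast
      then show "\<exists>y. run D e (s # xs) (Suc y)"
        using e[of "s # xs"] l by (cases "f (s # xs)") auto
    qed
  qed
  then show ?thesis unfolding calc_def by blast
qed

text \<open>Recovers the diagonal \<open>a + b\<close> of the Cantor code
  \<open>triangle (a + b) + a\<close>: the equation says
  \<open>z < triangle (Suc s)\<close>.\<close>

definition pair_sum :: "nat \<Rightarrow> nat" where
  "pair_sum z = (LEAST s. Suc z - triangle (Suc s) = 0)"

lemma calc_pair_sum1: "calc D 1 (\<lambda>ys. pair_sum (ys ! 0))"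
proof -
  have "calc D 1 (\<lambda>xs. LEAST t. Suc ((t # xs) ! 1) - triangle (Suc ((t # xs) ! 0)) = 0)"
  proof (rule calc_Least)
    show "calc D (Suc 1) (\<lambda>xs. Suc (xs ! 1) - triangle (Suc (xs ! 0)))"
      by (intro calc_diff calc_Suc calc_triangle calc_nth) auto
    have "t \<le> triangle t" for t by (induction t) auto
    then have "Suc z - triangle (Suc z) = 0" for z by (metis diff_is_0_eq)
    then show "\<exists>t. Suc ((t # xs) ! 1) - triangle (Suc ((t # xs) ! 0)) = 0" if "length xs = 1" for xs
      by (metis One_nat_def nth_Cons_0 nth_Cons_Suc)
  qed
  then show ?thesis by (simp add: pair_sum_def)
qed

lemma triangle_mono: "a \<le> b \<Longrightarrow> triangle a \<le> triangle b"
  unfolding triangle_def by (intro div_le_mono mult_le_mono) auto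

lemma pair_sum_prod_encode: "pair_sum (prod_encode (a, b)) = a + b"
  unfolding pair_sum_def
proof (rule Least_equality)
  show "Suc (prod_encode (a, b)) - triangle (Suc (a + b)) = 0"
    by (simp add: prod_encode_def)
  fix s assume s: "Suc (prod_encode (a, b)) - triangle (Suc s) = 0"
  show "a + b \<le> s"
  proof (rule ccontr)
    assume "\<not> a + b \<le> s"
    then have "triangle (Suc s) \<le> triangle (a + b)" by (intro triangle_mono) simp
    then show False using s by (simp add: prod_encode_def)
  qed
qed

lemma calc_fst1: "calc D 1 (\<lambda>ys. fst (prod_decode (ys ! 0)))"
proof (rule calc_cong)
  show "calc D 1 (\<lambda>ys. ys ! 0 - triangle (pair_sum (ys ! 0)))"
    by (intro calc_diff calc_triangle calc_pair_sum1 calc_nth) simp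
  fix xs :: "nat list" assume "length xs = 1"
  obtain a b where ab: "xs ! 0 = prod_encode (a, b)" by (metis prod_decode_inverse surj_pair)
  show "xs ! 0 - triangle (pair_sum (xs ! 0)) = fst (prod_decode (xs ! 0))"
    unfolding ab pair_sum_prod_encode by (simp only: prod_encode_inverse) (simp add: prod_encode_def)
qed

lemma calc_snd1: "calc D 1 (\<lambda>ys. snd (prod_decode (ys ! 0)))"
proof (rule calc_cong)
  show "calc D 1 (\<lambda>ys. pair_sum (ys ! 0) - fst (prod_decode (ys ! 0)))"
    by (intro calc_diff calc_fst1 calc_pair_sum1)
  fix xs :: "nat list" assume "length xs = 1"
  obtain a b where ab: "xs ! 0 = prod_encode (a, b)" by (metis prod_decode_inverse surj_pair)
  show "pair_sum (xs ! 0) - fst (prod_decode (xs ! 0)) = snd (prod_decode (xs ! 0))"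
    unfolding ab pair_sum_prod_encode by simp
qed

lemma calc_pair: "calc D k f \<Longrightarrow> calc D k g \<Longrightarrow> calc D k (\<lambda>xs. prod_encode (f xs, g xs))"
  by (simp add: prod_encode_def calc_add calc_triangle)

lemma computable_iff_calc: "computable D f \<longleftrightarrow> calc D 1 (\<lambda>ys. enc (f (dec (ys ! 0))))"
proof
  assume "computable D f"
  then obtain e where e: "\<And>x. run D e [enc x] (enc (f x))" unfolding computable_def by blast
  have "run D e xs (enc (f (dec (xs ! 0))))" if "length xs = 1" for xs
    using e[of "dec (xs ! 0)"] that by (auto simp: length_Suc_conv)
  then show "calc D 1 (\<lambda>ys. enc (f (dec (ys ! 0))))" unfolding calc_def by blast
next
  assume "calc D 1 (\<lambda>ys. enc (f (dec (ys ! 0))))"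
  then obtain e where e: "\<And>xs. length xs = 1 \<Longrightarrow> run D e xs (enc (f (dec (xs ! 0))))"
    unfolding calc_def by blast
  show "computable D f" unfolding computable_def
    by (rule exI[of _ e]) (use e in \<open>metis One_nat_def dec_enc length_Cons list.size(3) nth_Cons_0\<close>)
qed

lemma calc_apply: "computable D f \<Longrightarrow> calc D k (\<lambda>xs. enc (g xs)) \<Longrightarrow> calc D k (\<lambda>xs. enc (f (g xs)))"
  using calc_comp1[of D "\<lambda>y. enc (f (dec y))" k "\<lambda>xs. enc (g xs)"]
  by (simp add: computable_iff_calc)

lemma dec_Pair: "dec z = (dec (fst (prod_decode z)), dec (snd (prod_decode z)))"
proof -
  have "enc (dec (fst (prod_decode z)) :: 'a, dec (snd (prod_decode z)) :: 'b) = z"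
    by (simp add: enc_Pair)
  then show ?thesis by (metis dec_enc)
qed

section \<open>Functions and predicates of one coded argument\<close>

named_theorems computable_intros

lemma computable_id [computable_intros]: "computable D (\<lambda>x. x)"
  unfolding computable_iff_calc using calc_nth[of 0 1 D] by simp

lemma computable_const [computable_intros]: "computable D (\<lambda>x. c)"
  unfolding computable_iff_calc by (rule calc_const)

lemma computable_comp: "computable D f \<Longrightarrow> computable D g \<Longrightarrow> computable D (\<lambda>x. f (g x))"
  by (subst computable_iff_calc) (rule calc_apply, simp_all add: computable_iff_calc)

lemma computable_Pair [computable_intros]:
  "computable D f \<Longrightarrow> computable D g \<Longrightarrow> computable D (\<lambda>x. (f x, g x))"
  unfolding computable_iff_calc enc_Pair by (rule calc_pair)

lemma computable_fst' : "computable D fst"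
  unfolding computable_iff_calc using calc_fst1[of D] by (simp add: dec_Pair)

lemma computable_snd' : "computable D snd"
  unfolding computable_iff_calc using calc_snd1[of D] by (simp add: dec_Pair)

lemmas computable_fst [computable_intros] = computable_comp[OF computable_fst']
lemmas computable_snd [computable_intros] = computable_comp[OF computable_snd']

lemma computable_binary:
  assumes "calc D 2 (\<lambda>ys. enc (F (dec (ys ! 0)) (dec (ys ! 1))))" "computable D f" "computable D g"
  shows "computable D (\<lambda>x. F (f x) (g x))"
  using calc_comp2[where f = "\<lambda>a b. enc (F (dec a) (dec b))", OF assms(1)
      assms(2)[unfolded computable_iff_calc] assms(3)[unfolded computable_iff_calc]]
  by (simp add: computable_iff_calc)

lemma computable_uncurry:
  "computable D (\<lambda>p. F (fst p) (snd p)) \<Longrightarrow> computable D f \<Longrightarrow> computable D g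
    \<Longrightarrow> computable D (\<lambda>x. F (f x) (g x))"
  using computable_comp[of D "\<lambda>p. F (fst p) (snd p)" "\<lambda>x. (f x, g x)"] computable_Pair by force

lemma computable_Suc [computable_intros]: "computable D f \<Longrightarrow> computable D (\<lambda>x. Suc (f x))"
  unfolding computable_iff_calc by (simp add: calc_Suc)

lemma computable_plus [computable_intros]:
  "computable D f \<Longrightarrow> computable D g \<Longrightarrow> computable D (\<lambda>x. f x + g x :: nat)"
  unfolding computable_iff_calc by (simp add: calc_add)

lemma computable_minus [computable_intros]:
  "computable D f \<Longrightarrow> computable D g \<Longrightarrow> computable D (\<lambda>x. f x - g x :: nat)"
  unfolding computable_iff_calc by (simp add: calc_diff)

lemma computable_enc [computable_intros]: "computable D f \<Longrightarrow> computable D (\<lambda>x. enc (f x))"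
  unfolding computable_iff_calc by simp

lemma computable_dec [computable_intros]: "computable D f \<Longrightarrow> computable D (\<lambda>x. dec (f x))"
  unfolding computable_iff_calc by simp

text \<open>Iteration on a single coded state is the form of recursion used from here on; case
  distinctions, folds, ranges and indexing are all reduced to it.\<close>

lemma computable_funpow:
  fixes f :: "'b::coded \<Rightarrow> 'b"
  assumes "computable D f" "computable D g" "computable D h"
  shows "computable D (\<lambda>x. (f ^^ g x) (h x))"
proof -
  have *: "calc D (Suc (Suc 0)) (\<lambda>xs. rec_nat ((tl xs) ! 0) (\<lambda>t y. (\<lambda>zs. enc (f (dec (zs ! 1)))) (t # y # tl xs)) (hd xs))"
    by (rule calc_rec) (auto intro!: calc_nth
        calc_apply[OF assms(1), where g = "\<lambda>zs. dec (zs ! 1)", simplified])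
  have r: "rec_nat b (\<lambda>t y. enc (f (dec y))) a = enc ((f ^^ a) (dec b))" for a b :: nat
    by (induction a) auto
  have "calc D 2 (\<lambda>ys. enc ((f ^^ dec (ys ! 0)) (dec (ys ! 1))))"
    unfolding numeral_2_eq_2 by (rule calc_cong[OF *]) (auto simp: length_Suc_conv r)
  then show ?thesis using assms(2,3) by (rule computable_binary)
qed

lemma decidable_computable: "decidable D P \<Longrightarrow> computable D (\<lambda>x. of_bool (P x) :: nat)"
  by (simp add: decidable_def)

lemma decidable_eq_0: "computable D f \<Longrightarrow> decidable D (\<lambda>x. f x = (0::nat))"
proof -
  assume "computable D f"
  then have "computable D (\<lambda>x. 1 - f x)" by (intro computable_intros)
  moreover have "1 - f x = of_bool (f x = 0)" for x by auto
  ultimately show ?thesis by (simp add: decidable_def)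
qed

lemma decidable_const [computable_intros]: "decidable D (\<lambda>x. P)"
  unfolding decidable_def by (rule computable_const)

lemma decidable_not [computable_intros]: "decidable D P \<Longrightarrow> decidable D (\<lambda>x. \<not> P x)"
  using decidable_eq_0[of D "\<lambda>x. of_bool (P x)"] by (simp add: decidable_def)

lemma decidable_or [computable_intros]:
  "decidable D P \<Longrightarrow> decidable D Q \<Longrightarrow> decidable D (\<lambda>x. P x \<or> Q x)"
proof -
  assume "decidable D P" "decidable D Q"
  then have "computable D (\<lambda>x. of_bool (P x) + of_bool (Q x) :: nat)"
    unfolding decidable_def by (intro computable_intros)
  from decidable_not[OF decidable_eq_0[OF this]] show ?thesis by simp
qed

lemma decidable_and [computable_intros]:
  "decidable D P \<Longrightarrow> decidable D Q \<Longrightarrow> decidable D (\<lambda>x. P x \<and> Q x)"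
proof -
  assume "decidable D P" "decidable D Q"
  then have "decidable D (\<lambda>x. \<not> (\<not> P x \<or> \<not> Q x))"
    by (intro decidable_not decidable_or)
  then show ?thesis by simp
qed

lemma decidable_imp [computable_intros]:
  "decidable D P \<Longrightarrow> decidable D Q \<Longrightarrow> decidable D (\<lambda>x. P x \<longrightarrow> Q x)"
  unfolding imp_conv_disj by (intro decidable_or decidable_not)

lemma decidable_le [computable_intros]:
  "computable D f \<Longrightarrow> computable D g \<Longrightarrow> decidable D (\<lambda>x. f x \<le> (g x :: nat))"
  using decidable_eq_0[OF computable_minus, of D f g] by simp

lemma decidable_less [computable_intros]:
  "computable D f \<Longrightarrow> computable D g \<Longrightarrow> decidable D (\<lambda>x. f x < (g x :: nat))"
  using decidable_not[OF decidable_le, of D g f] by (simp add: not_le)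

lemma decidable_eq [computable_intros]:
  assumes "computable D f" "computable D g" shows "decidable D (\<lambda>x. f x = g x)"
proof -
  have "decidable D (\<lambda>x. enc (f x) \<le> enc (g x) \<and> enc (g x) \<le> enc (f x))"
    by (intro computable_intros assms)
  then show ?thesis by (simp add: eq_iff[symmetric])
qed

lemma decidable_iff [computable_intros]:
  "decidable D P \<Longrightarrow> decidable D Q \<Longrightarrow> decidable D (\<lambda>x. P x \<longleftrightarrow> Q x)"
  unfolding iff_conv_conj_imp by (intro decidable_and decidable_imp)

lemma decidable_comp: "decidable D P \<Longrightarrow> computable D f \<Longrightarrow> decidable D (\<lambda>x. P (f x))"
  unfolding decidable_def by (rule computable_comp)

lemma decidable_uncurry:
  "decidable D (\<lambda>p. P (fst p) (snd p)) \<Longrightarrow> computable D f \<Longrightarrow> computable D g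
    \<Longrightarrow> decidable D (\<lambda>x. P (f x) (g x))"
  using decidable_comp[of D "\<lambda>p. P (fst p) (snd p)" "\<lambda>x. (f x, g x)"] computable_Pair by force

lemma decidable_mem: "decidable D (\<lambda>x. x \<in> D)"
  unfolding decidable_def computable_def using run_Query by fastforce

text \<open>A case distinction is an iteration: the map that overwrites the first branch by the
  second is applied \<open>0\<close> or \<open>1\<close> times.\<close>

lemma computable_if [computable_intros]:
  fixes f g :: "'a::coded \<Rightarrow> 'b::coded"
  assumes "decidable D P" "computable D f" "computable D g"
  shows "computable D (\<lambda>x. if P x then f x else g x)"
proof -
  define F where "F = (\<lambda>p :: 'b \<times> 'b. (snd p, snd p))"
  have "computable D F" unfolding F_def by (intro computable_intros)
  then have "computable D (\<lambda>x. fst ((F ^^ of_bool (\<not> P x)) (f x, g x)))"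
    by (intro computable_fst computable_funpow computable_Pair assms
        decidable_computable[OF decidable_not])
  moreover have "fst ((F ^^ of_bool (\<not> P x)) (f x, g x)) = (if P x then f x else g x)" for x
    by (auto simp: F_def)
  ultimately show ?thesis by (simp add: fun_eq_iff[symmetric])
qed

lemma computable_Least:
  assumes "decidable D (\<lambda>p. R (fst p) (snd p))" "\<And>x. \<exists>n::nat. R x n"
  shows "computable D (\<lambda>x. LEAST n. R x n)"
proof -
  have c: "computable D (\<lambda>p. of_bool (\<not> R (fst p) (snd p)) :: nat)"
    by (rule decidable_computable[OF decidable_not[OF assms(1)]])
  have "calc D 1 (\<lambda>xs. LEAST t. (\<lambda>zs. of_bool (\<not> R (dec (zs ! 1)) (zs ! 0)) :: nat) (t # xs) = 0)"
  proof (rule calc_Least)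
    have "calc D (Suc 1) (\<lambda>xs. enc (dec (xs ! 1) :: 'a, xs ! 0))"
      unfolding enc_Pair by (auto intro!: calc_pair calc_nth)
    from calc_apply[OF c this]
    show "calc D (Suc 1) (\<lambda>xs. of_bool (\<not> R (dec (xs ! 1)) (xs ! 0)))" by simp
  qed (use assms(2) in auto)
  then show ?thesis by (simp add: computable_iff_calc)
qed

lemma computable_search:
  fixes R :: "'a::coded \<Rightarrow> 'b::coded \<Rightarrow> bool"
  assumes "decidable D (\<lambda>p. R (fst p) (snd p))" "\<And>x. \<exists>y. R x y"
  obtains f where "computable D f" "\<And>x. R x (f x)"
proof
  define f :: "'a \<Rightarrow> 'b" where "f x = dec (LEAST n. R x (dec n))" for x
  have "decidable D (\<lambda>p. R (fst p) (dec (snd p)))"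
    by (rule decidable_comp[OF assms(1), of "\<lambda>p. (fst p, dec (snd p))", unfolded fst_conv snd_conv]) (intro computable_intros)
  moreover have ex: "\<exists>n. R x (dec n)" for x using assms(2) by (metis dec_enc)
  ultimately show "computable D f"
    unfolding f_def by (intro computable_dec computable_Least)
  show "R x (f x)" for x unfolding f_def by (rule LeastI_ex[OF ex])
qed

text \<open>Post's theorem. One search looks for a pair whose first entry confirms \<open>P\<close>
  or whose second entry refutes it; testing the first entry of the pair found then decides
  \<open>P\<close>.\<close>

lemma decidable_by_search:
  assumes P: "decidable D (\<lambda>p. R (fst p) (snd p))" and N: "decidable D (\<lambda>p. S (fst p) (snd p))"
    and "\<And>x. P x \<longleftrightarrow> (\<exists>y. R x y)" "\<And>x. \<not> P x \<longleftrightarrow> (\<exists>y. S x y)"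
  shows "decidable D P"
proof -
  have "decidable D (\<lambda>p. R (fst p) (fst (snd p)) \<or> S (fst p) (snd (snd p)))"
    by (intro decidable_or decidable_comp[OF P, of "\<lambda>p. (fst p, fst (snd p))", simplified]
        decidable_comp[OF N, of "\<lambda>p. (fst p, snd (snd p))", simplified] computable_intros)
  moreover have "\<exists>y. R x (fst y) \<or> S x (snd y)" for x
    using assms(3,4) by (metis fst_conv snd_conv)
  ultimately obtain f where f: "computable D f" "\<And>x. R x (fst (f x)) \<or> S x (snd (f x))"
    using computable_search[where R = "\<lambda>x y. R x (fst y) \<or> S x (snd y)"] by blast
  have "P = (\<lambda>x. R x (fst (f x)))" using f(2) assms(3,4) by blast
  moreover have "decidable D (\<lambda>x. R x (fst (f x)))"
    by (rule decidable_comp[OF P, of "\<lambda>x. (x, fst (f x))", unfolded fst_conv snd_conv]) (intro computable_intros f(1))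
  ultimately show ?thesis by simp
qed

section \<open>Computable operations on lists\<close>

lemma computable_Cons [computable_intros]:
  assumes "computable D f" "computable D g" shows "computable D (\<lambda>x. f x # g x)"
proof -
  have "computable D (\<lambda>x. dec (Suc (enc (f x, g x))) :: 'b list)"
    by (intro computable_intros assms)
  then show ?thesis unfolding enc_Cons[symmetric] by simp
qed

lemma computable_case_list [computable_intros]:
  assumes "computable D l" "computable D f" "computable D (\<lambda>p. g (fst p) (fst (snd p)) (snd (snd p)))"
  shows "computable D (\<lambda>x. case l x of [] \<Rightarrow> f x | y # ys \<Rightarrow> g x y ys)"
proof -
  have "computable D (\<lambda>x. if enc (l x) = 0 then f x
     else (\<lambda>p. g (fst p) (fst (snd p)) (snd (snd p))) (x, dec (enc (l x) - 1)))"
    by (intro computable_if computable_comp[OF assms(3)] computable_intros assms)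
  moreover have "(if enc (l x) = 0 then f x
     else (\<lambda>p. g (fst p) (fst (snd p)) (snd (snd p))) (x, dec (enc (l x) - 1))) =
     (case l x of [] \<Rightarrow> f x | y # ys \<Rightarrow> g x y ys)" for x
    by (cases "l x") (auto simp: enc_Nil enc_Cons)
  ultimately show ?thesis by simp
qed

lemma length_le_enc: "length xs \<le> enc (xs :: 'a::coded list)"
proof (induction xs)
  case (Cons x xs)
  have "enc xs \<le> enc (x, xs)" by (simp add: enc_Pair le_prod_encode_2)
  then show ?case using Cons by (simp add: enc_Cons)
qed simp

lemma computable_foldl:
  assumes F: "computable D (\<lambda>p. F (fst p) (fst (snd p)) (snd (snd p)))"
    and "computable D b" "computable D l"
  shows "computable D (\<lambda>x. foldl (F x) (b x) (l x))"
proof -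
  \<comment> \<open>The state consists of the parameter, the accumulator and the rest of the list.
    It no longer changes when the list is empty, so iterating too often is harmless and the code of
    the list serves as the number of steps.\<close>
  define S :: "'a \<times> 'b \<times> 'c list \<Rightarrow> 'a \<times> 'b \<times> 'c list" where
    "S p = (case snd (snd p) of [] \<Rightarrow> p | y # ys \<Rightarrow> (fst p, F (fst p) (fst (snd p)) y, ys))" for p
  have *: "computable D (\<lambda>p. F (fst (f p)) (fst (snd (f p))) (g p))"
    if "computable D f" "computable D g" for f g
    by (rule computable_comp[OF F, of "\<lambda>p. (fst (f p), fst (snd (f p)), g p)", unfolded fst_conv snd_conv])
       (intro computable_intros that)
  have "computable D S"
    unfolding S_def by (intro computable_case_list computable_Pair computable_fst computable_snd computable_id *)
  then have "computable D (\<lambda>x. fst (snd ((S ^^ enc (l x)) (x, b x, l x))))"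
    by (intro computable_intros computable_funpow assms)
  moreover have S: "(S ^^ n) (x, c, xs) = (x, foldl (F x) c xs, [])" if "length xs \<le> n" for x c xs n
    using that
  proof (induction n arbitrary: c xs)
    case (Suc n)
    show ?case
    proof (cases xs)
      case Nil
      then have "S (x, c, xs) = (x, c, xs)" by (simp add: S_def)
      then show ?thesis using Suc.IH[of xs c] Nil by (simp add: funpow_swap1)
    next
      case (Cons y ys)
      then have "S (x, c, xs) = (x, F x c y, ys)" by (simp add: S_def)
      then show ?thesis using Suc.IH[of ys "F x c y"] Suc.prems Cons by (simp add: funpow_swap1)
    qed
  qed simp
  ultimately show ?thesis using S[OF length_le_enc] by simp
qed

lemma computable_rev [computable_intros]: "computable D l \<Longrightarrow> computable D (\<lambda>x. rev (l x))"
proof -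
  assume l: "computable D l"
  have "computable D (\<lambda>x. foldl (\<lambda>ys y. y # ys) [] (l x))"
    by (rule computable_foldl[where F = "\<lambda>_ ys y. y # ys"]) (intro computable_intros l)+
  moreover have "foldl (\<lambda>ys y. y # ys) zs xs = rev xs @ zs" for xs zs :: "'b list"
    by (induction xs arbitrary: zs) auto
  ultimately show ?thesis by simp
qed

lemma computable_foldr:
  assumes F: "computable D (\<lambda>p. F (fst p) (fst (snd p)) (snd (snd p)))"
    and "computable D l" "computable D b"
  shows "computable D (\<lambda>x. foldr (F x) (l x) (b x))"
proof -
  have "computable D (\<lambda>p. F (fst p) (snd (snd p)) (fst (snd p)))"
    by (rule computable_comp[OF F, of "\<lambda>p. (fst p, snd (snd p), fst (snd p))", unfolded fst_conv snd_conv]) (intro computable_intros)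
  then have "computable D (\<lambda>x. foldl (\<lambda>a b. F x b a) (b x) (rev (l x)))"
    by (intro computable_foldl[where F = "\<lambda>x a b. F x b a"] computable_intros assms)
  then show ?thesis by (simp add: foldr_conv_foldl)
qed

lemma computable_append [computable_intros]:
  assumes "computable D f" "computable D g" shows "computable D (\<lambda>x. f x @ g x)"
proof -
  have "computable D (\<lambda>x. foldr (\<lambda>a b. a # b) (f x) (g x))"
    by (rule computable_foldr[where F = "\<lambda>_ a b. a # b"]) (intro computable_intros assms)+
  moreover have "foldr (\<lambda>a b. a # b) xs ys = xs @ ys" for xs ys :: "'b list" by (induction xs) auto
  ultimately show ?thesis by simp
qed

lemma computable_map:
  assumes F: "computable D (\<lambda>p. F (fst p) (snd p))" and "computable D l"
  shows "computable D (\<lambda>x. map (F x) (l x))"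
proof -
  have "computable D (\<lambda>p. F (fst p) (fst (snd p)))"
    by (rule computable_comp[OF F, of "\<lambda>p. (fst p, fst (snd p))", unfolded fst_conv snd_conv])
      (intro computable_intros)
  then have "computable D (\<lambda>p. F (fst p) (fst (snd p)) # snd (snd p))"
    by (intro computable_intros)
  from computable_foldr[where F = "\<lambda>x a b. F x a # b", OF this assms(2) computable_const]
  have "computable D (\<lambda>x. foldr (\<lambda>a b. F x a # b) (l x) [])" .
  moreover have "foldr (\<lambda>a b. F x a # b) xs [] = map (F x) xs" for x xs by (induction xs) auto
  ultimately show ?thesis by simp
qed

lemma computable_concat [computable_intros]:
  assumes "computable D l" shows "computable D (\<lambda>x. concat (l x))"
proof -
  have "computable D (\<lambda>x. foldr (\<lambda>a b. a @ b) (l x) [])"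
    by (rule computable_foldr[where F = "\<lambda>_ a b. a @ b"]) (intro computable_intros assms)+
  moreover have "foldr (\<lambda>a b. a @ b) xs [] = concat xs" for xs :: "'b list list" by (induction xs) auto
  ultimately show ?thesis by simp
qed

lemma computable_length [computable_intros]:
  assumes "computable D l" shows "computable D (\<lambda>x. length (l x))"
proof -
  have "computable D (\<lambda>x. foldr (\<lambda>a b. Suc b) (l x) 0)"
    by (rule computable_foldr[where F = "\<lambda>_ a b. Suc b"]) (intro computable_intros assms)+
  moreover have "foldr (\<lambda>a b. Suc b) xs 0 = length xs" for xs :: "'b list" by (induction xs) auto
  ultimately show ?thesis by simp
qed

lemma decidable_Bex_list [computable_intros]:
  assumes P: "decidable D (\<lambda>p. P (fst p) (snd p))" and "computable D l"
  shows "decidable D (\<lambda>x. \<exists>a\<in>set (l x). P x a)"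
proof -
  have "decidable D (\<lambda>p. P (fst p) (fst (snd p)))"
    by (rule decidable_comp[OF P, of "\<lambda>p. (fst p, fst (snd p))", unfolded fst_conv snd_conv]) (intro computable_intros)
  then have "computable D (\<lambda>p. if P (fst p) (fst (snd p)) then 1 else snd (snd p) :: nat)"
    by (intro computable_if computable_intros)
  from computable_foldr[where F = "\<lambda>x a b. if P x a then 1 else b", OF this assms(2) computable_const]
  have "computable D (\<lambda>x. foldr (\<lambda>a b. if P x a then 1 else b :: nat) (l x) 0)" .
  moreover have "foldr (\<lambda>a b. if P x a then 1 else b :: nat) xs 0 = of_bool (\<exists>a\<in>set xs. P x a)" for x xs
    by (induction xs) (auto simp del: One_nat_def)
  ultimately show ?thesis by (simp add: decidable_def)
qed

lemma decidable_Ball_list [computable_intros]: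
  assumes "decidable D (\<lambda>p. P (fst p) (snd p))" and "computable D l"
  shows "decidable D (\<lambda>x. \<forall>a\<in>set (l x). P x a)"
  using decidable_not[OF decidable_Bex_list[OF decidable_not[OF assms(1)] assms(2)]] by simp

lemma decidable_mem_list [computable_intros]:
  assumes "computable D f" "computable D l" shows "decidable D (\<lambda>x. f x \<in> set (l x))"
proof -
  have "computable D (\<lambda>p. f (fst p))"
    using computable_comp[OF assms(1) computable_fst[OF computable_id]] .
  then have "decidable D (\<lambda>x. \<exists>a\<in>set (l x). f x = a)"
    by (intro decidable_Bex_list computable_intros assms)
  then show ?thesis by simp
qed

lemma computable_upt [computable_intros]:
  assumes "computable D f" shows "computable D (\<lambda>x. [0..<f x])"
proof -
  define S where "S l = l @ [length l]" for l :: "nat list"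
  have "computable D S" unfolding S_def by (intro computable_intros)
  then have "computable D (\<lambda>x. (S ^^ f x) [])" by (intro computable_funpow computable_intros assms)
  moreover have "(S ^^ n) [] = [0..<n]" for n by (induction n) (auto simp: S_def)
  ultimately show ?thesis by simp
qed

lemma decidable_all_less [computable_intros]:
  fixes f :: "'a::coded \<Rightarrow> nat"
  assumes "decidable D (\<lambda>p. P (fst p) (snd p))" "computable D f"
  shows "decidable D (\<lambda>x. \<forall>i<f x. P x i)"
  using decidable_Ball_list[where P = P, OF assms(1) computable_upt[OF assms(2)]] by (simp add: atLeast0LessThan Ball_def)

lemma decidable_ex_less [computable_intros]:
  fixes f :: "'a::coded \<Rightarrow> nat"
  assumes "decidable D (\<lambda>p. P (fst p) (snd p))" "computable D f"
  shows "decidable D (\<lambda>x. \<exists>i<f x. P x i)"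
  using decidable_Bex_list[where P = P, OF assms(1) computable_upt[OF assms(2)]] by (simp add: atLeast0LessThan Bex_def)

definition nth0 :: "nat list \<Rightarrow> nat \<Rightarrow> nat" where
  "nth0 l i = (if i < length l then l ! i else 0)"

lemma computable_nth0 [computable_intros]:
  assumes "computable D l" "computable D i" shows "computable D (\<lambda>x. nth0 (l x) (i x))"
proof -
  define T :: "nat list \<Rightarrow> nat list" where "T l = (case l of [] \<Rightarrow> [] | y # ys \<Rightarrow> ys)" for l
  have "computable D T" unfolding T_def by (intro computable_intros)
  then have "computable D (\<lambda>x. case (T ^^ i x) (l x) of [] \<Rightarrow> 0 | y # ys \<Rightarrow> y)"
    by (intro computable_intros computable_funpow assms)
  moreover have "(T ^^ n) l = drop n l" for n l
  proof (induction n arbitrary: l)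
    case (Suc n)
    show ?case using Suc[of "T l"] by (cases l) (auto simp: T_def funpow_Suc_right simp del: funpow.simps)
  qed simp
  then have "(case (T ^^ n) l of [] \<Rightarrow> 0 | y # ys \<Rightarrow> y) = nth0 l n" for n l
    by (cases "n < length l") (auto simp: nth0_def Cons_nth_drop_Suc[symmetric])
  ultimately show ?thesis by simp
qed

lemma turing_le_iff_decidable: "turing_le B A \<longleftrightarrow> decidable A (\<lambda>x. x \<in> B)"
  unfolding turing_le_def decidable_def computable_def by simp

lemma computable_turing_le: "computable B f \<Longrightarrow> turing_le B A \<Longrightarrow> computable A f"
  unfolding computable_def turing_le_def using run_answer_with by meson

section \<open>A set whose enumerations have no least Turing degree\<close>

text \<open>The use principle: a halting computation asks only finitely many oracle questions, and
  \<open>F\<close> collects them.\<close>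

lemma run_use:
  "run A e xs y \<Longrightarrow> \<exists>F. finite F \<and> (\<forall>A'. A' \<inter> F = A \<inter> F \<longrightarrow> run A' e xs y)"
proof (induction rule: run.induct)
  case (run_Query x xs)
  have "run A' Query (x # xs) (of_bool (x \<in> A))" if "A' \<inter> {x} = A \<inter> {x}" for A'
  proof -
    from that have "x \<in> A \<longleftrightarrow> x \<in> A'" by blast
    then show ?thesis using run.run_Query[of A' x xs] by simp
  qed
  then show ?case by (intro exI[of _ "{x}"]) auto
next
  case (run_Comp xs gs ys e z)
  from run_Comp.IH obtain F0 where F0: "finite F0"
    "\<And>A'. A' \<inter> F0 = A \<inter> F0 \<Longrightarrow> run A' e ys z" by blast
  have "\<forall>i<length gs. \<exists>F. finite F \<and> (\<forall>A'. A' \<inter> F = A \<inter> F \<longrightarrow> run A' (gs ! i) xs (ys ! i))"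
    using run_Comp(1) by (auto simp: list_all2_conv_all_nth)
  then obtain F where F: "\<And>i. i < length gs \<Longrightarrow> finite (F i)"
    "\<And>i A'. i < length gs \<Longrightarrow> A' \<inter> F i = A \<inter> F i \<Longrightarrow> run A' (gs ! i) xs (ys ! i)"
    by metis
  have l: "length gs = length ys" using run_Comp(1) by (rule list_all2_lengthD)
  show ?case
  proof (intro exI conjI allI impI)
    show "finite (F0 \<union> (\<Union>i<length gs. F i))" using F0(1) F(1) by auto
    fix A' assume *: "A' \<inter> (F0 \<union> (\<Union>i<length gs. F i)) = A \<inter> (F0 \<union> (\<Union>i<length gs. F i))"
    show "run A' (Comp e gs) xs z"
    proof (rule run.run_Comp)
      show "list_all2 (\<lambda>g y. run A' g xs y) gs ys"
        unfolding list_all2_conv_all_nth using l F(2) * by blast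
      show "run A' e ys z" using F0(2) * by blast
    qed
  qed
next
  case (run_PrimRec_Suc e g t xs y z)
  from run_PrimRec_Suc.IH obtain F G where "finite F" "finite G"
    "\<And>A'. A' \<inter> F = A \<inter> F \<Longrightarrow> run A' (PrimRec e g) (t # xs) y"
    "\<And>A'. A' \<inter> G = A \<inter> G \<Longrightarrow> run A' g (t # y # xs) z" by blast
  note FG = this
  show ?case
  proof (intro exI conjI allI impI)
    show "finite (F \<union> G)" using FG(1,2) by simp
    fix A' assume "A' \<inter> (F \<union> G) = A \<inter> (F \<union> G)"
    then have "A' \<inter> F = A \<inter> F" "A' \<inter> G = A \<inter> G" by blast+
    then show "run A' (PrimRec e g) (Suc t # xs) z"
      by (rule run.run_PrimRec_Suc[OF FG(3) FG(4)])
  qed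
next
  case (run_Mu e t xs)
  from run_Mu.IH(1) obtain F0 where F0: "finite F0"
    "\<And>A'. A' \<inter> F0 = A \<inter> F0 \<Longrightarrow> run A' e (t # xs) 0" by blast
  have "\<forall>s<t. \<exists>F. finite F \<and> (\<forall>A'. A' \<inter> F = A \<inter> F \<longrightarrow> (\<exists>y. run A' e (s # xs) (Suc y)))"
  proof (intro allI impI)
    fix s assume "s < t"
    with run_Mu.IH(2) obtain y F where "finite F" "\<And>A'. A' \<inter> F = A \<inter> F \<Longrightarrow> run A' e (s # xs) (Suc y)"
      by meson
    then show "\<exists>F. finite F \<and> (\<forall>A'. A' \<inter> F = A \<inter> F \<longrightarrow> (\<exists>y. run A' e (s # xs) (Suc y)))"
      by (intro exI[of _ F]) blast
  qed
  then obtain F where F: "\<And>i. i < t \<Longrightarrow> finite (F i)"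
    "\<And>i A'. i < t \<Longrightarrow> A' \<inter> F i = A \<inter> F i \<Longrightarrow> \<exists>y. run A' e (i # xs) (Suc y)"
    by metis
  show ?case
  proof (intro exI conjI allI impI)
    show "finite (F0 \<union> (\<Union>i<t. F i))" using F0(1) F(1) by auto
    fix A' assume *: "A' \<inter> (F0 \<union> (\<Union>i<t. F i)) = A \<inter> (F0 \<union> (\<Union>i<t. F i))"
    show "run A' (Mu e) xs t"
    proof (rule run.run_Mu)
      show "run A' e (t # xs) 0" using F0(2) * by blast
      show "\<forall>s<t. \<exists>y. run A' e (s # xs) (Suc y)" using F(2) * by blast
    qed
  qed
qed (auto intro: run.intros)

text \<open>Enumerability as the projection of a decidable relation, which needs neither partial
  functions nor an exception for the empty set.\<close>

definition ce_in :: "nat set \<Rightarrow> nat set \<Rightarrow> bool" where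
  "ce_in X D \<longleftrightarrow> (\<exists>W :: nat \<times> nat \<Rightarrow> bool. decidable D W \<and> X = {x. \<exists>s. W (x, s)})"

section \<open>Finite conditions and generic sequences\<close>

type_synonym pmap = "nat \<Rightarrow> bool option"

definition agrees :: "pmap \<Rightarrow> nat set \<Rightarrow> bool" where
  "agrees p A \<longleftrightarrow> (\<forall>i b. p i = Some b \<longrightarrow> (i \<in> A \<longleftrightarrow> b))"

text \<open>
  A condition is a finite piece of \<open>X\<close> together with finite pieces of two sets whose first
  projections are to be \<open>X\<close>; only positive information about the projections must already be
  reflected in the piece of \<open>X\<close>.
\<close>

definition projects :: "pmap \<Rightarrow> pmap \<Rightarrow> bool" where
  "projects p \<sigma> \<longleftrightarrow> (\<forall>x s. p (prod_encode (x, s)) = Some True \<longrightarrow> \<sigma> x = Some True)"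

definition condition :: "pmap \<times> pmap \<times> pmap \<Rightarrow> bool" where
  "condition c \<longleftrightarrow> (case c of (\<sigma>, p, q) \<Rightarrow> finite (dom \<sigma>) \<and> finite (dom p) \<and> finite (dom q) \<and>
     projects p \<sigma> \<and> projects q \<sigma>)"

definition extends :: "pmap \<times> pmap \<times> pmap \<Rightarrow> pmap \<times> pmap \<times> pmap \<Rightarrow> bool" where
  "extends c' c \<longleftrightarrow> fst c \<subseteq>\<^sub>m fst c' \<and> fst (snd c) \<subseteq>\<^sub>m fst (snd c') \<and> snd (snd c) \<subseteq>\<^sub>m snd (snd c')"

lemma extends_refl: "extends c c" by (simp add: extends_def)

lemma extends_trans: "extends c'' c' \<Longrightarrow> extends c' c \<Longrightarrow> extends c'' c"
  unfolding extends_def using map_le_trans by blast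

definition dense :: "(pmap \<times> pmap \<times> pmap) set \<Rightarrow> bool" where
  "dense \<D> \<longleftrightarrow> (\<forall>c. condition c \<longrightarrow> (\<exists>c'\<in>\<D>. condition c' \<and> extends c' c))"

text \<open>The Rasiowa--Sikorski lemma: the dense sets are met one after the other, and every
  condition of the sequence extends the earlier ones.\<close>

lemma generic_sequence:
  assumes "countable \<F>" "\<And>\<D>. \<D> \<in> \<F> \<Longrightarrow> dense \<D>"
  obtains c :: "nat \<Rightarrow> pmap \<times> pmap \<times> pmap" where "\<And>k. condition (c k)"
    "\<And>i j. i \<le> j \<Longrightarrow> extends (c j) (c i)" "\<And>\<D>. \<D> \<in> \<F> \<Longrightarrow> \<exists>k. c k \<in> \<D>"
proof -
  \<comment> \<open>Adding \<open>UNIV\<close>, which is trivially dense, makes the family nonempty,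
    so that \<open>from_nat_into\<close> lists it.\<close>
  define E where "E = from_nat_into (insert UNIV \<F>)"
  have "dense UNIV" unfolding dense_def using extends_refl by blast
  then have E: "dense (E k)" for k
    unfolding E_def using from_nat_into[of "insert UNIV \<F>" k] assms(2) by auto
  define nxt where "nxt k c = (SOME c'. c' \<in> E k \<and> condition c' \<and> extends c' c)" for k c
  have nxt: "nxt k c \<in> E k \<and> condition (nxt k c) \<and> extends (nxt k c) c" if "condition c" for k c
    unfolding nxt_def by (rule someI_ex) (use E[of k] that in \<open>unfold dense_def, blast\<close>)
  define c where "c = rec_nat (Map.empty, Map.empty, Map.empty) nxt"
  have c_Suc: "c (Suc k) = nxt k (c k)" for k by (simp add: c_def)
  have cond: "condition (c k)" for k
  proof (induction k)
    case 0 show ?case by (simp add: c_def condition_def projects_def)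
  qed (simp add: c_Suc nxt)
  show ?thesis
  proof
    show "condition (c k)" for k by (rule cond)
    show "extends (c j) (c i)" if "i \<le> j" for i j
      using that
    proof (induction rule: dec_induct)
      case (step m)
      then show ?case using nxt[OF cond, of m m] extends_trans[of "nxt m (c m)" "c m" "c i"] by (simp add: c_Suc)
    qed (rule extends_refl)
    fix \<D> assume "\<D> \<in> \<F>"
    then obtain k where "E k = \<D>"
      unfolding E_def using assms(1) by (metis countable_insert from_nat_into_to_nat_on insertCI)
    then have "c (Suc k) \<in> \<D>" using nxt[OF cond, of k] by (auto simp: c_Suc)
    then show "\<exists>k. c k \<in> \<D>" by blast
  qed
qed

definition forces :: "pmap \<Rightarrow> prog \<Rightarrow> nat \<Rightarrow> nat \<Rightarrow> bool" where
  "forces p e x u \<longleftrightarrow> (\<forall>A. agrees p A \<longrightarrow> run A e [x] u)"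

text \<open>Below a split the programs \<open>e\<close> and \<open>e'\<close> give different answers
  at \<open>x\<close>, so they cannot compute the same set from the two oracles.\<close>

definition splits :: "prog \<Rightarrow> prog \<Rightarrow> (pmap \<times> pmap \<times> pmap) set" where
  "splits e e' = {(\<sigma>, p, q). \<exists>x u v. u \<noteq> v \<and> forces p e x u \<and> forces q e' x v}"

text \<open>The only set that can be computed from both sides below a condition without a split.\<close>

definition decided_set :: "prog \<Rightarrow> pmap \<Rightarrow> pmap \<Rightarrow> nat set" where
  "decided_set e \<sigma> p = {x. \<exists>A. agrees p A \<and> (\<forall>y s. prod_encode (y, s) \<in> A \<longrightarrow> \<sigma> y \<noteq> Some False) \<and>
     run A e [x] 1}"

text \<open>Keeps the family of diagonal requirements countable: these are indexed by the finite
  pieces from which a \<open>decided_set\<close> is formed.\<close>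

lemma finite_pmap_countable: "countable {p :: pmap. finite (dom p)}"
proof -
  have "p \<in> range map_of" if "finite (dom p)" for p :: pmap
  proof -
    have m: "map_of (map (\<lambda>i. (i, the (p i))) xs) i = (if i \<in> set xs then Some (the (p i)) else None)"
      for xs i by (induction xs) auto
    have "p = map_of (map (\<lambda>i. (i, the (p i))) (sorted_list_of_set (dom p)))"
      by (auto simp: fun_eq_iff m that domIff)
    then show ?thesis by blast
  qed
  then have "{p :: pmap. finite (dom p)} \<subseteq> range map_of" by blast
  then show ?thesis by (rule countable_subset) simp
qed

instance prog :: countable by countable_datatype

definition restr :: "nat set \<Rightarrow> nat set \<Rightarrow> pmap" where
  "restr A F i = (if i \<in> F then Some (i \<in> A) else None)"

text \<open>Recording the oracle on the finite use of a computation turns this computation into a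
  forced one.\<close>

lemma join_piece:
  assumes "agrees p A" "finite F" "\<And>A'. A' \<inter> F = A \<inter> F \<Longrightarrow> run A' e [x] u"
  shows "forces (p ++ restr A F) e x u" "p \<subseteq>\<^sub>m p ++ restr A F"
proof -
  have "(p ++ restr A F) i = Some (i \<in> A)" if "i \<in> F" for i
    using that by (auto simp: restr_def map_add_def)
  then have "A' \<inter> F = A \<inter> F" if "agrees (p ++ restr A F) A'" for A'
    using that unfolding agrees_def by blast
  then show "forces (p ++ restr A F) e x u" unfolding forces_def using assms(3) by blast
  show "p \<subseteq>\<^sub>m p ++ restr A F"
    using assms(1) by (auto simp: map_le_def restr_def map_add_def agrees_def split: if_splits)
qed

text \<open>A condition with a splitting extension moves to that extension; any other condition
  already lies in the second set.\<close>

lemma dense_splits: "dense (splits e e' \<union> {c. \<forall>c'. condition c' \<longrightarrow> extends c' c \<longrightarrow> c' \<notin> splits e e'})"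
  unfolding dense_def using extends_refl by blast

lemma fresh_pair: "finite (dom (p :: pmap)) \<Longrightarrow> \<exists>s. p (prod_encode (x, s)) = None"
proof (rule ccontr)
  assume f: "finite (dom p)" and "\<nexists>s. p (prod_encode (x, s)) = None"
  then have "range (\<lambda>s. prod_encode (x, s)) \<subseteq> dom p" by auto
  then have "finite (range (\<lambda>s. prod_encode (x, s)))" using f finite_subset by blast
  then have "finite (UNIV :: nat set)"
    by (rule finite_imageD) (auto simp: inj_on_def)
  then show False by simp
qed

text \<open>An undecided \<open>x\<close> may be put outside \<open>X\<close>, and an
  \<open>x\<close> inside \<open>X\<close> is enumerated on both sides at stages that the finite
  pieces have not yet decided. Meeting these sets makes the projections of both oracles equal to
  \<open>X\<close>.\<close>

lemma dense_witness:
  "dense {(\<sigma>, p, q). x \<in> dom \<sigma> \<and> (\<sigma> x = Some True \<longrightarrow>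
     (\<exists>s. p (prod_encode (x, s)) = Some True) \<and> (\<exists>s. q (prod_encode (x, s)) = Some True))}"
  unfolding dense_def
proof (intro allI impI)
  fix c assume c: "condition c"
  obtain \<sigma> p q where cc: "c = (\<sigma>, p, q)" by (cases c) auto
  show "\<exists>c'\<in>{(\<sigma>, p, q). x \<in> dom \<sigma> \<and> (\<sigma> x = Some True \<longrightarrow>
     (\<exists>s. p (prod_encode (x, s)) = Some True) \<and> (\<exists>s. q (prod_encode (x, s)) = Some True))}.
     condition c' \<and> extends c' c"
  proof (cases "\<sigma> x")
    case None
    then show ?thesis using c
      by (intro bexI[of _ "(\<sigma>(x \<mapsto> False), p, q)"])
        (auto simp: condition_def extends_def cc projects_def map_le_def)
  next
    case (Some b)
    have "finite (dom p)" "finite (dom q)" using c by (auto simp: cc condition_def)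
    then obtain s t where st: "p (prod_encode (x, s)) = None" "q (prod_encode (x, t)) = None"
      using fresh_pair by metis
    have ce: "condition (\<sigma>, p(prod_encode (x, s) \<mapsto> True), q(prod_encode (x, t) \<mapsto> True))" if b
      using c Some that by (auto simp: condition_def cc projects_def)
    have ee: "extends (\<sigma>, p(prod_encode (x, s) \<mapsto> True), q(prod_encode (x, t) \<mapsto> True)) c"
      using st by (auto simp: extends_def cc map_le_def)
    have xd: "x \<in> dom \<sigma>" using Some by auto
    show ?thesis
    proof (cases b)
      case True
      show ?thesis
        by (intro bexI[of _ "(\<sigma>, p(prod_encode (x, s) \<mapsto> True), q(prod_encode (x, t) \<mapsto> True))"])
          (use ce ee xd True in auto)
    next
      case False
      then show ?thesis using c Some extends_refl[of c] by (intro bexI[of _ c]) (auto simp: cc)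
    qed
  qed
qed

text \<open>A point outside the finite domain of \<open>\<sigma>\<close> is still free and receives
  the value opposite to \<open>P\<close>. In the application, \<open>P x\<close> says that a fixed
  program with a fixed oracle enumerates \<open>x\<close>.\<close>

lemma dense_diagonal:
  "dense {(\<sigma>, p, q). \<exists>x. \<sigma> x = Some (\<not> P x)}"
  unfolding dense_def
proof (intro allI impI)
  fix c assume c: "condition c"
  obtain \<sigma> p q where cc: "c = (\<sigma>, p, q)" by (cases c) auto
  have "finite (dom \<sigma>)" using c by (simp add: cc condition_def)
  then obtain x where "x \<notin> dom \<sigma>" using ex_new_if_finite infinite_UNIV_nat by blast
  then have x: "\<sigma> x = None" by auto
  then show "\<exists>c'\<in>{(\<sigma>, p, q). \<exists>x. \<sigma> x = Some (\<not> P x)}. condition c' \<and> extends c' c"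
    using c by (intro bexI[of _ "(\<sigma>(x \<mapsto> \<not> P x), p, q)"])
      (auto simp: condition_def extends_def cc projects_def map_le_def split: if_splits)
qed

text \<open>Suppose \<open>x\<close> is in the decided set but not in \<open>B\<close>. Then an
  oracle \<open>A\<close> gives \<open>1\<close> on the first side and \<open>D'\<close> gives
  \<open>0\<close> on the second; recording both finite uses yields a condition that splits.\<close>

lemma no_split_decides:
  assumes c: "condition (\<sigma>, p, q)"
    and nosplit: "\<And>c'. condition c' \<Longrightarrow> extends c' (\<sigma>, p, q) \<Longrightarrow> c' \<notin> splits e e'"
    and D: "agrees p D" "agrees q D'"
    and leg: "\<And>y s. prod_encode (y, s) \<in> D \<Longrightarrow> \<sigma> y \<noteq> Some False"
      "\<And>y s. prod_encode (y, s) \<in> D' \<Longrightarrow> \<sigma> y \<noteq> Some False"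
    and B: "\<And>x. run D e [x] (of_bool (x \<in> B))" "\<And>x. run D' e' [x] (of_bool (x \<in> B))"
  shows "B = decided_set e \<sigma> p"
proof (intro equalityI subsetI)
  fix x assume "x \<in> B"
  then show "x \<in> decided_set e \<sigma> p"
    unfolding decided_set_def using B(1)[of x] D(1) leg(1) by auto
next
  fix x assume "x \<in> decided_set e \<sigma> p"
  then obtain A where A: "agrees p A" "\<And>y s. prod_encode (y, s) \<in> A \<Longrightarrow> \<sigma> y \<noteq> Some False"
    "run A e [x] 1" unfolding decided_set_def by blast
  show "x \<in> B"
  proof (rule ccontr)
    assume "x \<notin> B"
    then have r: "run D' e' [x] 0" using B(2)[of x] by simp
    obtain F where F: "finite F" "\<And>A'. A' \<inter> F = A \<inter> F \<Longrightarrow> run A' e [x] 1" using run_use[OF A(3)] by blast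
    obtain F' where F': "finite F'" "\<And>A'. A' \<inter> F' = D' \<inter> F' \<Longrightarrow> run A' e' [x] 0" using run_use[OF r] by blast
    note J = join_piece[OF A(1) F] join_piece[OF D(2) F']
    \<comment> \<open>These numbers have to enter \<open>X\<close> because the recorded uses contain
      positive information about them. Both oracles respect the exclusions of
      \<open>\<sigma>\<close>, so nothing forbids it.\<close>
    define Y where "Y = (\<lambda>i. fst (prod_decode i)) ` (A \<inter> F \<union> D' \<inter> F')"
    define \<sigma>' where "\<sigma>' y = (if y \<in> Y then Some True else \<sigma> y)" for y
    have Y: "\<sigma> y \<noteq> Some False" if yY: "y \<in> Y" for y
    proof -
      from yY obtain i where i: "i \<in> A \<inter> F \<union> D' \<inter> F'" "y = fst (prod_decode i)" unfolding Y_def by blast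
      have "i = prod_encode (y, snd (prod_decode i))" using i(2) by simp
      with i(1) A(2) leg(2) show ?thesis by (metis IntE UnE)
    qed
    have fin: "finite (dom \<sigma>')"
    proof -
      have "dom \<sigma>' \<subseteq> Y \<union> dom \<sigma>" by (auto simp: \<sigma>'_def split: if_splits)
      moreover have "finite Y" unfolding Y_def using F(1) F'(1) by auto
      ultimately show ?thesis using c
        by (auto simp: condition_def intro: finite_subset[of "dom \<sigma>'" "Y \<union> dom \<sigma>"])
    qed
    have ext: "\<sigma> \<subseteq>\<^sub>m \<sigma>'"
      unfolding map_le_def
    proof
      fix y assume "y \<in> dom \<sigma>"
      then show "\<sigma> y = \<sigma>' y" using Y[of y] by (auto simp: \<sigma>'_def)
    qed
    have proj: "projects (r ++ restr G H) \<sigma>'"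
      if "projects r \<sigma>" "(\<lambda>i. fst (prod_decode i)) ` (G \<inter> H) \<subseteq> Y" for r G H
    proof -
      have "\<sigma>' y = Some True" if "(r ++ restr G H) (prod_encode (y, s)) = Some True" for y s
      proof (cases "prod_encode (y, s) \<in> H")
        case True
        with that have "prod_encode (y, s) \<in> G \<inter> H" by (auto simp: restr_def map_add_def)
        then have "y \<in> (\<lambda>i. fst (prod_decode i)) ` (G \<inter> H)" by force
        then show ?thesis using \<open>_ ` (G \<inter> H) \<subseteq> Y\<close> by (auto simp: \<sigma>'_def)
      next
        case False
        with that have "r (prod_encode (y, s)) = Some True" by (auto simp: restr_def map_add_def)
        then show ?thesis using \<open>projects r \<sigma>\<close> by (auto simp: projects_def \<sigma>'_def)
      qed
      then show ?thesis by (simp add: projects_def)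
    qed
    have fr: "finite (dom (r ++ restr G H))" if "finite (dom r)" "finite H" for r G H
    proof -
      have "dom (restr G H) = H" by (auto simp: restr_def split: if_splits)
      then show ?thesis using that by simp
    qed
    have "condition (\<sigma>', p ++ restr A F, q ++ restr D' F')"
      using c F(1) F'(1) fin fr proj[of p A F] proj[of q D' F'] by (auto simp: condition_def Y_def)
    moreover have "extends (\<sigma>', p ++ restr A F, q ++ restr D' F') (\<sigma>, p, q)"
      using J ext by (auto simp: extends_def)
    moreover have "(\<sigma>', p ++ restr A F, q ++ restr D' F') \<in> splits e e'"
      unfolding splits_def using J zero_neq_one by fastforce
    ultimately show False using nosplit by blast
  qed
qed

text \<open>A set \<open>B\<close> computed from both generic oracles must equal the
  \<open>decided_set\<close> of some condition, since splits were excluded there. There are only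
  countably many such sets, and each is kept from enumerating \<open>X\<close> by
  diagonalization.\<close>

theorem enumerations_without_least_degree:
  obtains X D D' where "ce_in X D" "ce_in X D'"
    "\<And>B. turing_le B D \<Longrightarrow> turing_le B D' \<Longrightarrow> \<not> ce_in X B"
proof -
  define \<F>2 where "\<F>2 = range (\<lambda>x. {(\<sigma>, p, q). x \<in> dom \<sigma> \<and> (\<sigma> x = Some True \<longrightarrow>
     (\<exists>s. p (prod_encode (x, s)) = Some True) \<and> (\<exists>s. q (prod_encode (x, s)) = Some True))} :: (pmap \<times> pmap \<times> pmap) set)"
  define \<F>3 where "\<F>3 = range (\<lambda>(e, e'). splits e e' \<union> {c. \<forall>c'. condition c' \<longrightarrow> extends c' c \<longrightarrow> c' \<notin> splits e e'})"
  \<comment> \<open>Defeats program \<open>i\<close> with oracle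
    \<open>decided_set e \<sigma>0 p0\<close>. The pieces range over all finite ones, not only over
    those of the sequence, so the family is fixed before the sequence is chosen.\<close>
  define \<Delta> where "\<Delta> e i \<sigma>0 p0 =
      ({(\<sigma>, p, q). \<exists>x. \<sigma> x = Some (\<not> (\<exists>s::nat. run (decided_set e \<sigma>0 p0) i [enc (x, s)] 1))}
        :: (pmap \<times> pmap \<times> pmap) set)" for e i \<sigma>0 p0
  define \<F>4 where "\<F>4 = (\<lambda>(e, i, \<sigma>0, p0). \<Delta> e i \<sigma>0 p0) `
      (UNIV \<times> UNIV \<times> {p :: pmap. finite (dom p)} \<times> {p. finite (dom p)})"
  have cF: "countable (\<F>2 \<union> \<F>3 \<union> \<F>4)"
    unfolding \<F>2_def \<F>3_def \<F>4_def
    by (intro countable_Un countable_image countable_SIGMA finite_pmap_countable) auto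
  have dF: "dense \<D>" if "\<D> \<in> \<F>2 \<union> \<F>3 \<union> \<F>4" for \<D>
    using that
  proof (elim UnE)
    assume "\<D> \<in> \<F>2" then show ?thesis using dense_witness unfolding \<F>2_def by blast
  next
    assume "\<D> \<in> \<F>3"
    then obtain e e' where
      "\<D> = splits e e' \<union> {c. \<forall>c'. condition c' \<longrightarrow> extends c' c \<longrightarrow> c' \<notin> splits e e'}"
      unfolding \<F>3_def by auto
    then show ?thesis by (simp only: dense_splits)
  next
    assume "\<D> \<in> \<F>4"
    then obtain e i \<sigma>0 p0 where "\<D> = \<Delta> e i \<sigma>0 p0" unfolding \<F>4_def by auto
    then show ?thesis by (simp only: \<Delta>_def dense_diagonal)
  qed
  have "\<exists>c :: nat \<Rightarrow> _. (\<forall>k. condition (c k)) \<and> (\<forall>i j. i \<le> j \<longrightarrow> extends (c j) (c i)) \<and>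
      (\<forall>\<D>\<in>\<F>2 \<union> \<F>3 \<union> \<F>4. \<exists>k. c k \<in> \<D>)"
  proof (rule generic_sequence[OF cF dF])
    fix c :: "nat \<Rightarrow> pmap \<times> pmap \<times> pmap"
    assume "\<And>k. condition (c k)" "\<And>i j. i \<le> j \<Longrightarrow> extends (c j) (c i)"
      "\<And>\<D>. \<D> \<in> \<F>2 \<union> \<F>3 \<union> \<F>4 \<Longrightarrow> \<exists>k. c k \<in> \<D>"
    then show ?thesis by (intro exI[of _ c]) simp
  qed
  then obtain c :: "nat \<Rightarrow> pmap \<times> pmap \<times> pmap" where c: "(\<forall>k. condition (c k)) \<and>
      (\<forall>i j. i \<le> j \<longrightarrow> extends (c j) (c i)) \<and> (\<forall>\<D>\<in>\<F>2 \<union> \<F>3 \<union> \<F>4. \<exists>k. c k \<in> \<D>)" ..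
  have cond: "condition (c k)" for k using c by simp
  have ext: "extends (c j) (c i)" if "i \<le> j" for i j using c that by simp
  have meets: "\<exists>k. c k \<in> \<D>" if "\<D> \<in> \<F>2 \<union> \<F>3 \<union> \<F>4" for \<D>
    using conjunct2[OF conjunct2[OF c]] that by (rule bspec)
  define s where "s k = fst (c k)" for k
  define p where "p k = fst (snd (c k))" for k
  define q where "q k = snd (snd (c k))" for k
  have ck: "c k = (s k, p k, q k)" for k by (simp add: s_def p_def q_def)
  define X where "X = {x. \<exists>k. s k x = Some True}"
  define D where "D = {x. \<exists>k. p k x = Some True}"
  define D' where "D' = {x. \<exists>k. q k x = Some True}"
  have agr: "agrees (f k) {x. \<exists>k. f k x = Some True}"
    if "\<And>i j. i \<le> j \<Longrightarrow> f i \<subseteq>\<^sub>m f j" for f :: "nat \<Rightarrow> pmap" and k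
    unfolding agrees_def
  proof (intro allI impI)
    fix i b assume b: "f k i = Some b"
    have "f l i = Some True \<longrightarrow> b" for l
    proof
      assume l: "f l i = Some True"
      have "f k i = f l i"
      proof (cases "l \<le> k")
        case True
        then show ?thesis using that[OF True] l by (metis domI map_le_def)
      next
        case False
        then show ?thesis using that[of k l] b by (metis domI map_le_def nat_le_linear)
      qed
      then show b using l b by simp
    qed
    then show "(i \<in> {x. \<exists>k. f k x = Some True}) = b" using b by auto
  qed
  have sX: "agrees (s k) X" and pD: "agrees (p k) D" and qD: "agrees (q k) D'" for k
    unfolding X_def D_def D'_def using ext
    by (auto intro!: agr simp: s_def p_def q_def extends_def)
  have DX: "x \<in> X" if "prod_encode (x, t) \<in> D" for x t
    using that cond unfolding D_def X_def condition_def ck projects_def by blast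
  have D'X: "x \<in> X" if "prod_encode (x, t) \<in> D'" for x t
    using that cond unfolding D'_def X_def condition_def ck projects_def by blast
  have wit: "(\<exists>t. prod_encode (x, t) \<in> D) \<and> (\<exists>t. prod_encode (x, t) \<in> D')" if "x \<in> X" for x
  proof -
    have "{(\<sigma>, p, q). x \<in> dom \<sigma> \<and> (\<sigma> x = Some True \<longrightarrow>
     (\<exists>s. p (prod_encode (x, s)) = Some True) \<and> (\<exists>s. q (prod_encode (x, s)) = Some True))} \<in> \<F>2"
      unfolding \<F>2_def by blast
    then have "\<exists>k. c k \<in> {(\<sigma>, p, q). x \<in> dom \<sigma> \<and> (\<sigma> x = Some True \<longrightarrow>
     (\<exists>s. p (prod_encode (x, s)) = Some True) \<and> (\<exists>s. q (prod_encode (x, s)) = Some True))}"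
      by (intro meets) simp
    then obtain k where k: "x \<in> dom (s k)" "s k x = Some True \<longrightarrow>
     (\<exists>s. p k (prod_encode (x, s)) = Some True) \<and> (\<exists>s. q k (prod_encode (x, s)) = Some True)"
      unfolding ck by auto
    from k(1) sX[of k] that have "s k x = Some True" unfolding agrees_def by auto
    then show ?thesis using k(2) unfolding D_def D'_def by blast
  qed
  show ?thesis
  proof
    have mem: "decidable E (\<lambda>r :: nat \<times> nat. enc r \<in> E)" for E
      by (rule decidable_comp[OF decidable_mem]) (intro computable_intros)
    have "X = {x. \<exists>t::nat. enc (x, t) \<in> D}" "X = {x. \<exists>t::nat. enc (x, t) \<in> D'}"
      using DX D'X wit by (auto simp: enc_Pair)
    then show "ce_in X D" "ce_in X D'" unfolding ce_in_def using mem by blast+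
    fix B assume "turing_le B D" "turing_le B D'"
    then obtain e e' where e: "\<And>x. run D e [x] (of_bool (x \<in> B))" and e': "\<And>x. run D' e' [x] (of_bool (x \<in> B))"
      unfolding turing_le_def by blast
    have "splits e e' \<union> {c. \<forall>c'. condition c' \<longrightarrow> extends c' c \<longrightarrow> c' \<notin> splits e e'} \<in> \<F>3"
      unfolding \<F>3_def by blast
    then obtain k where k: "c k \<in> splits e e' \<or> (\<forall>c'. condition c' \<longrightarrow> extends c' (c k) \<longrightarrow> c' \<notin> splits e e')"
      using meets by blast
    have "c k \<notin> splits e e'"
    proof
      assume "c k \<in> splits e e'"
      then obtain x u v where "u \<noteq> v" "run D e [x] u" "run D' e' [x] v"
        unfolding splits_def ck forces_def using pD qD by blast
      then show False using e e' run_deterministic by metis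
    qed
    with k have ns: "\<And>c'. condition c' \<Longrightarrow> extends c' (s k, p k, q k) \<Longrightarrow> c' \<notin> splits e e'"
      unfolding ck by blast
    have B: "B = decided_set e (s k) (p k)"
    proof (rule no_split_decides[OF _ ns])
      show "condition (s k, p k, q k)" using cond[of k] by (simp add: ck)
      show "s k y \<noteq> Some False" if "prod_encode (y, t) \<in> D" for y t
        using DX[OF that] sX[of k] unfolding agrees_def by blast
      show "s k y \<noteq> Some False" if "prod_encode (y, t) \<in> D'" for y t
        using D'X[OF that] sX[of k] unfolding agrees_def by blast
    qed (use pD qD e e' in auto)
    show "\<not> ce_in X B"
    proof
      assume "ce_in X B"
      then obtain W :: "nat \<times> nat \<Rightarrow> bool" where W: "decidable B W" "X = {x. \<exists>s. W (x, s)}"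
        unfolding ce_in_def by blast
      from W(1) obtain i where i: "\<And>r. run B i [enc r] (of_bool (W r))"
        unfolding decidable_def computable_def by auto
      have Wi: "W r \<longleftrightarrow> run B i [enc r] 1" for r
        using i[of r] run_deterministic by (cases "W r") fastforce+
      have "(e, i, s k, p k) \<in> UNIV \<times> UNIV \<times> {p :: pmap. finite (dom p)} \<times> {p. finite (dom p)}"
        using cond[of k] by (simp add: ck condition_def)
      then have "\<Delta> e i (s k) (p k) \<in> \<F>4"
        unfolding \<F>4_def by (rule rev_image_eqI) simp
      then obtain l where "c l \<in> \<Delta> e i (s k) (p k)"
        using meets by blast
      then obtain x where "s l x = Some (\<not> (\<exists>t. W (x, t)))"
        unfolding ck Wi \<Delta>_def B[symmetric] by blast
      then show False using sX[of l] W(2) unfolding agrees_def by auto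
    qed
  qed
qed

section \<open>Evaluation of multivariate polynomials\<close>

abbreviation mlookup where "mlookup \<equiv> Poly_Mapping.lookup"
abbreviation mkeys where "mkeys \<equiv> Poly_Mapping.keys"
abbreviation msingle where "msingle \<equiv> Poly_Mapping.single"

definition mon_val :: "(nat \<Rightarrow> 'r::comm_ring_1) \<Rightarrow> (nat \<Rightarrow>\<^sub>0 nat) \<Rightarrow> 'r" where
  "mon_val a m = (\<Prod>i\<in>mkeys m. a i ^ mlookup m i)"

text \<open>The common form of all substitutions: \<open>meval\<close>, \<open>msubst\<close>, the
  retractions, the specializations of codes and the map to the function field are instances.\<close>

definition mev :: "('k::field \<Rightarrow> 'r::comm_ring_1) \<Rightarrow> (nat \<Rightarrow> 'r) \<Rightarrow> 'k mpoly \<Rightarrow> 'r" where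
  "mev \<sigma> a p = (\<Sum>m\<in>mkeys p. \<sigma> (mlookup p m) * mon_val a m)"

lemma mon_val_superset:
  "finite S \<Longrightarrow> mkeys m \<subseteq> S \<Longrightarrow> mon_val a m = (\<Prod>i\<in>S. a i ^ mlookup m i)"
  unfolding mon_val_def by (rule prod.mono_neutral_left) (auto simp: in_keys_iff)

lemma mon_val_add: "mon_val a (m + m') = mon_val a m * mon_val a m'"
proof -
  have "mkeys (m + m') \<subseteq> mkeys m \<union> mkeys m'" by (rule Poly_Mapping.keys_add)
  then show ?thesis
    by (simp add: mon_val_superset[of "mkeys m \<union> mkeys m'"] lookup_add power_add prod.distrib)
qed

lemma mon_val_0: "mon_val a 0 = 1" by (simp add: mon_val_def)

lemma mon_val_single: "mon_val a (msingle i e) = a i ^ e"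
  by (cases "e = 0") (auto simp: mon_val_def)

lemma mpoly_as_sum: "p = (\<Sum>m\<in>mkeys p. msingle m (mlookup p m))"
  by (rule poly_mapping_eqI) (auto simp: lookup_sum lookup_single when_def in_keys_iff sum.delta)

lemma mpoly_induct [case_names zero add_single]:
  fixes P :: "'k::field mpoly \<Rightarrow> bool"
  assumes "P 0" "\<And>m c q. P q \<Longrightarrow> P (msingle m c + q)"
  shows "P p"
proof -
  have "P (\<Sum>m\<in>S. msingle m (mlookup p m))" if "finite S" for S
    using that by induction (auto intro: assms)
  then have "P (\<Sum>m\<in>mkeys p. msingle m (mlookup p m))" by simp
  then show ?thesis using mpoly_as_sum[of p] by simp
qed

context
  fixes \<sigma> :: "'k::field \<Rightarrow> 'r::comm_ring_1"
  assumes \<sigma>: "comm_ring_hom \<sigma>"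
begin

interpretation \<sigma>: comm_ring_hom \<sigma> by (rule \<sigma>)

lemma mev_superset:
  "finite S \<Longrightarrow> mkeys p \<subseteq> S \<Longrightarrow> mev \<sigma> a p = (\<Sum>m\<in>S. \<sigma> (mlookup p m) * mon_val a m)"
  unfolding mev_def by (rule sum.mono_neutral_left) (auto simp: in_keys_iff)

lemma mev_add: "mev \<sigma> a (p + q) = mev \<sigma> a p + mev \<sigma> a q"
proof -
  have "mkeys (p + q) \<subseteq> mkeys p \<union> mkeys q" by (rule Poly_Mapping.keys_add)
  then show ?thesis
    by (simp add: mev_superset[of "mkeys p \<union> mkeys q"] lookup_add \<sigma>.hom_add sum.distrib algebra_simps)
qed

lemma mev_single: "mev \<sigma> a (msingle m c) = \<sigma> c * mon_val a m"
  by (cases "c = 0") (auto simp: mev_def)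

lemma mev_0: "mev \<sigma> a 0 = 0" by (simp add: mev_def)

lemma mev_mult_single: "mev \<sigma> a (msingle m c * q) = \<sigma> c * mon_val a m * mev \<sigma> a q"
proof (induction q rule: mpoly_induct)
  case (add_single m' c' q)
  then show ?case
    by (simp add: mev_add mev_single mult_single mon_val_add \<sigma>.hom_mult algebra_simps)
qed (simp add: mev_0)

lemma mev_mult: "mev \<sigma> a (p * q) = mev \<sigma> a p * mev \<sigma> a q"
proof (induction p rule: mpoly_induct)
  case (add_single m c p)
  then show ?case by (simp add: mev_add mev_single mev_mult_single distrib_right mult.assoc)
qed (simp add: mev_0)

lemma mev_hom: "comm_ring_hom (mev \<sigma> a)"
proof
  show "mev \<sigma> a 1 = 1"
    using mev_single[of a 0 1] by (simp add: mon_val_0)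
qed (simp_all add: mev_0 mev_add mev_mult)

lemma mev_Const: "mev \<sigma> a (Const c) = \<sigma> c"
  by (simp add: Const_def mev_single mon_val_0)

lemma mev_Var: "mev \<sigma> a (Var i) = a i"
  by (simp add: Var_def mev_single mon_val_single)

end

lemma Const_hom: "comm_ring_hom (Const :: 'k::field \<Rightarrow> 'k mpoly)"
  by unfold_locales (auto simp: Const_def single_add mult_single)

lemma id_hom: "comm_ring_hom (\<lambda>x :: 'k :: field. x)"
  by unfold_locales auto

lemma meval_eq_mev: "meval a = mev (\<lambda>x. x) a"
  by (simp add: fun_eq_iff meval_def mev_def mon_val_def)

lemma meval_hom: "comm_ring_hom (meval a)"
  unfolding meval_eq_mev by (rule mev_hom[OF id_hom])

lemma meval_Const [simp]: "meval a (Const c) = c" and meval_Var [simp]: "meval a (Var i) = a i"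
  unfolding meval_eq_mev by (simp_all add: mev_Const mev_Var id_hom)

lemma Var_power: "Var i ^ e = msingle (msingle i e) 1"
proof (induction e)
  case (Suc e)
  then show ?case by (simp add: Var_def mult_single single_add[symmetric])
qed simp

lemma msubst_eq_mev: "msubst j c = mev Const (Var(j := Const c))"
proof -
  interpret C: comm_ring_hom "Const :: 'a \<Rightarrow> 'a mpoly" by (rule Const_hom)
  have prod_single: "(\<Prod>i\<in>S. msingle (f i) 1) = msingle (\<Sum>i\<in>S. f i) (1::'a)"
    if "finite S" for f :: "nat \<Rightarrow> nat \<Rightarrow>\<^sub>0 nat" and S
    using that by induction (auto simp: mult_single)
  have "mon_val (Var(j := Const c)) m =
      msingle (m - msingle j (mlookup m j)) (c ^ mlookup m j)" for m
  proof -
    have "mon_val (Var(j := Const c)) m = (\<Prod>i\<in>insert j (mkeys m). (Var(j := Const c)) i ^ mlookup m i)"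
      by (rule mon_val_superset) auto
    also have "\<dots> = Const c ^ mlookup m j * (\<Prod>i\<in>mkeys m - {j}. Var i ^ mlookup m i)"
      by (subst prod.insert_remove) auto
    also have "(\<Prod>i\<in>mkeys m - {j}. Var i ^ mlookup m i) = msingle (\<Sum>i\<in>mkeys m - {j}. msingle i (mlookup m i)) (1::'a)"
      by (simp add: Var_power prod_single)
    also have "(\<Sum>i\<in>mkeys m - {j}. msingle i (mlookup m i)) = m - msingle j (mlookup m j)"
      by (rule poly_mapping_eqI)
        (auto simp: lookup_sum lookup_minus lookup_single when_def in_keys_iff sum.delta)
    also have "Const c ^ mlookup m j = (Const (c ^ mlookup m j) :: 'a mpoly)" by (rule C.hom_power[symmetric])
    also have "Const (c ^ mlookup m j) * msingle (m - msingle j (mlookup m j)) 1 =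
        msingle (m - msingle j (mlookup m j)) (c ^ mlookup m j)"
      by (simp add: Const_def mult_single)
    finally show ?thesis .
  qed
  note mv = this
  show ?thesis
    by (simp only: fun_eq_iff msubst_def mev_def mv) (simp add: Const_def mult_single)
qed

lemma msubst_hom: "comm_ring_hom (msubst j c)"
  unfolding msubst_eq_mev by (rule mev_hom[OF Const_hom])

lemma msubst_Const [simp]: "msubst j c (Const d) = Const d"
  unfolding msubst_eq_mev by (simp add: mev_Const Const_hom)

lemma msubst_Var: "msubst j c (Var i) = (if i = j then Const c else Var i)"
  unfolding msubst_eq_mev by (simp add: mev_Var Const_hom)

section \<open>Polynomials in a given set of variables\<close>

lemma Const_in [simp]: "Const c \<in> polys_in S"
  by (simp add: polys_in_def Const_def)

lemma Var_in [simp]: "Var i \<in> polys_in S \<longleftrightarrow> i \<in> S"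
  by (simp add: polys_in_def Var_def)

lemma zero_in [simp]: "0 \<in> polys_in S" and one_in [simp]: "1 \<in> polys_in S"
  by (simp_all add: polys_in_def)

lemma add_in [simp, intro]: "p \<in> polys_in S \<Longrightarrow> q \<in> polys_in S \<Longrightarrow> p + q \<in> polys_in S"
  using Poly_Mapping.keys_add[of p q] by (auto simp: polys_in_def)

lemma mult_in [simp, intro]:
  assumes "p \<in> polys_in S" "q \<in> polys_in S" shows "p * q \<in> polys_in S"
  unfolding polys_in_def
proof (intro CollectI ballI)
  fix m assume "m \<in> mkeys (p * q)"
  then obtain a b where "m = a + b" "a \<in> mkeys p" "b \<in> mkeys q"
    using keys_mult[of p q] by blast
  then show "mkeys m \<subseteq> S"
    using assms Poly_Mapping.keys_add[of a b] unfolding polys_in_def by blast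
qed

lemma uminus_in [simp, intro]: "p \<in> polys_in S \<Longrightarrow> - p \<in> polys_in S"
  by (simp add: polys_in_def)

lemma minus_in [simp, intro]: "p \<in> polys_in S \<Longrightarrow> q \<in> polys_in S \<Longrightarrow> p - q \<in> polys_in S"
  using add_in[of p S "- q"] by simp

lemma power_in [simp, intro]: "p \<in> polys_in S \<Longrightarrow> p ^ e \<in> polys_in S"
  by (induction e) auto

lemma sum_in [intro]: "(\<And>i. i \<in> A \<Longrightarrow> f i \<in> polys_in S) \<Longrightarrow> sum f A \<in> polys_in S"
  by (induction A rule: infinite_finite_induct) auto

lemma prod_in [intro]: "(\<And>i. i \<in> A \<Longrightarrow> f i \<in> polys_in S) \<Longrightarrow> prod f A \<in> polys_in S"
  by (induction A rule: infinite_finite_induct) auto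

lemma polys_in_mono: "S \<subseteq> T \<Longrightarrow> polys_in S \<subseteq> polys_in T"
  by (auto simp: polys_in_def)

lemma msingle_eq_mon_val: "msingle m c = Const c * mon_val Var m"
proof -
  have "mev Const Var (msingle m c) = Const c * mon_val Var m" by (rule mev_single[OF Const_hom])
  moreover have "mon_val Var m = (msingle m 1 :: 'a mpoly)"
  proof -
    have prod_single: "(\<Prod>i\<in>S. msingle (f i) 1) = msingle (\<Sum>i\<in>S. f i) (1::'a)"
      if "finite S" for f :: "nat \<Rightarrow> nat \<Rightarrow>\<^sub>0 nat" and S
      using that by induction (auto simp: mult_single)
    have "(\<Sum>i\<in>mkeys m. msingle i (mlookup m i)) = m"
      by (rule poly_mapping_eqI) (auto simp: lookup_sum lookup_single when_def in_keys_iff sum.delta)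
    then show ?thesis by (simp add: mon_val_def Var_power prod_single)
  qed
  ultimately show ?thesis by (simp add: Const_def mult_single)
qed

lemma polys_in_induct [consumes 1, case_names Const Var add mult]:
  assumes p: "p \<in> polys_in S"
    and "\<And>c. P (Const c)" "\<And>i. i \<in> S \<Longrightarrow> P (Var i)"
    and add: "\<And>p q. p \<in> polys_in S \<Longrightarrow> q \<in> polys_in S \<Longrightarrow> P p \<Longrightarrow> P q \<Longrightarrow> P (p + q)"
    and mult: "\<And>p q. p \<in> polys_in S \<Longrightarrow> q \<in> polys_in S \<Longrightarrow> P p \<Longrightarrow> P q \<Longrightarrow> P (p * q)"
  shows "P (p :: 'k::field mpoly)"
proof -
  have [simp]: "Const (0::'k) = 0" "Const (1::'k) = 1" by (simp_all add: Const_def)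
  have P01: "P 0" "P 1" using assms(2)[of 0] assms(2)[of 1] by simp_all
  have pow: "P (Var i ^ e)" if "i \<in> S" for i e
    using that by (induction e) (auto intro!: mult assms(3) P01)
  have mon: "P (\<Prod>i\<in>A. Var i ^ f i)" if "finite A" "A \<subseteq> S" for A and f :: "nat \<Rightarrow> nat"
    using that by (induction A rule: finite_induct) (auto intro!: mult pow P01 prod_in)
  have "P (\<Sum>m\<in>M. msingle m (mlookup p m))" if "finite M" "M \<subseteq> mkeys p" for M
    using that
  proof (induction M rule: finite_induct)
    case (insert m M)
    then have S: "mkeys m \<subseteq> S" using p by (auto simp: polys_in_def)
    have "(\<Prod>i\<in>mkeys m. Var i ^ mlookup m i) \<in> polys_in S"
      by (rule prod_in) (use S in auto)
    then have "P (Const (mlookup p m) * mon_val Var m)"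
      unfolding mon_val_def by (intro mult assms(2) mon S) auto
    moreover have "msingle m (mlookup p m) \<in> polys_in S"
      using S by (simp add: polys_in_def)
    moreover have "(\<Sum>m\<in>M. msingle m (mlookup p m)) \<in> polys_in S"
      using p insert.prems by (intro sum_in) (auto simp: polys_in_def)
    ultimately show ?case using insert by (auto intro!: add simp flip: msingle_eq_mon_val)
  qed (simp add: P01)
  then have "P (\<Sum>m\<in>mkeys p. msingle m (mlookup p m))" by simp
  then show ?thesis using mpoly_as_sum[of p] by simp
qed

lemma mev_in:
  assumes "comm_ring_hom \<sigma>" "\<And>c. \<sigma> c \<in> polys_in T" "\<And>i. i \<in> S \<Longrightarrow> a i \<in> polys_in T" "p \<in> polys_in S"
  shows "mev \<sigma> a p \<in> polys_in T"
proof -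
  interpret comm_ring_hom "mev \<sigma> a" by (rule mev_hom[OF assms(1)])
  show ?thesis using assms(4)
    by (induction rule: polys_in_induct) (auto simp: hom_add hom_mult mev_Const[OF assms(1)] mev_Var[OF assms(1)] assms)
qed

lemma mev_unique:
  assumes "comm_ring_hom h" "comm_ring_hom h'" "p \<in> polys_in S" "\<And>c. h (Const c) = h' (Const c)"
    "\<And>i. i \<in> S \<Longrightarrow> h (Var i) = h' (Var i)"
  shows "h p = h' (p :: 'k :: field mpoly)"
proof -
  interpret h: comm_ring_hom h by fact
  interpret h': comm_ring_hom h' by fact
  show ?thesis using assms(3)
    by (induction rule: polys_in_induct) (auto simp: assms h.hom_add h'.hom_add h.hom_mult h'.hom_mult)
qed

lemma UNIV_polys_in: "polys_in UNIV = UNIV"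
  by (auto simp: polys_in_def)

lemma finite_vars: "\<exists>S. finite S \<and> p \<in> polys_in S"
  by (rule exI[of _ "\<Union>m\<in>mkeys p. mkeys m"]) (auto simp: polys_in_def)

text \<open>A polynomial in a distinguished variable is treated as a univariate polynomial over the
  type of all multivariate ones; the condition on the coefficients records the smaller coefficient
  ring.\<close>

lemma polys_in_decompose:
  assumes "p \<in> polys_in (insert s S)"
  obtains P :: "'k::field mpoly poly" where "\<And>i. coeff P i \<in> polys_in S" "poly P (Var s) = p"
proof -
  have "\<exists>P. (\<forall>i. coeff P i \<in> polys_in S) \<and> poly P (Var s) = p" using assms
  proof (induction rule: polys_in_induct)
    case (Const c)
    show ?case by (rule exI[of _ "[:Const c:]"]) (auto simp: coeff_pCons split: nat.splits)
  next
    case (Var i)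
    show ?case
    proof (cases "i = s")
      case True
      then show ?thesis by (intro exI[of _ "[:0, 1:]"]) (auto simp: coeff_pCons split: nat.splits)
    next
      case False
      then show ?thesis using Var by (intro exI[of _ "[:Var i:]"]) (auto simp: coeff_pCons split: nat.splits)
    qed
  next
    case (add p q)
    then obtain P Q where "\<forall>i. coeff P i \<in> polys_in S" "poly P (Var s) = p"
      "\<forall>i. coeff Q i \<in> polys_in S" "poly Q (Var s) = q" by blast
    then show ?case by (intro exI[of _ "P + Q"]) auto
  next
    case (mult p q)
    then obtain P Q where "\<forall>i. coeff P i \<in> polys_in S" "poly P (Var s) = p"
      "\<forall>i. coeff Q i \<in> polys_in S" "poly Q (Var s) = q" by blast
    then show ?case by (intro exI[of _ "P * Q"]) (auto simp: coeff_mult)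
  qed
  then show ?thesis using that by blast
qed

lemma poly_Var_in: "(\<And>i. coeff P i \<in> polys_in S) \<Longrightarrow> s \<in> T \<Longrightarrow> S \<subseteq> T \<Longrightarrow> poly P (Var s) \<in> polys_in T"
  unfolding poly_altdef using polys_in_mono[of S T] by (intro sum_in mult_in power_in) auto

text \<open>If the field were finite, \<open>p\<close> would be a nonconstant polynomial with value
  \<open>1\<close> everywhere.\<close>

lemma infinite_alg_closed: "infinite (UNIV :: 'k::alg_closed_field set)"
proof
  assume f: "finite (UNIV :: 'k set)"
  define p :: "'k poly" where "p = (\<Prod>a\<in>UNIV. [:- a, 1:]) + 1"
  have "degree (\<Prod>a\<in>(UNIV::'k set). [:- a, 1:]) = card (UNIV :: 'k set)"
    by (subst degree_prod_eq_sum_degree) auto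
  moreover have "card (UNIV :: 'k set) > 0" using f by (simp add: card_gt_0_iff)
  ultimately have "degree p > 0" unfolding p_def by (subst degree_add_eq_left) auto
  then obtain x where "poly p x = 0" using alg_closed_imp_poly_has_root by blast
  moreover have "poly p x = 1" unfolding p_def using f by (simp add: poly_prod prod_zero[of UNIV])
  ultimately show False by simp
qed

lemma meval_cong: "p \<in> polys_in S \<Longrightarrow> (\<And>i. i \<in> S \<Longrightarrow> a i = b i) \<Longrightarrow> meval a p = meval b p"
  by (rule mev_unique[OF meval_hom meval_hom]) auto

text \<open>The other variables are chosen so that the leading coefficient in the new variable
  survives; then the finitely many roots are avoided, which requires an infinite field.\<close>

lemma nonvanishing:
  fixes p :: "'k::alg_closed_field mpoly"
  assumes "p \<noteq> 0" shows "\<exists>a. meval a p \<noteq> 0"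
proof -
  obtain S where S: "finite S" "p \<in> polys_in S" using finite_vars by blast
  then show ?thesis using assms
  proof (induction S arbitrary: p rule: finite_induct)
    case empty
    then have "p = Const (mlookup p 0)"
      unfolding Const_def polys_in_def
      by (intro poly_mapping_eqI) (auto simp: lookup_single when_def in_keys_iff)
    then show ?case using empty by (metis Const_def meval_Const single_zero)
  next
    case (insert s S)
    obtain P :: "'k mpoly poly" where P: "\<And>i. coeff P i \<in> polys_in S" "poly P (Var s) = p"
      using polys_in_decompose[OF insert.prems(1)] by blast
    then have "P \<noteq> 0" using insert.prems(2) by auto
    then obtain a where a: "meval a (lead_coeff P) \<noteq> 0" using insert.IH[OF P(1)] leading_coeff_0_iff by blast
    interpret h: comm_ring_hom "meval a" by (rule meval_hom)
    define Q where "Q = map_poly (meval a) P"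
    have "Q \<noteq> 0" using a unfolding Q_def by (metis coeff_0 h.coeff_map_poly_hom)
    then have "finite {x. poly Q x = 0}" by (rule poly_roots_finite)
    then obtain t where t: "poly Q t \<noteq> 0" using infinite_alg_closed
      by (metis (mono_tags, lifting) finite_subset mem_Collect_eq subsetI)
    define b where "b = a(s := t)"
    interpret hb: comm_ring_hom "meval b" by (rule meval_hom)
    have "meval b p = poly (map_poly (meval b) P) t"
      unfolding P(2)[symmetric] by (metis b_def fun_upd_same hb.poly_map_poly meval_Var)
    also have "map_poly (meval b) P = Q"
    proof (rule poly_eqI)
      fix i
      have "meval b (coeff P i) = meval a (coeff P i)"
        by (rule meval_cong[OF P(1)]) (use insert.hyps in \<open>auto simp: b_def\<close>)
      then show "coeff (map_poly (meval b) P) i = coeff Q i" by (simp add: Q_def)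
    qed
    finally show ?case using t by (intro exI[of _ b]) simp
  qed
qed

text \<open>The superfluous variables are specialized to generic constants.\<close>

lemma retraction:
  fixes N :: "'k::alg_closed_field mpoly"
  assumes "N \<noteq> 0"
  obtains \<rho> where "comm_ring_hom \<rho>" "\<And>p. \<rho> p \<in> polys_in S" "\<And>p. p \<in> polys_in S \<Longrightarrow> \<rho> p = p" "\<rho> N \<noteq> 0"
proof -
  obtain a where a: "meval a N \<noteq> 0" using nonvanishing[OF assms] by blast
  define \<rho> where "\<rho> = mev Const (\<lambda>i. if i \<in> S then Var i else Const (a i))"
  have h: "comm_ring_hom \<rho>" unfolding \<rho>_def by (rule mev_hom[OF Const_hom])
  interpret \<rho>: comm_ring_hom \<rho> by (rule h)
  interpret ev: comm_ring_hom "meval a" by (rule meval_hom)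
  have c: "\<rho> (Const c) = Const c" and v: "\<rho> (Var i) = (if i \<in> S then Var i else Const (a i))" for c i
    unfolding \<rho>_def by (simp_all add: mev_Const mev_Var Const_hom)
  have "meval a (\<rho> N) = meval a N"
  proof (rule mev_unique[where h = "\<lambda>p. meval a (\<rho> p)" and S = UNIV])
    show "comm_ring_hom (\<lambda>p. meval a (\<rho> p))"
      by unfold_locales (auto simp: \<rho>.hom_add \<rho>.hom_mult ev.hom_add ev.hom_mult)
  qed (auto simp: meval_hom c v UNIV_polys_in)
  then have "\<rho> N \<noteq> 0" using a by auto
  moreover have "\<rho> p \<in> polys_in S" for p
    unfolding \<rho>_def by (rule mev_in[OF Const_hom, where S = UNIV]) (auto simp: UNIV_polys_in)
  moreover have "\<rho> p = p" if "p \<in> polys_in S" for p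
  proof (rule mev_unique[OF h _ that])
    show "comm_ring_hom (\<lambda>p :: 'k mpoly. p)" by unfold_locales auto
  qed (use c v in auto)
  ultimately show ?thesis using that h by blast
qed

lemma msubst_in: "p \<in> polys_in S \<Longrightarrow> msubst j c p \<in> polys_in (S - {j})"
  unfolding msubst_eq_mev by (rule mev_in[OF Const_hom]) auto

lemma msubst_id: "p \<in> polys_in S \<Longrightarrow> j \<notin> S \<Longrightarrow> msubst j c p = p"
proof -
  assume p: "p \<in> polys_in S" "j \<notin> S"
  interpret comm_ring_hom "msubst j c" by (rule msubst_hom)
  show ?thesis using p(1)
    by (induction rule: polys_in_induct) (use p(2) in \<open>auto simp: msubst_Var hom_add hom_mult\<close>)
qed

lemma msubst_remainder:
  assumes "p \<in> polys_in S" "j \<in> S"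
  obtains q where "q \<in> polys_in S" "p = msubst j c p + (Var j - Const c) * q"
proof -
  interpret comm_ring_hom "msubst j c" by (rule msubst_hom)
  have "\<exists>q\<in>polys_in S. p = msubst j c p + (Var j - Const c) * q" using assms(1)
  proof (induction rule: polys_in_induct)
    case (Const d)
    show ?case by (intro bexI[of _ 0]) auto
  next
    case (Var i)
    show ?case
    proof (cases "i = j")
      case True then show ?thesis by (intro bexI[of _ 1]) (auto simp: msubst_Var)
    next
      case False then show ?thesis by (intro bexI[of _ 0]) (auto simp: msubst_Var)
    qed
  next
    case (add p q)
    then obtain p' q' where *: "p' \<in> polys_in S" "p = msubst j c p + (Var j - Const c) * p'"
      "q' \<in> polys_in S" "q = msubst j c q + (Var j - Const c) * q'" by blast
    show ?case
    proof (intro bexI[of _ "p' + q'"])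
      show "p + q = msubst j c (p + q) + (Var j - Const c) * (p' + q')"
        using arg_cong2[OF *(2) *(4), of "(+)"] by (simp add: hom_add algebra_simps)
    qed (use * in auto)
  next
    case (mult p q)
    then obtain p' q' where *: "p' \<in> polys_in S" "p = msubst j c p + (Var j - Const c) * p'"
      "q' \<in> polys_in S" "q = msubst j c q + (Var j - Const c) * q'" by blast
    \<comment> \<open>The quotient for a product comes from changing one factor at a time: first
      \<open>p\<close>, with \<open>q\<close> kept, then \<open>q\<close>, with the substituted
      \<open>p\<close>.\<close>
    show ?case
    proof (intro bexI[of _ "p' * q + msubst j c p * q'"])
      define d where "d = Var j - Const c"
      note *(2,4)[folded d_def]
      then have "p * q = msubst j c p * q + d * (p' * q)" by (metis distrib_right mult.assoc)
      also have "msubst j c p * q = msubst j c p * (msubst j c q + d * q')"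
        using \<open>q = msubst j c q + d * q'\<close> by simp
      finally have eq: "p * q = msubst j c p * (msubst j c q + d * q') + d * (p' * q)" .
      show "p * q = msubst j c (p * q) + (Var j - Const c) * (p' * q + msubst j c p * q')"
        unfolding hom_mult d_def[symmetric] using eq by (simp add: algebra_simps)
    qed (use * mult msubst_in[of p S j c] polys_in_mono[of "S - {j}" S] in auto)
  qed
  then show ?thesis using that by blast
qed

section \<open>Complete integral closedness of polynomial rings\<close>

text \<open>Complete integral closedness expressed inside the domain: if all powers of the fraction
  \<open>a / b\<close> have the common denominator \<open>c\<close>, then the fraction lies in the
  domain. It takes the place of unique factorization in Gauss's lemma.\<close>

definition almost_integral_closed :: "'a::idom itself \<Rightarrow> bool" where
  "almost_integral_closed _ \<longleftrightarrow>
     (\<forall>a b c :: 'a. b \<noteq> 0 \<longrightarrow> c \<noteq> 0 \<longrightarrow> (\<forall>N. b ^ N dvd c * a ^ N) \<longrightarrow> b dvd a)"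

text \<open>The monomial order is lexicographic on exponents, the smallest variable index being the
  most significant.\<close>

definition lmon :: "'k::field mpoly \<Rightarrow> nat \<Rightarrow>\<^sub>0 nat" where
  "lmon p = Max (mkeys p)"

definition lcf :: "'k::field mpoly \<Rightarrow> 'k" where
  "lcf p = mlookup p (lmon p)"

lemma lmon_in: "p \<noteq> 0 \<Longrightarrow> lmon p \<in> mkeys p"
  unfolding lmon_def by (rule Max_in) auto

lemma lmon_ge: "m \<in> mkeys p \<Longrightarrow> m \<le> lmon p"
  unfolding lmon_def by (rule Max_ge) auto

lemma lcf_nz: "p \<noteq> 0 \<Longrightarrow> lcf p \<noteq> 0"
  unfolding lcf_def using lmon_in by (auto simp: in_keys_iff)

lemma lmon_mult:
  assumes "p \<noteq> 0" "q \<noteq> 0"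
  shows "lmon (p * q) = lmon p + lmon q" "lcf (p * q) = lcf p * lcf q"
proof -
  have dec: "\<exists>r'. r = msingle (lmon r) (lcf r) + r' \<and> (\<forall>m\<in>mkeys r'. m < lmon r)" for r :: "'a mpoly"
  proof (intro exI conjI ballI)
    show "r = msingle (lmon r) (lcf r) + (r - msingle (lmon r) (lcf r))" by simp
    fix m assume m: "m \<in> mkeys (r - msingle (lmon r) (lcf r))"
    then have "m \<noteq> lmon r" by (auto simp: in_keys_iff lookup_minus lcf_def)
    moreover from this m have "m \<in> mkeys r"
      by (auto simp: in_keys_iff lookup_minus lookup_single when_def)
    ultimately show "m < lmon r" using lmon_ge[of m r] by simp
  qed
  obtain p' where p': "p = msingle (lmon p) (lcf p) + p'" "\<And>m. m \<in> mkeys p' \<Longrightarrow> m < lmon p"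
    using dec[of p] by blast
  obtain q' where q': "q = msingle (lmon q) (lcf q) + q'" "\<And>m. m \<in> mkeys q' \<Longrightarrow> m < lmon q"
    using dec[of q] by blast
  define r where "r = msingle (lmon p) (lcf p) * q' + p' * q"
  have pq: "p * q = msingle (lmon p + lmon q) (lcf p * lcf q) + r"
  proof -
    have "p * q = msingle (lmon p) (lcf p) * q + p' * q"
      by (subst p'(1)) (rule distrib_right)
    also have "msingle (lmon p) (lcf p) * q = msingle (lmon p + lmon q) (lcf p * lcf q) + msingle (lmon p) (lcf p) * q'"
      by (subst q'(1)) (simp add: distrib_left mult_single)
    finally show ?thesis by (simp add: r_def add.assoc)
  qed
  have r: "m < lmon p + lmon q" if "m \<in> mkeys r" for m
  proof -
    from that have "m \<in> mkeys (msingle (lmon p) (lcf p) * q') \<or> m \<in> mkeys (p' * q)"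
      unfolding r_def
      using Poly_Mapping.keys_add[of "msingle (lmon p) (lcf p) * q'" "p' * q"] by auto
    then show ?thesis
    proof
      assume "m \<in> mkeys (msingle (lmon p) (lcf p) * q')"
      then obtain a b where "m = a + b" "a \<in> mkeys (msingle (lmon p) (lcf p))" "b \<in> mkeys q'"
        using keys_mult[of "msingle (lmon p) (lcf p)" q'] by auto
      then show ?thesis using q'(2) by (auto split: if_splits)
    next
      assume "m \<in> mkeys (p' * q)"
      then obtain a b where "m = a + b" "a \<in> mkeys p'" "b \<in> mkeys q"
        using keys_mult[of p' q] by auto
      then show ?thesis using p'(2) lmon_ge[of b q] by (auto intro: add_less_le_mono)
    qed
  qed
  then have r0: "mlookup r (lmon p + lmon q) = 0" by (auto simp: in_keys_iff)
  have lk: "mlookup (p * q) (lmon p + lmon q) = lcf p * lcf q"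
    unfolding pq by (simp add: lookup_add r0)
  show *: "lmon (p * q) = lmon p + lmon q"
    unfolding lmon_def[of "p * q"]
  proof (rule Max_eqI)
    show "lmon p + lmon q \<in> mkeys (p * q)"
      using lk lcf_nz[OF assms(1)] lcf_nz[OF assms(2)] by (simp add: in_keys_iff)
    fix m assume "m \<in> mkeys (p * q)"
    then show "m \<le> lmon p + lmon q"
      unfolding pq using r[of m] Poly_Mapping.keys_add[of "msingle (lmon p + lmon q) (lcf p * lcf q)" r]
      by (auto split: if_splits)
  qed simp
  show "lcf (p * q) = lcf p * lcf q" unfolding lcf_def[of "p * q"] * by (rule lk)
qed

lemma lookup_lmon_power: "b \<noteq> 0 \<Longrightarrow> mlookup (lmon (b ^ N)) i = N * mlookup (lmon b) i"
proof (induction N)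
  case 0
  then show ?case by (simp add: lmon_def)
qed (simp add: lmon_mult lookup_add)

text \<open>The bound on the variables matters: in infinitely many variables, the variables
  themselves form an infinite descending chain.\<close>

lemma wf_monomials:
  "wf {(m, m' :: nat \<Rightarrow>\<^sub>0 nat). m < m' \<and> mkeys m \<subseteq> {..<N} \<and> mkeys m' \<subseteq> {..<N}}"
  (is "wf ?R")
proof (rule wf_subset)
  show "wf (inv_image (lex less_than) (\<lambda>m :: nat \<Rightarrow>\<^sub>0 nat. map (mlookup m) [0..<N]))"
    by (intro wf_inv_image wf_lex wf_less_than)
  show "?R \<subseteq> inv_image (lex less_than) (\<lambda>m :: nat \<Rightarrow>\<^sub>0 nat. map (mlookup m) [0..<N])"
  proof (safe)
    fix m m' :: "nat \<Rightarrow>\<^sub>0 nat" assume "m < m'" and k: "mkeys m' \<subseteq> {..<N}"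
    then obtain k where k': "mlookup m k < mlookup m' k" "\<And>l. l < k \<Longrightarrow> mlookup m l = mlookup m' l"
      unfolding less_poly_mapping.rep_eq less_fun_def by blast
    from k'(1) have "k \<in> mkeys m'" by (simp add: in_keys_iff)
    then have "k < N" using k by auto
    then have u: "[0..<N] = [0..<k] @ k # [Suc k..<N]"
      by (metis less_imp_le_nat upt_add_eq_append upt_conv_Cons le_add_diff_inverse zero_le)
    have "map (mlookup m) [0..<k] = map (mlookup m') [0..<k]" using k'(2) by auto
    then show "(m, m') \<in> inv_image (lex less_than) (\<lambda>m. map (mlookup m) [0..<N])"
      using k'(1) unfolding in_inv_image u lex_conv by force
  qed
qed

text \<open>In each term of the binomial expansion, \<open>k\<close> factors \<open>b\<close> come
  from the hypothesis and \<open>N - k\<close> from the powers of \<open>t * b\<close>.\<close>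

lemma almost_integral_reduce:
  fixes a b c t :: "'a::idom"
  assumes "\<And>N. b ^ N dvd c * a ^ N" shows "b ^ N dvd c * (a - t * b) ^ N"
proof -
  have "(a - t * b) ^ N = (\<Sum>k\<le>N. of_nat (N choose k) * a ^ k * (- (t * b)) ^ (N - k))"
    using binomial_ring[of a "- (t * b)" N] by simp
  then have "c * (a - t * b) ^ N = (\<Sum>k\<le>N. of_nat (N choose k) * ((c * a ^ k) * (- (t * b)) ^ (N - k)))"
    by (simp add: sum_distrib_left mult_ac)
  moreover have "b ^ N dvd (c * a ^ k) * (- (t * b)) ^ (N - k)" if "k \<le> N" for k
  proof -
    have "b ^ k * b ^ (N - k) dvd (c * a ^ k) * (- (t * b)) ^ (N - k)"
      by (intro mult_dvd_mono assms dvd_power_same) simp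
    then show ?thesis using that by (simp flip: power_add)
  qed
  ultimately show ?thesis by (simp only:) (rule dvd_sum, rule dvd_mult, simp)
qed

text \<open>
  The division algorithm for a monomial order: almost integrality of \<open>a / b\<close> forces the leading
  monomial of \<open>b\<close> to divide that of \<open>a\<close>, and is inherited by the next remainder.
\<close>

lemma almost_integral_closed_mpoly: "almost_integral_closed TYPE('k::field mpoly)"
  unfolding almost_integral_closed_def
proof (intro allI impI)
  fix a b c :: "'k mpoly" assume b: "b \<noteq> 0" and c: "c \<noteq> 0" and ai: "\<forall>N. b ^ N dvd c * a ^ N"
  obtain S where S: "finite S" "a \<in> polys_in S" using finite_vars by blast
  obtain S' where S': "finite S'" "b \<in> polys_in S'" using finite_vars by blast
  obtain N where N: "S \<union> S' \<subseteq> {..<N}" using S(1) S'(1)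
    by (metis finite_Un finite_nat_bounded)
  have "b \<in> polys_in {..<N}" "a \<in> polys_in {..<N}"
    using S S' N polys_in_mono[of S "{..<N}"] polys_in_mono[of S' "{..<N}"] by auto
  note bN = this(1) and aN = this(2)
  have "b dvd a" if "lmon a = l" "a \<in> polys_in {..<N}" "\<forall>N. b ^ N dvd c * a ^ N" for l a
    using that
  proof (induction l arbitrary: a rule: wf_induct_rule[OF wf_monomials[of N]])
    case (1 l a)
    show ?case
    proof (cases "a = 0")
      case False
      have le: "mlookup (lmon b) i \<le> mlookup (lmon a) i" for i
      proof (rule ccontr)
        assume *: "\<not> mlookup (lmon b) i \<le> mlookup (lmon a) i"
        \<comment> \<open>In the \<open>M\<close>-th power the variable \<open>i\<close> is short by
          at least \<open>M\<close> in \<open>a ^ M\<close> compared with \<open>b ^ M\<close>, one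
          more than its exponent in the leading monomial of \<open>c\<close> can supply.\<close>
        define M where "M = Suc (mlookup (lmon c) i)"
        obtain d where d: "c * a ^ M = b ^ M * d" using 1(4) by blast
        have "c * a ^ M \<noteq> 0" using False c by simp
        then have d0: "d \<noteq> 0" using d by auto
        have "mlookup (lmon c) i + M * mlookup (lmon a) i = M * mlookup (lmon b) i + mlookup (lmon d) i"
          using arg_cong[OF d, of "\<lambda>p. mlookup (lmon p) i"] b c d0 False
          by (simp add: lmon_mult lookup_add lookup_lmon_power)
        moreover have "M * mlookup (lmon b) i \<ge> M * Suc (mlookup (lmon a) i)"
          using * by (intro mult_le_mono) auto
        ultimately show False by (simp add: M_def)
      qed
      define m where "m = lmon a - lmon b"
      define t where "t = msingle m (lcf a / lcf b)"
      have m: "m + lmon b = lmon a"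
        unfolding m_def by (rule poly_mapping_eqI) (use le in \<open>auto simp: lookup_add lookup_minus\<close>)
      have t0: "t \<noteq> 0" using lcf_nz[OF b] lcf_nz[OF False]
        by (auto simp: t_def) (metis divide_eq_0_iff lookup_single_eq lookup_zero)
      have lt: "lmon t = m" "lcf t = lcf a / lcf b"
        using lcf_nz[OF b] lcf_nz[OF False] by (auto simp: t_def lmon_def lcf_def)
      have tb: "lmon (t * b) = lmon a" "lcf (t * b) = lcf a"
        using lmon_mult[OF t0 b] lt m lcf_nz[OF b] by auto
      define a' where "a' = a - t * b"
      have ka: "mkeys (lmon a) \<subseteq> {..<N}" using lmon_in[OF False] 1(3) by (auto simp: polys_in_def)
      have "mkeys m \<subseteq> mkeys (lmon a)"
        unfolding m_def by (auto simp: in_keys_iff lookup_minus)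
      then have "t \<in> polys_in {..<N}" using ka by (auto simp: t_def polys_in_def)
      then have a'in: "a' \<in> polys_in {..<N}" unfolding a'_def using 1(3) bN by auto
      have "b dvd a'"
      proof (cases "a' = 0")
        case False
        have "lmon a' \<noteq> lmon a"
        proof
          assume "lmon a' = lmon a"
          then have "mlookup a' (lmon a) \<noteq> 0" using lcf_nz[OF False] by (simp add: lcf_def)
          then show False using tb by (simp add: a'_def lookup_minus lcf_def)
        qed
        moreover have "lmon a' \<le> lmon a"
        proof -
          have "lmon a' \<in> mkeys a \<union> mkeys (t * b)"
            using lmon_in[OF False] by (auto simp: a'_def in_keys_iff lookup_minus)
          then show ?thesis using lmon_ge[of "lmon a'" a] lmon_ge[of "lmon a'" "t * b"] tb by auto
        qed
        moreover have "mkeys (lmon a') \<subseteq> {..<N}" using lmon_in[OF False] a'in by (auto simp: polys_in_def)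
        ultimately have "(lmon a', l) \<in> {(m, m'). m < m' \<and> mkeys m \<subseteq> {..<N} \<and> mkeys m' \<subseteq> {..<N}}"
          using 1(2) ka by auto
        moreover have "\<forall>N. b ^ N dvd c * a' ^ N"
          unfolding a'_def using almost_integral_reduce 1(4) by blast
        ultimately show ?thesis using 1(1) a'in by blast
      qed simp
      then have "b dvd a' + t * b" by simp
      then show ?thesis by (simp add: a'_def)
    qed simp
  qed
  then show "b dvd a" using aN ai by blast
qed

section \<open>Gauss's lemma over completely integrally closed domains\<close>

definition submodule :: "'a::idom fract set \<Rightarrow> bool" where
  "submodule Z \<longleftrightarrow> 0 \<in> Z \<and> (\<forall>x\<in>Z. \<forall>y\<in>Z. x + y \<in> Z) \<and> (\<forall>t. \<forall>x\<in>Z. to_fract t * x \<in> Z)"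

lemma submodule_zero: "submodule Z \<Longrightarrow> 0 \<in> Z"
  and submodule_add: "submodule Z \<Longrightarrow> x \<in> Z \<Longrightarrow> y \<in> Z \<Longrightarrow> x + y \<in> Z"
  and submodule_scale: "submodule Z \<Longrightarrow> x \<in> Z \<Longrightarrow> to_fract t * x \<in> Z"
  by (auto simp: submodule_def)

lemma submodule_diff: "submodule Z \<Longrightarrow> x \<in> Z \<Longrightarrow> y \<in> Z \<Longrightarrow> x - y \<in> Z"
  using submodule_add[of Z x "- y"] submodule_scale[of Z y "- 1"] by simp

lemma submodule_sum: "submodule Z \<Longrightarrow> (\<And>i. i \<in> A \<Longrightarrow> f i \<in> Z) \<Longrightarrow> sum f A \<in> Z"
  by (induction A rule: infinite_finite_induct) (auto intro: submodule_zero submodule_add)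

lemma submodule_vimage: "submodule Z \<Longrightarrow> submodule {y. y * h \<in> Z}"
  by (auto simp: submodule_def distrib_right mult.assoc)

text \<open>The \<open>e\<close>-th power of the content of \<open>G\<close>, the fractional ideal
  generated by the coefficients of \<open>G\<close>.\<close>

primrec coeff_span :: "'a::idom fract poly \<Rightarrow> nat \<Rightarrow> 'a fract set" where
  "coeff_span G 0 = range to_fract"
| "coeff_span G (Suc e) = {\<Sum>i\<le>degree G. coeff G i * x i | x. \<forall>i. x i \<in> coeff_span G e}"

lemma submodule_coeff_span: "submodule (coeff_span G e)"
proof (induction e)
  case 0
  show ?case unfolding submodule_def coeff_span.simps
    by (auto simp flip: to_fract_add to_fract_mult)
next
  case (Suc e)
  show ?case unfolding submodule_def
  proof (intro conjI ballI allI)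
    show "0 \<in> coeff_span G (Suc e)"
      using submodule_zero[OF Suc] by (auto intro!: exI[of _ "\<lambda>_. 0"])
    fix x assume "x \<in> coeff_span G (Suc e)"
    then obtain f where f: "x = (\<Sum>i\<le>degree G. coeff G i * f i)" "\<And>i. f i \<in> coeff_span G e" by auto
    show "x + y \<in> coeff_span G (Suc e)" if y: "y \<in> coeff_span G (Suc e)" for y
    proof -
      from y obtain g where g: "y = (\<Sum>i\<le>degree G. coeff G i * g i)" "\<And>i. g i \<in> coeff_span G e" by auto
      show ?thesis using f g submodule_add[OF Suc]
        by (auto intro!: exI[of _ "\<lambda>i. f i + g i"] simp: distrib_left sum.distrib)
    qed
    show "to_fract t * x \<in> coeff_span G (Suc e)" for t
    proof -
      have "to_fract t * x = (\<Sum>i\<le>degree G. coeff G i * (to_fract t * f i))"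
        unfolding f(1) by (simp add: sum_distrib_left mult.left_commute)
      moreover have "to_fract t * f i \<in> coeff_span G e" for i using f(2) submodule_scale[OF Suc] by simp
      ultimately show ?thesis
        by (simp only: coeff_span.simps mem_Collect_eq) (intro exI[of _ "\<lambda>i. to_fract t * f i"], simp)
    qed
  qed
qed

lemma coeff_span_mult:
  assumes "x \<in> coeff_span G e" shows "coeff G i * x \<in> coeff_span G (Suc e)"
proof (cases "i \<le> degree G")
  case True
  then have "(\<Sum>j\<le>degree G. coeff G j * (if j = i then x else 0)) = coeff G i * x"
    by (simp add: if_distrib[of "(*) _"] sum.delta cong: if_cong)
  then show ?thesis using assms submodule_zero[OF submodule_coeff_span]
    by (auto intro!: exI[of _ "\<lambda>j. if j = i then x else 0"])
next
  case False
  then have "coeff G i = 0" by (simp add: coeff_eq_0)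
  then show ?thesis using submodule_zero[OF submodule_coeff_span, of G "Suc e"] by simp
qed

lemma coeff_span_subset:
  assumes "submodule Z" "\<And>i x. x \<in> coeff_span G e \<Longrightarrow> coeff G i * x \<in> Z"
  shows "coeff_span G (Suc e) \<subseteq> Z"
  using assms by (auto intro!: submodule_sum)

text \<open>A weak form of the Dedekind--Mertens lemma on the contents of \<open>G\<close>, \<open>H\<close> and \<open>G * H\<close>.\<close>

lemma dedekind_mertens:
  assumes "submodule Z" "\<And>j. j > e \<Longrightarrow> coeff H j = 0"
    "\<And>x l. x \<in> coeff_span G e \<Longrightarrow> x * coeff (G * H) l \<in> Z" "x \<in> coeff_span G (Suc e)"
  shows "x * coeff H j \<in> Z"
  using assms
proof (induction e arbitrary: H Z x j)
  case 0
  show ?case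
  proof (cases "j = 0")
    case True
    have H: "H = [:coeff H 0:]" by (rule poly_eqI) (use 0(2) in \<open>auto simp: coeff_pCons split: nat.splits\<close>)
    have "coeff_span G (Suc 0) \<subseteq> {y. y * coeff H 0 \<in> Z}"
    proof (rule coeff_span_subset[OF submodule_vimage[OF 0(1)]])
      fix i x assume x: "x \<in> coeff_span G 0"
      have "coeff (G * H) i = coeff G i * coeff H 0" by (subst H) (simp add: mult.commute)
      then show "coeff G i * x \<in> {y. y * coeff H 0 \<in> Z}" using 0(3)[OF x, of i] by (simp add: mult_ac)
    qed
    then show ?thesis using 0(4) True by blast
  next
    case False
    then show ?thesis using 0(2)[of j] submodule_zero[OF 0(1)] by simp
  qed
next
  case (Suc e)
  define h where "h = coeff H (Suc e)"
  define H' where "H' = H - monom h (Suc e)"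
  have H'0: "coeff H' k = 0" if "k > e" for k
    using Suc.prems(2)[of k] that by (cases "k = Suc e") (auto simp: H'_def h_def)
  have H'1: "coeff H' k = coeff H k" if "k \<le> e" for k using that by (simp add: H'_def)
  have GH': "coeff (G * H') l = coeff (G * H) l - h * (if Suc e \<le> l then coeff G (l - Suc e) else 0)" for l
    by (simp add: H'_def right_diff_distrib coeff_monom_mult mult.commute[of G "monom h (Suc e)"])
  \<comment> \<open>Once the products of the top coefficient \<open>h\<close> with
    \<open>coeff G j\<close> are known to be harmless, the induction hypothesis applies to
    \<open>H'\<close>, with smaller degree bound, and to the module of elements that
    \<open>coeff G j\<close> multiplies into \<open>Z\<close>.\<close>
  have claim: "x * coeff H' k * coeff G j \<in> Z"
    if j: "\<And>x. x \<in> coeff_span G (Suc e) \<Longrightarrow> x * coeff G j * h \<in> Z" and x: "x \<in> coeff_span G (Suc e)" for j x k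
  proof -
    have "x * coeff H' k \<in> {y. y * coeff G j \<in> Z}"
    proof (rule Suc.IH[OF submodule_vimage[OF Suc.prems(1)] H'0 _ x])
      fix u l assume u: "u \<in> coeff_span G e"
      have 1: "(coeff G j * u) * coeff (G * H) l \<in> Z"
        by (rule Suc.prems(3)) (rule coeff_span_mult[OF u])
      have 2: "h * (if Suc e \<le> l then coeff G (l - Suc e) else 0) * u * coeff G j \<in> Z"
        using j[OF coeff_span_mult[OF u, of "l - Suc e"]] submodule_zero[OF Suc.prems(1)] by (simp add: mult_ac)
      have "u * coeff (G * H') l * coeff G j = (coeff G j * u) * coeff (G * H) l -
          h * (if Suc e \<le> l then coeff G (l - Suc e) else 0) * u * coeff G j"
        unfolding GH' by (simp add: algebra_simps)
      then show "u * coeff (G * H') l \<in> {y. y * coeff G j \<in> Z}"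
        using submodule_diff[OF Suc.prems(1) 1 2] by simp
    qed
    then show ?thesis by simp
  qed
  \<comment> \<open>Descending induction on \<open>i\<close>. In the coefficient of
    \<open>G * H\<close> at \<open>i + Suc e\<close>, indices below \<open>i\<close> contribute
    nothing by the degree bound on \<open>H\<close>, index \<open>i\<close> gives the wanted
    product, and larger indices meet only \<open>H'\<close> and fall under the claim.\<close>
  have top: "x * coeff G i * h \<in> Z" if "x \<in> coeff_span G (Suc e)" for i x
    using that
  proof (induction "degree G - i" arbitrary: i x rule: less_induct)
    case (less i x)
    show ?case
    proof (cases "i \<le> degree G")
      case False
      then show ?thesis using submodule_zero[OF Suc.prems(1)] by (simp add: coeff_eq_0)
    next
      case True
      have later: "x * coeff G j * h \<in> Z" if "j > i" "x \<in> coeff_span G (Suc e)" for j x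
      proof (cases "j \<le> degree G")
        case True
        then show ?thesis using less.hyps[of j x] that by auto
      next
        case False
        then show ?thesis using submodule_zero[OF Suc.prems(1)] by (simp add: coeff_eq_0)
      qed
      have "coeff (G * H) (i + Suc e) = (\<Sum>j\<le>i + Suc e. coeff G j * coeff H (i + Suc e - j))"
        by (simp add: coeff_mult)
      also have "{..i + Suc e} = {..<i} \<union> {i} \<union> {i<..i + Suc e}" by auto
      also have "(\<Sum>j\<in>{..<i} \<union> {i} \<union> {i<..i + Suc e}. coeff G j * coeff H (i + Suc e - j)) =
          (\<Sum>j\<in>{..<i}. coeff G j * coeff H (i + Suc e - j)) + coeff G i * h +
          (\<Sum>j\<in>{i<..i + Suc e}. coeff G j * coeff H (i + Suc e - j))"
        by (subst sum.union_disjoint, (auto)[3], subst sum.union_disjoint) (auto simp: h_def)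
      also have "(\<Sum>j\<in>{..<i}. coeff G j * coeff H (i + Suc e - j)) = 0"
        by (rule sum.neutral) (use Suc.prems(2) in auto)
      also have "(\<Sum>j\<in>{i<..i + Suc e}. coeff G j * coeff H (i + Suc e - j)) =
          (\<Sum>j\<in>{i<..i + Suc e}. coeff G j * coeff H' (i + Suc e - j))"
        by (rule sum.cong) (auto simp: H'1)
      finally have "x * coeff G i * h = x * coeff (G * H) (i + Suc e) -
          (\<Sum>j\<in>{i<..i + Suc e}. x * coeff H' (i + Suc e - j) * coeff G j)"
        by (simp add: algebra_simps sum_distrib_left)
      moreover have "(\<Sum>j\<in>{i<..i + Suc e}. x * coeff H' (i + Suc e - j) * coeff G j) \<in> Z"
        by (intro submodule_sum[OF Suc.prems(1)] claim later less.prems) auto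
      ultimately show ?thesis using submodule_diff[OF Suc.prems(1)] Suc.prems(3)[OF less.prems] by simp
    qed
  qed
  have "coeff_span G (Suc (Suc e)) \<subseteq> {y. y * coeff H j \<in> Z}"
  proof (rule coeff_span_subset[OF submodule_vimage[OF Suc.prems(1)]])
    fix i x assume x: "x \<in> coeff_span G (Suc e)"
    consider "j = Suc e" | "j \<le> e" | "j > Suc e" by linarith
    then show "coeff G i * x \<in> {y. y * coeff H j \<in> Z}"
    proof cases
      case 1
      then show ?thesis using top[OF x, of i] by (simp add: h_def mult_ac)
    next
      case 2
      then show ?thesis using claim[where j = i and k = j, OF top x] by (simp add: H'1 mult_ac)
    next
      case 3
      then show ?thesis using Suc.prems(2)[of j] submodule_zero[OF Suc.prems(1)] by simp
    qed
  qed
  then show ?case using Suc.prems(4) by blast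
qed

lemma common_denominator:
  fixes G :: "'a::idom fract poly"
  obtains d G0 where "d \<noteq> 0" "smult (to_fract d) G = map_poly to_fract G0"
proof -
  have "\<exists>d G0. d \<noteq> 0 \<and> smult (to_fract d) G = map_poly to_fract G0"
  proof (induction G)
    case (pCons a G)
    then obtain d G0 where d: "d \<noteq> 0" "smult (to_fract d) G = map_poly to_fract G0" by blast
    obtain p q where a: "a = Fract p q" "q \<noteq> 0" by (cases a) auto
    then have aq: "to_fract q * a = to_fract p" by (simp add: to_fract_def eq_fract)
    have "smult (to_fract (d * q)) (pCons a G) = map_poly to_fract (pCons (d * p) (smult q G0))"
    proof (rule poly_eqI)
      fix n
      have "coeff (smult (to_fract d) G) k = coeff (map_poly to_fract G0) k" for k using d(2) by simp
      then have *: "to_fract d * coeff G k = to_fract (coeff G0 k)" for k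
        by (simp add: coeff_map_poly)
      show "coeff (smult (to_fract (d * q)) (pCons a G)) n =
          coeff (map_poly to_fract (pCons (d * p) (smult q G0))) n"
        using aq *[of "n - 1"]
        by (cases n) (auto simp: coeff_map_poly mult_ac simp flip: aq *)
    qed
    then show ?case using d(1) a(2) by (intro exI[of _ "d * q"]) auto
  next
    case 0
    show ?case by (rule exI[of _ 1], rule exI[of _ 0]) simp
  qed
  then show ?thesis using that by blast
qed

text \<open>Each step of the recursion costs one further factor that clears the coefficients of
  \<open>G\<close>.\<close>

lemma coeff_span_denominator: "\<exists>d. d \<noteq> 0 \<and> (\<forall>x\<in>coeff_span G e. to_fract d * x \<in> range to_fract)"
proof (induction e)
  case 0
  show ?case by (intro exI[of _ 1]) auto
next
  case (Suc e)
  then obtain d where d: "d \<noteq> 0" "\<And>x. x \<in> coeff_span G e \<Longrightarrow> to_fract d * x \<in> range to_fract" by blast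
  obtain b G0 where b: "b \<noteq> 0" "smult (to_fract b) G = map_poly to_fract G0" by (rule common_denominator)
  then have bG: "to_fract b * coeff G i = to_fract (coeff G0 i)" for i
    by (metis coeff_smult coeff_map_poly to_fract_0)
  have T: "submodule (range to_fract :: 'a fract set)" using submodule_coeff_span[of G 0] by simp
  have "to_fract (d * b) * x \<in> range to_fract" if x: "x \<in> coeff_span G (Suc e)" for x
  proof -
    have sub: "submodule {y. y * to_fract (d * b) \<in> range to_fract}" by (rule submodule_vimage[OF T])
    have "coeff_span G (Suc e) \<subseteq> {y. y * to_fract (d * b) \<in> range to_fract}"
    proof (rule coeff_span_subset[OF sub])
      fix i y assume "y \<in> coeff_span G e"
      then obtain t where "to_fract d * y = to_fract t" using d(2) by blast
      then have "to_fract (coeff G0 i) * to_fract t = (to_fract b * coeff G i) * (to_fract d * y)"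
        using bG[of i] by simp
      also have "\<dots> = coeff G i * y * to_fract (d * b)" by (simp add: mult_ac)
      finally have "coeff G i * y * to_fract (d * b) = to_fract (coeff G0 i) * to_fract t" ..
      then show "coeff G i * y \<in> {y. y * to_fract (d * b) \<in> range to_fract}"
        by (simp flip: to_fract_mult)
    qed
    then show ?thesis using x by (auto simp: mult.commute)
  qed
  then show ?case using d(1) b(1) by (intro exI[of _ "d * b"]) auto
qed

text \<open>Since \<open>H\<close> is monic, Dedekind--Mertens makes \<open>coeff_span G e\<close>
  stable under multiplication by coefficients of \<open>G\<close>; since \<open>G\<close> is monic,
  it contains \<open>1\<close>. Hence it contains all powers of every coefficient of
  \<open>G\<close>, and its common denominator makes these coefficients almost integral.\<close>

lemma gauss_monic:
  fixes F :: "'a::idom poly"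
  assumes cic: "almost_integral_closed TYPE('a)" and F: "map_poly to_fract F = G * H"
    and G: "lead_coeff G = 1" and H: "lead_coeff H = 1"
  obtains G0 where "G = map_poly to_fract G0"
proof -
  define e where "e = degree H"
  have coF: "coeff (G * H) l = to_fract (coeff F l)" for l by (simp add: F[symmetric] coeff_map_poly)
  have stab: "coeff G i * x \<in> coeff_span G e" if x: "x \<in> coeff_span G e" for i x
  proof -
    have "coeff G i * x * coeff H e \<in> coeff_span G e"
    proof (rule dedekind_mertens[OF submodule_coeff_span, where e = e])
      show "x * coeff (G * H) l \<in> coeff_span G e" if "x \<in> coeff_span G e" for x l
        using submodule_scale[OF submodule_coeff_span that, of "coeff F l"] by (simp add: coF mult.commute)
    qed (auto simp: e_def coeff_eq_0 intro!: coeff_span_mult that[unfolded e_def] simp del: coeff_span.simps)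
    then show ?thesis using H by (simp add: e_def)
  qed
  have one: "1 \<in> coeff_span G n" for n
  proof (induction n)
    case 0
    show ?case using rangeI[of to_fract 1] by simp
  next
    case (Suc n)
    show ?case using coeff_span_mult[OF Suc, of "degree G"] G by simp
  qed
  obtain d where d: "d \<noteq> 0" "\<And>x. x \<in> coeff_span G e \<Longrightarrow> to_fract d * x \<in> range to_fract"
    using coeff_span_denominator by blast
  have "coeff G i \<in> range to_fract" for i
  proof -
    obtain p q where g: "coeff G i = Fract p q" "q \<noteq> 0" by (cases "coeff G i") auto
    have gq: "to_fract q * coeff G i = to_fract p" using g by (simp add: to_fract_def eq_fract)
    have "q ^ N dvd d * p ^ N" for N
    proof -
      have "coeff G i ^ N \<in> coeff_span G e"
        by (induction N) (auto intro: one stab)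
      then obtain t where t: "to_fract d * coeff G i ^ N = to_fract t" using d(2) by blast
      have "to_fract (d * p ^ N) = to_fract d * (to_fract q * coeff G i) ^ N"
        by (simp add: gq to_fract_hom.hom_power)
      also have "\<dots> = to_fract (q ^ N * t)"
        by (simp add: power_mult_distrib t[symmetric] to_fract_hom.hom_power mult_ac)
      finally show ?thesis by (metis dvd_triv_left to_fract_eq_iff)
    qed
    then have "q dvd p" using cic g(2) d(1) unfolding almost_integral_closed_def by blast
    then obtain r where "p = q * r" by blast
    then have "coeff G i = to_fract r" using g by (simp add: to_fract_def eq_fract)
    then show ?thesis by blast
  qed
  then have "\<exists>t. coeff G i = to_fract t" for i by (metis imageE)
  then obtain t where t: "\<And>i. coeff G i = to_fract (t i)" by metis
  have "t i = 0" if "i > degree G" for i using t[of i] that by (simp add: coeff_eq_0)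
  then have "G = map_poly to_fract (\<Sum>i\<le>degree G. monom (t i) i)"
    by (intro poly_eqI) (auto simp: coeff_map_poly coeff_sum t)
  then show ?thesis by (rule that)
qed

interpretation tfp: map_poly_inj_idom_hom to_fract ..

text \<open>Excluding monic factorizations is enough: over a field the factors of a monic polynomial
  become monic by exchanging leading coefficients, and Gauss's lemma brings them back to the
  domain.\<close>

definition monic_irreducible :: "'a::idom poly \<Rightarrow> bool" where
  "monic_irreducible F \<longleftrightarrow> lead_coeff F = 1 \<and> degree F > 0 \<and>
     (\<forall>G H. F = G * H \<longrightarrow> lead_coeff G = 1 \<longrightarrow> lead_coeff H = 1 \<longrightarrow> degree G = 0 \<or> degree H = 0)"

lemma irreducible_over_fractions:
  fixes F :: "'a::idom poly"
  assumes "almost_integral_closed TYPE('a)" and F: "monic_irreducible F"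
  shows "irreducible (map_poly to_fract F)"
proof (rule Factorial_Ring.irreducibleI)
  have dF: "degree (map_poly to_fract F) = degree F" by simp
  then show "map_poly to_fract F \<noteq> 0" "\<not> map_poly to_fract F dvd 1"
    using F by (auto simp: monic_irreducible_def is_unit_iff_degree)
  fix A B assume AB: "map_poly to_fract F = A * B"
  then have AB0: "A \<noteq> 0" "B \<noteq> 0" using F by (auto simp: monic_irreducible_def)
  have "lead_coeff A * lead_coeff B = lead_coeff (map_poly to_fract F)" by (simp add: AB lead_coeff_mult)
  then have ab: "lead_coeff A * lead_coeff B = 1" using F by (simp add: monic_irreducible_def)
  define G where "G = smult (lead_coeff B) A"
  define H where "H = smult (lead_coeff A) B"
  have GH: "map_poly to_fract F = G * H" "lead_coeff G = 1" "lead_coeff H = 1"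
    using ab by (auto simp: G_def H_def AB mult.commute)
  obtain G0 where G0: "G = map_poly to_fract G0" using gauss_monic[OF assms(1) GH] by blast
  have "map_poly to_fract F = H * G" using GH(1) by (simp add: mult.commute)
  then obtain H0 where H0: "H = map_poly to_fract H0"
    using gauss_monic[OF assms(1) _ GH(3,2)] by blast
  have "F = G0 * H0"
    using GH(1) unfolding G0 H0 by (metis tfp.hom_mult tfp.eq_iff)
  moreover have "lead_coeff G0 = 1" "lead_coeff H0 = 1" using GH unfolding G0 H0 by auto
  ultimately have "degree G0 = 0 \<or> degree H0 = 0" using F by (auto simp: monic_irreducible_def)
  then have "degree A = 0 \<or> degree B = 0"
  proof -
    have "degree G = degree G0" "degree H = degree H0" unfolding G0 H0 by simp_all
    moreover have "degree G = degree A" "degree H = degree B" using AB0 by (simp_all add: G_def H_def)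
    ultimately show ?thesis using \<open>degree G0 = 0 \<or> degree H0 = 0\<close> by simp
  qed
  then show "A dvd 1 \<or> B dvd 1" using AB0 by (auto simp: is_unit_iff_degree)
qed

text \<open>Division by a monic polynomial stays inside the domain, and over the fractions its
  remainder must vanish for reasons of degree.\<close>

lemma monic_dvd_descends:
  fixes P Q :: "'a::idom poly"
  assumes P: "lead_coeff P = 1" and dvd: "map_poly to_fract P dvd map_poly to_fract Q"
  shows "P dvd Q"
proof -
  obtain q r where qr: "pseudo_divmod Q P = (q, r)" by (cases "pseudo_divmod Q P")
  have P0: "P \<noteq> 0" using P by auto
  have Q: "Q = P * q + r" "r = 0 \<or> degree r < degree P"
    using pseudo_divmod[OF P0 qr] P by auto
  have "map_poly to_fract Q = map_poly to_fract P * map_poly to_fract q + map_poly to_fract r"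
    unfolding Q(1) by (simp add: tfp.hom_add tfp.hom_mult)
  then have "map_poly to_fract P dvd map_poly to_fract r" using dvd by (metis dvd_add_right_iff dvd_triv_left)
  then have "r = 0"
    using Q(2) dvd_imp_degree_le[of "map_poly to_fract P" "map_poly to_fract r"] by (cases "r = 0") simp_all
  then show ?thesis using Q(1) by simp
qed

lemma monic_irreducible_prime:
  fixes P :: "'a::idom poly"
  assumes "almost_integral_closed TYPE('a)" "monic_irreducible P" "P dvd A * B"
  shows "P dvd A \<or> P dvd B"
proof -
  have "prime_elem (map_poly to_fract P)"
    using irreducible_over_fractions[OF assms(1,2)] by (rule field_poly_irreducible_imp_prime)
  moreover have "map_poly to_fract P dvd map_poly to_fract A * map_poly to_fract B"
    using assms(3) by (metis tfp.hom_dvd tfp.hom_mult)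
  ultimately show ?thesis using assms(2) monic_dvd_descends
    unfolding monic_irreducible_def prime_elem_def by blast
qed

lemma field_poly_bezout:
  fixes P Q :: "'f::field poly"
  assumes P: "irreducible P" and "\<not> P dvd Q"
  obtains U V where "U * Q + V * P = 1"
proof -
  define J where "J = {U * Q + V * P | U V. True}"
  have "P \<in> J" unfolding J_def by (rule CollectI, rule exI[of _ 0], rule exI[of _ 1]) simp
  moreover have "P \<noteq> 0" using P by auto
  ultimately obtain D where D: "D \<in> J" "D \<noteq> 0" "\<And>E. E \<in> J \<Longrightarrow> E \<noteq> 0 \<Longrightarrow> degree D \<le> degree E"
    using exists_least_iff[of "\<lambda>n. \<exists>D\<in>J. D \<noteq> 0 \<and> degree D = n"] by (metis not_less)
  have dv: "D dvd E" if E: "E \<in> J" for E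
  proof -
    obtain U V U' V' where "D = U * Q + V * P" "E = U' * Q + V' * P" using D(1) E unfolding J_def by auto
    then have "E mod D = (U' - E div D * U) * Q + (V' - E div D * V) * P"
      by (simp add: minus_div_mult_eq_mod[symmetric] algebra_simps)
    then have "E mod D \<in> J" unfolding J_def by blast
    moreover have "E mod D = 0 \<or> degree (E mod D) < degree D" using D(2) by (rule degree_mod_less)
    ultimately have "E mod D = 0" using D(3) by force
    then show ?thesis by (simp add: mod_eq_0_iff_dvd)
  qed
  have "Q \<in> J" unfolding J_def by (rule CollectI, rule exI[of _ 1], rule exI[of _ 0]) simp
  then have "D dvd P" "D dvd Q" using dv \<open>P \<in> J\<close> by auto
  then obtain R where R: "P = D * R" by blast
  with P have "D dvd 1 \<or> R dvd 1" by (rule Factorial_Ring.irreducibleD)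
  moreover have False if "R dvd 1"
  proof -
    from that have "P dvd D" using R by (metis dvd_refl mult_unit_dvd_iff)
    then show False using \<open>D dvd Q\<close> assms(2) dvd_trans by blast
  qed
  ultimately obtain W where W: "D * W = 1" by (metis dvdE)
  obtain U V where "D = U * Q + V * P" using D(1) unfolding J_def by auto
  then have "(W * U) * Q + (W * V) * P = 1" using W by (simp add: algebra_simps)
  then show ?thesis by (rule that)
qed

text \<open>Bezout over the fraction field with denominators cleared. The constant \<open>d\<close>
  is free of the distinguished variable; applied to the defining polynomial, it is an element of the
  base ring in \<open>x_1, ..., x_n\<close>.\<close>

lemma monic_irreducible_bezout:
  fixes P Q :: "'a::idom poly"
  assumes "almost_integral_closed TYPE('a)" "monic_irreducible P" "\<not> P dvd Q"
  obtains U V d where "d \<noteq> 0" "U * Q + V * P = [:d:]"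
proof -
  have "\<not> map_poly to_fract P dvd map_poly to_fract Q"
    using assms(2,3) monic_dvd_descends unfolding monic_irreducible_def by blast
  then obtain U V where UV: "U * map_poly to_fract Q + V * map_poly to_fract P = 1"
    using field_poly_bezout[OF irreducible_over_fractions[OF assms(1,2)]] by blast
  obtain b U0 where b: "b \<noteq> 0" "smult (to_fract b) U = map_poly to_fract U0" by (rule common_denominator)
  obtain c V0 where c: "c \<noteq> 0" "smult (to_fract c) V = map_poly to_fract V0" by (rule common_denominator)
  have sm: "map_poly to_fract (smult a p) = smult (to_fract a) (map_poly to_fract p)" for a and p :: "'a poly"
    by (rule poly_eqI) (simp add: coeff_map_poly)
  define R where "R = smult c U0 * Q + smult b V0 * P"
  have "map_poly to_fract R = smult (to_fract c) (smult (to_fract b) U) * map_poly to_fract Q +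
      smult (to_fract b) (smult (to_fract c) V) * map_poly to_fract P"
    unfolding b c R_def by (simp add: tfp.hom_add tfp.hom_mult sm)
  also have "\<dots> = smult (to_fract (c * b)) (U * map_poly to_fract Q + V * map_poly to_fract P)"
    by (simp add: smult_add_right mult.commute)
  finally have "map_poly to_fract R = smult (to_fract (c * b)) 1" unfolding UV .
  then have "to_fract (coeff R n) = to_fract (coeff [:c * b:] n)" for n
    using coeff_map_poly[of to_fract R n] by (cases n) (simp_all del: to_fract_mult)
  then have "R = [:c * b:]" by (intro poly_eqI) simp
  then show ?thesis using b(1) c(1) by (intro that[of "c * b" "smult c U0" "smult b V0"]) (simp_all add: R_def)
qed

section \<open>Subrings as HOL-Algebra rings\<close>

definition is_subring :: "'a::comm_ring_1 set \<Rightarrow> bool" where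
  "is_subring A \<longleftrightarrow> 0 \<in> A \<and> 1 \<in> A \<and> (\<forall>x\<in>A. \<forall>y\<in>A. x + y \<in> A \<and> x * y \<in> A) \<and> (\<forall>x\<in>A. - x \<in> A)"

lemma is_subringD:
  assumes "is_subring A"
  shows "0 \<in> A" "1 \<in> A" "x \<in> A \<Longrightarrow> y \<in> A \<Longrightarrow> x + y \<in> A" "x \<in> A \<Longrightarrow> y \<in> A \<Longrightarrow> x * y \<in> A"
    "x \<in> A \<Longrightarrow> - x \<in> A" "x \<in> A \<Longrightarrow> y \<in> A \<Longrightarrow> x - y \<in> A" "x \<in> A \<Longrightarrow> x ^ k \<in> A"
proof -
  show *: "0 \<in> A" "1 \<in> A" "x \<in> A \<Longrightarrow> y \<in> A \<Longrightarrow> x + y \<in> A" "x \<in> A \<Longrightarrow> y \<in> A \<Longrightarrow> x * y \<in> A"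
    "x \<in> A \<Longrightarrow> - x \<in> A" for x y using assms by (auto simp: is_subring_def)
  show "x \<in> A \<Longrightarrow> y \<in> A \<Longrightarrow> x - y \<in> A" using *(3)[of x "- y"] *(5)[of y] by simp
  show "x \<in> A \<Longrightarrow> x ^ k \<in> A" by (induction k) (auto intro: *)
qed

lemma is_subring_sum: "is_subring A \<Longrightarrow> (\<And>i. i \<in> S \<Longrightarrow> f i \<in> A) \<Longrightarrow> sum f S \<in> A"
  by (induction S rule: infinite_finite_induct) (auto intro: is_subringD)

lemma is_subring_prod: "is_subring A \<Longrightarrow> (\<And>i. i \<in> S \<Longrightarrow> f i \<in> A) \<Longrightarrow> prod f S \<in> A"
  by (induction S rule: infinite_finite_induct) (auto intro: is_subringD)

lemma ring_on_simps [simp]: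
  "carrier (ring_on A) = A" "x \<otimes>\<^bsub>ring_on A\<^esub> y = x * y" "x \<oplus>\<^bsub>ring_on A\<^esub> y = x + y"
  "\<one>\<^bsub>ring_on A\<^esub> = 1" "\<zero>\<^bsub>ring_on A\<^esub> = 0"
  by (simp_all add: ring_on_def)

lemma ring_on_cring:
  assumes "is_subring A" shows "cring (ring_on A)"
proof (rule cringI)
  show "abelian_group (ring_on A)"
  proof (rule abelian_groupI)
    show "\<exists>y\<in>carrier (ring_on A). y \<oplus>\<^bsub>ring_on A\<^esub> x = \<zero>\<^bsub>ring_on A\<^esub>" if "x \<in> carrier (ring_on A)" for x
      using is_subringD(5)[OF assms] that by (intro bexI[of _ "- x"]) auto
  qed (auto simp: is_subringD[OF assms] add_ac)
  show "comm_monoid (ring_on A)"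
    by (rule comm_monoidI) (auto simp: is_subringD[OF assms] mult_ac)
qed (simp add: distrib_right)

lemma ring_on_domain:
  fixes A :: "'a::idom set"
  assumes "is_subring A" shows "domain (ring_on A)"
proof -
  interpret cring "ring_on A" by (rule ring_on_cring[OF assms])
  show ?thesis by (rule domainI) (auto simp: ring_on_cring[OF assms])
qed

lemma ring_on_ideal_iff:
  assumes A: "is_subring A"
  shows "ideal I (ring_on A) \<longleftrightarrow> I \<subseteq> A \<and> 0 \<in> I \<and> (\<forall>x\<in>I. \<forall>y\<in>I. x + y \<in> I) \<and> (\<forall>a\<in>A. \<forall>x\<in>I. a * x \<in> I)"
proof
  assume "ideal I (ring_on A)"
  then interpret ideal I "ring_on A" .
  show "I \<subseteq> A \<and> 0 \<in> I \<and> (\<forall>x\<in>I. \<forall>y\<in>I. x + y \<in> I) \<and> (\<forall>a\<in>A. \<forall>x\<in>I. a * x \<in> I)"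
    using a_subset additive_subgroup.a_closed[OF additive_subgroup_axioms]
      additive_subgroup.zero_closed[OF additive_subgroup_axioms] I_l_closed by auto
next
  assume I: "I \<subseteq> A \<and> 0 \<in> I \<and> (\<forall>x\<in>I. \<forall>y\<in>I. x + y \<in> I) \<and> (\<forall>a\<in>A. \<forall>x\<in>I. a * x \<in> I)"
  interpret R: cring "ring_on A" by (rule ring_on_cring[OF A])
  have minus: "\<ominus>\<^bsub>ring_on A\<^esub> x = - x" if "x \<in> A" for x
    by (rule R.minus_equality) (use that is_subringD(5)[OF A] in auto)
  have inv: "inv\<^bsub>add_monoid (ring_on A)\<^esub> x = - x" if "x \<in> A" for x
    using minus[OF that] by (simp add: a_inv_def)
  show "ideal I (ring_on A)"
  proof (rule idealI)
    show "subgroup I (add_monoid (ring_on A))"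
    proof
      fix x assume x: "x \<in> I"
      have "(- 1) * x \<in> I" using I x is_subringD(2,5)[OF A] by blast
      then show "inv\<^bsub>add_monoid (ring_on A)\<^esub> x \<in> I" using inv[of x] I x by auto
    qed (use I in auto)
    show "ring (ring_on A)" by (rule R.ring_axioms)
    show "x \<otimes>\<^bsub>ring_on A\<^esub> a \<in> I" "a \<otimes>\<^bsub>ring_on A\<^esub> x \<in> I" if "a \<in> I" "x \<in> carrier (ring_on A)" for a x
      using I that by (auto simp: mult.commute)
  qed
qed

lemma ring_on_primeideal_iff:
  assumes A: "is_subring A"
  shows "primeideal I (ring_on A) \<longleftrightarrow> I \<subseteq> A \<and> 0 \<in> I \<and> (\<forall>x\<in>I. \<forall>y\<in>I. x + y \<in> I) \<and>
    (\<forall>a\<in>A. \<forall>x\<in>I. a * x \<in> I) \<and> 1 \<notin> I \<and> (\<forall>a\<in>A. \<forall>b\<in>A. a * b \<in> I \<longrightarrow> a \<in> I \<or> b \<in> I)"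
  (is "_ \<longleftrightarrow> ?R")
proof
  assume "primeideal I (ring_on A)"
  then interpret primeideal I "ring_on A" .
  have I: "ideal I (ring_on A)" by (rule ideal_axioms)
  have "1 \<notin> I" using one_imp_carrier I_notcarr by auto
  then show ?R using I_prime I[unfolded ring_on_ideal_iff[OF A]] by auto
next
  assume R: ?R
  show "primeideal I (ring_on A)"
  proof (rule primeidealI)
    show "ideal I (ring_on A)" using R by (simp add: ring_on_ideal_iff[OF A])
    show "carrier (ring_on A) \<noteq> I" using R is_subringD(2)[OF A] by auto
  qed (use R ring_on_cring[OF A] in auto)
qed

lemma is_subring_polys_in: "is_subring (polys_in S)"
  by (auto simp: is_subring_def)

section \<open>The polynomial of an admissible variety\<close>

lemma meval_simps:
  "meval a 0 = 0" "meval a 1 = 1" "meval a (p + q) = meval a p + meval a q"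
  "meval a (p * q) = meval a p * meval a q" "meval a (p - q) = meval a p - meval a q"
proof -
  interpret comm_ring_hom "meval a" by (rule meval_hom)
  show "meval a 0 = 0" "meval a 1 = 1" "meval a (p + q) = meval a p + meval a q"
    "meval a (p * q) = meval a p * meval a q" "meval a (p - q) = meval a p - meval a q"
    by (simp_all add: hom_add hom_mult hom_minus)
qed

lemma nonunit_by_evaluation:
  assumes "p \<in> Units (ring_on (polys_in S))" shows "meval a p \<noteq> 0"
proof -
  interpret comm_ring_hom "meval a" by (rule meval_hom)
  obtain q where "q * p = 1" using assms by (auto simp: Units_def)
  then have "meval a q * meval a p = 1" by (metis hom_mult hom_one)
  then show ?thesis by auto
qed

text \<open>Specializing the coefficients of a monic polynomial keeps its degree, so the
  hypersurface has a point above every \<open>a\<close>.\<close>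

lemma monic_Var_root:
  fixes G :: "'k::alg_closed_field mpoly poly"
  assumes "lead_coeff G = 1" "degree G > 0" "\<And>i. coeff G i \<in> polys_in S" "s \<notin> S"
  obtains t where "meval (a(s := t)) (poly G (Var s)) = 0"
proof -
  interpret h: comm_ring_hom "meval a" by (rule meval_hom)
  define Q where "Q = map_poly (meval a) G"
  have "degree Q = degree G"
  proof (rule antisym)
    show "degree Q \<le> degree G" unfolding Q_def by (rule degree_map_poly_le)
    have "coeff Q (degree G) = 1" using assms(1) by (simp add: Q_def)
    then show "degree G \<le> degree Q" by (intro le_degree) simp
  qed
  then obtain t where t: "poly Q t = 0" using assms(2) alg_closed_imp_poly_has_root[of Q] by auto
  interpret hb: comm_ring_hom "meval (a(s := t))" by (rule meval_hom)
  have "meval (a(s := t)) (poly G (Var s)) = poly (map_poly (meval (a(s := t))) G) t"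
    by (metis fun_upd_same hb.poly_map_poly meval_Var)
  also have "map_poly (meval (a(s := t))) G = Q"
  proof (rule poly_eqI)
    fix i
    have "meval (a(s := t)) (coeff G i) = meval a (coeff G i)"
      by (rule meval_cong[OF assms(3)]) (use assms(4) in auto)
    then show "coeff (map_poly (meval (a(s := t))) G) i = coeff Q i" by (simp add: Q_def)
  qed
  finally show ?thesis by (intro that[of t]) (simp only: t)
qed

lemma map_poly_monic:
  assumes "comm_ring_hom h" "lead_coeff (G :: 'a::comm_ring_1 poly) = 1"
  shows "lead_coeff (map_poly h G :: 'b::comm_ring_1 poly) = 1" "degree (map_poly h G) = degree G"
proof -
  interpret comm_ring_hom h by fact
  have c: "coeff (map_poly h G) (degree G) = 1" using assms(2) by simp
  show d: "degree (map_poly h G) = degree G"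
    by (rule antisym[OF degree_map_poly_le le_degree]) (subst c, simp)
  show "lead_coeff (map_poly h G) = 1" using c d by simp
qed

lemma map_poly_hom:
  assumes "comm_ring_hom (h :: 'a::comm_ring_1 \<Rightarrow> 'b::comm_ring_1)"
  shows "map_poly h (P + Q) = map_poly h P + map_poly h Q" "map_poly h (P * Q) = map_poly h P * map_poly h Q"
    "map_poly h (P - Q) = map_poly h P - map_poly h Q" "coeff (map_poly h P) i = h (coeff P i)"
    "h (poly P x) = poly (map_poly h P) (h x)"
proof -
  interpret h: comm_ring_hom h by fact
  interpret m: map_poly_comm_ring_hom h ..
  show "map_poly h (P + Q) = map_poly h P + map_poly h Q" "map_poly h (P * Q) = map_poly h P * map_poly h Q"
    "map_poly h (P - Q) = map_poly h P - map_poly h Q"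
    by (simp_all add: m.hom_add m.hom_mult m.hom_minus)
  show "coeff (map_poly h P) i = h (coeff P i)" "h (poly P x) = poly (map_poly h P) (h x)" by simp_all
qed

lemma monic_irreducible_degree_1:
  assumes "lead_coeff F = 1" "degree F = 1" shows "monic_irreducible (F :: 'a::idom poly)"
  unfolding monic_irreducible_def
proof (intro conjI allI impI)
  fix G H assume "F = G * H" "lead_coeff G = 1" "lead_coeff H = 1"
  then have "degree G + degree H = 1" using assms degree_mult_eq[of G H] by fastforce
  then show "degree G = 0 \<or> degree H = 0" by linarith
qed (use assms in auto)

text \<open>The factors may involve foreign variables and are first retracted to \<open>S\<close>.
  Evaluated at \<open>Var s\<close> they have zeros, so neither is a unit, contrary to
  irreducibility.\<close>

lemma monic_irreducible_from_evaluation: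
  fixes Q :: "'k::alg_closed_field mpoly poly"
  assumes Q: "lead_coeff Q = 1" "degree Q > 0" "\<And>i. coeff Q i \<in> polys_in S" and "s \<notin> S"
    and irr: "ring_irreducible\<^bsub>ring_on (polys_in (insert s S))\<^esub> (poly Q (Var s))"
  shows "monic_irreducible Q"
  unfolding monic_irreducible_def
proof (intro conjI allI impI)
  fix G H assume GH: "Q = G * H" "lead_coeff G = 1" "lead_coeff H = 1"
  show "degree G = 0 \<or> degree H = 0"
  proof (rule ccontr)
    assume deg: "\<not> (degree G = 0 \<or> degree H = 0)"
    obtain \<rho> where \<rho>: "comm_ring_hom \<rho>" "\<And>p :: 'k mpoly. \<rho> p \<in> polys_in S"
      "\<And>p. p \<in> polys_in S \<Longrightarrow> \<rho> p = p"
      by (rule retraction[of 1 S]) auto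
    define G' where "G' = map_poly \<rho> G"
    define H' where "H' = map_poly \<rho> H"
    have "Q = map_poly \<rho> Q"
      by (rule poly_eqI) (simp add: map_poly_hom[OF \<rho>(1)] \<rho>(3)[OF Q(3)])
    then have Q': "Q = G' * H'" by (simp add: GH(1) map_poly_hom[OF \<rho>(1)] G'_def H'_def)
    have G': "lead_coeff G' = 1" "degree G' > 0" "\<And>i. coeff G' i \<in> polys_in S"
      and H': "lead_coeff H' = 1" "degree H' > 0" "\<And>i. coeff H' i \<in> polys_in S"
      using map_poly_monic[OF \<rho>(1) GH(2)] map_poly_monic[OF \<rho>(1) GH(3)] deg \<rho>(2)
      by (simp_all add: G'_def H'_def map_poly_hom[OF \<rho>(1)])
    interpret domain "ring_on (polys_in (insert s S))"
      by (rule ring_on_domain[OF is_subring_polys_in])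
    have in_R: "poly P (Var s) \<in> carrier (ring_on (polys_in (insert s S)))"
      if "\<And>i. coeff P i \<in> polys_in S" for P :: "'k mpoly poly"
      using poly_Var_in[OF that, of s "insert s S"] by auto
    have "poly G' (Var s) \<in> Units (ring_on (polys_in (insert s S))) \<or>
        poly H' (Var s) \<in> Units (ring_on (polys_in (insert s S)))"
      by (rule ring_irreducibleE(5)[OF in_R[OF Q(3)] irr in_R[OF G'(3)] in_R[OF H'(3)]]) (simp add: Q')
    then show False
      using monic_Var_root[OF G' assms(4)] monic_Var_root[OF H' assms(4)] nonunit_by_evaluation
      by metis
  qed
qed (use Q in auto)

text \<open>Affine space is the hypersurface with polynomial \<open>z\<close>, so both kinds of
  varieties are treated alike. Irreducibility of \<open>Fp\<close> itself follows from one
  specialization, since monic factors keep their degrees.\<close>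

lemma admissible_polynomial:
  fixes V :: "(nat \<Rightarrow> 'k::alg_closed_field) set"
  assumes "admissible_variety n V" "n \<ge> 1"
  obtains Fp :: "'k mpoly poly" where "\<And>i. coeff Fp i \<in> polys_in {1..n}" "monic_irreducible Fp"
    "\<And>j c. j \<in> {1..n} \<Longrightarrow> monic_irreducible (map_poly (msubst j c) Fp)"
    "V = zero_set n (poly Fp (Var 0))"
proof (cases "V = affine_hyperplane n")
  case True
  define Fp :: "'k mpoly poly" where "Fp = [:0, 1:]"
  have Fp: "lead_coeff Fp = 1" "degree Fp = 1" by (simp_all add: Fp_def)
  show ?thesis
  proof (rule that)
    show "coeff Fp i \<in> polys_in {1..n}" for i by (auto simp: Fp_def coeff_pCons split: nat.splits)
    show "monic_irreducible Fp" by (rule monic_irreducible_degree_1[OF Fp])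
    show "monic_irreducible (map_poly (msubst j c) Fp)" for j c
      using map_poly_monic[OF msubst_hom Fp(1)] Fp(2) by (intro monic_irreducible_degree_1) auto
    show "V = zero_set n (poly Fp (Var 0))"
      unfolding True by (simp add: Fp_def affine_hyperplane_def zero_set_def)
  qed
next
  case False
  then obtain m f F where f: "\<forall>i\<le>m. f i \<in> polys_in {1..n}" "f m = (1 :: 'k mpoly)"
    and F: "F = (\<Sum>i\<le>m. f i * Var 0 ^ i)"
    and irr: "\<forall>c. \<forall>j\<in>{1..n}. ring_irreducible\<^bsub>ring_on (polys_in ({0..n} - {j}))\<^esub> (msubst j c F)"
    and V: "V = zero_set n F"
    using assms(1) unfolding admissible_variety_def by blast
  define Fp where "Fp = (\<Sum>i\<le>m. monom (f i) i)"
  have co: "coeff Fp i = (if i \<le> m then f i else 0)" for i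
    by (simp add: Fp_def coeff_sum)
  have deg: "degree Fp = m"
    by (rule antisym) (use f(2) in \<open>auto intro!: degree_le le_degree simp: co\<close>)
  have mon: "lead_coeff Fp = 1" by (simp add: deg co f(2))
  have FpF: "poly Fp (Var 0) = F" by (simp add: Fp_def F poly_sum poly_monom)
  have in_S: "coeff Fp i \<in> polys_in {1..n}" for i using f(1) by (simp add: co)
  have sub: "msubst j c F = poly (map_poly (msubst j c) Fp) (Var 0)" if "j \<in> {1..n}" for j c
    using that map_poly_hom(5)[OF msubst_hom, of j c Fp "Var 0"] by (simp add: FpF msubst_Var)
  have m: "m > 0"
  proof (rule ccontr)
    assume "\<not> m > 0"
    then have "F = 1" using f(2) by (simp add: F)
    have 1: "1 \<in> {1..n}" using assms(2) by simp
    interpret comm_ring_hom "msubst 1 0 :: 'k mpoly \<Rightarrow> 'k mpoly" by (rule msubst_hom)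
    interpret domain "ring_on (polys_in ({0..n} - {1}) :: 'k mpoly set)"
      by (rule ring_on_domain[OF is_subring_polys_in])
    have "ring_irreducible\<^bsub>ring_on (polys_in ({0..n} - {1}))\<^esub> (1 :: 'k mpoly)"
      using irr[rule_format, OF 1, of 0] unfolding \<open>F = 1\<close> hom_one .
    then have "(1 :: 'k mpoly) \<notin> Units (ring_on (polys_in ({0..n} - {1})))"
      by (intro ring_irreducibleE(4)) auto
    then show False by (auto simp: Units_def)
  qed
  have irr': "monic_irreducible (map_poly (msubst j c) Fp)" if j: "j \<in> {1..n}" for j c
  proof (rule monic_irreducible_from_evaluation[where s = 0 and S = "{1..n} - {j}"])
    note mm = map_poly_monic[OF msubst_hom[of j c] mon]
    show "lead_coeff (map_poly (msubst j c) Fp) = 1" by (rule mm)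
    show "degree (map_poly (msubst j c) Fp) > 0" unfolding mm using m deg by simp
    show "coeff (map_poly (msubst j c) Fp) i \<in> polys_in ({1..n} - {j})" for i
      using msubst_in[OF in_S] by (simp add: map_poly_hom[OF msubst_hom])
    have ins: "insert 0 ({1..n} - {j}) = {0..n} - {j}" using j by auto
    then show "ring_irreducible\<^bsub>ring_on (polys_in (insert 0 ({1..n} - {j})))\<^esub> (poly (map_poly (msubst j c) Fp) (Var 0))"
      using irr[rule_format, OF j, of c] by (simp only: sub[OF j] ins)
  qed simp
  show ?thesis
  proof (rule that[OF in_S _ irr'])
    show "V = zero_set n (poly Fp (Var 0))" by (simp add: V FpF)
    show "monic_irreducible Fp" unfolding monic_irreducible_def
    proof (intro conjI allI impI)
      fix G H assume GH: "Fp = G * H" "lead_coeff G = 1" "lead_coeff H = 1"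
      have "monic_irreducible (map_poly (msubst 1 0) Fp)" using irr' assms(2) by simp
      then show "degree G = 0 \<or> degree H = 0"
        using map_poly_monic[OF msubst_hom GH(2), of 1 0] map_poly_monic[OF msubst_hom GH(3), of 1 0]
        unfolding monic_irreducible_def GH(1) map_poly_hom(2)[OF msubst_hom] by metis
    qed (use mon m deg in auto)
  qed
qed

section \<open>The evaluation map into the function field\<close>

text \<open>The quotient concerns polynomials in the variables up to \<open>n\<close> only.
  Extending the map to a homomorphism on the whole type makes later computations free of side
  conditions; the kernel is described on the original ring.\<close>

lemma fraction_field_evaluation:
  fixes V :: "(nat \<Rightarrow> 'k::field) set" and \<iota> :: "'k mpoly set \<Rightarrow> 'f::field"
  assumes "fraction_field_of (coordinate_ring n V) \<iota>"
  obtains \<Psi> where "comm_ring_hom \<Psi>"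
    "\<And>p. p \<in> polys_in {0..n} \<Longrightarrow> poly_to_field n V \<iota> p = \<Psi> p"
    "\<And>p. p \<in> polys_in {0..n} \<Longrightarrow> \<Psi> p = 0 \<longleftrightarrow> (\<forall>a\<in>V. meval a p = 0)"
    "\<And>y. \<exists>p\<in>polys_in {0..n}. \<exists>q\<in>polys_in {0..n}. \<Psi> q \<noteq> 0 \<and> y = \<Psi> p / \<Psi> q"
proof -
  define R where "R = ring_on (polys_in {0..n} :: 'k mpoly set)"
  define I where "I = vanishing_ideal n V"
  define \<psi> where "\<psi> = poly_to_field n V \<iota>"
  have \<psi>: "\<psi> g = \<iota> (I +>\<^bsub>R\<^esub> g)" for g by (simp add: \<psi>_def poly_to_field_def I_def R_def)
  have cR: "carrier R = polys_in {0..n}" by (simp add: R_def)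
  have "ideal I R"
    unfolding R_def ring_on_ideal_iff[OF is_subring_polys_in] I_def vanishing_ideal_def
    by (auto simp: meval_simps)
  then interpret I: ideal I R .
  note ff = assms[unfolded fraction_field_of_def coordinate_ring_def, folded R_def I_def]
  have hom: "\<iota> \<circ> (+>\<^bsub>R\<^esub>) I \<in> Ring.ring_hom R (ring_on UNIV)"
    using ring_hom_trans[OF I.rcos_ring_hom] ff by blast
  have add: "\<psi> (p + q) = \<psi> p + \<psi> q" and mult: "\<psi> (p * q) = \<psi> p * \<psi> q"
    if "p \<in> polys_in {0..n}" "q \<in> polys_in {0..n}" for p q
    using ring_hom_add[OF hom, of p q] ring_hom_mult[OF hom, of p q] that by (simp_all add: \<psi> R_def)
  have one: "\<psi> 1 = 1" using ring_hom_one[OF hom] by (simp add: \<psi> R_def)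
  have zero: "\<psi> 0 = 0" using add[of 0 0] by (metis add_0 add_cancel_right_right zero_in)
  have car: "carrier (R Quot I) = (\<lambda>g. I +>\<^bsub>R\<^esub> g) ` polys_in {0..n}"
    unfolding FactRing_def A_RCOSETS_def' by (auto simp: cR)
  have ker: "\<psi> p = 0 \<longleftrightarrow> (\<forall>a\<in>V. meval a p = 0)" if p: "p \<in> polys_in {0..n}" for p
  proof -
    have "\<psi> p = 0 \<longleftrightarrow> \<psi> p = \<psi> 0" by (simp add: zero)
    also have "\<dots> \<longleftrightarrow> I +>\<^bsub>R\<^esub> p = I +>\<^bsub>R\<^esub> 0"
      unfolding \<psi> using ff p by (intro inj_on_eq_iff) (auto simp: car)
    also have "\<dots> \<longleftrightarrow> p \<in> I"
    proof
      have z: "I +>\<^bsub>R\<^esub> 0 = I"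
        by (rule I.a_rcos_const) (simp add: I_def vanishing_ideal_def meval_simps)
      show "p \<in> I" if "I +>\<^bsub>R\<^esub> p = I +>\<^bsub>R\<^esub> 0"
        using I.a_rcos_self[of p] p that unfolding z cR by simp
      show "I +>\<^bsub>R\<^esub> p = I +>\<^bsub>R\<^esub> 0" if "p \<in> I"
        unfolding z using that by (rule I.a_rcos_const)
    qed
    also have "\<dots> \<longleftrightarrow> (\<forall>a\<in>V. meval a p = 0)" using p by (simp add: I_def vanishing_ideal_def)
    finally show ?thesis .
  qed
  \<comment> \<open>Sending the variables beyond \<open>n\<close> to \<open>0\<close> is an
    arbitrary choice.\<close>
  define \<Psi> where "\<Psi> = mev (\<lambda>c. \<psi> (Const c)) (\<lambda>i. if i \<le> n then \<psi> (Var i) else 0)"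
  interpret C: comm_ring_hom "Const :: 'k \<Rightarrow> 'k mpoly" by (rule Const_hom)
  have ch: "comm_ring_hom (\<lambda>c. \<psi> (Const c))"
    by unfold_locales (auto simp: C.hom_add C.hom_mult add mult zero one)
  have h: "comm_ring_hom \<Psi>" unfolding \<Psi>_def by (rule mev_hom[OF ch])
  interpret \<Psi>: comm_ring_hom \<Psi> by (rule h)
  have CV: "\<Psi> (Const c) = \<psi> (Const c)" "i \<le> n \<Longrightarrow> \<Psi> (Var i) = \<psi> (Var i)" for c i
    by (simp_all add: \<Psi>_def mev_Const[OF ch] mev_Var[OF ch])
  have eq: "\<psi> p = \<Psi> p" if "p \<in> polys_in {0..n}" for p using that
    by (induction rule: polys_in_induct) (auto simp: CV add mult \<Psi>.hom_add \<Psi>.hom_mult)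
  show ?thesis
  proof (rule that[OF h])
    show "\<exists>p\<in>polys_in {0..n}. \<exists>q\<in>polys_in {0..n}. \<Psi> q \<noteq> 0 \<and> y = \<Psi> p / \<Psi> q" for y
      using ff unfolding car by (auto simp: \<psi>[symmetric] eq)
  qed (use eq ker in \<open>auto simp: \<psi>_def\<close>)
qed

section \<open>Dedekind rings with a prescribed family of principal primes\<close>

text \<open>In the application, \<open>A\<close> and \<open>X\<close> are the images of the
  coordinate ring and of the polynomials in \<open>x_1, ..., x_n\<close>, and \<open>pr\<close>
  lists the \<open>x_j - a\<close>. The assumptions \<open>factor\<close> and \<open>maximal\<close>
  say that inverting the elements of \<open>X\<close> without a listed divisor leaves only the
  listed primes and makes them maximal. \<open>mult\<close> and \<open>den\<close> are defined
  parameters so that the assumptions can use them.\<close>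

locale prime_family =
  fixes A X :: "'f::field set" and pr :: "'i \<Rightarrow> 'f" and Ix :: "'i set"
    and mult :: "'i \<Rightarrow> 'f set" and den :: "'i set \<Rightarrow> 'f set"
  defines "mult i \<equiv> (*) (pr i) ` A"
    and "den L \<equiv> {h \<in> X. h \<noteq> 0 \<and> (\<forall>i\<in>L. h \<notin> mult i)}"
  assumes A: "is_subring A" and X: "is_subring X" and XA: "X \<subseteq> A"
    and frac: "\<And>y. \<exists>p\<in>A. \<exists>q\<in>X. q \<noteq> 0 \<and> y = p / q"
    and pr_X: "\<And>i. i \<in> Ix \<Longrightarrow> pr i \<in> X" and pr_nz: "\<And>i. i \<in> Ix \<Longrightarrow> pr i \<noteq> 0"
    and prime: "\<And>i p q. i \<in> Ix \<Longrightarrow> p \<in> A \<Longrightarrow> q \<in> A \<Longrightarrow> p * q \<in> mult i \<Longrightarrow> p \<in> mult i \<or> q \<in> mult i"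
    and one_notin: "\<And>i. i \<in> Ix \<Longrightarrow> 1 \<notin> mult i"
    and distinct: "\<And>i j. i \<in> Ix \<Longrightarrow> j \<in> Ix \<Longrightarrow> pr j \<in> mult i \<Longrightarrow> i = j"
    and factor: "\<And>q. q \<in> X \<Longrightarrow> q \<noteq> 0 \<Longrightarrow>
      \<exists>h\<in>den Ix. \<exists>ls. set ls \<subseteq> Ix \<and> q = h * prod_list (map pr ls)"
    and maximal: "\<And>i p. i \<in> Ix \<Longrightarrow> p \<in> A \<Longrightarrow> p \<notin> mult i \<Longrightarrow> \<exists>u\<in>A. \<exists>h\<in>den Ix. p * u - h \<in> mult i"
    and integral: "A \<subseteq> integral_closure X"
begin

definition base_ring :: "'i set \<Rightarrow> 'f set" where
  "base_ring L = {g / h | g h. g \<in> X \<and> h \<in> den L}"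

definition B :: "'i set \<Rightarrow> 'f set" where
  "B L = {p / h | p h. p \<in> A \<and> h \<in> den L}"

definition PP :: "'i set \<Rightarrow> 'i \<Rightarrow> 'f set" where
  "PP L i = (*) (pr i) ` B L"

section \<open>Principal ideals, denominators and products of primes\<close>

lemmas A_simps [simp] = is_subringD[OF A] and X_simps [simp] = is_subringD[OF X]

lemma X_in_A [simp]: "x \<in> X \<Longrightarrow> x \<in> A" using XA by blast

lemma mult_A: "x \<in> mult i \<Longrightarrow> i \<in> Ix \<Longrightarrow> x \<in> A"
  unfolding mult_def using pr_X by auto

lemma mult_zero: "0 \<in> mult i" unfolding mult_def by (rule image_eqI[of _ _ 0]) auto

lemma mult_absorb: "x \<in> mult i \<Longrightarrow> a \<in> A \<Longrightarrow> a * x \<in> mult i"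
  unfolding mult_def by (auto simp: mult.left_commute)

lemma mult_absorb': "x \<in> mult i \<Longrightarrow> a \<in> A \<Longrightarrow> x * a \<in> mult i"
  using mult_absorb[of x i a] by (simp add: mult.commute)

lemma mult_add: "x \<in> mult i \<Longrightarrow> y \<in> mult i \<Longrightarrow> x + y \<in> mult i"
  unfolding mult_def by (auto simp flip: distrib_left)

lemma mult_uminus: "x \<in> mult i \<Longrightarrow> - x \<in> mult i"
  using mult_absorb[of x i "- 1"] by simp

lemma mult_sum: "(\<And>k. k \<in> S \<Longrightarrow> f k \<in> mult i) \<Longrightarrow> sum f S \<in> mult i"
  by (induction S rule: infinite_finite_induct) (auto intro: mult_zero mult_add)

lemma mult_power: "i \<in> Ix \<Longrightarrow> p \<in> A \<Longrightarrow> p ^ k \<in> mult i \<Longrightarrow> p \<in> mult i"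
proof (induction k)
  case 0 then show ?case using one_notin by auto
next
  case (Suc k) then show ?case using prime[of i p "p ^ k"] by auto
qed

lemma pr_mult: "i \<in> Ix \<Longrightarrow> pr i \<in> mult i"
  unfolding mult_def by (rule image_eqI[of _ _ 1]) auto

lemma denD: "h \<in> den L \<Longrightarrow> h \<in> X" "h \<in> den L \<Longrightarrow> h \<noteq> 0" "h \<in> den L \<Longrightarrow> i \<in> L \<Longrightarrow> h \<notin> mult i"
  "h \<in> den L \<Longrightarrow> h \<in> A"
  unfolding den_def by auto

lemma den_one: "L \<subseteq> Ix \<Longrightarrow> 1 \<in> den L"
  unfolding den_def using one_notin by auto

lemma den_mult:
  assumes "L \<subseteq> Ix" "h \<in> den L" "h' \<in> den L" shows "h * h' \<in> den L"
proof -
  have "h * h' \<notin> mult i" if "i \<in> L" for i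
    using prime[of i h h'] denD(3)[OF assms(2) that] denD(3)[OF assms(3) that] assms that
      denD(4)[OF assms(2)] denD(4)[OF assms(3)] by blast
  then show ?thesis using assms(2,3) unfolding den_def by simp
qed

lemma den_power: "L \<subseteq> Ix \<Longrightarrow> h \<in> den L \<Longrightarrow> h ^ k \<in> den L"
  by (induction k) (auto intro: den_one den_mult)

lemma den_mono: "L \<subseteq> L' \<Longrightarrow> den L' \<subseteq> den L"
  unfolding den_def by auto

lemma den_pr:
  assumes "L \<subseteq> Ix" "j \<in> Ix" "j \<notin> L" shows "pr j \<in> den L"
proof -
  have "pr j \<notin> mult i" if "i \<in> L" for i using distinct[of i j] that assms by blast
  then show ?thesis using pr_X[OF assms(2)] pr_nz[OF assms(2)] unfolding den_def by simp
qed

lemma den_prod_list: "L \<subseteq> Ix \<Longrightarrow> set ls \<subseteq> Ix - L \<Longrightarrow> prod_list (map pr ls) \<in> den L"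
  by (induction ls) (auto intro: den_one den_mult den_pr)

lemma prod_list_X: "set ls \<subseteq> Ix \<Longrightarrow> prod_list (map pr ls) \<in> X"
  by (induction ls) (auto intro!: X_simps(4) pr_X)

lemma prod_list_nz: "set ls \<subseteq> Ix \<Longrightarrow> prod_list (map pr ls) \<noteq> 0"
  by (induction ls) (auto simp: pr_nz)

lemma prod_list_mult: "i \<in> Ix \<Longrightarrow> set ls \<subseteq> Ix \<Longrightarrow> prod_list (map pr ls) \<in> mult i \<Longrightarrow> i \<in> set ls"
proof (induction ls)
  case Nil
  then show ?case using one_notin by simp
next
  case (Cons l ls)
  then have "pr l \<in> mult i \<or> prod_list (map pr ls) \<in> mult i"
    by (intro prime) (auto intro: pr_X X_in_A prod_list_X)
  then show ?case using Cons distinct by auto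
qed

text \<open>The factors from \<open>S\<close> disappear in a representation with the least number of linear factors.\<close>

lemma reduced_representation:
  assumes S: "S \<subseteq> Ix"
    and reg: "\<And>i p q. i \<in> S \<Longrightarrow> p \<in> A \<Longrightarrow> q \<in> X \<Longrightarrow> q \<noteq> 0 \<Longrightarrow> y = p / q \<Longrightarrow> q \<in> mult i \<Longrightarrow> p \<in> mult i"
  obtains p h ls where "p \<in> A" "h \<in> den Ix" "set ls \<subseteq> Ix - S" "y = p / (h * prod_list (map pr ls))"
proof -
  define P where "P k \<longleftrightarrow> (\<exists>p h ls. p \<in> A \<and> h \<in> den Ix \<and> set ls \<subseteq> Ix \<and> length ls = k \<and>
      y = p / (h * prod_list (map pr ls)))" for k
  have "\<exists>k. P k"
  proof -
    obtain p q where pq: "p \<in> A" "q \<in> X" "q \<noteq> 0" "y = p / q" using frac by blast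
    with factor[OF pq(2,3)] show ?thesis unfolding P_def by blast
  qed
  then obtain k where k: "P k" "\<And>l. l < k \<Longrightarrow> \<not> P l" using exists_least_iff[of P] by auto
  then obtain p h ls where r: "p \<in> A" "h \<in> den Ix" "set ls \<subseteq> Ix" "length ls = k"
    "y = p / (h * prod_list (map pr ls))" unfolding P_def by blast
  have "l \<notin> S" if l: "l \<in> set ls" for l
  proof
    assume lS: "l \<in> S"
    then have lI: "l \<in> Ix" using S by blast
    have split: "prod_list (map pr ls) = pr l * prod_list (map pr (remove1 l ls))"
      using l by (induction ls) auto
    have sub: "set (remove1 l ls) \<subseteq> Ix" using r(3) set_remove1_subset by fast
    have q: "h * prod_list (map pr ls) \<in> X" "h * prod_list (map pr ls) \<noteq> 0"
      using denD(1,2)[OF r(2)] prod_list_X[OF r(3)] prod_list_nz[OF r(3)] by auto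
    have "h * prod_list (map pr (remove1 l ls)) \<in> A"
      using denD(1)[OF r(2)] prod_list_X[OF sub] by auto
    then have "pr l * (h * prod_list (map pr (remove1 l ls))) \<in> mult l" unfolding mult_def by blast
    then have "h * prod_list (map pr ls) \<in> mult l" by (simp add: split mult.left_commute)
    then have "p \<in> mult l" using reg[OF lS r(1) q r(5)] by blast
    then obtain p' where p': "p = pr l * p'" "p' \<in> A" unfolding mult_def by blast
    have "y = p' / (h * prod_list (map pr (remove1 l ls)))"
      using pr_nz[OF lI] unfolding r(5) split p'(1) by (simp add: field_simps)
    then have "P (length (remove1 l ls))" unfolding P_def using p'(2) r(2) sub by blast
    moreover have "length (remove1 l ls) < k" using l r(4) length_pos_if_in_set[OF l] by (simp add: length_remove1)
    ultimately show False using k(2) by blast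
  qed
  then show ?thesis using that r by blast
qed

lemma mem_B_A: "L \<subseteq> Ix \<Longrightarrow> p \<in> A \<Longrightarrow> p \<in> B L"
  unfolding B_def using den_one[of L] by (intro CollectI exI[of _ p] exI[of _ 1]) simp

lemma mem_BI: "p \<in> A \<Longrightarrow> h \<in> den L \<Longrightarrow> p / h \<in> B L"
  unfolding B_def by blast

lemma B_subring: assumes L: "L \<subseteq> Ix" shows "is_subring (B L)"
  unfolding is_subring_def
proof (intro conjI ballI)
  show "0 \<in> B L" "1 \<in> B L" using mem_B_A[OF L] by auto
  fix x assume x: "x \<in> B L"
  then obtain p h where p: "x = p / h" "p \<in> A" "h \<in> den L" unfolding B_def by blast
  have "- x = (- p) / h" using p by simp
  then show "- x \<in> B L" using p mem_BI[of "- p" h L] by simp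
  fix y assume y: "y \<in> B L"
  then obtain q g where q: "y = q / g" "q \<in> A" "g \<in> den L" unfolding B_def by blast
  have "x + y = (p * g + q * h) / (h * g)" "x * y = (p * q) / (h * g)"
    using p q denD(2) by (simp_all add: add_frac_eq)
  moreover have "h * g \<in> den L" using den_mult[OF L] p q by blast
  moreover have "p * g + q * h \<in> A" "p * q \<in> A" using p q denD(4) by auto
  ultimately show "x + y \<in> B L" "x * y \<in> B L" using mem_BI by simp_all
qed

lemma common_den:
  assumes L: "L \<subseteq> Ix" and "finite S" "\<And>k. k \<in> S \<Longrightarrow> f k \<in> base_ring L"
  shows "\<exists>d\<in>den L. \<forall>k\<in>S. d * f k \<in> X"
  using assms(2,3)
proof (induction S rule: finite_induct)
  case empty
  show ?case using den_one[OF L] by blast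
next
  case (insert k S)
  then obtain d where d: "d \<in> den L" "\<And>k. k \<in> S \<Longrightarrow> d * f k \<in> X" by blast
  obtain g h where gh: "f k = g / h" "g \<in> X" "h \<in> den L" using insert.prems unfolding base_ring_def by blast
  show ?case
  proof (intro bexI[of _ "d * h"] ballI)
    show "d * h \<in> den L" using den_mult[OF L d(1) gh(3)] .
    fix l assume "l \<in> insert k S"
    then show "d * h * f l \<in> X"
    proof
      assume "l = k"
      then have "h * f l = g" using gh(1) denD(2)[OF gh(3)] by simp
      then have "d * h * f l = d * g" by (simp only: mult.assoc)
      moreover have "d * g \<in> X" using denD(1)[OF d(1)] gh(2) by simp
      ultimately show ?thesis by (simp only:)
    next
      assume "l \<in> S"
      then have "h * (d * f l) \<in> X" using d(2) denD(1)[OF gh(3)] by simp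
      then show ?thesis by (simp add: mult_ac)
    qed
  qed
qed

text \<open>For an integral element \<open>y = p / q\<close>, the equation with denominators cleared
  shows that a prime of \<open>L\<close> dividing \<open>q\<close> also divides \<open>p\<close>. A
  reduced representation then has no prime of \<open>L\<close> in its denominator.\<close>

theorem integral_closure_base_ring:
  assumes L: "L \<subseteq> Ix" shows "integral_closure (base_ring L) = B L"
proof (intro equalityI subsetI)
  fix y assume "y \<in> B L"
  then obtain p h where y: "y = p / h" "p \<in> A" "h \<in> den L" unfolding B_def by blast
  then have "p \<in> integral_closure X" using integral by blast
  then obtain P where P: "lead_coeff P = 1" "\<And>i. coeff P i \<in> X" "poly P p = 0"
    unfolding integral_closure_def by blast
  define M where "M = degree P"
  \<comment> \<open>This is \<open>P\<close> with its argument scaled by \<open>h\<close> and made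
    monic again, so that \<open>p / h\<close> becomes a root.\<close>
  define Q where "Q = (\<Sum>i\<le>M. monom (coeff P i / h ^ (M - i)) i)"
  have h0: "h \<noteq> 0" using denD(2) y(3) by blast
  have coQ: "coeff Q i = (if i \<le> M then coeff P i / h ^ (M - i) else 0)" for i
    by (simp add: Q_def coeff_sum)
  have "coeff Q M = 1" using P(1) by (simp add: coQ M_def)
  then have "degree Q = M"
    by (intro antisym degree_le le_degree) (auto simp: coQ)
  then have "lead_coeff Q = 1" using P(1) by (simp add: coQ M_def)
  moreover have "coeff Q i \<in> base_ring L" for i
  proof (cases "i \<le> M")
    case True
    then show ?thesis unfolding base_ring_def coQ using P(2) den_power[OF L y(3)] by auto
  next
    case False
    have "0 / 1 \<in> base_ring L" unfolding base_ring_def using den_one[OF L] X_simps(1) by blast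
    then show ?thesis using False by (simp add: coQ)
  qed
  moreover have "poly Q y = 0"
  proof -
    have "poly Q y = (\<Sum>i\<le>M. coeff P i / h ^ (M - i) * (p / h) ^ i)"
      by (simp add: Q_def poly_sum poly_monom y(1))
    also have "\<dots> = (\<Sum>i\<le>M. coeff P i * p ^ i / h ^ M)"
    proof (rule sum.cong)
      fix i assume "i \<in> {..M}"
      then have "h ^ M = h ^ (M - i) * h ^ i" by (simp flip: power_add)
      then show "coeff P i / h ^ (M - i) * (p / h) ^ i = coeff P i * p ^ i / h ^ M"
        by (simp add: power_divide)
    qed simp
    also have "\<dots> = poly P p / h ^ M" by (simp add: poly_altdef M_def sum_divide_distrib)
    finally show ?thesis using P(3) by simp
  qed
  ultimately show "y \<in> integral_closure (base_ring L)" unfolding integral_closure_def by blast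
next
  fix y assume "y \<in> integral_closure (base_ring L)"
  then obtain P where P: "lead_coeff P = 1" "\<And>i. coeff P i \<in> base_ring L" "poly P y = 0"
    unfolding integral_closure_def by blast
  define M where "M = degree P"
  obtain d where d: "d \<in> den L" "\<And>k. k \<le> M \<Longrightarrow> d * coeff P k \<in> X"
    using common_den[OF L, of "{..M}" "coeff P"] P(2) by auto
  have reg: "p \<in> mult i" if i: "i \<in> L" and pq: "p \<in> A" "q \<in> X" "q \<noteq> 0" "y = p / q" "q \<in> mult i" for i p q
  proof -
    have iI: "i \<in> Ix" using i L by blast
    have "0 = d * q ^ M * poly P y" using P(3) by simp
    also have "\<dots> = (\<Sum>k\<le>M. (d * coeff P k) * p ^ k * q ^ (M - k))"
      unfolding poly_altdef M_def[symmetric] sum_distrib_left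
    proof (rule sum.cong)
      fix k assume "k \<in> {..M}"
      then have "q ^ M = q ^ (M - k) * q ^ k" by (simp flip: power_add)
      then show "d * q ^ M * (coeff P k * y ^ k) = (d * coeff P k) * p ^ k * q ^ (M - k)"
        using pq(3) by (simp add: pq(4) power_divide)
    qed simp
    also have "{..M} = insert M {..<M}" by auto
    also have "(\<Sum>k\<in>insert M {..<M}. (d * coeff P k) * p ^ k * q ^ (M - k)) =
        d * p ^ M + (\<Sum>k<M. (d * coeff P k) * p ^ k * q ^ (M - k))"
      using P(1) by (simp add: M_def)
    finally have "d * p ^ M = - (\<Sum>k<M. (d * coeff P k) * p ^ k * q ^ (M - k))"
      by (simp add: eq_neg_iff_add_eq_0)
    moreover have "(\<Sum>k<M. (d * coeff P k) * p ^ k * q ^ (M - k)) \<in> mult i"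
    proof (intro mult_sum mult_absorb)
      fix k assume k: "k \<in> {..<M}"
      then have "q ^ (M - k) = q * q ^ (M - k - 1)" by (metis Suc_diff_1 lessThan_iff power_Suc zero_less_diff)
      then show "q ^ (M - k) \<in> mult i" using mult_absorb'[OF pq(5), of "q ^ (M - k - 1)"] pq(2) by simp
      have "d * coeff P k \<in> A" using d(2)[of k] k by (intro X_in_A) simp
      then show "d * coeff P k * p ^ k \<in> A" using pq(1) A_simps(4,7) by blast
    qed
    ultimately have "d * p ^ M \<in> mult i" using mult_uminus by simp
    then have "p ^ M \<in> mult i" using prime[OF iI, of d "p ^ M"] denD(3)[OF d(1) i] denD(4)[OF d(1)] pq(1) A_simps(7) by blast
    then show ?thesis using mult_power[OF iI pq(1)] by blast
  qed
  obtain p h ls where r: "p \<in> A" "h \<in> den Ix" "set ls \<subseteq> Ix - L" "y = p / (h * prod_list (map pr ls))"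
    by (rule reduced_representation[OF L reg])
  have "h * prod_list (map pr ls) \<in> den L"
    using den_mult[OF L] den_prod_list[OF L r(3)] den_mono[OF L] r(2) by blast
  then show "y \<in> B L" unfolding r(4) using mem_BI r(1) by blast
qed

section \<open>Spectrum, open sets and sections of the integral closure\<close>

lemma PP_iff:
  assumes L: "L \<subseteq> Ix" and i: "i \<in> L" and p: "p \<in> A" and h: "h \<in> den L"
  shows "p / h \<in> PP L i \<longleftrightarrow> p \<in> mult i"
proof
  have iI: "i \<in> Ix" using i L by blast
  assume "p / h \<in> PP L i"
  then obtain r g where r: "p / h = pr i * (r / g)" "r \<in> A" "g \<in> den L" unfolding PP_def B_def by blast
  have "p * g = pr i * (r * h)" using r denD(2)[OF r(3)] denD(2)[OF h] by (simp add: field_simps)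
  moreover have "r * h \<in> A" using r denD(4)[OF h] by simp
  ultimately have "p * g \<in> mult i" unfolding mult_def by blast
  then show "p \<in> mult i" using prime[OF iI p denD(4)[OF r(3)]] denD(3)[OF r(3) i] by blast
next
  assume "p \<in> mult i"
  then obtain r where "p = pr i * r" "r \<in> A" unfolding mult_def by blast
  then have "p / h = pr i * (r / h)" "r / h \<in> B L" using mem_BI h by auto
  then show "p / h \<in> PP L i" unfolding PP_def by blast
qed

lemma PP_iff_A: "L \<subseteq> Ix \<Longrightarrow> i \<in> L \<Longrightarrow> p \<in> A \<Longrightarrow> p \<in> PP L i \<longleftrightarrow> p \<in> mult i"
  using PP_iff[of L i p 1] den_one by simp

lemma PP_inj: assumes L: "L \<subseteq> Ix" shows "inj_on (PP L) L"
proof (rule inj_onI)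
  fix i j assume ij: "i \<in> L" "j \<in> L" "PP L i = PP L j"
  then have I: "i \<in> Ix" "j \<in> Ix" using L by auto
  have "pr i \<in> PP L i" using PP_iff_A[OF L ij(1)] pr_mult pr_X I by simp
  then have "pr i \<in> mult j" using PP_iff_A[OF L ij(2), of "pr i"] pr_X I ij(3) by simp
  then show "i = j" using distinct[of j i] I by simp
qed

lemma PP_nonzero: "L \<subseteq> Ix \<Longrightarrow> i \<in> L \<Longrightarrow> PP L i \<noteq> {0}"
  using PP_iff_A[of L i "pr i"] pr_mult[of i] pr_X[of i] pr_nz[of i] by auto

lemma den_unit: "L \<subseteq> Ix \<Longrightarrow> h \<in> den L \<Longrightarrow> 1 / h \<in> B L"
  using mem_BI[of 1 h L] by simp

text \<open>A nonzero prime meets \<open>X\<close>, hence contains some \<open>pr l\<close> after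
  the invertible factors are dropped. By \<open>maximal\<close>, an element outside
  \<open>PP L l\<close> would bring a unit into it.\<close>

theorem Spec_B: assumes L: "L \<subseteq> Ix" shows "Spec (B L) = insert {0} (PP L ` L)"
proof (intro equalityI subsetI)
  note Bs = is_subringD[OF B_subring[OF L]]
  fix \<pp> assume "\<pp> \<in> Spec (B L)"
  then have P: "\<pp> \<subseteq> B L" "0 \<in> \<pp>" "\<And>x y. x \<in> \<pp> \<Longrightarrow> y \<in> \<pp> \<Longrightarrow> x + y \<in> \<pp>"
    "\<And>a x. a \<in> B L \<Longrightarrow> x \<in> \<pp> \<Longrightarrow> a * x \<in> \<pp>" "1 \<notin> \<pp>"
    "\<And>a b. a \<in> B L \<Longrightarrow> b \<in> B L \<Longrightarrow> a * b \<in> \<pp> \<Longrightarrow> a \<in> \<pp> \<or> b \<in> \<pp>"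
    unfolding Spec_def ring_on_primeideal_iff[OF B_subring[OF L]] by blast+
  have unit: "h \<notin> \<pp>" if "h \<in> den L" for h
    using P(4)[OF den_unit[OF L that], of h] denD(2)[OF that] P(5) by auto
  show "\<pp> \<in> insert {0} (PP L ` L)"
  proof (cases "\<pp> = {0}")
    case False
    then obtain x where x: "x \<in> \<pp>" "x \<noteq> 0" using P(2) by blast
    then obtain a h where a: "x = a / h" "a \<in> A" "h \<in> den L" using P(1) unfolding B_def by blast
    have "h * x \<in> \<pp>" using P(4)[OF _ x(1)] mem_B_A[OF L] denD(4)[OF a(3)] by blast
    then have a\<pp>: "a \<in> \<pp>" "a \<noteq> 0" using a x(2) denD(2)[OF a(3)] by auto
    \<comment> \<open>Writing the inverse of \<open>a\<close> with a denominator in \<open>X\<close>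
      shows that \<open>a\<close> divides the nonzero element \<open>q\<close> of
      \<open>X\<close>.\<close>
    obtain p q where pq: "p \<in> A" "q \<in> X" "q \<noteq> 0" "1 / a = p / q" using frac by blast
    have "q = p * a" using pq(3,4) a\<pp>(2) by (simp add: field_simps)
    then have "q \<in> \<pp>" using P(4)[OF mem_B_A[OF L pq(1)] a\<pp>(1)] by simp
    moreover obtain g ls where g: "g \<in> den Ix" "set ls \<subseteq> Ix" "q = g * prod_list (map pr ls)"
      using factor[OF pq(2,3)] by blast
    have gL: "g \<in> den L" using g(1) den_mono[OF L] by blast
    ultimately have "prod_list (map pr ls) \<in> \<pp>"
      using P(6)[of g "prod_list (map pr ls)"] unit[OF gL] mem_B_A[OF L] denD(4)[OF gL] prod_list_X[OF g(2)] g(3) by auto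
    then have "\<exists>l\<in>set ls. pr l \<in> \<pp>" using g(2)
    proof (induction ls)
      case Nil then show ?case using P(5) by simp
    next
      case (Cons l ls)
      then show ?case using P(6)[of "pr l" "prod_list (map pr ls)"] mem_B_A[OF L] pr_X prod_list_X by auto
    qed
    then obtain l where l: "l \<in> Ix" "pr l \<in> \<pp>" using g(2) by blast
    have lL: "l \<in> L" using unit[OF den_pr[OF L l(1)]] l(2) by blast
    have sub: "PP L l \<subseteq> \<pp>" unfolding PP_def using P(4) l(2) by (auto simp: mult.commute)
    have "\<pp> \<subseteq> PP L l"
    proof
      fix b assume b: "b \<in> \<pp>"
      then obtain p h where p: "b = p / h" "p \<in> A" "h \<in> den L" using P(1) unfolding B_def by blast
      have "h * b \<in> \<pp>" using P(4)[OF _ b] mem_B_A[OF L] denD(4)[OF p(3)] by blast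
      then have p\<pp>: "p \<in> \<pp>" using p denD(2)[OF p(3)] by auto
      have "p \<in> mult l"
      proof (rule ccontr)
        assume "p \<notin> mult l"
        then obtain u h0 where u: "u \<in> A" "h0 \<in> den Ix" "p * u - h0 \<in> mult l" using maximal[OF l(1) p(2)] by blast
        have "p * u - h0 \<in> \<pp>" using sub PP_iff_A[OF L lL mult_A[OF u(3) l(1)]] u(3) by blast
        then have "- (p * u - h0) \<in> \<pp>" using P(4)[of "- 1" "p * u - h0"] Bs by simp
        moreover have "p * u \<in> \<pp>" using P(4)[OF mem_B_A[OF L u(1)] p\<pp>] by (simp add: mult.commute)
        ultimately have "h0 \<in> \<pp>" using P(3)[of "p * u" "- (p * u - h0)"] by simp
        then show False using unit den_mono[OF L] u(2) by blast
      qed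
      then show "b \<in> PP L l" using PP_iff[OF L lL p(2,3)] p(1) by simp
    qed
    then show ?thesis using sub lL by blast
  qed simp
next
  note Bs = is_subringD[OF B_subring[OF L]]
  fix \<pp> assume "\<pp> \<in> insert {0} (PP L ` L)"
  then show "\<pp> \<in> Spec (B L)"
  proof
    assume "\<pp> = {0}"
    then show ?thesis
      unfolding Spec_def ring_on_primeideal_iff[OF B_subring[OF L]] using Bs by auto
  next
    assume "\<pp> \<in> PP L ` L"
    then obtain i where i: "i \<in> L" "\<pp> = PP L i" by blast
    then have iI: "i \<in> Ix" using L by blast
    have pB: "pr i \<in> B L" using mem_B_A[OF L] pr_X[OF iI] by simp
    have "primeideal (PP L i) (ring_on (B L))"
      unfolding ring_on_primeideal_iff[OF B_subring[OF L]]
    proof (intro conjI ballI impI)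
      show "PP L i \<subseteq> B L" unfolding PP_def using pB Bs by auto
      show "0 \<in> PP L i" unfolding PP_def by (rule image_eqI[of _ _ 0]) (auto simp: Bs)
      show "x + y \<in> PP L i" if "x \<in> PP L i" "y \<in> PP L i" for x y
        using that Bs unfolding PP_def by (auto simp flip: distrib_left)
      show "a * x \<in> PP L i" if "a \<in> B L" "x \<in> PP L i" for a x
        using that Bs unfolding PP_def by (auto simp: mult.left_commute)
      show "1 \<notin> PP L i" using PP_iff_A[OF L i(1), of 1] one_notin[OF iI] by simp
      fix a b assume "a \<in> B L" "b \<in> B L" and ab: "a * b \<in> PP L i"
      then obtain p h q g where p: "a = p / h" "p \<in> A" "h \<in> den L" and q: "b = q / g" "q \<in> A" "g \<in> den L"
        unfolding B_def by blast
      have "(p * q) / (h * g) \<in> PP L i" using ab p q by simp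
      then have "p * q \<in> mult i" using PP_iff[OF L i(1) _ den_mult[OF L p(3) q(3)], of "p * q"] p q by simp
      then show "a \<in> PP L i \<or> b \<in> PP L i"
        using prime[OF iI p(2) q(2)] PP_iff[OF L i(1) p(2,3)] PP_iff[OF L i(1) q(2,3)] p(1) q(1) by blast
    qed
    then show ?thesis by (simp add: Spec_def i(2))
  qed
qed

text \<open>A nonzero element divides, up to a unit, an element of \<open>X\<close> with a finite
  list of prime factors, so it lies in finitely many closed points; conversely the product of the
  primes in \<open>E\<close> vanishes exactly there. The empty set is separate because all other
  open sets contain the generic point.\<close>

theorem zariski_open_B:
  assumes L: "L \<subseteq> Ix"
  shows "zariski_open (B L) U \<longleftrightarrow> U = {} \<or> (\<exists>E\<subseteq>L. finite E \<and> U = Spec (B L) - PP L ` E)"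
proof
  assume "zariski_open (B L) U"
  then obtain S where S: "S \<subseteq> B L" "U = {\<pp> \<in> Spec (B L). \<not> S \<subseteq> \<pp>}" unfolding zariski_open_def by blast
  show "U = {} \<or> (\<exists>E\<subseteq>L. finite E \<and> U = Spec (B L) - PP L ` E)"
  proof (cases "S \<subseteq> {0}")
    case True
    have "0 \<in> \<pp>" if "\<pp> \<in> Spec (B L)" for \<pp>
      using that unfolding Spec_def ring_on_primeideal_iff[OF B_subring[OF L]] by blast
    then show ?thesis using True S(2) by blast
  next
    case False
    then obtain s where s: "s \<in> S" "s \<noteq> 0" by blast
    then obtain a h where a: "s = a / h" "a \<in> A" "h \<in> den L" using S(1) unfolding B_def by blast
    obtain p q where pq: "p \<in> A" "q \<in> X" "q \<noteq> 0" "1 / a = p / q" using frac by blast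
    have "a \<noteq> 0" using s(2) a(1) by auto
    then have qpa: "q = p * a" using pq(3,4) by (simp add: field_simps)
    obtain g ls where g: "g \<in> den Ix" "set ls \<subseteq> Ix" "q = g * prod_list (map pr ls)"
      using factor[OF pq(2,3)] by blast
    define E where "E = {i \<in> L. S \<subseteq> PP L i}"
    have "E \<subseteq> set ls"
    proof
      fix i assume "i \<in> E"
      then have i: "i \<in> L" "i \<in> Ix" "s \<in> PP L i" using s(1) L unfolding E_def by auto
      then have "a \<in> mult i" using PP_iff[OF L i(1) a(2,3)] a(1) by simp
      then have "g * prod_list (map pr ls) \<in> mult i" unfolding g(3)[symmetric] qpa using mult_absorb pq(1) by blast
      then have "prod_list (map pr ls) \<in> mult i"
        using prime[OF i(2), of g "prod_list (map pr ls)"] denD(3)[OF g(1) i(2)] denD(4)[OF g(1)] prod_list_X[OF g(2)] by auto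
      then show "i \<in> set ls" using prod_list_mult[OF i(2) g(2)] by blast
    qed
    then have "finite E" by (rule finite_subset) simp
    moreover have "U = Spec (B L) - PP L ` E"
      unfolding S(2) using Spec_B[OF L] False by (auto simp: E_def)
    ultimately show ?thesis unfolding E_def by blast
  qed
next
  assume "U = {} \<or> (\<exists>E\<subseteq>L. finite E \<and> U = Spec (B L) - PP L ` E)"
  then show "zariski_open (B L) U"
  proof
    assume "U = {}"
    then show ?thesis unfolding zariski_open_def by (intro exI[of _ "{}"]) auto
  next
    assume "\<exists>E\<subseteq>L. finite E \<and> U = Spec (B L) - PP L ` E"
    then obtain E where E: "E \<subseteq> L" "finite E" "U = Spec (B L) - PP L ` E" by blast
    obtain ls where ls: "set ls = E" using finite_list[OF E(2)] by blast
    define s where "s = prod_list (map pr ls)"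
    have lsI: "set ls \<subseteq> Ix" using ls E(1) L by blast
    have sX: "s \<in> X" "s \<noteq> 0" unfolding s_def using prod_list_X[OF lsI] prod_list_nz[OF lsI] by auto
    have "s \<in> PP L i \<longleftrightarrow> i \<in> E" if i: "i \<in> L" for i
    proof -
      have iI: "i \<in> Ix" using i L by blast
      have "s \<in> PP L i \<longleftrightarrow> s \<in> mult i" using PP_iff_A[OF L i] sX by simp
      also have "\<dots> \<longleftrightarrow> i \<in> E"
      proof
        assume "s \<in> mult i"
        then show "i \<in> E" using prod_list_mult[OF iI lsI] ls unfolding s_def by blast
      next
        assume "i \<in> E"
        then have "i \<in> set ls" using ls by simp
        then have "prod_list (map pr ls) = pr i * prod_list (map pr (remove1 i ls))"
          by (induction ls) auto
        moreover have "prod_list (map pr (remove1 i ls)) \<in> X"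
          using prod_list_X[of "remove1 i ls"] lsI set_remove1_subset by fast
        ultimately show "s \<in> mult i" unfolding s_def mult_def by auto
      qed
      finally show ?thesis .
    qed
    then have "U = {\<pp> \<in> Spec (B L). \<not> {s} \<subseteq> \<pp>}"
      unfolding E(3) Spec_B[OF L] using sX(2) E(1) PP_nonzero[OF L] by auto
    moreover have "{s} \<subseteq> B L" using mem_B_A[OF L] sX(1) by simp
    ultimately show ?thesis unfolding zariski_open_def by blast
  qed
qed

text \<open>Poles are allowed at the removed points \<open>E\<close> and at the primes absent from
  \<open>L\<close>. Splitting the denominator into a part without listed primes and a list of listed
  ones prepares the coding of sections.\<close>

theorem sections_B:
  assumes L: "L \<subseteq> Ix" and E: "E \<subseteq> L"
  shows "sections (B L) (Spec (B L) - PP L ` E) =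
    {p / (h * prod_list (map pr ls)) | p h ls. p \<in> A \<and> h \<in> den Ix \<and> set ls \<subseteq> (Ix - L) \<union> E}"
proof -
  define U where "U = Spec (B L) - PP L ` E"
  have "{0} \<in> U" unfolding U_def Spec_B[OF L] using PP_nonzero[OF L] E by blast
  then have sec: "sections (B L) U = (\<Inter>\<pp>\<in>U. localization_at (B L) \<pp>)" unfolding sections_def by auto
  have "y \<in> sections (B L) U \<longleftrightarrow>
    (\<exists>p h ls. y = p / (h * prod_list (map pr ls)) \<and> p \<in> A \<and> h \<in> den Ix \<and> set ls \<subseteq> (Ix - L) \<union> E)" for y
  proof
    assume y: "y \<in> sections (B L) U"
    have reg: "p \<in> mult i" if i: "i \<in> L - E" and pq: "p \<in> A" "q \<in> X" "q \<noteq> 0" "y = p / q" "q \<in> mult i" for i p q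
    proof -
      have iI: "i \<in> Ix" "i \<in> L" using i L by auto
      have "PP L i \<in> U" unfolding U_def Spec_B[OF L] using i E PP_inj[OF L] by (auto simp: inj_on_def)
      then obtain a b where ab: "y = a / b" "a \<in> B L" "b \<in> B L" "b \<notin> PP L i"
        using y unfolding sec localization_at_def by blast
      obtain a' h1 where a: "a = a' / h1" "a' \<in> A" "h1 \<in> den L" using ab(2) unfolding B_def by blast
      obtain b' h2 where b: "b = b' / h2" "b' \<in> A" "h2 \<in> den L" using ab(3) unfolding B_def by blast
      have b'n: "b' \<notin> mult i" using PP_iff[OF L iI(2) b(2,3)] ab(4) b(1) by simp
      then have "b' \<noteq> 0" using mult_zero by auto
      then have "p * (h1 * b') = (a' * h2) * q"
        using ab(1) pq(3,4) denD(2)[OF a(3)] denD(2)[OF b(3)] unfolding a(1) b(1) by (simp add: field_simps)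
      moreover have "(a' * h2) * q \<in> mult i" using mult_absorb[OF pq(5)] a(2) denD(4)[OF b(3)] by simp
      ultimately have "p * (h1 * b') \<in> mult i" by simp
      then show ?thesis
        using prime[OF iI(1) pq(1), of "h1 * b'"] prime[OF iI(1) denD(4)[OF a(3)] b(2)] denD(3)[OF a(3) iI(2)] b'n
          denD(4)[OF a(3)] b(2) by auto
    qed
    have S: "L - E \<subseteq> Ix" using L by blast
    obtain p h ls where "p \<in> A" "h \<in> den Ix" "set ls \<subseteq> Ix - (L - E)" "y = p / (h * prod_list (map pr ls))"
      by (rule reduced_representation[OF S reg])
    then show "\<exists>p h ls. y = p / (h * prod_list (map pr ls)) \<and> p \<in> A \<and> h \<in> den Ix \<and> set ls \<subseteq> (Ix - L) \<union> E"
      by blast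
  next
    assume "\<exists>p h ls. y = p / (h * prod_list (map pr ls)) \<and> p \<in> A \<and> h \<in> den Ix \<and> set ls \<subseteq> (Ix - L) \<union> E"
    then obtain p h ls where r: "y = p / (h * prod_list (map pr ls))" "p \<in> A" "h \<in> den Ix" "set ls \<subseteq> (Ix - L) \<union> E"
      by blast
    define q where "q = h * prod_list (map pr ls)"
    have lsI: "set ls \<subseteq> Ix" using r(4) E L by blast
    have q: "q \<in> X" "q \<noteq> 0" unfolding q_def
      using denD(1,2)[OF r(3)] prod_list_X[OF lsI] prod_list_nz[OF lsI] by auto
    have "y \<in> localization_at (B L) \<pp>" if pU: "\<pp> \<in> U" for \<pp>
    proof -
      have "q \<notin> \<pp>"
      proof (cases "\<pp> = {0}")
        case True then show ?thesis using q(2) by simp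
      next
        case False
        then obtain i where i: "i \<in> L" "\<pp> = PP L i" "i \<notin> E" using pU False unfolding U_def Spec_B[OF L] by blast
        then have iI: "i \<in> Ix" using L by blast
        show ?thesis
        proof
          assume "q \<in> \<pp>"
          then have "q \<in> mult i" using PP_iff_A[OF L i(1)] q i(2) by simp
          then have "prod_list (map pr ls) \<in> mult i"
            unfolding q_def using prime[OF iI, of h "prod_list (map pr ls)"] denD(3)[OF r(3) iI] denD(4)[OF r(3)] prod_list_X[OF lsI] by auto
          then have "i \<in> set ls" using prod_list_mult[OF iI lsI] by blast
          then show False using r(4) i by blast
        qed
      qed
      then show ?thesis unfolding localization_at_def r(1) q_def[symmetric]
        using mem_B_A[OF L r(2)] mem_B_A[OF L] q(1) X_in_A by blast
    qed
    then show "y \<in> sections (B L) U" unfolding sec by blast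
  qed
  then show ?thesis unfolding U_def by blast
qed

lemma global_sections_B: assumes L: "L \<subseteq> Ix" shows "sections (B L) (Spec (B L)) = B L"
proof -
  have "sections (B L) (Spec (B L)) = {p / (h * prod_list (map pr ls)) | p h ls. p \<in> A \<and> h \<in> den Ix \<and> set ls \<subseteq> Ix - L}"
    using sections_B[OF L, of "{}"] by simp
  also have "\<dots> = B L"
  proof (intro equalityI subsetI)
    fix y assume "y \<in> {p / (h * prod_list (map pr ls)) | p h ls. p \<in> A \<and> h \<in> den Ix \<and> set ls \<subseteq> Ix - L}"
    then obtain p h ls where r: "y = p / (h * prod_list (map pr ls))" "p \<in> A" "h \<in> den Ix" "set ls \<subseteq> Ix - L" by blast
    have "h * prod_list (map pr ls) \<in> den L"
      using den_mult[OF L] den_prod_list[OF L r(4)] den_mono[OF L] r(3) by blast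
    then show "y \<in> B L" using mem_BI r by simp
  next
    fix y assume "y \<in> B L"
    then obtain p h where y: "y = p / h" "p \<in> A" "h \<in> den L" unfolding B_def by blast
    obtain g ls where g: "g \<in> den Ix" "set ls \<subseteq> Ix" "h = g * prod_list (map pr ls)"
      using factor[OF denD(1,2)[OF y(3)]] by blast
    have "l \<notin> L" if "l \<in> set ls" for l
    proof
      assume l: "l \<in> L"
      have "prod_list (map pr ls) = pr l * prod_list (map pr (remove1 l ls))"
        using that by (induction ls) auto
      moreover have "prod_list (map pr (remove1 l ls)) \<in> X"
        using prod_list_X[of "remove1 l ls"] g(2) set_remove1_subset by fast
      ultimately have "h = pr l * (g * prod_list (map pr (remove1 l ls)))" "g * prod_list (map pr (remove1 l ls)) \<in> A"
        using g(3) denD(1)[OF g(1)] by (auto simp: mult_ac)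
      then have "h \<in> mult l" unfolding mult_def by blast
      then show False using denD(3)[OF y(3) l] by blast
    qed
    then show "y \<in> {p / (h * prod_list (map pr ls)) | p h ls. p \<in> A \<and> h \<in> den Ix \<and> set ls \<subseteq> Ix - L}"
      using y g by blast
  qed
  finally show ?thesis .
qed

lemma unit_B_iff: assumes L: "L \<subseteq> Ix" and g: "g \<in> X" shows "(\<exists>t\<in>B L. g * t = 1) \<longleftrightarrow> g \<in> den L"
proof
  assume "\<exists>t\<in>B L. g * t = 1"
  then obtain t where t: "t \<in> B L" "g * t = 1" by blast
  have "g \<notin> mult i" if i: "i \<in> L" for i
  proof
    assume "g \<in> mult i"
    then obtain r where r: "g = pr i * r" "r \<in> A" unfolding mult_def by blast
    have "1 = pr i * (r * t)" using t(2) r(1) by (simp add: mult.assoc)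
    moreover have "r * t \<in> B L" using is_subringD(4)[OF B_subring[OF L]] mem_B_A[OF L r(2)] t(1) by blast
    ultimately have "1 \<in> PP L i" unfolding PP_def by blast
    then show False using PP_iff_A[OF L i, of 1] one_notin i L by auto
  qed
  then show "g \<in> den L" using g t(2) unfolding den_def by auto
next
  assume "g \<in> den L"
  then show "\<exists>t\<in>B L. g * t = 1" using den_unit[OF L] denD(2) by (intro bexI[of _ "1 / g"]) auto
qed

end

section \<open>The primes of an admissible variety\<close>

lemma comm_ring_hom_zero: "comm_ring_hom h \<Longrightarrow> h 0 = 0"
proof -
  assume "comm_ring_hom h"
  then interpret comm_ring_hom h .
  show ?thesis by (rule hom_zero)
qed

text \<open>The general identity may use foreign variables. A retraction chosen not to kill
  \<open>d\<close> moves \<open>U\<close> and \<open>d\<close> back to \<open>S\<close> and fixes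
  \<open>P\<close> and \<open>Q\<close>.\<close>

lemma monic_bezout_in:
  fixes P Q :: "'k::alg_closed_field mpoly poly"
  assumes Q: "monic_irreducible Q" "\<And>i. coeff Q i \<in> polys_in S" and P: "\<And>i. coeff P i \<in> polys_in S"
    and "\<not> Q dvd P"
  obtains U V d where "\<And>i. coeff U i \<in> polys_in S" "d \<in> polys_in S" "d \<noteq> 0" "U * P + V * Q = [:d:]"
proof -
  obtain U V d where U: "d \<noteq> 0" "U * P + V * Q = [:d:]"
    by (rule monic_irreducible_bezout[OF almost_integral_closed_mpoly Q(1) assms(4)])
  obtain \<rho> where \<rho>: "comm_ring_hom \<rho>" "\<And>p :: 'k mpoly. \<rho> p \<in> polys_in S"
    "\<And>p. p \<in> polys_in S \<Longrightarrow> \<rho> p = p" "\<rho> d \<noteq> 0" by (rule retraction[OF U(1), of S]) blast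
  have fix_PQ: "map_poly \<rho> P = P" "map_poly \<rho> Q = Q"
    by (rule poly_eqI, simp add: map_poly_hom[OF \<rho>(1)] \<rho>(3)[OF P] \<rho>(3)[OF Q(2)])+
  have "map_poly \<rho> (U * P + V * Q) = map_poly \<rho> [:d:]" by (simp only: U(2))
  moreover have "map_poly \<rho> [:d:] = [:\<rho> d:]"
    by (rule poly_eqI)
      (simp add: map_poly_hom[OF \<rho>(1)] coeff_pCons comm_ring_hom_zero[OF \<rho>(1)] split: nat.splits)
  ultimately have "map_poly \<rho> U * P + map_poly \<rho> V * Q = [:\<rho> d:]"
    by (simp only: map_poly_hom[OF \<rho>(1)] fix_PQ)
  then show ?thesis by (rule that[rotated 3]) (simp_all add: \<rho> map_poly_hom[OF \<rho>(1)])
qed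

lemma dvd_in:
  fixes P Q :: "'k::alg_closed_field mpoly poly"
  assumes "\<And>i. coeff Q i \<in> polys_in S" "\<And>i. coeff P i \<in> polys_in S" "Q dvd P"
  obtains T where "\<And>i. coeff T i \<in> polys_in S" "P = Q * T"
proof -
  obtain T where T: "P = Q * T" using assms(3) by blast
  obtain \<rho> where \<rho>: "comm_ring_hom \<rho>" "\<And>p :: 'k mpoly. \<rho> p \<in> polys_in S"
    "\<And>p. p \<in> polys_in S \<Longrightarrow> \<rho> p = p" by (rule retraction[of 1 S]) auto
  have fix_PQ: "map_poly \<rho> P = P" "map_poly \<rho> Q = Q"
    by (rule poly_eqI, simp add: map_poly_hom[OF \<rho>(1)] \<rho>(3)[OF assms(1)] \<rho>(3)[OF assms(2)])+
  have "map_poly \<rho> P = map_poly \<rho> (Q * T)" by (simp only: T)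
  then have "P = Q * map_poly \<rho> T" by (simp only: map_poly_hom[OF \<rho>(1)] fix_PQ)
  then show ?thesis by (rule that[rotated]) (simp add: \<rho> map_poly_hom[OF \<rho>(1)])
qed

lemma monic_remainder_in:
  fixes P Q :: "'k::alg_closed_field mpoly poly"
  assumes "lead_coeff Q = 1" "degree Q > 0" "\<And>i. coeff Q i \<in> polys_in S" "\<And>i. coeff P i \<in> polys_in S"
  obtains T R where "\<And>i. coeff T i \<in> polys_in S" "\<And>i. coeff R i \<in> polys_in S" "degree R < degree Q" "P = Q * T + R"
proof -
  obtain T R where TR: "pseudo_divmod P Q = (T, R)" by (cases "pseudo_divmod P Q")
  have Q0: "Q \<noteq> 0" using assms(1) by auto
  have PR: "P = Q * T + R" "R = 0 \<or> degree R < degree Q" using pseudo_divmod[OF Q0 TR] assms(1) by auto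
  obtain \<rho> where \<rho>: "comm_ring_hom \<rho>" "\<And>p :: 'k mpoly. \<rho> p \<in> polys_in S"
    "\<And>p. p \<in> polys_in S \<Longrightarrow> \<rho> p = p" by (rule retraction[of 1 S]) auto
  have fix_PQ: "map_poly \<rho> P = P" "map_poly \<rho> Q = Q"
    by (rule poly_eqI, simp add: map_poly_hom[OF \<rho>(1)] \<rho>(3)[OF assms(3)] \<rho>(3)[OF assms(4)])+
  have "map_poly \<rho> P = map_poly \<rho> (Q * T + R)" by (simp only: PR(1))
  then have "P = Q * map_poly \<rho> T + map_poly \<rho> R" by (simp only: map_poly_hom[OF \<rho>(1)] fix_PQ)
  moreover have "degree (map_poly \<rho> R) < degree Q"
    using PR(2) degree_map_poly_le[of \<rho> R] assms(2) by auto
  ultimately show ?thesis by (intro that[of "map_poly \<rho> T" "map_poly \<rho> R"]) (simp_all add: \<rho> map_poly_hom[OF \<rho>(1)])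
qed

lemma map_poly_msubst_remainder:
  fixes P :: "'k::field mpoly poly"
  assumes "\<And>i. coeff P i \<in> polys_in S" "j \<in> S"
  obtains P' where "\<And>i. coeff P' i \<in> polys_in S" "P = map_poly (msubst j c) P + smult (Var j - Const c) P'"
proof -
  have "\<exists>q\<in>polys_in S. coeff P i = msubst j c (coeff P i) + (Var j - Const c) * q" for i
    using msubst_remainder[OF assms(1)[of i] assms(2)] by metis
  then obtain q where q: "\<And>i. q i \<in> polys_in S" "\<And>i. coeff P i = msubst j c (coeff P i) + (Var j - Const c) * q i"
    by metis
  define P' where "P' = (\<Sum>i\<le>degree P. monom (q i) i)"
  have co: "coeff P' i = (if i \<le> degree P then q i else 0)" for i by (simp add: P'_def coeff_sum)
  have "P = map_poly (msubst j c) P + smult (Var j - Const c) P'"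
  proof (rule poly_eqI)
    fix i
    have "coeff (map_poly (msubst j c) P + smult (Var j - Const c) P') i =
        msubst j c (coeff P i) + (Var j - Const c) * (if i \<le> degree P then q i else 0)"
      by (simp add: map_poly_hom[OF msubst_hom] co)
    also have "\<dots> = coeff P i"
    proof (cases "i \<le> degree P")
      case True
      then show ?thesis using q(2)[of i] by simp
    next
      case False
      then have "coeff P i = 0" by (simp add: coeff_eq_0)
      moreover have "msubst j c 0 = 0" by (simp add: msubst_def)
      ultimately show ?thesis using False by simp
    qed
    finally show "coeff P i = coeff (map_poly (msubst j c) P + smult (Var j - Const c) P') i" ..
  qed
  then show ?thesis by (rule that[rotated]) (use q(1) in \<open>simp add: co\<close>)
qed

lemma Const_inj: "Const c = Const d \<Longrightarrow> c = d"
  by (metis meval_Const)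

lemma msubst_simps:
  "msubst j c 0 = 0" "msubst j c 1 = 1" "msubst j c (p + q) = msubst j c p + msubst j c q"
  "msubst j c (p * q) = msubst j c p * msubst j c q" "msubst j c (p - q) = msubst j c p - msubst j c q"
proof -
  interpret comm_ring_hom "msubst j c" by (rule msubst_hom)
  show "msubst j c 0 = 0" "msubst j c 1 = 1" "msubst j c (p + q) = msubst j c p + msubst j c q"
    "msubst j c (p * q) = msubst j c p * msubst j c q" "msubst j c (p - q) = msubst j c p - msubst j c q"
    by (simp_all add: hom_add hom_mult hom_minus)
qed

lemma msubst_linear_eq_0:
  "msubst j c (Var i - Const d) = 0 \<longleftrightarrow> i = j \<and> c = d"
proof
  assume 0: "msubst j c (Var i - Const d) = 0"
  show "i = j \<and> c = d"
  proof (cases "i = j")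
    case True
    then show ?thesis using 0 by (auto simp: msubst_simps msubst_Var intro: Const_inj)
  next
    case False
    then have "Var i = (Const d :: 'a mpoly)" using 0 by (simp add: msubst_simps msubst_Var)
    then have "meval (\<lambda>_. d + 1) (Var i :: 'a mpoly) = meval (\<lambda>_. d + 1) (Const d)" by simp
    then show ?thesis by simp
  qed
qed (simp add: msubst_simps msubst_Var)

lemma linear_nz: "Var i - Const d \<noteq> 0"
  using msubst_linear_eq_0[of i "d + 1" i d] by (auto simp: msubst_simps)

text \<open>The leading monomial of \<open>x_j - c\<close> is \<open>x_j\<close>, so each linear
  factor split off lowers the total degree of the leading monomial by one.\<close>

lemma factor_linear:
  fixes q :: "'k::field mpoly"
  assumes "q \<in> polys_in {1..n}" "q \<noteq> 0"
  shows "\<exists>h\<in>polys_in {1..n}. \<exists>ls. h \<noteq> 0 \<and> (\<forall>j\<in>{1..n}. \<forall>c. msubst j c h \<noteq> 0) \<and> set ls \<subseteq> {1..n} \<times> UNIV \<and>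
    q = h * prod_list (map (\<lambda>(j, c). Var j - Const c) ls)"
  using assms
proof (induction "\<Sum>i\<in>{1..n}. mlookup (lmon q) i" arbitrary: q rule: less_induct)
  case less
  show ?case
  proof (cases "\<forall>j\<in>{1..n}. \<forall>c. msubst j c q \<noteq> 0")
    case True
    then show ?thesis using less.prems by (intro bexI[of _ q] exI[of _ "[]"]) auto
  next
    case False
    then obtain j c where j: "j \<in> {1..n}" "msubst j c q = 0" by blast
    obtain q' where q': "q' \<in> polys_in {1..n}" "q = (Var j - Const c) * q'"
      using msubst_remainder[OF less.prems(1) j(1), of c] j(2) by auto
    have q'0: "q' \<noteq> 0" using q'(2) less.prems(2) by auto
    have lin: "lmon (Var j - Const c :: 'k mpoly) = msingle j 1"
    proof -
      have "lmon (Var j - Const c :: 'k mpoly) \<in> mkeys (Var j - Const c)" by (rule lmon_in[OF linear_nz])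
      then have 1: "lmon (Var j - Const c :: 'k mpoly) = msingle j 1 \<or> lmon (Var j - Const c :: 'k mpoly) = 0"
        by (auto simp: in_keys_iff lookup_minus Var_def Const_def lookup_single when_def split: if_splits)
      have "msingle j (1::nat) \<noteq> 0" by (metis lookup_single_eq lookup_zero zero_neq_one)
      then have "msingle j 1 \<in> mkeys (Var j - Const c :: 'k mpoly)"
        by (auto simp: in_keys_iff lookup_minus Var_def Const_def lookup_single when_def)
      then have "msingle j 1 \<le> lmon (Var j - Const c :: 'k mpoly)" by (rule lmon_ge)
      moreover have "\<not> msingle j (1::nat) < 0"
        by (auto simp: less_poly_mapping.rep_eq less_fun_def)
      ultimately show ?thesis using 1 \<open>msingle j (1::nat) \<noteq> 0\<close> by (auto simp: le_less)
    qed
    have "lmon q = msingle j 1 + lmon q'" using lmon_mult(1)[OF linear_nz q'0] by (simp add: q'(2) lin)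
    then have "(\<Sum>i\<in>{1..n}. mlookup (lmon q) i) = (\<Sum>i\<in>{1..n}. mlookup (msingle j (1::nat)) i) + (\<Sum>i\<in>{1..n}. mlookup (lmon q') i)"
      by (simp add: lookup_add sum.distrib)
    also have "(\<Sum>i\<in>{1..n}. mlookup (msingle j (1::nat)) i) = 1"
      using j(1) by (simp add: lookup_single when_def)
    finally have "(\<Sum>i\<in>{1..n}. mlookup (lmon q') i) < (\<Sum>i\<in>{1..n}. mlookup (lmon q) i)" by simp
    from less.hyps[OF this q'(1) q'0] obtain h ls where h: "h \<in> polys_in {1..n}" "h \<noteq> 0"
      "\<forall>j\<in>{1..n}. \<forall>c. msubst j c h \<noteq> 0" "set ls \<subseteq> {1..n} \<times> UNIV"
      "q' = h * prod_list (map (\<lambda>(j, c). Var j - Const c) ls)" by blast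
    show ?thesis
      using h j by (intro bexI[of _ h] exI[of _ "(j, c) # ls"]) (auto simp: q'(2) h(5) mult_ac)
  qed
qed

locale variety =
  fixes n :: nat and Fp :: "'k::alg_closed_field mpoly poly" and \<Psi> :: "'k mpoly \<Rightarrow> 'f::field"
  assumes n: "n \<ge> 1" and coef: "\<And>i. coeff Fp i \<in> polys_in {1..n}"
    and irr: "monic_irreducible Fp"
    and irr_sub: "\<And>j c. j \<in> {1..n} \<Longrightarrow> monic_irreducible (map_poly (msubst j c) Fp)"
    and hom: "comm_ring_hom \<Psi>"
    and ker: "\<And>p. p \<in> polys_in {0..n} \<Longrightarrow> \<Psi> p = 0 \<longleftrightarrow> (\<forall>a\<in>zero_set n (poly Fp (Var 0)). meval a p = 0)"
    and quot: "\<And>y. \<exists>p\<in>polys_in {0..n}. \<exists>q\<in>polys_in {0..n}. \<Psi> q \<noteq> 0 \<and> y = \<Psi> p / \<Psi> q"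
begin

sublocale \<Psi>: comm_ring_hom \<Psi> by (rule hom)

definition ev :: "'k mpoly poly \<Rightarrow> 'f" where "ev P = \<Psi> (poly P (Var 0))"

lemma ev_simps: "ev (P + Q) = ev P + ev Q" "ev (P * Q) = ev P * ev Q" "ev (P - Q) = ev P - ev Q"
  "ev (smult a P) = \<Psi> a * ev P" "ev [:a:] = \<Psi> a"
  by (simp_all add: ev_def \<Psi>.hom_add \<Psi>.hom_mult \<Psi>.hom_minus)

lemma insert_vars: "{0..n} = insert 0 {1..n}" by auto

lemma X_sub_XZ: "p \<in> polys_in {1..n} \<Longrightarrow> p \<in> polys_in {0..n}"
  using polys_in_mono[of "{1..n}" "{0..n}"] by auto

lemma poly_in_XZ: "(\<And>i. coeff P i \<in> polys_in {1..n}) \<Longrightarrow> poly P (Var 0) \<in> polys_in {0..n}"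
  by (rule poly_Var_in) auto

lemma decompose:
  assumes "p \<in> polys_in {0..n}"
  obtains P where "\<And>i. coeff P i \<in> polys_in {1..n}" "\<Psi> p = ev P"
  using polys_in_decompose[of p 0 "{1..n}"] assms unfolding insert_vars ev_def by metis

lemma ev_mem: "(\<And>i. coeff P i \<in> polys_in {1..n}) \<Longrightarrow> ev P \<in> \<Psi> ` polys_in {0..n}"
  unfolding ev_def using poly_in_XZ by blast

lemma monic_Fp: "lead_coeff Fp = 1" "degree Fp > 0"
  using irr by (auto simp: monic_irreducible_def)

text \<open>Every point of affine \<open>n\<close>-space lifts to the hypersurface, so a polynomial
  in the \<open>x_j\<close> alone that vanishes on the hypersurface vanishes everywhere.\<close>

lemma inj_X: assumes p: "p \<in> polys_in {1..n}" and 0: "\<Psi> p = 0" shows "p = 0"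
proof (rule ccontr)
  assume "p \<noteq> 0"
  then obtain a where a: "meval a p \<noteq> 0" using nonvanishing by blast
  obtain t where t: "meval (a(0 := t)) (poly Fp (Var 0)) = 0"
    by (rule monic_Var_root[OF monic_Fp coef, of 0 a]) auto
  define b where "b = restrict (a(0 := t)) {0..n}"
  have "meval b (poly Fp (Var 0)) = meval (a(0 := t)) (poly Fp (Var 0))"
    by (rule meval_cong[OF poly_in_XZ[OF coef]]) (simp add: b_def)
  then have "b \<in> zero_set n (poly Fp (Var 0))" by (simp add: zero_set_def t) (simp add: b_def)
  then have "meval b p = 0" using ker[OF X_sub_XZ[OF p]] 0 by blast
  moreover have "meval b p = meval a p" by (rule meval_cong[OF p]) (auto simp: b_def)
  ultimately show False using a by simp
qed

lemma ev_Fp: "ev Fp = 0"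
  unfolding ev_def using ker[OF poly_in_XZ[OF coef]] by (simp add: zero_set_def)

text \<open>Does the work of the Nullstellensatz: if \<open>Fp\<close> did not divide
  \<open>P\<close>, a Bezout identity would put a nonzero polynomial in the \<open>x_j\<close> alone
  into the kernel.\<close>

lemma ev_eq_0_iff:
  assumes P: "\<And>i. coeff P i \<in> polys_in {1..n}" shows "ev P = 0 \<longleftrightarrow> Fp dvd P"
proof
  assume 0: "ev P = 0"
  show "Fp dvd P"
  proof (rule ccontr)
    assume "\<not> Fp dvd P"
    then obtain U V d where "d \<in> polys_in {1..n}" "d \<noteq> 0" "U * P + V * Fp = [:d:]"
      by (rule monic_bezout_in[OF irr coef P])
    then have "\<Psi> d = ev U * ev P + ev V * ev Fp" by (metis ev_simps(1,2,5))
    then show False using 0 ev_Fp inj_X[OF \<open>d \<in> _\<close>] \<open>d \<noteq> 0\<close> by simp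
  qed
next
  assume "Fp dvd P"
  then show "ev P = 0" using ev_Fp by (auto simp: ev_simps elim!: dvdE)
qed

text \<open>The Bezout identity inverts \<open>ev Q\<close> up to a denominator in which
  \<open>z\<close> does not occur.\<close>

lemma frac: "\<exists>p\<in>\<Psi> ` polys_in {0..n}. \<exists>q\<in>\<Psi> ` polys_in {1..n}. q \<noteq> 0 \<and> y = p / q"
proof -
  obtain p q where pq: "p \<in> polys_in {0..n}" "q \<in> polys_in {0..n}" "\<Psi> q \<noteq> 0" "y = \<Psi> p / \<Psi> q" using quot by blast
  obtain P where P: "\<And>i. coeff P i \<in> polys_in {1..n}" "\<Psi> p = ev P" using decompose[OF pq(1)] by blast
  obtain Q where Q: "\<And>i. coeff Q i \<in> polys_in {1..n}" "\<Psi> q = ev Q" using decompose[OF pq(2)] by blast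
  have "\<not> Fp dvd Q" using ev_eq_0_iff[OF Q(1)] Q(2) pq(3) by simp
  then obtain U V d where U: "\<And>i. coeff U i \<in> polys_in {1..n}" "d \<in> polys_in {1..n}" "d \<noteq> 0" "U * Q + V * Fp = [:d:]"
    by (rule monic_bezout_in[OF irr coef Q(1)]) blast
  have "ev U * ev Q + ev V * ev Fp = \<Psi> d" using U(4) by (metis ev_simps(1,2,5))
  then have UQ: "ev U * ev Q = \<Psi> d" using ev_Fp by simp
  have d0: "\<Psi> d \<noteq> 0" using inj_X[OF U(2)] U(3) by blast
  then have "ev U \<noteq> 0" using UQ by auto
  then have "y = ev (P * U) / \<Psi> d" using pq(3,4) P(2) Q(2) by (simp add: UQ[symmetric] ev_simps mult.commute)
  moreover have "ev (P * U) \<in> \<Psi> ` polys_in {0..n}"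
    by (rule ev_mem) (unfold coeff_mult, intro sum_in mult_in P(1) U(1))
  ultimately show ?thesis using d0 U(2) by blast
qed

definition lin :: "nat \<times> 'k \<Rightarrow> 'f" where "lin i = \<Psi> (Var (fst i) - Const (snd i))"

text \<open>Modulo \<open>x_j - c\<close> the coordinate ring becomes that of the slice
  \<open>x_j = c\<close>, which is defined by the specialized polynomial.\<close>

lemma multiple_iff:
  assumes P: "\<And>i. coeff P i \<in> polys_in {1..n}" and j: "j \<in> {1..n}"
  shows "ev P \<in> (*) (lin (j, c)) ` \<Psi> ` polys_in {0..n} \<longleftrightarrow> map_poly (msubst j c) Fp dvd map_poly (msubst j c) P"
proof
  let ?d = "Var j - Const c :: 'k mpoly"
  assume "ev P \<in> (*) (lin (j, c)) ` \<Psi> ` polys_in {0..n}"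
  then obtain r where r: "r \<in> polys_in {0..n}" "ev P = \<Psi> ?d * \<Psi> r" unfolding lin_def by auto
  obtain R where R: "\<And>i. coeff R i \<in> polys_in {1..n}" "\<Psi> r = ev R" using decompose[OF r(1)] by blast
  have "ev (P - smult ?d R) = 0" by (simp add: ev_simps r(2) R(2))
  then have "Fp dvd P - smult ?d R" by (subst (asm) ev_eq_0_iff) (use P R j in auto)
  then have "map_poly (msubst j c) Fp dvd map_poly (msubst j c) (P - smult ?d R)"
    by (auto simp: map_poly_hom(2)[OF msubst_hom] elim!: dvdE)
  moreover have "map_poly (msubst j c) (smult ?d R) = 0"
    by (rule poly_eqI) (simp add: map_poly_hom(4)[OF msubst_hom] msubst_simps msubst_Var)
  ultimately show "map_poly (msubst j c) Fp dvd map_poly (msubst j c) P"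
    by (simp add: map_poly_hom(3)[OF msubst_hom])
next
  let ?d = "Var j - Const c :: 'k mpoly"
  assume dvd: "map_poly (msubst j c) Fp dvd map_poly (msubst j c) P"
  have sub_in: "coeff (map_poly (msubst j c) Q) i \<in> polys_in ({1..n} - {j})"
    if "\<And>i. coeff Q i \<in> polys_in {1..n}" for Q i
    by (simp only: map_poly_hom(4)[OF msubst_hom] msubst_in[OF that])
  obtain T where T: "\<And>i. coeff T i \<in> polys_in ({1..n} - {j})" "map_poly (msubst j c) P = map_poly (msubst j c) Fp * T"
    using dvd_in[OF sub_in[OF coef] sub_in[OF P] dvd] by blast
  have TX: "coeff T i \<in> polys_in {1..n}" for i using T(1) polys_in_mono[of "{1..n} - {j}" "{1..n}"] by blast
  obtain P' where P': "\<And>i. coeff P' i \<in> polys_in {1..n}" "P = map_poly (msubst j c) P + smult ?d P'"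
    by (rule map_poly_msubst_remainder[OF P j, of c]) blast
  obtain F' where F': "\<And>i. coeff F' i \<in> polys_in {1..n}" "Fp = map_poly (msubst j c) Fp + smult ?d F'"
    by (rule map_poly_msubst_remainder[OF coef j, of c]) blast
  have "ev (map_poly (msubst j c) Fp) + \<Psi> ?d * ev F' = 0"
    using arg_cong[OF F'(2), of ev] ev_Fp by (simp add: ev_simps)
  \<comment> \<open>Because \<open>Fp\<close> vanishes in the function field, its specialization is
    there a multiple of \<open>x_j - c\<close>.\<close>
  then have Fc: "ev (map_poly (msubst j c) Fp) = - (\<Psi> ?d * ev F')" by (simp add: eq_neg_iff_add_eq_0)
  have "ev P = ev (map_poly (msubst j c) P) + \<Psi> ?d * ev P'"
    using arg_cong[OF P'(2), of ev] by (simp add: ev_simps)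
  also have "\<dots> = \<Psi> ?d * ev (P' - F' * T)"
    by (simp add: T(2) ev_simps Fc algebra_simps)
  finally have "ev P = lin (j, c) * ev (P' - F' * T)" by (simp add: lin_def)
  moreover have "ev (P' - F' * T) \<in> \<Psi> ` polys_in {0..n}"
    by (rule ev_mem) (unfold coeff_diff coeff_mult, intro minus_in sum_in mult_in P'(1) F'(1) TX)
  ultimately show "ev P \<in> (*) (lin (j, c)) ` \<Psi> ` polys_in {0..n}" by blast
qed

text \<open>A polynomial without \<open>z\<close> is divisible by one of positive degree in
  \<open>z\<close> only if it is zero.\<close>

lemma multiple_X_iff:
  assumes g: "g \<in> polys_in {1..n}" and j: "j \<in> {1..n}"
  shows "\<Psi> g \<in> (*) (lin (j, c)) ` \<Psi> ` polys_in {0..n} \<longleftrightarrow> msubst j c g = 0"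
proof -
  have co: "coeff [:g:] i \<in> polys_in {1..n}" for i using g by (auto simp: coeff_pCons split: nat.splits)
  have deg: "degree (map_poly (msubst j c) Fp) > 0" using irr_sub[OF j] by (simp add: monic_irreducible_def)
  have m: "map_poly (msubst j c) [:g:] = [:msubst j c g:]"
    by (rule poly_eqI) (auto simp: map_poly_hom(4)[OF msubst_hom] msubst_simps coeff_pCons split: nat.splits)
  have "\<Psi> g \<in> (*) (lin (j, c)) ` \<Psi> ` polys_in {0..n} \<longleftrightarrow> map_poly (msubst j c) Fp dvd [:msubst j c g:]"
    using multiple_iff[OF co j, of c] by (simp only: ev_simps m)
  also have "\<dots> \<longleftrightarrow> msubst j c g = 0"
    using deg dvd_imp_degree_le[of "map_poly (msubst j c) Fp" "[:msubst j c g:]"] by auto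
  finally show ?thesis .
qed

lemma lin_X: "i \<in> {1..n} \<times> UNIV \<Longrightarrow> Var (fst i) - Const (snd i) \<in> polys_in {1..n}"
  by auto

lemma char_poly_coeffs:
  assumes S: "is_subring S" and M: "M \<in> carrier_mat m m" "\<And>i j. i < m \<Longrightarrow> j < m \<Longrightarrow> M $$ (i, j) \<in> S"
  shows "coeff (char_poly M) k \<in> (S :: 'f set)"
proof -
  define T where "T = {p :: 'f poly. \<forall>k. coeff p k \<in> S}"
  have T: "is_subring T" unfolding is_subring_def T_def
    using is_subringD[OF S] by (auto simp: coeff_mult intro!: is_subring_sum[OF S])
  have C: "char_poly_matrix M \<in> carrier_mat m m" using M(1) by simp
  have ent: "char_poly_matrix M $$ (i, j) \<in> T" if "i < m" "j < m" for i j
    using M that is_subringD[OF S] by (auto simp: char_poly_matrix_def T_def coeff_pCons split: nat.splits)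
  have sg: "signof p \<in> T" for p :: "nat \<Rightarrow> nat"
    using is_subringD(2,5)[OF T] by (cases p rule: sign_cases) auto
  have "det (char_poly_matrix M) \<in> T"
    unfolding det_def'[OF C]
    by (intro is_subring_sum[OF T] is_subringD(4)[OF T] is_subring_prod[OF T] sg ent)
      (auto simp: permutes_def intro: permutes_in_image[THEN iffD2])
  then show ?thesis by (simp add: char_poly_def T_def)
qed

lemma is_subring_image: "is_subring (\<Psi> ` polys_in S)"
  unfolding is_subring_def
proof (intro conjI ballI)
  show "0 \<in> \<Psi> ` polys_in S" "1 \<in> \<Psi> ` polys_in S" by (metis \<Psi>.hom_zero image_eqI zero_in) (metis \<Psi>.hom_one image_eqI one_in)
qed (auto simp flip: \<Psi>.hom_add \<Psi>.hom_mult \<Psi>.hom_uminus)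

text \<open>The determinant trick: remainders modulo the monic \<open>Fp\<close> express
  multiplication by \<open>p\<close> on the powers of \<open>z\<close> as a matrix over
  \<open>X\<close>. The vector of these powers is an eigenvector for \<open>p\<close>, so
  \<open>p\<close> is a root of the characteristic polynomial.\<close>

lemma integral: "\<Psi> ` polys_in {0..n} \<subseteq> integral_closure (\<Psi> ` polys_in {1..n})"
proof
  fix p assume "p \<in> \<Psi> ` polys_in {0..n}"
  then obtain P where P: "\<And>i. coeff P i \<in> polys_in {1..n}" "p = ev P" using decompose by blast
  define m where "m = degree Fp"
  define \<zeta> where "\<zeta> = \<Psi> (Var 0)"
  have "\<exists>x. (\<forall>j. x j \<in> \<Psi> ` polys_in {1..n}) \<and> p * \<zeta> ^ i = (\<Sum>j<m. x j * \<zeta> ^ j)" for i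
  proof -
    have co: "coeff (P * monom 1 i) k \<in> polys_in {1..n}" for k
      unfolding coeff_mult by (intro sum_in mult_in P(1)) (simp add: Var_in)
    obtain T R where R: "\<And>k. coeff R k \<in> polys_in {1..n}" "degree R < degree Fp" "P * monom 1 i = Fp * T + R"
      using monic_remainder_in[OF monic_Fp coef co] by metis
    have "p * \<zeta> ^ i = ev (P * monom 1 i)" by (simp add: ev_def P(2) poly_monom \<Psi>.hom_mult \<Psi>.hom_power \<zeta>_def)
    also have "\<dots> = ev R" by (simp add: R(3) ev_simps ev_Fp)
    also have "\<dots> = (\<Sum>j\<le>degree R. \<Psi> (coeff R j) * \<zeta> ^ j)"
      by (simp add: ev_def poly_altdef \<Psi>.hom_sum \<Psi>.hom_mult \<Psi>.hom_power \<zeta>_def)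
    also have "\<dots> = (\<Sum>j<m. \<Psi> (coeff R j) * \<zeta> ^ j)"
      by (rule sum.mono_neutral_left) (use R(2) in \<open>auto simp: m_def coeff_eq_0\<close>)
    finally show ?thesis using R(1) by (intro exI[of _ "\<lambda>j. \<Psi> (coeff R j)"]) auto
  qed
  then obtain x where x: "\<And>i j. x i j \<in> \<Psi> ` polys_in {1..n}" "\<And>i. p * \<zeta> ^ i = (\<Sum>j<m. x i j * \<zeta> ^ j)" by metis
  define M where "M = mat m m (\<lambda>(i, j). x i j)"
  define v where "v = vec m (\<lambda>j. \<zeta> ^ j)"
  have M: "M \<in> carrier_mat m m" by (simp add: M_def)
  have m: "m > 0" using monic_Fp by (simp add: m_def)
  have "eigenvector M v p"
    unfolding eigenvector_def
  proof (intro conjI)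
    show "v \<in> carrier_vec (dim_row M)" by (simp add: v_def M_def)
    have "v $ 0 = 1" using m by (simp add: v_def)
    then show "v \<noteq> 0\<^sub>v (dim_row M)" using m by (auto simp: M_def)
    show "M *\<^sub>v v = p \<cdot>\<^sub>v v"
      by (rule eq_vecI) (auto simp: M_def v_def scalar_prod_def x(2) atLeast0LessThan)
  qed
  then have root: "poly (char_poly M) p = 0"
    using eigenvalue_root_char_poly[OF M] unfolding eigenvalue_def by blast
  have "coeff (char_poly M) k \<in> \<Psi> ` polys_in {1..n}" for k
    by (rule char_poly_coeffs[OF is_subring_image M]) (simp add: M_def x(1) del: One_nat_def)
  moreover have "lead_coeff (char_poly M) = 1" using degree_monic_char_poly[OF M] by simp
  ultimately show "p \<in> integral_closure (\<Psi> ` polys_in {1..n})"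
    unfolding integral_closure_def using root by blast
qed

text \<open>Bezout in the slice \<open>x_j = c\<close> gives a nonzero \<open>N\<close> free of
  \<open>x_j\<close> that is congruent to a multiple of \<open>p\<close>. It may still have linear
  divisors in other variables and has to be corrected.\<close>

lemma maximal_aux:
  assumes i: "i \<in> {1..n} \<times> UNIV" and p: "p \<in> \<Psi> ` polys_in {0..n}" and np: "p \<notin> (*) (lin i) ` \<Psi> ` polys_in {0..n}"
  obtains u h where "u \<in> \<Psi> ` polys_in {0..n}" "h \<in> polys_in {1..n}" "h \<noteq> 0" "\<And>j c. j \<in> {1..n} \<Longrightarrow> msubst j c h \<noteq> 0"
    "p * u - \<Psi> h \<in> (*) (lin i) ` \<Psi> ` polys_in {0..n}"
proof -
  obtain j c where ij: "i = (j, c)" "j \<in> {1..n}" using i by auto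
  let ?M = "(*) (lin i) ` \<Psi> ` polys_in {0..n}"
  let ?d = "Var j - Const c :: 'k mpoly"
  obtain P where P: "\<And>i. coeff P i \<in> polys_in {1..n}" "p = ev P" using p decompose by blast
  have sub_in: "coeff (map_poly (msubst j c) Q) k \<in> polys_in ({1..n} - {j})" if "\<And>i. coeff Q i \<in> polys_in {1..n}" for Q k
    using msubst_in[OF that] by (simp add: map_poly_hom(4)[OF msubst_hom])
  have "\<not> map_poly (msubst j c) Fp dvd map_poly (msubst j c) P"
    using np multiple_iff[OF P(1) ij(2), of c] by (simp add: ij(1) P(2))
  then obtain U V N where U: "\<And>k. coeff U k \<in> polys_in ({1..n} - {j})" "N \<in> polys_in ({1..n} - {j})" "N \<noteq> 0"
    "U * map_poly (msubst j c) P + V * map_poly (msubst j c) Fp = [:N:]"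
    by (rule monic_bezout_in[OF irr_sub[OF ij(2)] sub_in[OF coef] sub_in[OF P(1)]]) blast
  have sub: "q \<in> polys_in {1..n}" if "q \<in> polys_in ({1..n} - {j})" for q :: "'k mpoly"
    using that polys_in_mono[of "{1..n} - {j}" "{1..n}"] by blast
  have Uid: "map_poly (msubst j c) U = U"
    by (rule poly_eqI) (simp add: map_poly_hom(4)[OF msubst_hom] msubst_id[OF U(1)])
  have Nid: "map_poly (msubst j c) [:N:] = [:N:]"
    by (rule poly_eqI) (auto simp: map_poly_hom(4)[OF msubst_hom] msubst_simps msubst_id[OF U(2)] coeff_pCons split: nat.splits)
  have "map_poly (msubst j c) (P * U - [:N:]) = map_poly (msubst j c) Fp * (- V)"
    unfolding map_poly_hom(2,3)[OF msubst_hom] Uid Nid using U(4) by (simp add: algebra_simps)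
  then have "map_poly (msubst j c) Fp dvd map_poly (msubst j c) (P * U - [:N:])" by simp
  moreover have "coeff (P * U - [:N:]) k \<in> polys_in {1..n}" for k
    unfolding coeff_diff coeff_mult
    by (intro minus_in sum_in mult_in P(1) sub[OF U(1)])
      (use sub[OF U(2)] in \<open>auto simp: coeff_pCons split: nat.splits\<close>)
  ultimately have "ev (P * U - [:N:]) \<in> ?M" using multiple_iff[of "P * U - [:N:]" j c] ij by simp
  then have pu: "p * ev U - \<Psi> N \<in> ?M" by (simp add: ev_simps P(2))
  have uA: "ev U \<in> \<Psi> ` polys_in {0..n}" by (rule ev_mem) (rule sub[OF U(1)])
  show ?thesis
  proof (cases "\<exists>a. N = Const a")
    case True
    then obtain a where a: "N = Const a" by blast
    show ?thesis by (rule that[OF uA _ U(3) _ pu]) (use U(3) in \<open>auto simp: a\<close>)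
  next
    case False
    \<comment> \<open>Adding the prime itself does not change the class. The sum survives all
      substitutions: for \<open>x_j\<close> because \<open>N\<close> is not constant, for the other
      variables because \<open>x_j\<close> still occurs.\<close>
    define h where "h = N + ?d"
    have nz: "msubst l b h \<noteq> 0" if l: "l \<in> {1..n}" for l b
    proof (cases "l = j")
      case True
      have "msubst l b h = N + (Const b - Const c)"
        unfolding h_def True msubst_simps by (simp add: msubst_Var msubst_id[OF U(2)])
      moreover have "Const b - Const c = (Const (b - c) :: 'k mpoly)" by (simp add: Const_def single_diff)
      moreover have "- Const (b - c) = (Const (c - b) :: 'k mpoly)" by (simp add: Const_def single_uminus[symmetric])
      ultimately show ?thesis using False by (metis add_eq_0_iff2)
    next
      case F: False
      define N' where "N' = msubst l b N"
      have N': "N' \<in> polys_in ({1..n} - {j} - {l})" unfolding N'_def by (rule msubst_in[OF U(2)])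
      have N'id: "msubst j e N' = N'" for e by (rule msubst_id[OF N']) simp
      show ?thesis
      proof
        assume "msubst l b h = 0"
        then have "N' + (Var j - Const c) = 0" using F by (simp add: h_def msubst_simps msubst_Var N'_def)
        then have "msubst j e (N' + (Var j - Const c)) = 0" for e by (simp add: msubst_simps)
        then have "N' + (Const e - Const c) = 0" for e by (simp add: msubst_simps msubst_Var N'id)
        from this[of 0] this[of 1] have "(Const 0 :: 'k mpoly) = Const 1" by (simp add: add_eq_0_iff2)
        then show False using Const_inj by fastforce
      qed
    qed
    have "h \<noteq> 0" using nz[OF ij(2), of 0] by (auto simp: msubst_simps)
    moreover have "h \<in> polys_in {1..n}" unfolding h_def using sub[OF U(2)] ij(2) by auto
    moreover have "p * ev U - \<Psi> h \<in> ?M"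
    proof -
      obtain r where r: "r \<in> polys_in {0..n}" "p * ev U - \<Psi> N = lin i * \<Psi> r" using pu by blast
      have "p * ev U - \<Psi> h = lin i * \<Psi> (r - 1)"
        using r(2) by (simp add: h_def \<Psi>.hom_add \<Psi>.hom_minus lin_def ij(1) algebra_simps)
      moreover have "r - 1 \<in> polys_in {0..n}" using r(1) by auto
      ultimately show ?thesis by blast
    qed
    ultimately show ?thesis using that[OF uA] nz by blast
  qed
qed

sublocale P: prime_family "\<Psi> ` polys_in {0..n}" "\<Psi> ` polys_in {1..n}" lin "{1..n} \<times> UNIV"
  "\<lambda>i. (*) (lin i) ` \<Psi> ` polys_in {0..n}"
  "\<lambda>L. {h \<in> \<Psi> ` polys_in {1..n}. h \<noteq> 0 \<and> (\<forall>i\<in>L. h \<notin> (*) (lin i) ` \<Psi> ` polys_in {0..n})}"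
proof (unfold_locales)
  let ?A = "\<Psi> ` polys_in {0..n}" and ?X = "\<Psi> ` polys_in {1..n}"
  let ?M = "\<lambda>i. (*) (lin i) ` \<Psi> ` polys_in {0..n}"
  have den: "\<Psi> h \<in> {h \<in> ?X. h \<noteq> 0 \<and> (\<forall>i\<in>{1..n} \<times> UNIV. h \<notin> ?M i)}"
    if "h \<in> polys_in {1..n}" "h \<noteq> 0" "\<And>j c. j \<in> {1..n} \<Longrightarrow> msubst j c h \<noteq> 0" for h
    using that inj_X[OF that(1)] multiple_X_iff[OF that(1)] by auto
  show "is_subring ?A" "is_subring ?X" by (rule is_subring_image)+
  show "?X \<subseteq> ?A" using X_sub_XZ by blast
  show "\<exists>p\<in>?A. \<exists>q\<in>?X. q \<noteq> 0 \<and> y = p / q" for y by (rule frac)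
  show "lin i \<in> ?X" if "i \<in> {1..n} \<times> UNIV" for i unfolding lin_def using lin_X[OF that] by blast
  show "lin i \<noteq> 0" if "i \<in> {1..n} \<times> UNIV" for i
    unfolding lin_def using inj_X[OF lin_X[OF that]] linear_nz by blast
  show "p \<in> ?M i \<or> q \<in> ?M i" if i: "i \<in> {1..n} \<times> UNIV" and p: "p \<in> ?A" and q: "q \<in> ?A" and pq: "p * q \<in> ?M i" for i p q
  proof -
    obtain j c where ij: "i = (j, c)" "j \<in> {1..n}" using i by auto
    obtain P where P: "\<And>i. coeff P i \<in> polys_in {1..n}" "p = ev P" using p decompose by blast
    obtain Q where Q: "\<And>i. coeff Q i \<in> polys_in {1..n}" "q = ev Q" using q decompose by blast
    have co: "coeff (P * Q) k \<in> polys_in {1..n}" for k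
      unfolding coeff_mult by (intro sum_in mult_in P(1) Q(1))
    have "ev (P * Q) \<in> ?M (j, c)" using pq by (simp add: ev_simps P Q ij)
    then have "map_poly (msubst j c) Fp dvd map_poly (msubst j c) (P * Q)"
      by (simp only: multiple_iff[OF co ij(2)])
    then have "map_poly (msubst j c) Fp dvd map_poly (msubst j c) P * map_poly (msubst j c) Q"
      by (simp add: map_poly_hom(2)[OF msubst_hom])
    from monic_irreducible_prime[OF almost_integral_closed_mpoly irr_sub[OF ij(2)] this]
    show ?thesis using multiple_iff[OF P(1) ij(2), of c] multiple_iff[OF Q(1) ij(2), of c] P Q ij by simp
  qed
  show "1 \<notin> ?M i" if i: "i \<in> {1..n} \<times> UNIV" for i
  proof -
    obtain j c where ij: "i = (j, c)" "j \<in> {1..n}" using i by auto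
    show ?thesis using multiple_X_iff[OF one_in ij(2), of c] by (simp add: ij(1) msubst_simps)
  qed
  show "i = j" if i: "i \<in> {1..n} \<times> UNIV" and j: "j \<in> {1..n} \<times> UNIV" and m: "lin j \<in> ?M i" for i j
  proof -
    obtain a c where ij: "i = (a, c)" "a \<in> {1..n}" using i by auto
    show ?thesis using m multiple_X_iff[OF lin_X[OF j] ij(2), of c]
      unfolding lin_def[of j] by (auto simp: ij(1) msubst_linear_eq_0 prod_eq_iff)
  qed
  show "\<exists>h\<in>{h \<in> ?X. h \<noteq> 0 \<and> (\<forall>i\<in>{1..n} \<times> UNIV. h \<notin> ?M i)}.
      \<exists>ls. set ls \<subseteq> {1..n} \<times> UNIV \<and> q = h * prod_list (map lin ls)" if q: "q \<in> ?X" "q \<noteq> 0" for q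
  proof -
    obtain g where g: "g \<in> polys_in {1..n}" "q = \<Psi> g" "g \<noteq> 0" using q \<Psi>.hom_zero by blast
    obtain h ls where h: "h \<in> polys_in {1..n}" "h \<noteq> 0" "\<forall>j\<in>{1..n}. \<forall>c. msubst j c h \<noteq> 0" "set ls \<subseteq> {1..n} \<times> UNIV"
      "g = h * prod_list (map (\<lambda>(j, c). Var j - Const c) ls)" using factor_linear[OF g(1,3)] by blast
    have "\<Psi> (prod_list (map (\<lambda>(j, c). Var j - Const c) ls)) = prod_list (map lin ls)"
      by (induction ls) (auto simp: \<Psi>.hom_mult lin_def)
    then have "q = \<Psi> h * prod_list (map lin ls)" by (simp add: g(2) h(5) \<Psi>.hom_mult)
    then show ?thesis using den[of h] h by blast
  qed
  show "\<exists>u\<in>?A. \<exists>h\<in>{h \<in> ?X. h \<noteq> 0 \<and> (\<forall>i\<in>{1..n} \<times> UNIV. h \<notin> ?M i)}. p * u - h \<in> ?M i"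
    if i: "i \<in> {1..n} \<times> UNIV" and p: "p \<in> ?A" "p \<notin> ?M i" for i p
  proof -
    obtain u h where uh: "u \<in> ?A" "h \<in> polys_in {1..n}" "h \<noteq> 0" "\<And>j c. j \<in> {1..n} \<Longrightarrow> msubst j c h \<noteq> 0"
      "p * u - \<Psi> h \<in> ?M i"
      using maximal_aux[OF i p] by blast
    show ?thesis
      by (rule bexI[OF _ uh(1)], rule bexI[OF _ den[OF uh(2,3,4)]], rule uh(5))
  qed
  show "?A \<subseteq> integral_closure ?X" by (rule integral)
qed

end

section \<open>Codes for elements of the constant field and for polynomials\<close>

lemma computable_empty_oracle: "computable {} f \<Longrightarrow> computable D f"
  by (erule computable_turing_le) (simp add: turing_le_iff_decidable decidable_const)

text \<open>Constants are named by positions in the listing, so every number is a name; the shift by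
  one accounts for the listing starting at \<open>1\<close>. Sums and products are found by
  searching the listing, and equality is tested through \<open>\<nu>\<close>.\<close>

lemma computable_field_numbering:
  fixes \<nu> :: "'k::field \<Rightarrow> nat"
  assumes "computable_field \<nu>" "computable_listing \<nu> \<phi>"
  obtains addk mulk :: "nat \<Rightarrow> nat \<Rightarrow> nat"
  where "\<And>D. computable D (\<lambda>p. addk (fst p) (snd p))" "\<And>D. computable D (\<lambda>p. mulk (fst p) (snd p))"
    "\<And>i j. \<phi> (Suc (addk i j)) = \<phi> (Suc i) + \<phi> (Suc j)" "\<And>i j. \<phi> (Suc (mulk i j)) = \<phi> (Suc i) * \<phi> (Suc j)"
    "\<And>D. decidable D (\<lambda>p. \<phi> (Suc (fst p)) = \<phi> (Suc (snd p)))"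
    "\<And>x. \<exists>i. \<phi> (Suc i) = x"
proof -
  define \<kappa> where "\<kappa> i = \<phi> (Suc i)" for i
  have surj: "\<exists>i. \<kappa> i = x" for x
  proof -
    have "x \<in> \<phi> ` {0<..}" using assms(2) unfolding computable_listing_def by blast
    then obtain i where "i > 0" "x = \<phi> i" by auto
    then show ?thesis by (intro exI[of _ "i - 1"]) (simp add: \<kappa>_def)
  qed
  obtain e where e: "\<And>i. i > 0 \<Longrightarrow> run {} e [i] (\<nu> (\<phi> i))"
    using assms(2) unfolding computable_listing_def by blast
  have "run {} (Comp e [Sc]) [i] (\<nu> (\<kappa> i))" for i
    by (rule run_Comp[where ys = "[Suc i]"]) (auto intro: run_Sc e simp: \<kappa>_def)
  then have "computable {} (\<lambda>i. \<nu> (\<kappa> i))" unfolding computable_def by auto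
  then have \<nu>: "computable D (\<lambda>i. \<nu> (\<kappa> i))" for D by (rule computable_empty_oracle)
  have eq: "\<kappa> i = \<kappa> j \<longleftrightarrow> \<nu> (\<kappa> i) = \<nu> (\<kappa> j)" for i j
    using assms(1) unfolding computable_field_def by (auto dest: injD)
  have op: "\<exists>F. (\<forall>D. computable D F) \<and> (\<forall>p. \<kappa> (F p) = g (\<kappa> (fst p)) (\<kappa> (snd p)))"
    if g: "\<exists>e. \<forall>a b. run {} e [\<nu> a, \<nu> b] (\<nu> (g a b))" for g
  proof -
    obtain e2 where e2: "\<And>a b. run {} e2 [\<nu> a, \<nu> b] (\<nu> (g a b))" using g by blast
    have "computable {} (\<lambda>p :: nat \<times> nat. \<nu> (\<kappa> (fst p)))" "computable {} (\<lambda>p :: nat \<times> nat. \<nu> (\<kappa> (snd p)))"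
      by (intro computable_comp[OF \<nu>] computable_intros)+
    then obtain e0 e1 where e01: "\<And>p :: nat \<times> nat. run {} e0 [enc p] (\<nu> (\<kappa> (fst p)))"
      "\<And>p :: nat \<times> nat. run {} e1 [enc p] (\<nu> (\<kappa> (snd p)))"
      unfolding computable_def enc_nat by blast
    have "run {} (Comp e2 [e0, e1]) [enc p] (\<nu> (g (\<kappa> (fst p)) (\<kappa> (snd p))))" for p :: "nat \<times> nat"
      by (rule run_Comp[where ys = "[\<nu> (\<kappa> (fst p)), \<nu> (\<kappa> (snd p))]"]) (auto intro: e01 e2)
    then have G: "computable {} (\<lambda>p :: nat \<times> nat. \<nu> (g (\<kappa> (fst p)) (\<kappa> (snd p))))"
      unfolding computable_def enc_nat by blast
    have "decidable {} (\<lambda>q :: (nat \<times> nat) \<times> nat. \<nu> (\<kappa> (snd q)) = \<nu> (g (\<kappa> (fst (fst q))) (\<kappa> (snd (fst q)))))"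
      by (rule decidable_eq[OF computable_comp[OF \<nu>] computable_comp[OF G]]) (intro computable_intros)+
    moreover have "\<exists>r. \<nu> (\<kappa> r) = \<nu> (g (\<kappa> (fst p)) (\<kappa> (snd p)))" for p :: "nat \<times> nat" using surj by metis
    ultimately obtain F where F: "computable {} F" "\<And>p. \<nu> (\<kappa> (F p)) = \<nu> (g (\<kappa> (fst p)) (\<kappa> (snd p)))"
      by (rule computable_search[where R = "\<lambda>p r. \<nu> (\<kappa> r) = \<nu> (g (\<kappa> (fst p)) (\<kappa> (snd p)))"]) blast
    have "\<kappa> (F p) = g (\<kappa> (fst p)) (\<kappa> (snd p))" for p
      using F(2)[of p] assms(1) unfolding computable_field_def by (auto dest: injD)
    then show ?thesis using computable_empty_oracle[OF F(1)] by blast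
  qed
  obtain Fa where Fa: "\<And>D. computable D Fa" "\<And>p. \<kappa> (Fa p) = \<kappa> (fst p) + \<kappa> (snd p)"
    using op[of "(+)"] assms(1) unfolding computable_field_def by blast
  obtain Fm where Fm: "\<And>D. computable D Fm" "\<And>p. \<kappa> (Fm p) = \<kappa> (fst p) * \<kappa> (snd p)"
    using op[of "(*)"] assms(1) unfolding computable_field_def by blast
  show ?thesis
  proof (rule that[of "\<lambda>i j. Fa (i, j)" "\<lambda>i j. Fm (i, j)"])
    show "decidable D (\<lambda>p. \<phi> (Suc (fst p)) = \<phi> (Suc (snd p)))" for D
      unfolding \<kappa>_def[symmetric] eq
      by (rule decidable_eq[OF computable_comp[OF \<nu>] computable_comp[OF \<nu>]]) (intro computable_intros)+
  qed (use Fa Fm surj in \<open>simp_all add: \<kappa>_def\<close>)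
qed

locale numbered_field =
  fixes \<kappa> :: "nat \<Rightarrow> 'k::field" and addk mulk :: "nat \<Rightarrow> nat \<Rightarrow> nat" and n :: nat
  assumes addk_computable: "\<And>D. computable D (\<lambda>p. addk (fst p) (snd p))"
    and mulk_computable: "\<And>D. computable D (\<lambda>p. mulk (fst p) (snd p))"
    and addk: "\<And>i j. \<kappa> (addk i j) = \<kappa> i + \<kappa> j" and mulk: "\<And>i j. \<kappa> (mulk i j) = \<kappa> i * \<kappa> j"
    and eq_decidable: "\<And>D. decidable D (\<lambda>p. \<kappa> (fst p) = \<kappa> (snd p))"
    and surj: "\<And>x. \<exists>i. \<kappa> i = x"
begin

lemmas computable_addk [computable_intros] = computable_uncurry[of _ addk, OF addk_computable]
lemmas computable_mulk [computable_intros] = computable_uncurry[of _ mulk, OF mulk_computable]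
lemmas decidable_\<kappa>_eq = decidable_uncurry[of _ "\<lambda>i j. \<kappa> i = \<kappa> j", OF eq_decidable]

text \<open>A noneffective choice; inside computable functions it is applied to fixed constants
  only.\<close>

definition code_of :: "'k \<Rightarrow> nat" where "code_of x = (SOME i. \<kappa> i = x)"

lemma \<kappa>_code_of [simp]: "\<kappa> (code_of x) = x"
  unfolding code_of_def by (rule someI_ex[OF surj])

lemma decidable_\<kappa>_eq_const: "computable D f \<Longrightarrow> decidable D (\<lambda>x. \<kappa> (f x) = c)"
  using decidable_\<kappa>_eq[of D f "\<lambda>_. code_of c", OF _ computable_const] by simp

text \<open>A polynomial is coded as a list of monomials, each a list of variables and constants.\<close>

definition atom :: "nat \<Rightarrow> 'k mpoly" where
  "atom a = (if a \<le> n then Var a else Const (\<kappa> (a - Suc n)))"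

definition word_val :: "nat list \<Rightarrow> 'k mpoly" where "word_val w = prod_list (map atom w)"

definition pval :: "nat list list \<Rightarrow> 'k mpoly" where "pval p = sum_list (map word_val p)"

definition cst :: "nat \<Rightarrow> nat list list" where "cst c = [[Suc n + c]]"

definition pmul :: "nat list list \<Rightarrow> nat list list \<Rightarrow> nat list list" where
  "pmul p q = concat (map (\<lambda>w. map (\<lambda>w'. w @ w') q) p)"

lemma word_val_append: "word_val (w @ w') = word_val w * word_val w'"
  by (simp add: word_val_def)

lemma pval_append [simp]: "pval (p @ q) = pval p + pval q"
  by (simp add: pval_def)

lemma pval_pmul [simp]: "pval (pmul p q) = pval p * pval q"
proof -
  have *: "pval (map (\<lambda>w'. w @ w') q) = word_val w * pval q" for w
    by (induction q) (auto simp: pval_def word_val_append distrib_left)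
  show ?thesis
    by (induction p) (auto simp: pmul_def *, auto simp: pval_def distrib_right)
qed

lemma pval_cst [simp]: "pval (cst c) = Const (\<kappa> c)"
  by (simp add: pval_def cst_def word_val_def atom_def)

lemma pval_var: "i \<le> n \<Longrightarrow> pval [[i]] = Var i"
  by (simp add: pval_def word_val_def atom_def)

lemma pval_Nil [simp]: "pval [] = 0" by (simp add: pval_def)

definition z_free :: "nat list list \<Rightarrow> bool" where "z_free p \<longleftrightarrow> (\<forall>w\<in>set p. \<forall>a\<in>set w. a \<noteq> 0)"

lemma atom_in: "atom a \<in> polys_in {0..n}" "a \<noteq> 0 \<Longrightarrow> atom a \<in> polys_in {1..n}"
  by (auto simp: atom_def)

lemma prod_list_in: "(\<And>x. x \<in> set xs \<Longrightarrow> x \<in> polys_in S) \<Longrightarrow> prod_list xs \<in> polys_in S"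
  by (induction xs) auto

lemma sum_list_in: "(\<And>x. x \<in> set xs \<Longrightarrow> x \<in> polys_in S) \<Longrightarrow> sum_list xs \<in> polys_in S"
  by (induction xs) auto

lemma pval_in: "pval p \<in> polys_in {0..n}"
  unfolding pval_def word_val_def using atom_in(1) by (intro sum_list_in) (auto intro!: prod_list_in)

lemma pval_in_X: "z_free p \<Longrightarrow> pval p \<in> polys_in {1..n}"
  unfolding pval_def word_val_def z_free_def using atom_in(2)
  by (intro sum_list_in) (auto intro!: prod_list_in simp del: One_nat_def)

lemma pval_surj:
  assumes "p \<in> polys_in {0..n}" obtains c where "pval c = p"
proof -
  have "\<exists>c. pval c = p" using assms
  proof (induction rule: polys_in_induct)
    case (Const c)
    show ?case by (rule exI[of _ "cst (code_of c)"]) simp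
  next
    case (Var i)
    then show ?case by (intro exI[of _ "[[i]]"]) (simp add: pval_var)
  next
    case (add p q)
    then show ?case using pval_append by metis
  next
    case (mult p q)
    then show ?case using pval_pmul by metis
  qed
  then show ?thesis using that by blast
qed

lemma z_free_pmul: "z_free c \<Longrightarrow> z_free d \<Longrightarrow> z_free (pmul c d)"
  by (auto simp: z_free_def pmul_def)

lemma pval_surj_X:
  assumes "p \<in> polys_in {1..n}" obtains c where "z_free c" "pval c = p"
proof -
  have "\<exists>c. z_free c \<and> pval c = p" using assms
  proof (induction rule: polys_in_induct)
    case (Const c)
    have "z_free (cst (code_of c))" by (simp add: z_free_def cst_def)
    then show ?case by (intro exI[of _ "cst (code_of c)"]) simp
  next
    case (Var i)
    then show ?case by (intro exI[of _ "[[i]]"]) (simp add: pval_var z_free_def)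
  next
    case (add p q)
    then obtain c d where "z_free c" "pval c = p" "z_free d" "pval d = q" by blast
    then show ?case by (intro exI[of _ "c @ d"]) (auto simp: z_free_def)
  next
    case (mult p q)
    then obtain c d where "z_free c" "pval c = p" "z_free d" "pval d = q" by blast
    then show ?case by (intro exI[of _ "pmul c d"]) (auto simp: z_free_pmul)
  qed
  then show ?thesis using that by blast
qed

definition word_count :: "nat \<Rightarrow> nat list \<Rightarrow> nat" where
  "word_count i w = foldr (\<lambda>a b. if a = i then Suc b else b) w 0"

definition word_mon :: "nat list \<Rightarrow> nat \<Rightarrow>\<^sub>0 nat" where
  "word_mon w = sum_list (map (\<lambda>a. if a \<le> n then msingle a 1 else 0) w)"

definition word_coeff :: "nat list \<Rightarrow> nat" where
  "word_coeff w = foldr (\<lambda>a b. if a \<le> n then b else mulk (a - Suc n) b) w (code_of 1)"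

definition same_mon :: "nat list \<Rightarrow> nat list \<Rightarrow> bool" where
  "same_mon w w' \<longleftrightarrow> (\<forall>i<Suc n. word_count i w = word_count i w')"

definition code_coeff :: "nat list list \<Rightarrow> nat list \<Rightarrow> nat" where
  "code_coeff p w = foldr (\<lambda>w' b. if same_mon w w' then addk (word_coeff w') b else b) p (code_of 0)"

lemma word_val_eq: "word_val w = msingle (word_mon w) (\<kappa> (word_coeff w))"
  by (induction w)
    (auto simp: word_val_def word_mon_def word_coeff_def atom_def Var_def Const_def mult_single mulk)

lemma lookup_word_mon: "mlookup (word_mon w) i = (if i \<le> n then word_count i w else 0)"
  by (induction w) (auto simp: word_mon_def word_count_def lookup_add lookup_single when_def)

lemma same_mon_iff: "same_mon w w' \<longleftrightarrow> word_mon w = word_mon w'"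
  by (auto simp: same_mon_def poly_mapping_eq_iff fun_eq_iff lookup_word_mon less_Suc_eq_le split: if_splits)

lemma \<kappa>_code_coeff: "\<kappa> (code_coeff p w) = mlookup (pval p) (word_mon w)"
  by (induction p)
    (auto simp: code_coeff_def pval_def word_val_eq lookup_add lookup_single when_def same_mon_iff addk)

text \<open>Only monomials of words in the code can have a nonzero coefficient, which makes the zero
  test finite.\<close>

lemma pval_eq_0_iff: "pval p = 0 \<longleftrightarrow> (\<forall>w\<in>set p. \<kappa> (code_coeff p w) = 0)"
proof
  assume *: "\<forall>w\<in>set p. \<kappa> (code_coeff p w) = 0"
  have keys: "m \<in> word_mon ` set q" if "m \<in> mkeys (pval q)" for m q
    using that
  proof (induction q)
    case (Cons w q)
    then have "m \<in> mkeys (word_val w) \<or> m \<in> mkeys (pval q)"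
      using Poly_Mapping.keys_add[of "word_val w" "pval q"] by (auto simp: pval_def)
    then show ?case using Cons.IH by (auto simp: word_val_eq split: if_splits)
  qed (simp add: pval_def)
  have "mlookup (pval p) m = 0" for m
  proof (cases "m \<in> mkeys (pval p)")
    case True
    then obtain w where "w \<in> set p" "m = word_mon w" using keys by blast
    then show ?thesis using * \<kappa>_code_coeff[of p w] by simp
  qed (simp add: in_keys_iff)
  then show "pval p = 0" by (intro poly_mapping_eqI) simp
qed (simp add: \<kappa>_code_coeff)

section \<open>Computability of the operations on polynomial codes\<close>

lemma computable_word_count [computable_intros]:
  assumes "computable D i" "computable D w" shows "computable D (\<lambda>x. word_count (i x) (w x))"
  unfolding word_count_def
  by (rule computable_foldr[where F = "\<lambda>x a b. if a = i x then Suc b else b", OF _ assms(2) computable_const])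
    (intro computable_intros computable_comp[OF assms(1)])

lemma computable_word_coeff [computable_intros]:
  assumes "computable D w" shows "computable D (\<lambda>x. word_coeff (w x))"
  unfolding word_coeff_def
  by (rule computable_foldr[where F = "\<lambda>x a b. if a \<le> n then b else mulk (a - Suc n) b", OF _ assms computable_const])
    (intro computable_intros)

lemma decidable_same_mon [computable_intros]:
  assumes "computable D w" "computable D w'" shows "decidable D (\<lambda>x. same_mon (w x) (w' x))"
  unfolding same_mon_def
  by (intro computable_intros computable_comp[OF assms(1)] computable_comp[OF assms(2)])

lemma computable_code_coeff [computable_intros]:
  assumes "computable D p" "computable D w" shows "computable D (\<lambda>x. code_coeff (p x) (w x))"
  unfolding code_coeff_def
  by (rule computable_foldr[where F = "\<lambda>x w' b. if same_mon (w x) w' then addk (word_coeff w') b else b",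
        OF _ assms(1) computable_const])
    (intro computable_intros computable_comp[OF assms(2)])

lemma decidable_pval_eq_0 [computable_intros]:
  assumes "computable D p" shows "decidable D (\<lambda>x. pval (p x) = 0)"
  unfolding pval_eq_0_iff
  by (rule decidable_Ball_list[OF _ assms])
    (intro decidable_\<kappa>_eq_const computable_intros computable_comp[OF assms])

lemma computable_pmul [computable_intros]:
  assumes "computable D p" "computable D q" shows "computable D (\<lambda>x. pmul (p x) (q x))"
proof -
  have "computable D (\<lambda>y. map (\<lambda>w'. snd y @ w') (q (fst y)))"
    by (rule computable_map[where F = "\<lambda>y w'. snd y @ w'"]) (intro computable_intros computable_comp[OF assms(2)])+
  then show ?thesis unfolding pmul_def
    by (intro computable_concat computable_map[where F = "\<lambda>x w. map (\<lambda>w'. w @ w') (q x)"] assms(1))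
qed

lemma computable_cst [computable_intros]: "computable D c \<Longrightarrow> computable D (\<lambda>x. cst (c x))"
  unfolding cst_def by (intro computable_intros)

lemma decidable_z_free [computable_intros]:
  assumes "computable D p" shows "decidable D (\<lambda>x. z_free (p x))"
  unfolding z_free_def by (intro computable_intros assms)

definition pneg :: "nat list list \<Rightarrow> nat list list" where "pneg p = pmul (cst (code_of (- 1))) p"

lemma pval_pneg [simp]: "pval (pneg p) = - pval p"
proof -
  have "Const (- 1 :: 'k) = - 1" by (simp add: Const_def single_uminus)
  then show ?thesis by (simp add: pneg_def)
qed

lemma computable_pneg [computable_intros]: "computable D p \<Longrightarrow> computable D (\<lambda>x. pneg (p x))"
  unfolding pneg_def by (intro computable_intros)

definition linc :: "nat \<Rightarrow> nat \<Rightarrow> nat list list" where "linc j c = [[j]] @ pneg (cst c)"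

lemma pval_linc: "j \<le> n \<Longrightarrow> pval (linc j c) = Var j - Const (\<kappa> c)"
  unfolding linc_def pval_append by (simp add: pval_var)

lemma computable_linc [computable_intros]:
  "computable D j \<Longrightarrow> computable D c \<Longrightarrow> computable D (\<lambda>x. linc (j x) (c x))"
  unfolding linc_def by (intro computable_intros)

definition lin_prod :: "(nat \<times> nat) list \<Rightarrow> nat list list" where
  "lin_prod ls = foldr (\<lambda>l q. pmul (linc (fst l) (snd l)) q) ls (cst (code_of 1))"

lemma pval_lin_prod:
  "(\<And>l. l \<in> set ls \<Longrightarrow> fst l \<le> n) \<Longrightarrow>
     pval (lin_prod ls) = prod_list (map (\<lambda>l. Var (fst l) - Const (\<kappa> (snd l))) ls)"
proof (induction ls)
  case Nil
  have "Const (1 :: 'k) = 1" by (simp add: Const_def)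
  then show ?case by (simp add: lin_prod_def)
next
  case (Cons l ls)
  then show ?case by (simp add: lin_prod_def pval_linc)
qed

lemma computable_lin_prod [computable_intros]:
  assumes "computable D ls" shows "computable D (\<lambda>x. lin_prod (ls x))"
  unfolding lin_prod_def
  by (rule computable_foldr[where F = "\<lambda>x l q. pmul (linc (fst l) (snd l)) q", OF _ assms computable_const])
    (intro computable_intros)

text \<open>Letters above \<open>n\<close> are constants and stay; every variable other than
  \<open>j\<close> becomes the letter of the constant that \<open>bs\<close> lists for it.\<close>

definition pspec :: "nat \<Rightarrow> nat list \<Rightarrow> nat list list \<Rightarrow> nat list list" where
  "pspec j bs p = map (map (\<lambda>a. if a = j \<or> n < a then a else Suc n + nth0 bs a)) p"

definition psubst :: "nat \<Rightarrow> nat \<Rightarrow> nat list list \<Rightarrow> nat list list" where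
  "psubst j c p = map (map (\<lambda>a. if a = j then Suc n + c else a)) p"

lemma pval_map:
  assumes h: "comm_ring_hom h" and s: "\<And>a. h (atom a) = atom (s a)"
  shows "pval (map (map s) p) = h (pval p)"
proof -
  interpret comm_ring_hom h by fact
  have w: "word_val (map s w) = h (word_val w)" for w
    by (induction w) (auto simp: word_val_def hom_mult s)
  show ?thesis by (induction p) (auto simp: pval_def hom_add w)
qed

definition spec_hom :: "nat \<Rightarrow> nat list \<Rightarrow> 'k mpoly \<Rightarrow> 'k mpoly" where
  "spec_hom j bs = mev Const (\<lambda>i. if i = j then Var j else Const (\<kappa> (nth0 bs i)))"

lemma spec_hom: "comm_ring_hom (spec_hom j bs)"
  unfolding spec_hom_def by (rule mev_hom[OF Const_hom])

lemma spec_hom_Const: "spec_hom j bs (Const c) = Const c"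
  and spec_hom_Var: "spec_hom j bs (Var i) = (if i = j then Var j else Const (\<kappa> (nth0 bs i)))"
  unfolding spec_hom_def by (simp_all add: mev_Const[OF Const_hom] mev_Var[OF Const_hom])

lemma pval_pspec: "pval (pspec j bs p) = spec_hom j bs (pval p)"
  unfolding pspec_def by (rule pval_map[OF spec_hom]) (auto simp: atom_def spec_hom_Const spec_hom_Var)

lemma pval_psubst: "j \<le> n \<Longrightarrow> pval (psubst j c p) = msubst j (\<kappa> c) (pval p)"
  unfolding psubst_def by (rule pval_map[OF msubst_hom]) (auto simp: atom_def msubst_Var)

lemma computable_pspec [computable_intros]:
  assumes "computable D j" "computable D bs" "computable D p"
  shows "computable D (\<lambda>x. pspec (j x) (bs x) (p x))"
proof -
  have "computable D (\<lambda>y. map (\<lambda>a. if a = j (fst y) \<or> n < a then a else Suc n + nth0 (bs (fst y)) a) (snd y))"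
    by (rule computable_map[where F = "\<lambda>y a. if a = j (fst y) \<or> n < a then a else Suc n + nth0 (bs (fst y)) a"])
      (intro computable_intros computable_comp[OF assms(1)] computable_comp[OF assms(2)])+
  then show ?thesis unfolding pspec_def
    by (intro computable_map[where F = "\<lambda>x. map (\<lambda>a. if a = j x \<or> n < a then a else Suc n + nth0 (bs x) a)"] assms(3))
qed

lemma computable_psubst [computable_intros]:
  assumes "computable D j" "computable D c" "computable D p"
  shows "computable D (\<lambda>x. psubst (j x) (c x) (p x))"
proof -
  have "computable D (\<lambda>y. map (\<lambda>a. if a = j (fst y) then Suc n + c (fst y) else a) (snd y))"
    by (rule computable_map[where F = "\<lambda>y a. if a = j (fst y) then Suc n + c (fst y) else a"])
      (intro computable_intros computable_comp[OF assms(1)] computable_comp[OF assms(2)])+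
  then show ?thesis unfolding psubst_def
    by (intro computable_map[where F = "\<lambda>x. map (\<lambda>a. if a = j x then Suc n + c x else a)"] assms(3))
qed

text \<open>
  A certificate that no linear polynomial in the variable with index \<open>j\<close> divides \<open>h\<close>: a
  specialization of \<open>h\<close> to a nonzero polynomial in that variable, factored into linear factors,
  none of whose roots comes from a linear divisor.
\<close>

definition lin_free_cert :: "nat \<Rightarrow> nat list list \<Rightarrow> nat list \<times> nat \<times> nat list \<Rightarrow> bool" where
  "lin_free_cert j h t \<longleftrightarrow> \<kappa> (fst (snd t)) \<noteq> 0 \<and>
     pval (pspec j (fst t) h @ pneg (pmul (cst (fst (snd t))) (lin_prod (map (\<lambda>a. (j, a)) (snd (snd t)))))) = 0 \<and>
     (\<forall>a\<in>set (snd (snd t)). pval (psubst j a h) \<noteq> 0)"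

lemma decidable_lin_free_cert [computable_intros]:
  assumes "computable D j" "computable D h" "computable D t"
  shows "decidable D (\<lambda>x. lin_free_cert (j x) (h x) (t x))"
  unfolding lin_free_cert_def
  by (intro computable_intros decidable_\<kappa>_eq_const computable_map[where F = "\<lambda>x a. (j x, a)"] assms
      computable_comp[OF assms(1)] computable_comp[OF assms(2)])

end

locale numbered_alg_closed = numbered_field \<kappa> addk mulk n
  for \<kappa> :: "nat \<Rightarrow> 'k::alg_closed_field" and addk mulk n
begin

text \<open>A \<open>c\<close> with \<open>h = 0\<close> at \<open>x_j = c\<close> is a root of the
  specialization, hence one of the listed roots, which are all tested. Conversely, a point where
  \<open>h\<close> does not vanish provides a specialization, and algebraic closedness its
  factorization.\<close>

lemma lin_free_cert_iff:
  assumes j: "j \<in> {1..n}"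
  shows "(\<exists>t. lin_free_cert j h t) \<longleftrightarrow> (\<forall>c. msubst j c (pval h) \<noteq> 0)"
proof
  have jn: "j \<le> n" using j by simp
  assume "\<exists>t. lin_free_cert j h t"
  then obtain bs c0 as where t: "\<kappa> c0 \<noteq> 0"
    "pval (pspec j bs h @ pneg (pmul (cst c0) (lin_prod (map (\<lambda>a. (j, a)) as)))) = 0"
    "\<And>a. a \<in> set as \<Longrightarrow> pval (psubst j a h) \<noteq> 0"
    unfolding lin_free_cert_def by auto
  have "pval (lin_prod (map (\<lambda>a. (j, a)) as)) = prod_list (map (\<lambda>a. Var j - Const (\<kappa> a)) as)"
    by (subst pval_lin_prod) (auto simp: jn o_def)
  then have sp: "spec_hom j bs (pval h) = Const (\<kappa> c0) * prod_list (map (\<lambda>a. Var j - Const (\<kappa> a)) as)"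
    using t(2) by (simp add: pval_pspec)
  show "\<forall>c. msubst j c (pval h) \<noteq> 0"
  proof (intro allI notI)
    fix c assume 0: "msubst j c (pval h) = 0"
    interpret s: comm_ring_hom "spec_hom j bs" by (rule spec_hom)
    obtain q where q: "pval h = msubst j c (pval h) + (Var j - Const c) * q"
      by (rule msubst_remainder[of "pval h" "{0..n}" j c]) (use pval_in jn in auto)
    have "spec_hom j bs (pval h) = (Var j - Const c) * spec_hom j bs q"
      using q 0 by (simp add: s.hom_mult s.hom_minus spec_hom_Const spec_hom_Var)
    then have "meval (\<lambda>_. c) (Const (\<kappa> c0) * prod_list (map (\<lambda>a. Var j - Const (\<kappa> a)) as)) = 0"
      unfolding sp[symmetric] by (simp add: meval_simps)
    then have "meval (\<lambda>_. c) (prod_list (map (\<lambda>a. Var j - Const (\<kappa> a)) as)) = 0" using t(1) by (simp add: meval_simps)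
    then have "\<exists>a\<in>set as. c = \<kappa> a" by (induction as) (auto simp: meval_simps)
    then show False using t(3) 0 by (auto simp: pval_psubst[OF jn])
  qed
next
  have jn: "j \<le> n" using j by simp
  assume nz: "\<forall>c. msubst j c (pval h) \<noteq> 0"
  then have "pval h \<noteq> 0" by (auto simp: msubst_simps)
  then obtain b where b: "meval b (pval h) \<noteq> 0" using nonvanishing by blast
  define bs where "bs = map (\<lambda>i. code_of (b i)) [0..<Suc n]"
  have bs: "\<kappa> (nth0 bs i) = b i" if "i \<le> n" for i using that by (simp add: bs_def nth0_def del: upt_Suc)
  interpret s: comm_ring_hom "spec_hom j bs" by (rule spec_hom)
  have "spec_hom j bs (pval h) \<in> polys_in (insert j {})"
    unfolding spec_hom_def by (rule mev_in[OF Const_hom _ _ pval_in]) auto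
  then obtain P where P: "\<And>i. coeff P i \<in> polys_in {}" "poly P (Var j) = spec_hom j bs (pval h)"
    by (rule polys_in_decompose) blast
  interpret m: comm_ring_hom "meval (\<lambda>_. 0 :: 'k)" by (rule meval_hom)
  interpret C: comm_ring_hom "Const :: 'k \<Rightarrow> 'k mpoly" by (rule Const_hom)
  have const: "p = Const (meval (\<lambda>_. 0) p)" if "p \<in> polys_in {}" for p :: "'k mpoly"
    using that by (induction rule: polys_in_induct) (auto simp: meval_simps C.hom_add C.hom_mult)
  define q where "q = map_poly (meval (\<lambda>_. 0)) P"
  have Pq: "P = map_poly Const q"
    by (rule poly_eqI) (use const[OF P(1)] in \<open>simp add: q_def\<close>)
  have evq: "spec_hom j bs (pval h) = poly (map_poly Const q) (Var j)" using P(2) Pq by simp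
  have "meval b (spec_hom j bs (pval h)) = meval b (pval h)"
  proof -
    interpret mb: comm_ring_hom "meval b" by (rule meval_hom)
    show ?thesis
    proof (rule mev_unique[OF _ meval_hom pval_in, where h = "\<lambda>p. meval b (spec_hom j bs p)"])
      show "comm_ring_hom (\<lambda>p. meval b (spec_hom j bs p))"
        by unfold_locales (simp_all add: s.hom_add s.hom_mult mb.hom_add mb.hom_mult)
    qed (auto simp: spec_hom_Const spec_hom_Var bs)
  qed
  then have "q \<noteq> 0" using b evq by (auto simp: meval_simps)
  then obtain A where A: "q = smult (lead_coeff q) (\<Prod>x\<in>#A. [:- x, 1:])"
    using alg_closed_imp_factorization[of q] by blast
  obtain xs where xs: "mset xs = A" using ex_mset by blast
  define as where "as = map code_of xs"
  interpret mp: map_poly_comm_ring_hom "Const :: 'k \<Rightarrow> 'k mpoly" ..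
  have pl: "poly (map_poly Const (\<Prod>x\<in>#mset ys. [:- x, 1:])) (Var j) = prod_list (map (\<lambda>x. Var j - Const x) ys)" for ys :: "'k list"
  proof (induction ys)
    case (Cons y ys)
    have lin: "map_poly Const [:- y, 1:] = [:- Const y, 1 :: 'k mpoly:]"
      by (rule poly_eqI) (auto simp: coeff_pCons C.hom_uminus split: nat.splits)
    have e: "(\<Prod>x\<in>#mset (y # ys). [:- x, 1:]) = [:- y, 1:] * (\<Prod>x\<in>#mset ys. [:- x, 1:])" by simp
    show ?case unfolding e mp.hom_mult lin poly_mult Cons by simp
  qed simp
  have "map_poly Const q = smult (Const (lead_coeff q)) (map_poly Const (\<Prod>x\<in>#A. [:- x, 1:]))"
    by (subst A) (rule poly_eqI, simp add: C.hom_mult)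
  then have sp: "spec_hom j bs (pval h) = Const (lead_coeff q) * prod_list (map (\<lambda>x. Var j - Const x) xs)"
    unfolding evq using pl[of xs] xs by simp
  have "pval (lin_prod (map (\<lambda>a. (j, a)) as)) = prod_list (map (\<lambda>x. Var j - Const x) xs)"
    by (subst pval_lin_prod) (auto simp: jn o_def as_def)
  then have "lin_free_cert j h (bs, code_of (lead_coeff q), as)"
    unfolding lin_free_cert_def using \<open>q \<noteq> 0\<close> nz by (simp add: pval_pspec sp pval_psubst[OF jn])
  then show "\<exists>t. lin_free_cert j h t" by blast
qed

end

section \<open>Structures presented by a numbering\<close>

lemma isomorphic_sym: "isomorphic M N \<Longrightarrow> isomorphic N M"
proof -
  assume "isomorphic M N"
  then obtain h where h: "bij_betw h (universe M) (universe N)"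
    "\<And>r xs. set xs \<subseteq> universe M \<Longrightarrow> length xs = arity r \<Longrightarrow> holds M r xs \<longleftrightarrow> holds N r (map h xs)"
    unfolding isomorphic_def by blast
  define g where "g = inv_into (universe M) h"
  have g: "bij_betw g (universe N) (universe M)" unfolding g_def by (rule bij_betw_inv_into[OF h(1)])
  have "holds N r ys \<longleftrightarrow> holds M r (map g ys)" if ys: "set ys \<subseteq> universe N" "length ys = arity r" for r ys
  proof -
    have "map h (map g ys) = ys"
      using ys(1) by (auto simp: map_idI g_def bij_betw_inv_into_right[OF h(1)] subset_iff)
    moreover have "set (map g ys) \<subseteq> universe M" using ys(1) g by (auto simp: bij_betw_def)
    ultimately show ?thesis using h(2)[of "map g ys" r] ys(2) by simp
  qed
  then show ?thesis unfolding isomorphic_def using g by blast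
qed

lemma isomorphic_trans: "isomorphic M N \<Longrightarrow> isomorphic N K \<Longrightarrow> isomorphic M K"
proof -
  assume "isomorphic M N" "isomorphic N K"
  then obtain h g where h: "bij_betw h (universe M) (universe N)"
    "\<And>r xs. set xs \<subseteq> universe M \<Longrightarrow> length xs = arity r \<Longrightarrow> holds M r xs \<longleftrightarrow> holds N r (map h xs)"
    and g: "bij_betw g (universe N) (universe K)"
    "\<And>r xs. set xs \<subseteq> universe N \<Longrightarrow> length xs = arity r \<Longrightarrow> holds N r xs \<longleftrightarrow> holds K r (map g xs)"
    unfolding isomorphic_def by blast
  have "holds M r xs \<longleftrightarrow> holds K r (map (g \<circ> h) xs)" if xs: "set xs \<subseteq> universe M" "length xs = arity r" for r xs
  proof -
    have "set (map h xs) \<subseteq> universe N" using xs(1) h(1) by (auto simp: bij_betw_def)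
    then show ?thesis using h(2)[OF xs] g(2)[of "map h xs" r] xs(2) by simp
  qed
  then show ?thesis unfolding isomorphic_def using bij_betw_trans[OF h(1) g(1)] by blast
qed

lemma ex_rs_symbol: "(\<exists>r. P r) \<longleftrightarrow> P IsPoint \<or> P IsOpen \<or> P PointIn \<or> P SectionOver \<or> P SumIs \<or> P ProdIs \<or>
    P IsZero \<or> P IsOne \<or> P RestrictsTo"
  by (metis (full_types) rs_symbol.exhaust)

definition tl0 :: "'a list \<Rightarrow> 'a list" where "tl0 l = (case l of [] \<Rightarrow> [] | y # ys \<Rightarrow> ys)"

lemma computable_tl0 [computable_intros]:
  assumes "computable D l" shows "computable D (\<lambda>x. tl0 (l x))"
  unfolding tl0_def by (rule computable_case_list[OF assms computable_const]) (intro computable_intros)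

text \<open>Repetitions in the numbering are removed by keeping the least number of every element;
  this universe is decidable because equality of elements is.\<close>

lemma pulled_back_structure:
  fixes S :: "'a rs_structure" and e :: "nat \<Rightarrow> 'a"
  assumes rng: "range e = universe S" and eq: "decidable D (\<lambda>p. e (fst p) = e (snd p))"
    and rel: "\<And>r. decidable D (\<lambda>xs. length xs = arity r \<and> holds S r (map e xs))"
  obtains N :: "nat rs_structure" where "isomorphic N S" "turing_le (atomic_diagram N) D"
proof -
  define A where "A = {x. \<forall>y<x. e y \<noteq> e x}"
  define N :: "nat rs_structure" where "N = \<lparr>universe = A, holds = (\<lambda>r xs. holds S r (map e xs))\<rparr>"
  have least: "(LEAST y. e y = e x) \<in> A" "e (LEAST y. e y = e x) = e x" for x
  proof -
    show 1: "e (LEAST y. e y = e x) = e x" by (rule LeastI[of "\<lambda>y. e y = e x" x]) simp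
    show "(LEAST y. e y = e x) \<in> A"
      unfolding A_def mem_Collect_eq 1 by (intro allI impI) (rule not_less_Least)
  qed
  have "inj_on e A"
  proof (rule inj_onI)
    fix x y assume "x \<in> A" "y \<in> A" "e x = e y"
    then show "x = y" unfolding A_def by (cases x y rule: linorder_cases) auto
  qed
  moreover have "e ` A = universe S"
  proof -
    have "e x \<in> e ` A" for x
      by (rule image_eqI[where x = "LEAST y. e y = e x"]) (rule least(2)[symmetric], rule least(1))
    then have "range e \<subseteq> e ` A" by blast
    then show ?thesis using rng by auto
  qed
  ultimately have "isomorphic N S"
    unfolding isomorphic_def N_def by (intro exI[of _ e]) (auto simp: bij_betw_def)
  moreover have "turing_le (atomic_diagram N) D"
  proof -
    have A: "decidable D (\<lambda>x. x \<in> A)"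
      unfolding A_def mem_Collect_eq
      by (intro computable_intros decidable_uncurry[of D "\<lambda>y x. e y = e x", OF eq])
    define xs where "xs l = tl0 (tl0 l)" for l :: "nat list"
    have xs [computable_intros]: "computable D (\<lambda>x. xs (l x))" if "computable D l" for l :: "nat \<Rightarrow> nat list"
      unfolding xs_def by (intro computable_intros that)
    \<comment> \<open>The first entry is compared with the computed truth value, so that one test
      covers atomic and negated atomic sentences.\<close>
    define P where "P l \<longleftrightarrow> 2 \<le> length l \<and> (\<forall>x\<in>set (xs l). x \<in> A) \<and>
        ((nth0 l 1 = 0 \<and> length (xs l) = 2 \<and> nth0 l 0 = of_bool (nth0 (xs l) 0 = nth0 (xs l) 1)) \<or>
         (\<exists>r. nth0 l 1 = symbol_code r \<and> length (xs l) = arity r \<and>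
            nth0 l 0 = of_bool (length (xs l) = arity r \<and> holds S r (map e (xs l)))))" for l
    have P: "list_encode l \<in> atomic_diagram N \<longleftrightarrow> P l" for l
    proof -
      have "P l \<longleftrightarrow> (\<exists>x y. x \<in> A \<and> y \<in> A \<and> l = [of_bool (x = y), 0, x, y]) \<or>
          (\<exists>r ys. set ys \<subseteq> A \<and> length ys = arity r \<and> l = of_bool (holds S r (map e ys)) # symbol_code r # ys)"
      proof (cases l)
        case (Cons b l')
        note l = Cons
        show ?thesis
        proof (cases l')
          case (Cons c ys)
          have sx: "xs l = ys" "nth0 l 0 = b" "nth0 l 1 = c" by (simp_all add: l Cons xs_def tl0_def nth0_def)
          have 1: "c = 0 \<and> length ys = 2 \<and> b = of_bool (nth0 ys 0 = nth0 ys 1) \<and> (\<forall>x\<in>set ys. x \<in> A) \<longleftrightarrow>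
              (\<exists>x y. x \<in> A \<and> y \<in> A \<and> l = [of_bool (x = y), 0, x, y])" (is "?L \<longleftrightarrow> ?R")
          proof
            assume L: ?L
            then obtain x y where "ys = [x, y]" by (auto simp: numeral_2_eq_2 length_Suc_conv)
            then show ?R using L by (intro exI[of _ x] exI[of _ y]) (simp add: l Cons nth0_def)
          next
            assume ?R
            then obtain x y where "x \<in> A" "y \<in> A" "l = [of_bool (x = y), 0, x, y]" by blast
            then show ?L by (simp add: l Cons nth0_def)
          qed
          have 2: "(\<exists>r. c = symbol_code r \<and> length ys = arity r \<and>
                b = of_bool (length ys = arity r \<and> holds S r (map e ys))) \<and> (\<forall>x\<in>set ys. x \<in> A) \<longleftrightarrow>
              (\<exists>r zs. set zs \<subseteq> A \<and> length zs = arity r \<and> l = of_bool (holds S r (map e zs)) # symbol_code r # zs)"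
            (is "?L \<longleftrightarrow> ?R")
          proof
            assume L: ?L
            then obtain r where "c = symbol_code r" "length ys = arity r" "b = of_bool (holds S r (map e ys))"
              by (elim conjE exE) simp
            moreover have "set ys \<subseteq> A" using L by blast
            ultimately show ?R by (intro exI[of _ r] exI[of _ ys]) (simp add: l Cons)
          next
            assume ?R
            then obtain r zs where "set zs \<subseteq> A" "length zs = arity r"
              "l = of_bool (holds S r (map e zs)) # symbol_code r # zs" by blast
            then show ?L by (auto simp: l Cons)
          qed
          have "2 \<le> length l" by (simp add: l Cons)
          then show ?thesis unfolding P_def sx using 1 2 by blast
        qed (auto simp: P_def l)
      qed (auto simp: P_def)
      then show ?thesis by (simp add: atomic_diagram_def N_def list_encode_eq conj_ac del: list_encode.simps)
    qed
    have "decidable D (\<lambda>v. P (dec v))"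
      unfolding P_def ex_rs_symbol
      by (intro computable_intros decidable_comp[OF A] decidable_computable decidable_comp[OF rel])
    moreover have "v \<in> atomic_diagram N \<longleftrightarrow> P (dec v)" for v
      using P[of "dec v"] enc_nat_list[of "dec v"] by simp
    ultimately show ?thesis by (simp add: turing_le_iff_decidable)
  qed
  ultimately show ?thesis by (rule that)
qed

section \<open>A sequence of polynomials with pairwise distinct roots\<close>

text \<open>Sylvester's recursion in shifted form: \<open>s = q + 1\<close> is replaced by
  \<open>s * (s - 1) + 1\<close>. Each \<open>q_e + 1\<close> divides every later
  \<open>q_f\<close>, so a common root of two of them would give \<open>1 = 0\<close>.\<close>

primrec qseq :: "'a::comm_ring_1 \<Rightarrow> nat \<Rightarrow> 'a" where
  "qseq x 0 = x"
| "qseq x (Suc e) = qseq x e * (qseq x e + 1)"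

lemma qseq_hom: assumes "comm_ring_hom h" shows "h (qseq x e) = qseq (h x) e"
proof -
  interpret comm_ring_hom h by fact
  show ?thesis by (induction e) (auto simp: hom_add hom_mult)
qed

lemma qseq_dvd: "e < f \<Longrightarrow> qseq x e + 1 dvd qseq x f"
proof (induction f)
  case (Suc f)
  then show ?case by (cases "e = f") (auto intro: dvd_mult2)
qed simp

lemma qseq_root_unique:
  fixes x :: "'a::idom"
  assumes "qseq x e + 1 = 0" "qseq x f + 1 = 0" shows "e = f"
proof -
  have False if "e < f" "qseq x e + 1 = 0" "qseq x f + 1 = 0" for e f
    using qseq_dvd[OF that(1), of x] that(2,3) by simp
  then show ?thesis using assms by (metis linorder_neqE_nat)
qed

lemma degree_qseq: "degree (qseq [:0, 1 :: 'k::idom:] e) > 0"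
proof (induction e)
  case (Suc e)
  define q where "q = qseq [:0, 1 :: 'k:] e"
  have q: "degree q > 0" using Suc by (simp add: q_def)
  then have "degree (q + 1) = degree q" by (intro degree_add_eq_left) simp
  then have "q \<noteq> 0" "q + 1 \<noteq> 0" using q by auto
  then show ?case using q by (simp add: degree_mult_eq q_def)
qed simp

lemma qseq_root_exists: "\<exists>x :: 'k::alg_closed_field. qseq x e + 1 = 0"
proof -
  have "degree (qseq [:0, 1 :: 'k:] e + 1) = degree (qseq [:0, 1 :: 'k:] e)"
    by (rule degree_add_eq_left) (use degree_qseq in simp)
  then obtain x where x: "poly (qseq [:0, 1 :: 'k:] e + 1) x = 0"
    using degree_qseq alg_closed_imp_poly_has_root by metis
  have "poly (qseq [:0, 1:] e) x = qseq x e"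
    using qseq_hom[of "\<lambda>p. poly p x" "[:0, 1:]" e] by (simp add: comm_ring_hom_def ring_hom_def poly_hom.semiring_hom_axioms)
  then show ?thesis using x by auto
qed

context numbered_alg_closed
begin

definition is_root :: "nat \<Rightarrow> nat \<Rightarrow> bool" where "is_root e c \<longleftrightarrow> qseq (\<kappa> c) e + 1 = 0"

lemma decidable_is_root [computable_intros]:
  assumes "computable D e" "computable D c" shows "decidable D (\<lambda>x. is_root (e x) (c x))"
proof -
  define S where "S a = mulk a (addk a (code_of 1))" for a
  have "computable D S" unfolding S_def by (intro computable_intros)
  then have "decidable D (\<lambda>x. \<kappa> (addk ((S ^^ e x) (c x)) (code_of 1)) = 0)"
    by (intro decidable_\<kappa>_eq_const computable_intros computable_funpow assms)
  moreover have "\<kappa> ((S ^^ k) a) = qseq (\<kappa> a) k" for k a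
    by (induction k) (auto simp: S_def mulk addk)
  ultimately show ?thesis by (simp add: is_root_def addk)
qed

definition canonical :: "nat \<Rightarrow> bool" where "canonical c \<longleftrightarrow> (\<forall>i<c. \<kappa> i \<noteq> \<kappa> c)"

lemma decidable_canonical [computable_intros]:
  assumes "computable D c" shows "decidable D (\<lambda>x. canonical (c x))"
  unfolding canonical_def by (intro computable_intros decidable_\<kappa>_eq assms computable_comp[OF assms])

lemma canonical_ex: "\<exists>c. canonical c \<and> \<kappa> c = x"
proof -
  define c where "c = (LEAST c. \<kappa> c = x)"
  have c: "\<kappa> c = x" unfolding c_def by (rule LeastI_ex[OF surj])
  have "\<kappa> i \<noteq> \<kappa> c" if "i < c" for i
    unfolding c using that not_less_Least[of i "\<lambda>c. \<kappa> c = x"] by (simp add: c_def)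
  then show ?thesis using c unfolding canonical_def by blast
qed

lemma canonical_inj:
  assumes "canonical c" "canonical d" "\<kappa> c = \<kappa> d" shows "c = d"
proof (rule ccontr)
  assume "c \<noteq> d"
  then have "c < d \<or> d < c" by linarith
  then show False using assms unfolding canonical_def by metis
qed

text \<open>Different indices have different roots, so the canonical codes of roots with even index
  are unbounded and the search for a larger one always succeeds. Monotonicity later bounds the
  search for the position of a given code.\<close>

lemma reserved_sequence:
  obtains g :: "nat \<Rightarrow> nat" where "strict_mono g" "\<And>D. computable D g"
    "\<And>t. canonical (g t)" "\<And>t. \<exists>e. is_root (2 * e) (g t)"
proof -
  have ex: "\<exists>q :: nat \<times> nat. m < fst q \<and> canonical (fst q) \<and> is_root (snd q + snd q) (fst q)" for m :: nat
  proof (rule ccontr)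
    assume no: "\<not> ?thesis"
    have "\<exists>c. canonical c \<and> is_root (2 * e) c" for e
      unfolding is_root_def using qseq_root_exists canonical_ex by metis
    then obtain r where r: "\<And>e. canonical (r e)" "\<And>e. is_root (2 * e) (r e)" by metis
    have "inj r"
    proof (rule injI)
      fix e f assume "r e = r f"
      then have "2 * e = 2 * f" using r(2)[of e] r(2)[of f] qseq_root_unique unfolding is_root_def by metis
      then show "e = f" by simp
    qed
    moreover have "range r \<subseteq> {..m}"
    proof
      fix c assume "c \<in> range r"
      then obtain e where "c = r e" by blast
      then show "c \<in> {..m}" using no r[of e] by (metis atMost_iff fst_conv mult_2 not_le snd_conv)
    qed
    ultimately show False by (meson finite_atMost finite_imageD finite_subset infinite_UNIV_nat)
  qed
  have "decidable {} (\<lambda>p :: nat \<times> nat \<times> nat. fst p < fst (snd p) \<and> canonical (fst (snd p)) \<and>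
      is_root (snd (snd p) + snd (snd p)) (fst (snd p)))"
    by (intro computable_intros)
  then obtain f :: "nat \<Rightarrow> nat \<times> nat" where f: "computable {} f" "\<And>m. m < fst (f m) \<and> canonical (fst (f m)) \<and>
      is_root (snd (f m) + snd (f m)) (fst (f m))"
    by (rule computable_search[where R = "\<lambda>m q. m < fst q \<and> canonical (fst q) \<and> is_root (snd q + snd q) (fst q)"])
      (use ex in blast)+
  define S where "S m = fst (f m)" for m
  define g where "g t = (S ^^ Suc t) 0" for t
  have S: "computable {} S" unfolding S_def by (rule computable_fst[OF f(1)])
  have g_Suc: "g t = S ((S ^^ t) 0)" for t by (simp add: g_def)
  show ?thesis
  proof (rule that[of g])
    show "strict_mono g"
      unfolding strict_mono_Suc_iff using f(2) by (simp add: g_def S_def)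
    show "computable D g" for D
      unfolding g_def by (intro computable_funpow computable_empty_oracle[OF S] computable_intros)
    show "canonical (g t)" for t unfolding g_Suc S_def using f(2) by blast
    show "\<exists>e. is_root (2 * e) (g t)" for t unfolding g_Suc S_def mult_2 using f(2) by blast
  qed
qed

end

section \<open>Copies of the schemes computed from an enumeration\<close>

context variety
begin

text \<open>Membership in the kernel and its negation are both existential statements about
  polynomials, so a search decides the kernel; the second form is a Bezout identity evaluated at
  \<open>z\<close>.\<close>

lemma zero_test:
  assumes p: "p \<in> polys_in {0..n}"
  shows "\<Psi> p = 0 \<longleftrightarrow> (\<exists>s\<in>polys_in {0..n}. p = poly Fp (Var 0) * s)"
    and "\<Psi> p \<noteq> 0 \<longleftrightarrow> (\<exists>u\<in>polys_in {0..n}. \<exists>s\<in>polys_in {0..n}. \<exists>N\<in>polys_in {1..n}. N \<noteq> 0 \<and>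
      p * u = N + poly Fp (Var 0) * s)"
proof -
  have F0: "\<Psi> (poly Fp (Var 0)) = 0" using ev_Fp by (simp add: ev_def)
  obtain P where P: "\<And>i. coeff P i \<in> polys_in {1..n}" "p = poly P (Var 0)"
    using polys_in_decompose[of p 0 "{1..n}"] p unfolding insert_vars by metis
  have pe: "\<Psi> p = ev P" by (simp add: P(2) ev_def)
  show 1: "\<Psi> p = 0 \<longleftrightarrow> (\<exists>s\<in>polys_in {0..n}. p = poly Fp (Var 0) * s)"
  proof
    assume "\<Psi> p = 0"
    then have "Fp dvd P" using ev_eq_0_iff[OF P(1)] pe by simp
    then obtain T where T: "\<And>i. coeff T i \<in> polys_in {1..n}" "P = Fp * T"
      using dvd_in[OF coef P(1)] by blast
    then show "\<exists>s\<in>polys_in {0..n}. p = poly Fp (Var 0) * s"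
      using poly_in_XZ[OF T(1)] by (intro bexI[of _ "poly T (Var 0)"]) (auto simp: P(2))
  qed (auto simp: \<Psi>.hom_mult F0)
  show "\<Psi> p \<noteq> 0 \<longleftrightarrow> (\<exists>u\<in>polys_in {0..n}. \<exists>s\<in>polys_in {0..n}. \<exists>N\<in>polys_in {1..n}. N \<noteq> 0 \<and>
      p * u = N + poly Fp (Var 0) * s)"
  proof
    assume "\<Psi> p \<noteq> 0"
    then have "\<not> Fp dvd P" using ev_eq_0_iff[OF P(1)] pe by simp
    then obtain U V d where U: "\<And>i. coeff U i \<in> polys_in {1..n}" "d \<in> polys_in {1..n}" "d \<noteq> 0" "U * P + V * Fp = [:d:]"
      by (rule monic_bezout_in[OF irr coef P(1)]) blast
    have co: "coeff (U * P - [:d:]) k \<in> polys_in {1..n}" for k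
      unfolding coeff_diff coeff_mult
      by (intro minus_in sum_in mult_in P(1) U(1)) (use U(2) in \<open>auto simp: coeff_pCons split: nat.splits\<close>)
    have "U * P - [:d:] = Fp * (- V)" using U(4) by (simp add: algebra_simps flip: U(4))
    then have "Fp dvd U * P - [:d:]" by simp
    then obtain T where T: "\<And>i. coeff T i \<in> polys_in {1..n}" "U * P - [:d:] = Fp * T"
      using dvd_in[OF coef co] by blast
    have "poly (U * P - [:d:]) (Var 0) = poly (Fp * T) (Var 0)" by (simp only: T(2))
    then have "p * poly U (Var 0) = d + poly Fp (Var 0) * poly T (Var 0)"
      by (simp add: P(2) algebra_simps)
    then show "\<exists>u\<in>polys_in {0..n}. \<exists>s\<in>polys_in {0..n}. \<exists>N\<in>polys_in {1..n}. N \<noteq> 0 \<and>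
      p * u = N + poly Fp (Var 0) * s"
      using poly_in_XZ[OF T(1)] poly_in_XZ[OF U(1)] U(2,3) by blast
  next
    assume "\<exists>u\<in>polys_in {0..n}. \<exists>s\<in>polys_in {0..n}. \<exists>N\<in>polys_in {1..n}. N \<noteq> 0 \<and>
      p * u = N + poly Fp (Var 0) * s"
    then obtain u s N where N: "N \<in> polys_in {1..n}" "N \<noteq> 0" "p * u = N + poly Fp (Var 0) * s" by blast
    have "\<Psi> p * \<Psi> u = \<Psi> N" using arg_cong[OF N(3), of \<Psi>] by (simp add: \<Psi>.hom_mult \<Psi>.hom_add F0)
    then show "\<Psi> p \<noteq> 0" using inj_X[OF N(1)] N(2) by auto
  qed
qed

abbreviation Ix :: "(nat \<times> 'k) set" where "Ix \<equiv> {1..n} \<times> UNIV"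

abbreviation den_X :: "'f set" where
  "den_X \<equiv> {h \<in> \<Psi> ` polys_in {1..n}. h \<noteq> 0 \<and> (\<forall>i\<in>Ix. h \<notin> (*) (lin i) ` \<Psi> ` polys_in {0..n})}"

lemma den_X_iff: "h \<in> polys_in {1..n} \<Longrightarrow> \<Psi> h \<in> den_X \<longleftrightarrow> (\<forall>j\<in>{1..n}. \<forall>c. msubst j c h \<noteq> 0)"
proof -
  assume h: "h \<in> polys_in {1..n}"
  have "\<Psi> h \<noteq> 0" if "\<forall>j\<in>{1..n}. \<forall>c. msubst j c h \<noteq> 0"
  proof
    assume "\<Psi> h = 0"
    then have "h = 0" using inj_X[OF h] by blast
    then have "msubst 1 0 h = 0" by (simp add: msubst_simps)
    then show False using that n by auto
  qed
  then show ?thesis using multiple_X_iff[OF h] h by auto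
qed

end

locale scheme_copy = variety n Fp \<Psi> + numbered_alg_closed \<kappa> addk mulk n
  for n :: nat and Fp :: "'k::alg_closed_field mpoly poly" and \<Psi> :: "'k mpoly \<Rightarrow> 'f::field"
    and \<kappa> :: "nat \<Rightarrow> 'k" and addk mulk :: "nat \<Rightarrow> nat \<Rightarrow> nat"
begin

lemma decidable_ker [computable_intros]:
  assumes "computable D p" shows "decidable D (\<lambda>x. \<Psi> (pval (p x)) = 0)"
proof -
  \<comment> \<open>The defining polynomial is fixed, so its code is a constant of the
    algorithm.\<close>
  obtain f where f: "pval f = poly Fp (Var 0)" by (rule pval_surj[OF poly_in_XZ[OF coef]])
  have "decidable D (\<lambda>p. \<Psi> (pval p) = 0)"
  proof (rule decidable_by_search)
    show "decidable D (\<lambda>q. pval (fst q @ pneg (pmul f (snd q))) = 0)" by (intro computable_intros)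
    show "decidable D (\<lambda>q. z_free (snd (snd (snd q))) \<and> pval (snd (snd (snd q))) \<noteq> 0 \<and>
        pval (pmul (fst q) (fst (snd q)) @ pneg (snd (snd (snd q)) @ pmul f (fst (snd (snd q))))) = 0)"
      by (intro computable_intros)
    show "\<Psi> (pval x) = 0 \<longleftrightarrow> (\<exists>y. pval (x @ pneg (pmul f y)) = 0)" for x
      unfolding zero_test(1)[OF pval_in] by (auto simp: f intro: pval_in) (metis pval_surj)
    show "\<Psi> (pval x) \<noteq> 0 \<longleftrightarrow> (\<exists>y. z_free (snd (snd y)) \<and> pval (snd (snd y)) \<noteq> 0 \<and>
        pval (pmul x (fst y) @ pneg (snd (snd y) @ pmul f (fst (snd y)))) = 0)" for x
    proof
      assume "\<Psi> (pval x) \<noteq> 0"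
      then obtain u s N where N: "u \<in> polys_in {0..n}" "s \<in> polys_in {0..n}" "N \<in> polys_in {1..n}" "N \<noteq> 0"
        "pval x * u = N + poly Fp (Var 0) * s" unfolding zero_test(2)[OF pval_in] by blast
      obtain uc sc Nc where "pval uc = u" "pval sc = s" "z_free Nc" "pval Nc = N"
        using pval_surj[OF N(1)] pval_surj[OF N(2)] pval_surj_X[OF N(3)] by metis
      then show "\<exists>y. z_free (snd (snd y)) \<and> pval (snd (snd y)) \<noteq> 0 \<and>
        pval (pmul x (fst y) @ pneg (snd (snd y) @ pmul f (fst (snd y)))) = 0"
        using N(4,5) by (intro exI[of _ "(uc, sc, Nc)"]) (simp add: f)
    next
      assume "\<exists>y. z_free (snd (snd y)) \<and> pval (snd (snd y)) \<noteq> 0 \<and>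
        pval (pmul x (fst y) @ pneg (snd (snd y) @ pmul f (fst (snd y)))) = 0"
      then obtain u s N where "z_free N" "pval N \<noteq> 0" "pval x * pval u = pval N + poly Fp (Var 0) * pval s"
        by (auto simp: f algebra_simps)
      then show "\<Psi> (pval x) \<noteq> 0" unfolding zero_test(2)[OF pval_in] using pval_in pval_in_X by blast
    qed
  qed
  then show ?thesis using assms by (rule decidable_comp)
qed

end

text \<open>
  The points \<open>x\<^sub>1 = c\<close> with \<open>c\<close> in a set \<open>Rm\<close> that is only enumerated (by \<open>V\<close>) have to be absent.
  The label of such a point is therefore moved to a reserved point \<open>g t\<close> as soon as the stage \<open>t\<close>
  witnessing \<open>c \<in> Rm\<close> is reached, and the reserved points with such indices lose their own labels.
  The relations of the structure depend on the labels only, and the sections over an open set can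
  be enumerated since poles at the old position of a moved label are harmless.
\<close>

locale scheme_enumeration = scheme_copy n Fp \<Psi> \<kappa> addk mulk
  for n :: nat and Fp :: "'k::alg_closed_field mpoly poly" and \<Psi> :: "'k mpoly \<Rightarrow> 'f::field"
    and \<kappa> :: "nat \<Rightarrow> 'k" and addk mulk :: "nat \<Rightarrow> nat \<Rightarrow> nat" +
  fixes D :: "nat set" and V :: "nat \<Rightarrow> nat \<Rightarrow> bool" and g :: "nat \<Rightarrow> nat"
  assumes V_decidable: "decidable D (\<lambda>p. V (fst p) (snd p))"
    and V_canonical: "\<And>c s. V c s \<Longrightarrow> canonical c"
    and g_mono: "strict_mono g" and g_computable: "computable D g" and g_canonical: "\<And>t. canonical (g t)"
    and g_reserved: "\<And>t s. \<not> V (g t) s"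
begin

lemmas decidable_V [computable_intros] = decidable_uncurry[of D V, OF V_decidable]
lemmas computable_g [computable_intros] = computable_comp[OF g_computable]

definition Rm :: "nat set" where "Rm = {c. \<exists>s. V c s}"

definition wc :: "nat \<Rightarrow> nat" where "wc t = fst (prod_decode t)"
definition ws :: "nat \<Rightarrow> nat" where "ws t = snd (prod_decode t)"

lemma computable_wc [computable_intros]: "computable D t \<Longrightarrow> computable D (\<lambda>x. wc (t x))"
proof -
  have "wc z = fst (dec z :: nat \<times> nat)" for z by (simp add: wc_def dec_Pair)
  then show "computable D t \<Longrightarrow> computable D (\<lambda>x. wc (t x))" by (simp add: computable_intros)
qed

lemma computable_ws [computable_intros]: "computable D t \<Longrightarrow> computable D (\<lambda>x. ws (t x))"
proof -
  have "ws z = snd (dec z :: nat \<times> nat)" for z by (simp add: ws_def dec_Pair)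
  then show "computable D t \<Longrightarrow> computable D (\<lambda>x. ws (t x))" by (simp add: computable_intros)
qed

text \<open>A stage codes a point together with a witness for its removal; only the least stage of a
  point counts, so every removed point claims exactly one reserved point.\<close>

definition stage :: "nat \<Rightarrow> bool" where
  "stage t \<longleftrightarrow> V (wc t) (ws t) \<and> (\<forall>u<t. wc u = wc t \<longrightarrow> \<not> V (wc u) (ws u))"

lemma decidable_stage [computable_intros]:
  assumes "computable D t" shows "decidable D (\<lambda>x. stage (t x))"
  unfolding stage_def by (intro computable_intros assms computable_comp[OF assms])

lemma stage_unique: "stage t \<Longrightarrow> stage u \<Longrightarrow> wc t = wc u \<Longrightarrow> t = u"
  unfolding stage_def by (cases t u rule: linorder_cases) auto

definition stage_of :: "nat \<Rightarrow> nat" where "stage_of c = (LEAST t. wc t = c \<and> V (wc t) (ws t))"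

lemma stage_of: "c \<in> Rm \<Longrightarrow> stage (stage_of c) \<and> wc (stage_of c) = c"
proof -
  assume "c \<in> Rm"
  then obtain s where "V c s" unfolding Rm_def by blast
  then have "wc (prod_encode (c, s)) = c \<and> V (wc (prod_encode (c, s))) (ws (prod_encode (c, s)))"
    by (simp add: wc_def ws_def)
  then have 1: "wc (stage_of c) = c \<and> V (wc (stage_of c)) (ws (stage_of c))" unfolding stage_of_def by (rule LeastI)
  have "\<not> V (wc u) (ws u)" if "u < stage_of c" "wc u = c" for u
    using not_less_Least[OF that(1)[unfolded stage_of_def]] that(2) by simp
  then show ?thesis unfolding stage_def using 1 by metis
qed

lemma stage_Rm: "stage t \<Longrightarrow> wc t \<in> Rm"
  unfolding stage_def Rm_def by blast

lemma stage_of_wc: "stage t \<Longrightarrow> stage_of (wc t) = t"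
  using stage_of[OF stage_Rm] stage_unique by blast

lemma g_notin_Rm: "g t \<notin> Rm" using g_reserved unfolding Rm_def by blast

text \<open>The bound on \<open>t\<close> loses nothing, since \<open>t \<le> g t\<close>, and makes
  the predicate decidable.\<close>

definition taken :: "nat \<Rightarrow> bool" where "taken c \<longleftrightarrow> (\<exists>t<Suc c. g t = c \<and> stage t)"

lemma taken_iff: "taken c \<longleftrightarrow> (\<exists>t. g t = c \<and> stage t)"
proof
  assume "\<exists>t. g t = c \<and> stage t"
  then obtain t where t: "g t = c" "stage t" by blast
  have "t \<le> g t" using g_mono by (rule strict_mono_imp_increasing)
  then have "t < Suc c" using t(1) by simp
  then show "taken c" unfolding taken_def using t by blast
qed (auto simp: taken_def)

definition valid :: "nat \<times> nat \<Rightarrow> bool" where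
  "valid l \<longleftrightarrow> 1 \<le> fst l \<and> fst l \<le> n \<and> canonical (snd l) \<and> (fst l = 1 \<longrightarrow> \<not> taken (snd l))"

lemma decidable_valid [computable_intros]:
  assumes "computable D l" shows "decidable D (\<lambda>x. valid (l x))"
  unfolding valid_def taken_def by (intro computable_intros assms computable_comp[OF assms])

text \<open>Not claimed to be computable: whether \<open>c\<close> is ever enumerated may not be
  decidable from \<open>D\<close>. It only interprets labels and is never evaluated.\<close>

definition moved :: "nat \<Rightarrow> nat" where "moved c = (if c \<in> Rm then g (stage_of c) else c)"

definition pt :: "nat \<times> nat \<Rightarrow> nat \<times> 'k" where
  "pt l = (fst l, \<kappa> (if fst l = 1 then moved (snd l) else snd l))"

definition \<Lambda> :: "(nat \<times> 'k) set" where "\<Lambda> = Ix - {1} \<times> \<kappa> ` Rm"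

lemma \<Lambda>_Ix: "\<Lambda> \<subseteq> Ix" by (auto simp: \<Lambda>_def)

lemma moved_canonical: "canonical c \<Longrightarrow> canonical (moved c)"
  by (simp add: moved_def g_canonical)

lemma moved_inj:
  assumes "canonical c" "canonical d" "\<not> taken c" "\<not> taken d" "moved c = moved d" shows "c = d"
proof -
  have inj: "g t = g u \<longleftrightarrow> t = u" for t u using g_mono by (simp add: strict_mono_eq)
  show ?thesis
  proof (cases "c \<in> Rm"; cases "d \<in> Rm")
    assume R: "c \<in> Rm" "d \<in> Rm"
    then have "stage_of c = stage_of d" using assms(5) by (simp add: moved_def inj)
    then have "wc (stage_of c) = wc (stage_of d)" by (rule arg_cong)
    then show ?thesis unfolding conjunct2[OF stage_of[OF R(1)]] conjunct2[OF stage_of[OF R(2)]] .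
  next
    assume c: "c \<in> Rm" and "d \<notin> Rm"
    then have "taken d" unfolding taken_iff using assms(5) stage_of[OF c] by (auto simp: moved_def)
    then show ?thesis using assms(4) by blast
  next
    assume "c \<notin> Rm" and d: "d \<in> Rm"
    then have "taken c" unfolding taken_iff using assms(5) stage_of[OF d] by (auto simp: moved_def)
    then show ?thesis using assms(3) by blast
  qed (use assms(5) in \<open>simp add: moved_def\<close>)
qed

lemma canonical_in_Rm: "canonical c \<Longrightarrow> \<kappa> c \<in> \<kappa> ` Rm \<Longrightarrow> c \<in> Rm"
proof -
  assume c: "canonical c" "\<kappa> c \<in> \<kappa> ` Rm"
  then obtain d where d: "d \<in> Rm" "\<kappa> c = \<kappa> d" by blast
  then have "canonical d" using V_canonical unfolding Rm_def by blast
  then show ?thesis using canonical_inj[OF c(1) _ d(2)] d(1) by simp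
qed

text \<open>The label of a removed point \<open>wc t\<close> is reused for the reserved point
  \<open>g t\<close>, and exactly the reserved points reached in this way have lost their own
  label.\<close>

lemma pt_bij: "bij_betw pt {l. valid l} \<Lambda>"
proof (rule bij_betw_imageI)
  show "inj_on pt {l. valid l}"
  proof (rule inj_onI)
    fix l m assume l: "l \<in> {l. valid l}" and m: "m \<in> {l. valid l}" and e: "pt l = pt m"
    have f: "fst l = fst m" using e by (simp add: pt_def)
    have "snd l = snd m"
    proof (cases "fst l = 1")
      case True
      have "\<kappa> (moved (snd l)) = \<kappa> (moved (snd m))" using e f True by (simp add: pt_def)
      then have "moved (snd l) = moved (snd m)"
        using l m by (intro canonical_inj moved_canonical) (simp_all add: valid_def)
      moreover have "fst m = 1" using True f by simp
      ultimately show ?thesis using True l m moved_inj[of "snd l" "snd m"] by (simp add: valid_def)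
    next
      case False
      then show ?thesis using e f l m by (intro canonical_inj) (auto simp: pt_def valid_def)
    qed
    then show "l = m" using f by (simp add: prod_eq_iff)
  qed
  show "pt ` {l. valid l} = \<Lambda>"
  proof (intro equalityI subsetI)
    fix i assume "i \<in> pt ` {l. valid l}"
    then obtain l where l: "valid l" "i = pt l" by blast
    have "\<kappa> (moved (snd l)) \<notin> \<kappa> ` Rm" if "fst l = 1"
    proof
      assume "\<kappa> (moved (snd l)) \<in> \<kappa> ` Rm"
      then have "moved (snd l) \<in> Rm" using canonical_in_Rm moved_canonical l(1) by (auto simp: valid_def)
      then show False using g_notin_Rm by (auto simp: moved_def split: if_splits)
    qed
    then show "i \<in> \<Lambda>" using l by (auto simp: \<Lambda>_def pt_def valid_def)
  next
    fix i assume i: "i \<in> \<Lambda>"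
    obtain j a where ja: "i = (j, a)" by (cases i)
    obtain c where c: "canonical c" "\<kappa> c = a" using canonical_ex by blast
    have j: "1 \<le> j" "j \<le> n" using i ja by (auto simp: \<Lambda>_def)
    show "i \<in> pt ` {l. valid l}"
    proof (cases "j = 1 \<and> taken c")
      case False
      then have "valid (j, c)" using j c by (auto simp: valid_def)
      moreover have "pt (j, c) = i"
        using i ja c(2) by (auto simp: pt_def moved_def \<Lambda>_def)
      ultimately show ?thesis by blast
    next
      case True
      then obtain t where t: "g t = c" "stage t" unfolding taken_iff by blast
      have R: "wc t \<in> Rm" by (rule stage_Rm[OF t(2)])
      have "\<not> taken (wc t)" using R g_notin_Rm unfolding taken_iff by metis
      moreover have "canonical (wc t)" using R V_canonical unfolding Rm_def by blast
      ultimately have "valid (1, wc t)" using j by (auto simp: valid_def)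
      moreover have "pt (1, wc t) = i" using R t ja c(2) True by (simp add: pt_def moved_def stage_of_wc)
      ultimately show ?thesis by blast
    qed
  qed
qed

lemma pt_inj: "valid l \<Longrightarrow> valid m \<Longrightarrow> pt l = pt m \<longleftrightarrow> l = m"
  using pt_bij unfolding bij_betw_def inj_on_def by blast

lemma pt_\<Lambda>: "valid l \<Longrightarrow> pt l \<in> \<Lambda>"
  using pt_bij unfolding bij_betw_def by blast

text \<open>
  A code consists of a tag, a label for a point, an open set given by a flag for nonemptiness and a
  list of labels for the missing points, and a section given by numerator, denominator without
  linear factors, certificates for the latter, and a list of linear factors with evidence.
\<close>

type_synonym opcode = "nat \<times> (nat \<times> nat) list"
type_synonym secode = "nat list list \<times> nat list list \<times> (nat list \<times> nat \<times> nat list) list \<times> (nat \<times> nat \<times> nat) list"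
type_synonym elcode = "nat \<times> (nat \<times> nat) \<times> opcode \<times> secode"

text \<open>Invalid labels denote the generic point, so every code has a meaning.\<close>

definition point :: "nat \<times> nat \<Rightarrow> 'f set" where
  "point l = (if valid l then P.PP \<Lambda> (pt l) else {0})"

definition missing :: "opcode \<Rightarrow> (nat \<times> 'k) set" where
  "missing u = pt ` {l \<in> set (snd u). valid l}"

definition opn :: "opcode \<Rightarrow> 'f set set" where
  "opn u = (if fst u = 0 then {} else Spec (P.B \<Lambda>) - P.PP \<Lambda> ` missing u)"

text \<open>Three kinds of evidence for a permitted pole: a missing label taken at face value, a
  constant witnessed as removed, and the reserved position to which a missing label has moved. Each
  can be checked although \<open>moved\<close> cannot be computed.\<close>

definition factor_ok :: "opcode \<Rightarrow> nat \<times> nat \<times> nat \<Rightarrow> bool" where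
  "factor_ok u f \<longleftrightarrow> 1 \<le> fst f \<and> fst f \<le> n \<and>
     ((valid (fst f, fst (snd f)) \<and> (fst f, fst (snd f)) \<in> set (snd u)) \<or>
      (fst f = 1 \<and> V (fst (snd f)) (snd (snd f))) \<or>
      (fst f = 1 \<and> stage (snd (snd f)) \<and> fst (snd f) = g (snd (snd f)) \<and>
        valid (1, wc (snd (snd f))) \<and> (1, wc (snd (snd f))) \<in> set (snd u)))"

definition section_ok :: "opcode \<Rightarrow> secode \<Rightarrow> bool" where
  "section_ok u d \<longleftrightarrow> fst u \<noteq> 0 \<and> z_free (fst (snd d)) \<and>
     (\<forall>j<n. \<exists>t\<in>set (fst (snd (snd d))). lin_free_cert (Suc j) (fst (snd d)) t) \<and>
     (\<forall>f\<in>set (snd (snd (snd d))). factor_ok u f)"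

text \<open>Malformed codes, and all codes over the empty set, denote \<open>0 / 1\<close>.\<close>

definition numer :: "opcode \<Rightarrow> secode \<Rightarrow> nat list list" where
  "numer u d = (if section_ok u d then fst d else [])"

definition denom :: "opcode \<Rightarrow> secode \<Rightarrow> nat list list" where
  "denom u d = (if section_ok u d
     then pmul (fst (snd d)) (lin_prod (map (\<lambda>f. (fst f, fst (snd f))) (snd (snd (snd d))))) else cst (code_of 1))"

definition sval :: "opcode \<Rightarrow> secode \<Rightarrow> 'f" where
  "sval u d = \<Psi> (pval (numer u d)) / \<Psi> (pval (denom u d))"

definition elt :: "elcode \<Rightarrow> 'f rs_element" where
  "elt x = (if fst x = 0 then Pt (point (fst (snd x)))
     else if fst x = 1 then Op (opn (fst (snd (snd x))))
     else Sect (opn (fst (snd (snd x)))) (sval (fst (snd (snd x))) (snd (snd (snd x)))))"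

section \<open>The codes denote exactly the points, open sets and sections\<close>

lemma missing_\<Lambda>: "missing u \<subseteq> \<Lambda>" "finite (missing u)"
  unfolding missing_def using pt_\<Lambda> by auto

lemma factor_ok_sound:
  assumes "factor_ok u f" shows "(fst f, \<kappa> (fst (snd f))) \<in> (Ix - \<Lambda>) \<union> missing u"
proof -
  define j c t where "j = fst f" "c = fst (snd f)" "t = snd (snd f)"
  have I: "(j, \<kappa> c) \<in> Ix" using assms by (auto simp: factor_ok_def j_c_t_def)
  consider "valid (j, c)" "(j, c) \<in> set (snd u)" | "j = 1" "V c t"
    | "j = 1" "stage t" "c = g t" "valid (1, wc t)" "(1, wc t) \<in> set (snd u)"
    using assms unfolding factor_ok_def j_c_t_def by blast
  then have "(j, \<kappa> c) \<in> (Ix - \<Lambda>) \<union> missing u"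
  proof cases
    case 1
    show ?thesis
    proof (cases "j = 1 \<and> c \<in> Rm")
      \<comment> \<open>Such a label has moved, and the prime at its old position is absent from
        \<open>\<Lambda>\<close>.\<close>
      case True
      then show ?thesis using I by (auto simp: \<Lambda>_def)
    next
      case False
      then have "pt (j, c) = (j, \<kappa> c)" by (auto simp: pt_def moved_def)
      then show ?thesis unfolding missing_def using 1 by force
    qed
  next
    case 2
    then have "c \<in> Rm" unfolding Rm_def by blast
    then show ?thesis using I 2 by (auto simp: \<Lambda>_def)
  next
    case 3
    then have "pt (1, wc t) = (j, \<kappa> c)" using stage_Rm[OF 3(2)] by (simp add: pt_def moved_def stage_of_wc)
    then show ?thesis unfolding missing_def using 3 by force
  qed
  then show ?thesis by (simp add: j_c_t_def)
qed

lemma factor_ok_complete: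
  assumes "i \<in> (Ix - \<Lambda>) \<union> missing u"
  shows "\<exists>f. factor_ok u f \<and> i = (fst f, \<kappa> (fst (snd f)))"
  using assms
proof
  assume i: "i \<in> Ix - \<Lambda>"
  then obtain c where c: "i = (1, \<kappa> c)" "c \<in> Rm" by (cases i) (auto simp: \<Lambda>_def)
  then obtain s where "V c s" unfolding Rm_def by blast
  then show ?thesis using c(1) n by (intro exI[of _ "(1, c, s)"]) (simp add: factor_ok_def)
next
  assume "i \<in> missing u"
  then obtain l where l: "l \<in> set (snd u)" "valid l" "i = pt l" unfolding missing_def by blast
  show ?thesis
  proof (cases "fst l = 1 \<and> snd l \<in> Rm")
    case False
    then have "pt l = (fst l, \<kappa> (snd l))" by (auto simp: pt_def moved_def)
    then show ?thesis using l by (intro exI[of _ "(fst l, snd l, 0)"]) (auto simp: factor_ok_def valid_def)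
  next
    case True
    then have s: "stage (stage_of (snd l))" "wc (stage_of (snd l)) = snd l" using stage_of by auto
    have l1: "l = (1, snd l)" using True by (simp add: prod_eq_iff)
    have "pt l = (1, \<kappa> (g (stage_of (snd l))))" using True by (simp add: pt_def moved_def)
    then show ?thesis using l l1 s n
      by (intro exI[of _ "(1, g (stage_of (snd l)), stage_of (snd l))"]) (auto simp: factor_ok_def)
  qed
qed

lemma lin_prod_eq:
  assumes "\<And>f. f \<in> set fs \<Longrightarrow> factor_ok u f"
  shows "\<Psi> (pval (lin_prod (map (\<lambda>f. (fst f, fst (snd f))) fs))) =
    prod_list (map lin (map (\<lambda>f. (fst f, \<kappa> (fst (snd f)))) fs))"
proof -
  have "pval (lin_prod (map (\<lambda>f. (fst f, fst (snd f))) fs)) =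
      prod_list (map (\<lambda>f. Var (fst f) - Const (\<kappa> (fst (snd f)))) fs)"
    by (subst pval_lin_prod) (use assms in \<open>auto simp: factor_ok_def o_def\<close>)
  also have "\<Psi> \<dots> = prod_list (map lin (map (\<lambda>f. (fst f, \<kappa> (fst (snd f)))) fs))"
    by (simp add: \<Psi>.hom_prod_list o_def lin_def)
  finally show ?thesis .
qed

lemma section_okD:
  assumes "section_ok u d"
  shows "\<Psi> (pval (fst (snd d))) \<in> den_X"
    "set (map (\<lambda>f. (fst f, \<kappa> (fst (snd f)))) (snd (snd (snd d)))) \<subseteq> (Ix - \<Lambda>) \<union> missing u"
    "\<Psi> (pval (denom u d)) = \<Psi> (pval (fst (snd d))) *
       prod_list (map lin (map (\<lambda>f. (fst f, \<kappa> (fst (snd f)))) (snd (snd (snd d)))))"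
proof -
  have z: "z_free (fst (snd d))" using assms by (simp add: section_ok_def)
  have "\<forall>c. msubst j c (pval (fst (snd d))) \<noteq> 0" if j: "j \<in> {1..n}" for j
  proof -
    from j have "j - 1 < n" "Suc (j - 1) = j" by auto
    then have "\<exists>t. lin_free_cert j (fst (snd d)) t" using assms unfolding section_ok_def by metis
    then show ?thesis unfolding lin_free_cert_iff[OF j] .
  qed
  then show "\<Psi> (pval (fst (snd d))) \<in> den_X" using den_X_iff[OF pval_in_X[OF z]] by blast
  have ok: "\<And>f. f \<in> set (snd (snd (snd d))) \<Longrightarrow> factor_ok u f" using assms by (simp add: section_ok_def)
  show "set (map (\<lambda>f. (fst f, \<kappa> (fst (snd f)))) (snd (snd (snd d)))) \<subseteq> (Ix - \<Lambda>) \<union> missing u"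
    unfolding set_map using factor_ok_sound[OF ok] by (rule image_subsetI)
  show "\<Psi> (pval (denom u d)) = \<Psi> (pval (fst (snd d))) *
       prod_list (map lin (map (\<lambda>f. (fst f, \<kappa> (fst (snd f)))) (snd (snd (snd d)))))"
    using assms lin_prod_eq[OF ok] by (simp add: denom_def \<Psi>.hom_mult)
qed

lemma missing_Ix: "(Ix - \<Lambda>) \<union> missing u \<subseteq> Ix"
  using missing_\<Lambda>(1) \<Lambda>_Ix by blast

lemma denom_nz: "\<Psi> (pval (denom u d)) \<noteq> 0"
proof (cases "section_ok u d")
  case True
  have "set (map (\<lambda>f. (fst f, \<kappa> (fst (snd f)))) (snd (snd (snd d)))) \<subseteq> Ix"
    using section_okD(2)[OF True] missing_Ix by (rule subset_trans)
  moreover have "\<Psi> (pval (fst (snd d))) \<noteq> 0" using section_okD(1)[OF True] by blast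
  ultimately show ?thesis
    unfolding section_okD(3)[OF True] by (intro no_zero_divisors P.prod_list_nz)
next
  case False
  have "Const (1 :: 'k) = 1" by (simp add: Const_def)
  then show ?thesis using False by (simp add: denom_def)
qed

lemma opn_eq_empty: "opn u = {} \<longleftrightarrow> fst u = 0"
proof -
  have "{0} \<noteq> P.PP \<Lambda> i" if "i \<in> missing u" for i
    using P.PP_nonzero[OF \<Lambda>_Ix, of i] missing_\<Lambda>(1) that by blast
  then have "{0} \<in> Spec (P.B \<Lambda>) - P.PP \<Lambda> ` missing u"
    unfolding P.Spec_B[OF \<Lambda>_Ix] by blast
  then show ?thesis unfolding opn_def by (metis empty_iff)
qed

lemma sval_sections: "sval u d \<in> sections (P.B \<Lambda>) (opn u)"
proof (cases "fst u = 0")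
  case True
  then show ?thesis by (simp add: opn_def sections_def sval_def numer_def section_ok_def)
next
  case u: False
  show ?thesis
  proof (cases "section_ok u d")
    case True
    have num: "pval (numer u d) \<in> polys_in {0..n}" by (rule pval_in)
    show ?thesis
      unfolding opn_def sval_def section_okD(3)[OF True] if_not_P[OF u] P.sections_B[OF \<Lambda>_Ix missing_\<Lambda>(1)]
      using section_okD(1,2)[OF True] num by blast
  next
    case False
    have "\<Psi> 1 \<in> den_X" by (subst den_X_iff) (auto simp: msubst_simps)
    moreover have "0 = \<Psi> 0 / (\<Psi> 1 * prod_list (map lin []))" by simp
    moreover have "sval u d = 0" using False by (simp add: sval_def numer_def)
    ultimately show ?thesis
      unfolding opn_def if_not_P[OF u] P.sections_B[OF \<Lambda>_Ix missing_\<Lambda>(1)]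
      by (intro CollectI exI[of _ "\<Psi> 0"] exI[of _ "\<Psi> 1"] exI[of _ "[]"]) auto
  qed
qed

text \<open>Certificates and evidence are chosen noneffectively; a code only has to exist, since
  \<open>section_ok\<close> checks evidence and does not search for it.\<close>

lemma sections_coded:
  assumes "s \<in> sections (P.B \<Lambda>) (opn u)" shows "\<exists>d. s = sval u d"
proof (cases "fst u = 0")
  case True
  then show ?thesis using assms by (intro exI[of _ undefined]) (simp add: opn_def sections_def sval_def numer_def section_ok_def)
next
  case u: False
  obtain p h ls where r: "s = p / (h * prod_list (map lin ls))" "p \<in> \<Psi> ` polys_in {0..n}" "h \<in> den_X"
    "set ls \<subseteq> (Ix - \<Lambda>) \<union> missing u"
    using assms unfolding opn_def if_not_P[OF u] P.sections_B[OF \<Lambda>_Ix missing_\<Lambda>(1)] by blast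
  obtain p' where p': "p' \<in> polys_in {0..n}" "p = \<Psi> p'" using r(2) by blast
  obtain pc where pc: "pval pc = p'" by (rule pval_surj[OF p'(1)])
  obtain h' where h': "h' \<in> polys_in {1..n}" "h = \<Psi> h'" using r(3) by blast
  obtain hc where hc: "z_free hc" "pval hc = h'" by (rule pval_surj_X[OF h'(1)])
  have "\<forall>j\<in>{1..n}. \<exists>t. lin_free_cert j hc t"
    using r(3) den_X_iff[OF h'(1)] h'(2) hc(2) lin_free_cert_iff by simp
  then obtain t where t: "\<And>j. j \<in> {1..n} \<Longrightarrow> lin_free_cert j hc (t j)" by metis
  obtain F where F: "\<And>i. i \<in> (Ix - \<Lambda>) \<union> missing u \<Longrightarrow> factor_ok u (F i) \<and> i = (fst (F i), \<kappa> (fst (snd (F i))))"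
    using factor_ok_complete[of _ u] by metis
  define d where "d = (pc, hc, map (\<lambda>j. t (Suc j)) [0..<n], map F ls)"
  have ok: "section_ok u d"
    unfolding section_ok_def
  proof (intro conjI allI impI ballI)
    fix j assume j: "j < n"
    then have "lin_free_cert (Suc j) hc (t (Suc j))" by (intro t) simp
    moreover have "t (Suc j) \<in> set (fst (snd (snd d)))" using j by (simp add: d_def)
    ultimately show "\<exists>t\<in>set (fst (snd (snd d))). lin_free_cert (Suc j) (fst (snd d)) t"
      unfolding d_def fst_conv snd_conv by blast
  next
    fix f assume "f \<in> set (snd (snd (snd d)))"
    then show "factor_ok u f" using F r(4) by (auto simp: d_def)
  qed (use u hc(1) in \<open>simp_all add: d_def\<close>)
  have "map (\<lambda>f. (fst f, \<kappa> (fst (snd f)))) (map F ls) = ls"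
    unfolding map_map o_def using r(4) by (intro map_idI conjunct2[OF F, symmetric]) (rule subsetD)
  then have "sval u d = s"
    unfolding sval_def section_okD(3)[OF ok] using ok by (simp add: numer_def d_def r(1) pc p' hc h')
  then show ?thesis by blast
qed

lemma opn_open: "zariski_open (P.B \<Lambda>) U \<longleftrightarrow> (\<exists>u. U = opn u)"
proof
  assume "zariski_open (P.B \<Lambda>) U"
  then consider "U = {}" | E where "E \<subseteq> \<Lambda>" "finite E" "U = Spec (P.B \<Lambda>) - P.PP \<Lambda> ` E"
    unfolding P.zariski_open_B[OF \<Lambda>_Ix] by blast
  then show "\<exists>u. U = opn u"
  proof cases
    case 1
    then show ?thesis by (intro exI[of _ "(0, [])"]) (simp add: opn_def)
  next
    case 2
    have "\<exists>L. finite L \<and> L \<subseteq> {l. valid l} \<and> E = pt ` L"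
      using finite_subset_image[OF 2(2), of pt "{l. valid l}"] 2(1) pt_bij unfolding bij_betw_def by metis
    then obtain L where L: "finite L" "L \<subseteq> {l. valid l}" "E = pt ` L" by blast
    obtain ls where ls: "set ls = L" using finite_list[OF L(1)] by blast
    have "missing (1, ls) = E" unfolding missing_def using ls L by auto
    then show ?thesis using 2(3) by (intro exI[of _ "(1, ls)"]) (simp add: opn_def)
  qed
next
  assume "\<exists>u. U = opn u"
  then show "zariski_open (P.B \<Lambda>) U"
    unfolding P.zariski_open_B[OF \<Lambda>_Ix] opn_def using missing_\<Lambda> by metis
qed

lemma point_0: "point (0, 0) = {0}" by (simp add: point_def valid_def)

lemma point_Spec: "point l \<in> Spec (P.B \<Lambda>)"
  unfolding P.Spec_B[OF \<Lambda>_Ix] point_def using pt_\<Lambda>[of l] by (cases "valid l") simp_all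

lemma Spec_points: "Spec (P.B \<Lambda>) = range point"
proof (intro equalityI subsetI)
  fix \<pp> assume "\<pp> \<in> Spec (P.B \<Lambda>)"
  then consider "\<pp> = {0}" | i where "i \<in> \<Lambda>" "\<pp> = P.PP \<Lambda> i"
    unfolding P.Spec_B[OF \<Lambda>_Ix] by blast
  then show "\<pp> \<in> range point"
  proof cases
    case 1
    then show ?thesis using point_0 rangeI[of point "(0, 0)"] by simp
  next
    case (2 i)
    then obtain l where l: "valid l" "i = pt l" using pt_bij unfolding bij_betw_def by blast
    then have "\<pp> = point l" by (simp add: point_def 2)
    then show ?thesis by simp
  qed
qed (use point_Spec in blast)

lemma range_elt: "range elt = universe (spec_structure (P.B \<Lambda>))"
proof (intro equalityI subsetI)
  fix y assume "y \<in> range elt"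
  then obtain x where x: "y = elt x" by blast
  have "zariski_open (P.B \<Lambda>) (opn u)" for u unfolding opn_open by blast
  then show "y \<in> universe (spec_structure (P.B \<Lambda>))"
    unfolding x elt_def spec_structure_def rs_structure.select_convs
    using point_Spec sval_sections by simp
next
  fix y assume "y \<in> universe (spec_structure (P.B \<Lambda>))"
  then consider \<pp> where "y = Pt \<pp>" "\<pp> \<in> Spec (P.B \<Lambda>)" | U where "y = Op U" "zariski_open (P.B \<Lambda>) U"
    | U s where "y = Sect U s" "zariski_open (P.B \<Lambda>) U" "s \<in> sections (P.B \<Lambda>) U"
    by (auto simp: spec_structure_def)
  then show "y \<in> range elt"
  proof cases
    case 1
    then obtain l where "\<pp> = point l" unfolding Spec_points by blast
    then have "y = elt (0, l, undefined)" using 1 by (simp add: elt_def)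
    then show ?thesis by blast
  next
    case 2
    then obtain u where "U = opn u" unfolding opn_open by blast
    then have "y = elt (1, undefined, u, undefined)" using 2 by (simp add: elt_def)
    then show ?thesis by blast
  next
    case 3
    then obtain u where u: "U = opn u" unfolding opn_open by blast
    then obtain d where "s = sval u d" using sections_coded 3(3) by blast
    then have "y = elt (2, undefined, u, d)" using 3 u by (simp add: elt_def)
    then show ?thesis by blast
  qed
qed

section \<open>Deciding the relations from the codes\<close>

definition sub_open :: "opcode \<Rightarrow> opcode \<Rightarrow> bool" where
  "sub_open u v \<longleftrightarrow> fst u = 0 \<or> (fst v \<noteq> 0 \<and> (\<forall>l\<in>set (snd v). valid l \<longrightarrow> l \<in> set (snd u)))"

lemma decidable_sub_open [computable_intros]:
  assumes "computable D u" "computable D v" shows "decidable D (\<lambda>x. sub_open (u x) (v x))"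
proof -
  have u: "computable D (\<lambda>p. u (fst p))" using assms(1) by (rule computable_comp) (intro computable_intros)
  show ?thesis unfolding sub_open_def
    by (intro decidable_or decidable_and decidable_not decidable_eq
        decidable_Ball_list[where P = "\<lambda>x l. valid l \<longrightarrow> l \<in> set (snd (u x))"]
        decidable_imp decidable_valid decidable_mem_list computable_intros u assms)
qed

lemma PP_missing: "valid l \<Longrightarrow> P.PP \<Lambda> (pt l) \<in> P.PP \<Lambda> ` missing u \<longleftrightarrow> l \<in> set (snd u)"
proof -
  assume l: "valid l"
  have "P.PP \<Lambda> (pt l) \<in> P.PP \<Lambda> ` missing u \<longleftrightarrow> pt l \<in> missing u"
    using inj_on_image_mem_iff[OF P.PP_inj[OF \<Lambda>_Ix] pt_\<Lambda>[OF l] missing_\<Lambda>(1)] .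
  also have "\<dots> \<longleftrightarrow> l \<in> set (snd u)"
    unfolding missing_def using l by (auto simp: pt_inj)
  finally show ?thesis .
qed

lemma zero_not_missing: "{0} \<notin> P.PP \<Lambda> ` missing u"
proof
  assume "{0} \<in> P.PP \<Lambda> ` missing u"
  then obtain i where "i \<in> missing u" "P.PP \<Lambda> i = {0}" by auto
  then show False using P.PP_nonzero[OF \<Lambda>_Ix, of i] missing_\<Lambda>(1) by blast
qed

lemma point_in_opn: "point l \<in> opn u \<longleftrightarrow> fst u \<noteq> 0 \<and> (valid l \<longrightarrow> l \<notin> set (snd u))"
proof (cases "fst u = 0")
  case False
  then show ?thesis
    using point_Spec[of l] PP_missing[of l u] zero_not_missing[of u]
    unfolding opn_def point_def by (cases "valid l") simp_all
qed (simp add: opn_def)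

lemma sub_open_iff: "sub_open u v \<longleftrightarrow> opn u \<subseteq> opn v"
proof
  assume *: "sub_open u v"
  show "opn u \<subseteq> opn v"
  proof
    fix \<pp> assume p: "\<pp> \<in> opn u"
    then have "\<pp> \<in> Spec (P.B \<Lambda>)" unfolding opn_def by (metis DiffD1 empty_iff)
    then obtain l where "\<pp> = point l" unfolding Spec_points by blast
    then show "\<pp> \<in> opn v" using * p unfolding sub_open_def by (auto simp: point_in_opn)
  qed
next
  assume *: "opn u \<subseteq> opn v"
  show "sub_open u v"
  proof (cases "fst u = 0")
    case u: False
    have "fst v \<noteq> 0" using * u opn_eq_empty[of u] opn_eq_empty[of v] by auto
    moreover have "l \<in> set (snd u)" if l: "l \<in> set (snd v)" "valid l" for l
    proof -
      have "point l \<notin> opn v" using l by (simp add: point_in_opn)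
      then have "point l \<notin> opn u" using * by blast
      then show "l \<in> set (snd u)" using u l(2) by (simp add: point_in_opn)
    qed
    ultimately show ?thesis unfolding sub_open_def by blast
  qed (simp add: sub_open_def)
qed

definition same_open :: "opcode \<Rightarrow> opcode \<Rightarrow> bool" where
  "same_open u v \<longleftrightarrow> sub_open u v \<and> sub_open v u"

lemma same_open_iff: "same_open u v \<longleftrightarrow> opn u = opn v"
  unfolding same_open_def sub_open_iff by blast

lemma decidable_same_open [computable_intros]:
  assumes "computable D u" "computable D v" shows "decidable D (\<lambda>x. same_open (u x) (v x))"
  unfolding same_open_def by (intro computable_intros assms)

lemma point_eq_iff: "point l = point m \<longleftrightarrow> (valid l \<longleftrightarrow> valid m) \<and> (valid l \<longrightarrow> l = m)"
proof -
  have "P.PP \<Lambda> (pt l) = P.PP \<Lambda> (pt m) \<longleftrightarrow> l = m" if "valid l" "valid m" for l m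
    using inj_on_eq_iff[OF P.PP_inj[OF \<Lambda>_Ix] pt_\<Lambda>[OF that(1)] pt_\<Lambda>[OF that(2)]] pt_inj[OF that] by simp
  moreover have "P.PP \<Lambda> (pt l) \<noteq> {0}" if "valid l" for l
    by (rule P.PP_nonzero[OF \<Lambda>_Ix pt_\<Lambda>[OF that]])
  ultimately show ?thesis unfolding point_def
    by (cases "valid l"; cases "valid m") (simp_all add: eq_commute[of "{0}"])
qed

lemma computable_numer [computable_intros]:
  assumes "computable D u" "computable D d"
  shows "computable D (\<lambda>x. numer (u x) (d x))" "computable D (\<lambda>x. denom (u x) (d x))"
proof -
  have u: "computable D (\<lambda>p. u (fst p))" using assms(1) by (rule computable_comp) (intro computable_intros)
  have d: "computable D (\<lambda>p. d (fst p))" using assms(2) by (rule computable_comp) (intro computable_intros)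
  have d': "computable D (\<lambda>p. d (fst (fst p)))" using d by (rule computable_comp) (intro computable_intros)
  have f: "decidable D (\<lambda>p. factor_ok (u (fst p)) (snd p))"
    unfolding factor_ok_def by (intro computable_intros u)
  have s: "decidable D (\<lambda>x. section_ok (u x) (d x))"
    unfolding section_ok_def
    by (intro decidable_and decidable_not decidable_eq decidable_z_free decidable_all_less
        decidable_Bex_list[where P = "\<lambda>p t. lin_free_cert (Suc (snd p)) (fst (snd (d (fst p)))) t"]
        decidable_Ball_list[where P = "\<lambda>x. factor_ok (u x)"] f
        decidable_lin_free_cert computable_intros d d' assms)
  show "computable D (\<lambda>x. numer (u x) (d x))" unfolding numer_def by (intro computable_intros s assms)
  show "computable D (\<lambda>x. denom (u x) (d x))" unfolding denom_def
    by (intro computable_if s computable_pmul computable_lin_prod computable_const computable_intros assms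
        computable_map[where F = "\<lambda>_ f. (fst f, fst (snd f))"])
qed

definition tag :: "elcode \<Rightarrow> nat" where "tag x = fst x"
definition lab :: "elcode \<Rightarrow> nat \<times> nat" where "lab x = fst (snd x)"
definition opc :: "elcode \<Rightarrow> opcode" where "opc x = fst (snd (snd x))"
definition num :: "elcode \<Rightarrow> nat list list" where "num x = numer (opc x) (snd (snd (snd x)))"
definition den :: "elcode \<Rightarrow> nat list list" where "den x = denom (opc x) (snd (snd (snd x)))"

lemma computable_selectors [computable_intros]:
  assumes "computable D x"
  shows "computable D (\<lambda>y. tag (x y))" "computable D (\<lambda>y. lab (x y))" "computable D (\<lambda>y. opc (x y))"
    "computable D (\<lambda>y. num (x y))" "computable D (\<lambda>y. den (x y))"
  unfolding tag_def lab_def opc_def num_def den_def by (intro computable_intros assms)+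

definition val :: "elcode \<Rightarrow> 'f" where "val x = \<Psi> (pval (num x)) / \<Psi> (pval (den x))"

lemma elt_eq: "elt x = (if tag x = 0 then Pt (point (lab x)) else if tag x = 1 then Op (opn (opc x))
    else Sect (opn (opc x)) (val x))"
  by (simp add: elt_def tag_def lab_def opc_def val_def sval_def num_def den_def)

lemma den_nz [simp]: "\<Psi> (pval (den x)) \<noteq> 0" unfolding den_def by (rule denom_nz)

text \<open>Cross-multiplication turns relations between sections into membership of a computed
  polynomial in the kernel, which \<open>decidable_ker\<close> decides.\<close>

lemma val_eq_iff: "val x = val y \<longleftrightarrow> \<Psi> (pval (pmul (num x) (den y) @ pneg (pmul (num y) (den x)))) = 0"
  unfolding val_def by (simp add: \<Psi>.hom_mult \<Psi>.hom_add \<Psi>.hom_minus frac_eq_eq)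

lemma val_add_iff: "val z = val x + val y \<longleftrightarrow>
  \<Psi> (pval (pmul (pmul (num z) (den x)) (den y) @
    pneg (pmul (pmul (num x) (den y)) (den z) @ pmul (pmul (num y) (den x)) (den z)))) = 0"
  unfolding val_def by (simp add: \<Psi>.hom_mult \<Psi>.hom_add \<Psi>.hom_minus field_simps)

lemma val_mult_iff: "val z = val x * val y \<longleftrightarrow>
  \<Psi> (pval (pmul (pmul (num z) (den x)) (den y) @ pneg (pmul (pmul (num x) (num y)) (den z)))) = 0"
  unfolding val_def by (simp add: \<Psi>.hom_mult \<Psi>.hom_add \<Psi>.hom_minus field_simps)

lemma val_zero_iff: "val x = 0 \<longleftrightarrow> \<Psi> (pval (num x)) = 0"
  unfolding val_def by simp

lemma val_one_iff: "val x = 1 \<longleftrightarrow> \<Psi> (pval (num x @ pneg (den x))) = 0"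
  unfolding val_def by (simp add: \<Psi>.hom_add \<Psi>.hom_minus)

lemma elt_eq_iff: "elt x = elt y \<longleftrightarrow>
   (tag x = 0 \<and> tag y = 0 \<and> (valid (lab x) \<longleftrightarrow> valid (lab y)) \<and> (valid (lab x) \<longrightarrow> lab x = lab y)) \<or>
   (tag x = 1 \<and> tag y = 1 \<and> same_open (opc x) (opc y)) \<or>
   (1 < tag x \<and> 1 < tag y \<and> same_open (opc x) (opc y) \<and> val x = val y)"
  unfolding elt_eq same_open_iff by (simp add: point_eq_iff)

text \<open>The case distinctions reflect that the only section over the empty set is
  \<open>0\<close>. The position of a label never enters the right-hand sides except through
  \<open>val\<close>, which is computed from explicit polynomials.\<close>

lemma scheme_holds_elt:
  "scheme_holds IsPoint [elt x] \<longleftrightarrow> tag x = 0"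
  "scheme_holds IsOpen [elt x] \<longleftrightarrow> tag x = 1"
  "scheme_holds PointIn [elt x, elt y] \<longleftrightarrow> tag x = 0 \<and> tag y = 1 \<and> fst (opc y) \<noteq> 0 \<and>
     (valid (lab x) \<longrightarrow> lab x \<notin> set (snd (opc y)))"
  "scheme_holds SectionOver [elt x, elt y] \<longleftrightarrow> 1 < tag x \<and> tag y = 1 \<and> same_open (opc x) (opc y)"
  "scheme_holds SumIs [elt x, elt y, elt z] \<longleftrightarrow> 1 < tag x \<and> 1 < tag y \<and> 1 < tag z \<and>
     same_open (opc x) (opc y) \<and> same_open (opc x) (opc z) \<and> val z = val x + val y"
  "scheme_holds ProdIs [elt x, elt y, elt z] \<longleftrightarrow> 1 < tag x \<and> 1 < tag y \<and> 1 < tag z \<and>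
     same_open (opc x) (opc y) \<and> same_open (opc x) (opc z) \<and> val z = val x * val y"
  "scheme_holds IsZero [elt x] \<longleftrightarrow> 1 < tag x \<and> val x = 0"
  "scheme_holds IsOne [elt x] \<longleftrightarrow> 1 < tag x \<and> (if fst (opc x) = 0 then val x = 0 else val x = 1)"
  "scheme_holds RestrictsTo [elt x, elt y] \<longleftrightarrow> 1 < tag x \<and> 1 < tag y \<and> sub_open (opc y) (opc x) \<and>
     (if fst (opc y) = 0 then val y = 0 else val y = val x)"
  unfolding elt_eq
  by (auto simp: same_open_iff sub_open_iff unit_section_def restrict_section_def point_in_opn opn_eq_empty)

lemmas val_iffs = val_eq_iff val_add_iff val_mult_iff val_zero_iff val_one_iff

lemma decidable_if_else: "decidable D P \<Longrightarrow> decidable D Q \<Longrightarrow> decidable D R \<Longrightarrow> decidable D (\<lambda>x. if P x then Q x else R x)"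
  unfolding if_bool_eq_conj by (intro computable_intros)

lemma map_nth0:
  "length xs = 1 \<longleftrightarrow> (\<exists>x. xs = [x])" "length xs = 2 \<longleftrightarrow> (\<exists>x y. xs = [x, y])" "length xs = 3 \<longleftrightarrow> (\<exists>x y z. xs = [x, y, z])"
  "nth0 (x # ys) 0 = x" "nth0 (x # y # ys) 1 = y" "nth0 (x # y # z # ys) 2 = z"
  by (auto simp: nth0_def numeral_2_eq_2 numeral_3_eq_3 length_Suc_conv)

lemma copy_exists:
  obtains N :: "nat rs_structure" where "isomorphic N (spec_structure (P.B \<Lambda>))" "turing_le (atomic_diagram N) D"
proof -
  define e where "e x = elt (dec x)" for x
  have "e ` UNIV = elt ` range dec" unfolding e_def by blast
  moreover have "range (dec :: nat \<Rightarrow> elcode) = UNIV" by (metis dec_enc surjI)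
  ultimately have rng: "range e = universe (spec_structure (P.B \<Lambda>))" by (simp add: range_elt)
  have E [computable_intros]: "computable D (\<lambda>xs. dec (nth0 xs i) :: elcode)" for i
    by (intro computable_intros)
  note decs = decidable_or decidable_and decidable_imp decidable_not decidable_iff decidable_if_else decidable_eq decidable_less
    decidable_ker decidable_same_open decidable_sub_open decidable_valid decidable_mem_list
    computable_selectors computable_pmul computable_append computable_pneg E computable_const computable_fst computable_snd
  show ?thesis
  proof (rule pulled_back_structure[OF rng])
    show "decidable D (\<lambda>p. e (fst p) = e (snd p))"
      unfolding e_def elt_eq_iff val_iffs by (intro decs computable_dec computable_id)
    show "decidable D (\<lambda>xs. length xs = arity r \<and> holds (spec_structure (P.B \<Lambda>)) r (map e xs))" for r
    proof -
      define T :: "nat list \<Rightarrow> nat \<Rightarrow> elcode" where "T xs i = dec (nth0 xs i)" for xs i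
      have T: "computable D (\<lambda>xs. T xs i)" for i unfolding T_def by (rule E)
      have h: "holds (spec_structure (P.B \<Lambda>)) = scheme_holds" by (simp add: spec_structure_def)
      have 1: "length xs = 1 \<and> Q (map e xs) \<longleftrightarrow> length xs = 1 \<and> Q [elt (T xs 0)]"
        and 2: "length xs = 2 \<and> Q (map e xs) \<longleftrightarrow> length xs = 2 \<and> Q [elt (T xs 0), elt (T xs 1)]"
        and 3: "length xs = 3 \<and> Q (map e xs) \<longleftrightarrow> length xs = 3 \<and> Q [elt (T xs 0), elt (T xs 1), elt (T xs 2)]" for xs Q
        by (auto simp: map_nth0 T_def e_def simp del: One_nat_def)
      have l: "decidable D (\<lambda>xs. length xs = k)" for k by (intro computable_intros)
      show ?thesis unfolding h
        by (cases r; simp only: arity.simps 1 2 3 scheme_holds_elt val_iffs)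
          (intro decs l T)+
    qed
  qed (rule that)
qed

end

section \<open>Reading an enumeration off a copy\<close>

text \<open>An invertible global section is recognized by finding its inverse.\<close>

lemma invertible_indices_enumerable:
  fixes A :: "'f::field set" and N :: "nat rs_structure"
  assumes A: "is_subring A" and op: "zariski_open A (Spec A)" and sec: "sections A (Spec A) = A"
    and \<xi>: "\<xi> \<in> A" and iso: "isomorphic N (spec_structure A)"
  shows "ce_in {e. \<exists>t\<in>A. (qseq \<xi> (Suc (e + e)) + 1) * t = 1} (atomic_diagram N)"
proof -
  define D where "D = atomic_diagram N"
  obtain h where h: "bij_betw h (universe N) (universe (spec_structure A))"
    "\<And>r xs. set xs \<subseteq> universe N \<Longrightarrow> length xs = arity r \<Longrightarrow> holds N r xs \<longleftrightarrow> scheme_holds r (map h xs)"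
    using iso unfolding isomorphic_def spec_structure_def by auto
  \<comment> \<open>A positive entry of the diagram also certifies that its arguments lie in the
    universe, so no separate test for the universe is needed.\<close>
  define pos where "pos r xs \<longleftrightarrow> list_encode (1 # symbol_code r # xs) \<in> D" for r xs
  have symbol_code_inj: "symbol_code r = symbol_code r' \<Longrightarrow> r = r'" for r r' by (cases r; cases r') auto
  have symbol_code_nz: "symbol_code r \<noteq> 0" for r by (cases r) auto
  have pos: "pos r xs \<longleftrightarrow> set xs \<subseteq> universe N \<and> length xs = arity r \<and> scheme_holds r (map h xs)" for r xs
  proof -
    have "pos r xs \<longleftrightarrow> set xs \<subseteq> universe N \<and> length xs = arity r \<and> holds N r xs"
      unfolding pos_def D_def atomic_diagram_def
      using symbol_code_nz[of r] symbol_code_inj[of r]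
      by (auto simp: list_encode_eq simp del: list_encode.simps split: if_splits)
    then show ?thesis using h(2) by blast
  qed
  have decidable_pos: "decidable D (\<lambda>x. pos r (l x))" if "computable D l" for l :: "'a::coded \<Rightarrow> nat list" and r
    unfolding pos_def enc_nat_list[symmetric]
    by (intro decidable_comp[OF decidable_mem] computable_intros that)
  have univ: "Op (Spec A) \<in> universe (spec_structure A)" "s \<in> A \<Longrightarrow> Sect (Spec A) s \<in> universe (spec_structure A)" for s
    using op sec by (auto simp: spec_structure_def)
  have surj: "\<exists>x. x \<in> universe N \<and> h x = y" if "y \<in> universe (spec_structure A)" for y
    using that h(1) unfolding bij_betw_def by (metis imageE)
  obtain u where u: "u \<in> universe N" "h u = Op (Spec A)" using surj univ(1) by blast
  define code where "code s x \<longleftrightarrow> s \<in> A \<and> x \<in> universe N \<and> h x = Sect (Spec A) s" for s x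
  have code_ex: "\<exists>x. code s x" if "s \<in> A" for s
    using surj[OF univ(2)[OF that]] that unfolding code_def by blast
  have sect: "pos SectionOver [x, u] \<longleftrightarrow> (\<exists>s. code s x)" for x
  proof -
    have "s \<in> A" if "x \<in> universe N" "h x = Sect (Spec A) s" for s
    proof -
      have "h x \<in> universe (spec_structure A)" using that(1) h(1) by (auto simp: bij_betw_def)
      then show ?thesis unfolding that(2) using sec by (auto simp: spec_structure_def)
    qed
    then show ?thesis unfolding pos code_def using u by auto
  qed
  have inj: "h x = h y \<longleftrightarrow> x = y" if "x \<in> universe N" "y \<in> universe N" for x y
    using inj_on_eq_iff[OF bij_betw_imp_inj_on[OF h(1)] that] .
  have op_search: "\<exists>F. computable D F \<and> (\<forall>x y s t. code s x \<longrightarrow> code t y \<longrightarrow> code (f s t) (F (x, y)))"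
    if f: "\<And>s t. s \<in> A \<Longrightarrow> t \<in> A \<Longrightarrow> f s t \<in> A"
      and r: "arity r = 3" "\<And>xs. scheme_holds r xs \<longleftrightarrow> (\<exists>U s t. xs = [Sect U s, Sect U t, Sect U (f s t)])" for f r
  proof -
    \<comment> \<open>The premise makes the search succeed vacuously when an argument is not a
      global section; hence the function found is total.\<close>
    define R where "R p z \<longleftrightarrow> pos SectionOver [fst p, u] \<and> pos SectionOver [snd p, u] \<longrightarrow> pos r [fst p, snd p, z]"
      for p :: "nat \<times> nat" and z
    have "decidable D (\<lambda>p. R (fst p) (snd p))" unfolding R_def by (intro computable_intros decidable_pos)
    moreover have "\<exists>z. R p z" for p
    proof (cases "(\<exists>s. code s (fst p)) \<and> (\<exists>s. code s (snd p))")
      case True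
      then obtain s t where st: "code s (fst p)" "code t (snd p)" by blast
      then obtain z where "code (f s t) z" using code_ex f unfolding code_def by metis
      then have "pos r [fst p, snd p, z]" unfolding pos r using st by (simp add: code_def)
      then show ?thesis unfolding R_def by blast
    qed (auto simp: R_def sect)
    ultimately obtain F where F: "computable D F" "\<And>p. R p (F p)"
      by (rule computable_search[where R = R]) blast
    have "code (f s t) (F (x, y))" if "code s x" "code t y" for x y s t
    proof -
      have "pos r [x, y, F (x, y)]" using F(2)[of "(x, y)"] that unfolding R_def fst_conv snd_conv sect by blast
      then show ?thesis unfolding pos r using that f by (auto simp: code_def)
    qed
    then show ?thesis using F(1) by blast
  qed
  obtain add where add: "computable D add" "\<And>x y s t. code s x \<Longrightarrow> code t y \<Longrightarrow> code (s + t) (add (x, y))"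
    using op_search[of "(+)" SumIs] is_subringD(3)[OF A] by auto
  obtain mul where mul: "computable D mul" "\<And>x y s t. code s x \<Longrightarrow> code t y \<Longrightarrow> code (s * t) (mul (x, y))"
    using op_search[of "(*)" ProdIs] is_subringD(4)[OF A] by auto
  obtain i where i: "code 1 i" using code_ex is_subringD(2)[OF A] by blast
  obtain x where x: "code \<xi> x" using code_ex \<xi> by blast
  \<comment> \<open>The recursion for \<open>qseq\<close> carried out in the copy, from the two
    parameters \<open>x\<close> and \<open>i\<close> that stand for \<open>\<xi>\<close> and
    \<open>1\<close>.\<close>
  define S where "S a = mul (a, add (a, i))" for a
  have S: "computable D S" unfolding S_def by (intro computable_intros computable_comp[OF mul(1)] computable_comp[OF add(1)])
  have Sm: "code (qseq \<xi> m) ((S ^^ m) x)" for m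
    by (induction m) (auto simp: S_def x intro!: mul(2) add(2) i)
  \<comment> \<open>The second component is the candidate inverse: the product relation with result
    \<open>i\<close> verifies it.\<close>
  define W where "W p \<longleftrightarrow> pos ProdIs [add ((S ^^ Suc (fst p + fst p)) x, i), snd p, i]" for p :: "nat \<times> nat"
  have W: "decidable D W" unfolding W_def
    by (intro decidable_pos computable_intros computable_comp[OF add(1)] computable_funpow S)
  have "(\<exists>t\<in>A. (qseq \<xi> (Suc (e + e)) + 1) * t = 1) \<longleftrightarrow> (\<exists>v. W (e, v))" for e
  proof -
    define a where "a = add ((S ^^ Suc (e + e)) x, i)"
    have a: "code (qseq \<xi> (Suc (e + e)) + 1) a" unfolding a_def by (rule add(2)[OF Sm i])
    have "W (e, v) \<longleftrightarrow> (\<exists>t. code t v \<and> (qseq \<xi> (Suc (e + e)) + 1) * t = 1)" for v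
    proof
      assume "W (e, v)"
      then have p: "pos ProdIs [a, v, i]" by (simp add: W_def a_def)
      then obtain t where t: "h v = Sect (Spec A) t" "(qseq \<xi> (Suc (e + e)) + 1) * t = 1"
        unfolding pos using a i by (auto simp: code_def simp del: qseq.simps)
      have "v \<in> universe N" using p unfolding pos by simp
      then have "pos SectionOver [v, u]" unfolding pos using t u by auto
      then obtain t' where "code t' v" unfolding sect by blast
      then have "code t v" using t(1) by (simp add: code_def)
      then show "\<exists>t. code t v \<and> (qseq \<xi> (Suc (e + e)) + 1) * t = 1" using t(2) by blast
    next
      assume "\<exists>t. code t v \<and> (qseq \<xi> (Suc (e + e)) + 1) * t = 1"
      then show "W (e, v)" using a i
        unfolding W_def pos fst_conv snd_conv a_def[symmetric] by (auto simp: code_def simp del: qseq.simps)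
    qed
    then show ?thesis using code_ex unfolding code_def by metis
  qed
  then show ?thesis unfolding ce_in_def D_def[symmetric] using W by blast
qed

section \<open>The schemes coding a set\<close>

definition remaining :: "nat set \<Rightarrow> 'k::comm_ring_1 set" where
  "remaining X = {c. \<forall>e\<in>X. qseq c (Suc (e + e)) + 1 \<noteq> 0}"

context variety
begin

abbreviation primes_of :: "nat set \<Rightarrow> (nat \<times> 'k) set" where
  "primes_of X \<equiv> {i \<in> Ix. fst i = 1 \<longrightarrow> snd i \<in> remaining X}"

lemma msubst_qseq: "msubst j (c :: 'k) (qseq (Var 1) m + 1) = (if j = 1 then Const (qseq c m + 1) else qseq (Var 1) m + 1)"
proof -
  interpret C: comm_ring_hom "Const :: 'k \<Rightarrow> 'k mpoly" by (rule Const_hom)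
  show ?thesis by (simp add: msubst_simps qseq_hom[OF msubst_hom] qseq_hom[OF Const_hom] msubst_Var C.hom_add)
qed

lemma qseq_Var: "qseq (Var 1 :: 'k mpoly) m + 1 \<in> polys_in {1..n}" "qseq (Var 1) m + 1 \<noteq> (0 :: 'k mpoly)"
proof -
  have "qseq (Var 1 :: 'k mpoly) m \<in> polys_in {1..n}" using n by (induction m) (auto intro!: mult_in)
  then show "qseq (Var 1 :: 'k mpoly) m + 1 \<in> polys_in {1..n}" by (rule add_in) simp
  have "qseq (0 :: 'k) m = 0" by (induction m) auto
  then have "msubst 1 0 (qseq (Var 1) m + 1) = (Const 1 :: 'k mpoly)" unfolding msubst_qseq by simp
  moreover have "Const (1 :: 'k) \<noteq> 0" using Const_inj[of "1 :: 'k" 0] by (auto simp: Const_def)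
  ultimately show "qseq (Var 1) m + 1 \<noteq> (0 :: 'k mpoly)" by (metis msubst_simps(1))
qed

text \<open>Modulo \<open>x_1 - c\<close> the element becomes the constant
  \<open>q_m(c) + 1\<close>, and it is divisible by no \<open>x_j - c\<close> with
  \<open>j \<ge> 2\<close>. It is thus a unit exactly if all roots of \<open>q_m + 1\<close> are
  removed; a root exists and belongs to no other index, so this means
  \<open>e \<in> X\<close>.\<close>

lemma invertible_iff:
  "(\<exists>t\<in>P.B (primes_of X). (qseq (\<Psi> (Var 1)) (Suc (e + e)) + 1) * t = 1) \<longleftrightarrow> e \<in> X"
proof -
  define m where "m = Suc (e + e)"
  define q :: "'k mpoly" where "q = qseq (Var 1) m + 1"
  have q: "q \<in> polys_in {1..n}" "q \<noteq> 0" unfolding q_def by (rule qseq_Var)+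
  have eq: "\<Psi> q = qseq (\<Psi> (Var 1)) m + 1" unfolding q_def by (simp add: \<Psi>.hom_add qseq_hom[OF hom])
  have L: "primes_of X \<subseteq> Ix" and im: "\<Psi> q \<in> \<Psi> ` polys_in {1..n}" and nz: "\<Psi> q \<noteq> 0"
    using q inj_X[OF q(1)] by blast+
  have "(\<exists>t\<in>P.B (primes_of X). (qseq (\<Psi> (Var 1)) m + 1) * t = 1) \<longleftrightarrow>
      (\<forall>i\<in>primes_of X. \<Psi> q \<notin> (*) (lin i) ` \<Psi> ` polys_in {0..n})"
    unfolding eq[symmetric] P.unit_B_iff[OF L im] mem_Collect_eq using im nz by blast
  also have "\<dots> \<longleftrightarrow> (\<forall>i\<in>primes_of X. msubst (fst i) (snd i) q \<noteq> 0)"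
  proof (rule ball_cong[OF refl])
    fix i assume "i \<in> primes_of X"
    then have "fst i \<in> {1..n}" by auto
    from multiple_X_iff[OF q(1) this, of "snd i"]
    show "\<Psi> q \<notin> (*) (lin i) ` \<Psi> ` polys_in {0..n} \<longleftrightarrow> msubst (fst i) (snd i) q \<noteq> 0" by simp
  qed
  also have "\<dots> \<longleftrightarrow> (\<forall>c\<in>remaining X. qseq (c :: 'k) m + 1 \<noteq> 0)"
  proof -
    have C: "Const (c :: 'k) = 0 \<longleftrightarrow> c = 0" for c using Const_inj[of c 0] by (auto simp: Const_def)
    have "(\<forall>i\<in>primes_of X. msubst (fst i) (snd i) q \<noteq> 0) \<longleftrightarrow> (\<forall>i\<in>primes_of X. fst i = 1 \<longrightarrow> qseq (snd i) m + 1 \<noteq> 0)"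
      using q(2) unfolding q_def msubst_qseq by (intro ball_cong refl) (simp add: C)
    also have "\<dots> \<longleftrightarrow> (\<forall>c\<in>remaining X. qseq (c :: 'k) m + 1 \<noteq> 0)"
      using n by (auto simp del: One_nat_def)
    finally show ?thesis .
  qed
  also have "\<dots> \<longleftrightarrow> e \<in> X"
  proof
    assume *: "\<forall>c\<in>remaining X. qseq (c :: 'k) m + 1 \<noteq> 0"
    obtain c :: 'k where c: "qseq c m + 1 = 0" using qseq_root_exists by blast
    then obtain f where f: "f \<in> X" "qseq c (Suc (f + f)) + 1 = 0" using * unfolding remaining_def by blast
    then have "Suc (f + f) = m" using qseq_root_unique c by blast
    then have "f = e" unfolding m_def by simp
    then show "e \<in> X" using f(1) by simp
  qed (auto simp: remaining_def m_def simp del: qseq.simps)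
  finally show ?thesis unfolding m_def .
qed

text \<open>Divisibility by \<open>x_j - a\<close> among polynomials in \<open>x_1, ..., x_n\<close>
  amounts to vanishing of a substitution, and so does divisibility in the coordinate ring; hence
  both descriptions have the same denominators.\<close>

lemma R_bar_eq:
  assumes to_field: "\<And>p. p \<in> polys_in {0..n} \<Longrightarrow> poly_to_field n V \<iota> p = \<Psi> p" and \<phi>: "\<phi> ` {0<..} = UNIV"
  shows "R_bar n V \<iota> \<phi> {i. 0 < i \<and> \<phi> i \<in> remaining X} = P.B (primes_of X)"
proof -
  let ?J = "index_sets {i. 0 < i \<and> \<phi> i \<in> remaining X}"
  have img: "\<phi> ` ?J j = {c. j = 1 \<longrightarrow> c \<in> remaining X}" for j
  proof -
    have "\<exists>i>0. \<phi> i = c" for c using \<phi> by (metis UNIV_I greaterThan_iff imageE)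
    then show ?thesis unfolding index_sets_def by (cases "j = 1") (auto simp: \<phi>, metis image_eqI mem_Collect_eq)
  qed
  have XA: "p \<in> polys_in {1..n} \<Longrightarrow> p \<in> polys_in {0..n}" for p :: "'k mpoly"
    by (auto simp: polys_in_def) (meson atLeastAtMost_iff le0 subsetD)
  have dvd: "(Var j - Const a) divides\<^bsub>ring_on (polys_in {1..n})\<^esub> p \<longleftrightarrow> msubst j a p = 0"
    if p: "p \<in> polys_in {1..n}" and j: "j \<in> {1..n}" for p j and a :: 'k
  proof
    assume "(Var j - Const a) divides\<^bsub>ring_on (polys_in {1..n})\<^esub> p"
    then obtain q where "p = (Var j - Const a) * q" unfolding factor_def by auto
    then show "msubst j a p = 0" using msubst_linear_eq_0[of j a j a] by (simp add: msubst_simps(4))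
  next
    assume 0: "msubst j a p = 0"
    obtain q where "q \<in> polys_in {1..n}" "p = msubst j a p + (Var j - Const a) * q"
      by (rule msubst_remainder[OF p j])
    then show "(Var j - Const a) divides\<^bsub>ring_on (polys_in {1..n})\<^esub> p"
      using 0 unfolding factor_def by auto
  qed
  have pairs: "(\<forall>j\<in>{1..n}. \<forall>a\<in>{c. j = 1 \<longrightarrow> c \<in> remaining X}. Q (j, a)) \<longleftrightarrow> (\<forall>i\<in>primes_of X. Q i)" for Q
    by auto
  have den: "p \<in> P_set n \<phi> ?J \<and> p \<noteq> 0 \<longleftrightarrow> p \<in> polys_in {1..n} \<and> \<Psi> p \<noteq> 0 \<and>
      (\<forall>i\<in>primes_of X. \<Psi> p \<notin> (*) (lin i) ` \<Psi> ` polys_in {0..n})" for p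
  proof (cases "p \<in> polys_in {1..n}")
    case p: True
    have "(\<forall>j\<in>{1..n}. \<forall>a\<in>\<phi> ` ?J j. \<not> (Var j - Const a) divides\<^bsub>ring_on (polys_in {1..n})\<^esub> p) \<longleftrightarrow>
        (\<forall>j\<in>{1..n}. \<forall>a\<in>{c. j = 1 \<longrightarrow> c \<in> remaining X}. \<Psi> p \<notin> (*) (lin (j, a)) ` \<Psi> ` polys_in {0..n})"
      unfolding img using dvd[OF p] multiple_X_iff[OF p] by (intro ball_cong) auto
    also have "\<dots> \<longleftrightarrow> (\<forall>i\<in>primes_of X. \<Psi> p \<notin> (*) (lin i) ` \<Psi> ` polys_in {0..n})"
      by (rule pairs)
    finally show ?thesis using p inj_X[OF p] unfolding P_set_def by auto
  qed (simp add: P_set_def)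
  have "R_ring n V \<iota> \<phi> ?J = {\<Psi> g1 / \<Psi> g2 | g1 g2. g1 \<in> polys_in {1..n} \<and> g2 \<in> polys_in {1..n} \<and> \<Psi> g2 \<noteq> 0 \<and>
      (\<forall>i\<in>primes_of X. \<Psi> g2 \<notin> (*) (lin i) ` \<Psi> ` polys_in {0..n})}"
  proof -
    have "poly_to_field n V \<iota> g = \<Psi> g" if "g \<in> polys_in {1..n}" for g using to_field[OF XA[OF that]] .
    then show ?thesis unfolding R_ring_def den by (intro Collect_cong ex_cong1) auto
  qed
  also have "\<dots> = P.base_ring (primes_of X)" unfolding P.base_ring_def by blast
  finally show ?thesis
    unfolding R_bar_def using P.integral_closure_base_ring[of "primes_of X"] by auto
qed

lemma coding:
  assumes "isomorphic N (spec_structure (P.B (primes_of X)))"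
  shows "ce_in X (atomic_diagram N)"
proof -
  have L: "primes_of X \<subseteq> Ix" by blast
  have "zariski_open (P.B (primes_of X)) (Spec (P.B (primes_of X)))"
    unfolding P.zariski_open_B[OF L] by (intro disjI2 exI[of _ "{}"]) simp
  moreover have "\<Psi> (Var 1) \<in> P.B (primes_of X)"
    using n by (intro P.mem_B_A[OF L] imageI) simp
  ultimately have "ce_in {e. \<exists>t\<in>P.B (primes_of X). (qseq (\<Psi> (Var 1)) (Suc (e + e)) + 1) * t = 1} (atomic_diagram N)"
    using P.B_subring[OF L] P.global_sections_B[OF L] assms by (intro invertible_indices_enumerable)
  then show ?thesis unfolding invertible_iff by simp
qed

end

context scheme_copy
begin

lemma copy_from_enumeration:
  assumes "ce_in X D"
  shows "\<exists>N :: nat rs_structure. isomorphic N (spec_structure (P.B (primes_of X))) \<and> turing_le (atomic_diagram N) D"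
proof -
  obtain W :: "nat \<times> nat \<Rightarrow> bool" where W: "decidable D W" "X = {x. \<exists>s. W (x, s)}"
    using assms unfolding ce_in_def by blast
  \<comment> \<open>The witness \<open>s\<close> codes an index of \<open>X\<close> together with
    the stage that enumerates it, so that \<open>Z\<close> is decidable although \<open>X\<close>
    need not be.\<close>
  define Z where "Z c s \<longleftrightarrow> canonical c \<and> is_root (Suc (fst (dec s :: nat \<times> nat) + fst (dec s :: nat \<times> nat))) c \<and> W (dec s)" for c s
  obtain g :: "nat \<Rightarrow> nat" where g: "strict_mono g" "\<And>D. computable D g" "\<And>t. canonical (g t)" "\<And>t. \<exists>e. is_root (2 * e) (g t)"
    by (rule reserved_sequence) blast
  interpret scheme_enumeration n Fp \<Psi> \<kappa> addk mulk D Z g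
  proof
    show "decidable D (\<lambda>p. Z (fst p) (snd p))"
      unfolding Z_def by (intro computable_intros decidable_comp[OF W(1)])
    show "\<not> Z (g t) s" for t s
    proof
      assume "Z (g t) s"
      then have "is_root (Suc (fst (dec s :: nat \<times> nat) + fst (dec s :: nat \<times> nat))) (g t)" by (simp add: Z_def)
      moreover obtain e where "is_root (2 * e) (g t)" using g(4) by blast
      ultimately have "Suc (fst (dec s :: nat \<times> nat) + fst (dec s :: nat \<times> nat)) = 2 * e"
        unfolding is_root_def by (rule qseq_root_unique)
      then show False by presburger
    qed
  qed (use g Z_def in auto)
  have "x \<in> \<kappa> ` Rm \<longleftrightarrow> x \<notin> remaining X" for x
  proof
    assume "x \<in> \<kappa> ` Rm"
    then obtain c s where "x = \<kappa> c" "Z c s" unfolding Rm_def by blast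
    moreover have "fst (dec s :: nat \<times> nat) \<in> X" if "W (dec s)" for s
      unfolding W(2) using that by (intro CollectI exI[of _ "snd (dec s :: nat \<times> nat)"]) simp
    ultimately show "x \<notin> remaining X" unfolding Z_def is_root_def remaining_def by blast
  next
    assume "x \<notin> remaining X"
    then obtain e s where e: "W (e, s)" "qseq x (Suc (e + e)) + 1 = 0" unfolding remaining_def W(2) by blast
    obtain c where c: "canonical c" "\<kappa> c = x" using canonical_ex by blast
    then have "Z c (enc (e, s))" using e unfolding Z_def is_root_def dec_enc by simp
    then show "x \<in> \<kappa> ` Rm" using c(2) unfolding Rm_def by blast
  qed
  then have "\<kappa> ` Rm = - remaining X" by blast
  then have "\<Lambda> = primes_of X" unfolding \<Lambda>_def by auto
  then show ?thesis using copy_exists by metis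
qed

end

section \<open>Degrees\<close>

text \<open>The even part lists \<open>A\<close> and the odd part its complement, so enumerating the
  join amounts to deciding \<open>A\<close>.\<close>

lemma ce_join_iff:
  fixes A :: "nat set"
  defines "X \<equiv> {x. \<exists>a. x = a + a \<and> a \<in> A \<or> x = Suc (a + a) \<and> a \<notin> A}"
  shows "ce_in X B \<longleftrightarrow> turing_le A B"
proof
  assume "turing_le A B"
  then have A: "decidable B (\<lambda>a. a \<in> A)" by (simp add: turing_le_iff_decidable)
  have "decidable B (\<lambda>p :: nat \<times> nat. fst p = snd p + snd p \<and> snd p \<in> A \<or> fst p = Suc (snd p + snd p) \<and> snd p \<notin> A)"
    by (intro computable_intros decidable_comp[OF A])
  then show "ce_in X B" unfolding ce_in_def X_def by (intro exI conjI) auto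
next
  assume "ce_in X B"
  then obtain W :: "nat \<times> nat \<Rightarrow> bool" where W: "decidable B W" "X = {x. \<exists>s. W (x, s)}"
    unfolding ce_in_def by blast
  have even: "a + a \<in> X \<longleftrightarrow> a \<in> A" and odd: "Suc (a + a) \<in> X \<longleftrightarrow> a \<notin> A" for a
  proof -
    have "a + a = b + b \<longleftrightarrow> a = b" "a + a \<noteq> Suc (b + b)" "Suc (a + a) \<noteq> b + b" for b by presburger+
    then show "a + a \<in> X \<longleftrightarrow> a \<in> A" "Suc (a + a) \<in> X \<longleftrightarrow> a \<notin> A" unfolding X_def by auto
  qed
  have "decidable B (\<lambda>a. a \<in> A)"
  proof (rule decidable_by_search)
    show "decidable B (\<lambda>p :: nat \<times> nat. W (fst p + fst p, snd p))" "decidable B (\<lambda>p :: nat \<times> nat. W (Suc (fst p + fst p), snd p))"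
      by (intro decidable_comp[OF W(1)] computable_intros)+
  qed (use even odd W(2) in auto)
  then show "turing_le A B" by (simp add: turing_le_iff_decidable)
qed

lemma degrees_of_isomorphism_types:
  fixes S :: "nat set \<Rightarrow> 'a rs_structure"
  assumes copy: "\<And>X D. ce_in X D \<Longrightarrow> \<exists>N :: nat rs_structure. isomorphic N (S X) \<and> turing_le (atomic_diagram N) D"
    and coding: "\<And>X N. isomorphic N (S X) \<Longrightarrow> ce_in X (atomic_diagram N)"
  shows "d \<in> turing_degrees \<Longrightarrow> \<exists>X (M :: nat rs_structure). isomorphic M (S X) \<and> iso_type_has_degree M d"
    and "\<exists>X (M :: nat rs_structure). isomorphic M (S X) \<and> \<not> (\<exists>d\<in>turing_degrees. iso_type_has_degree M d)"
proof -
  assume "d \<in> turing_degrees"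
  then obtain A where d: "d = turing_degree A" by (auto simp: turing_degrees_def turing_degree_def quotient_def)
  define X where "X = {x. \<exists>a. x = a + a \<and> a \<in> A \<or> x = Suc (a + a) \<and> a \<notin> A}"
  have X: "ce_in X B \<longleftrightarrow> turing_le A B" for B unfolding X_def by (rule ce_join_iff)
  obtain M :: "nat rs_structure" where M: "isomorphic M (S X)" "turing_le (atomic_diagram M) A"
    using copy[of X A] X turing_le_refl by blast
  have lower: "turing_le A (atomic_diagram N)" if "isomorphic N M" for N
    using coding[OF isomorphic_trans[OF that M(1)]] X by blast
  have refl: "isomorphic M M" using isomorphic_trans[OF M(1) isomorphic_sym[OF M(1)]] .
  have "structure_degree M = d"
    unfolding structure_degree_def d turing_degree_def
    by (rule equiv_class_eq[OF equiv_turing_equiv]) (use M(2) lower[OF refl] in \<open>simp add: turing_equiv_def\<close>)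
  then have "iso_type_has_degree M d"
    unfolding iso_type_has_degree_def using refl lower by (auto simp: d structure_degree_def degree_le_iff)
  then show "\<exists>X (M :: nat rs_structure). isomorphic M (S X) \<and> iso_type_has_degree M d" using M(1) by blast
next
  obtain X D D' where X: "ce_in X D" "ce_in X D'" "\<And>B. turing_le B D \<Longrightarrow> turing_le B D' \<Longrightarrow> \<not> ce_in X B"
    by (rule enumerations_without_least_degree) blast
  obtain M :: "nat rs_structure" where M: "isomorphic M (S X)" "turing_le (atomic_diagram M) D" using copy[OF X(1)] by blast
  obtain M' :: "nat rs_structure" where M': "isomorphic M' (S X)" "turing_le (atomic_diagram M') D'" using copy[OF X(2)] by blast
  have iso: "isomorphic M M" "isomorphic M' M"
    using isomorphic_trans[OF M(1) isomorphic_sym[OF M(1)]] isomorphic_trans[OF M'(1) isomorphic_sym[OF M(1)]] .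
  have "\<not> iso_type_has_degree M d" for d
  proof
    assume d: "iso_type_has_degree M d"
    then obtain N :: "nat rs_structure" where N: "isomorphic N M" "structure_degree N = d"
      unfolding iso_type_has_degree_def by blast
    \<comment> \<open>A copy of least degree would be computable from both enumerations and yet, by
      \<open>coding\<close>, enumerate \<open>X\<close>.\<close>
    have "turing_le (atomic_diagram N) (atomic_diagram K)" if "isomorphic K M" for K
      using d that N(2) unfolding iso_type_has_degree_def structure_degree_def by (metis degree_le_iff)
    then have "turing_le (atomic_diagram N) D" "turing_le (atomic_diagram N) D'"
      using iso M(2) M'(2) turing_le_trans by blast+
    then show False using X(3) coding[OF isomorphic_trans[OF N(1) M(1)]] by blast
  qed
  then show "\<exists>X (M :: nat rs_structure). isomorphic M (S X) \<and> \<not> (\<exists>d\<in>turing_degrees. iso_type_has_degree M d)"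
    using M(1) by blast
qed

theorem theorem5p31:
  fixes \<nu> :: "'k::alg_closed_field \<Rightarrow> nat"
    and \<phi> :: "nat \<Rightarrow> 'k"
    and n :: nat
    and V :: "(nat \<Rightarrow> 'k) set"
    and \<iota> :: "'k mpoly set \<Rightarrow> 'f::field"
  assumes "computable_field \<nu>"
    and "computable_listing \<nu> \<phi>"
    and "n \<ge> 1"
    and "admissible_variety n V"
    and "fraction_field_of (coordinate_ring n V) \<iota>"
  shows "(\<forall>d\<in>turing_degrees. \<exists>M\<in>scheme_class n V \<iota> \<phi>. iso_type_has_degree M d) \<and>
    (\<exists>M\<in>scheme_class n V \<iota> \<phi>. \<not> (\<exists>d\<in>turing_degrees. iso_type_has_degree M d))"
proof -
  obtain Fp :: "'k mpoly poly" where Fp: "\<And>i. coeff Fp i \<in> polys_in {1..n}" "monic_irreducible Fp"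
    "\<And>j c. j \<in> {1..n} \<Longrightarrow> monic_irreducible (map_poly (msubst j c) Fp)"
    "V = zero_set n (poly Fp (Var 0))"
    by (rule admissible_polynomial[OF assms(4,3)]) blast
  obtain \<Psi> :: "'k mpoly \<Rightarrow> 'f" where \<Psi>: "comm_ring_hom \<Psi>"
    "\<And>p. p \<in> polys_in {0..n} \<Longrightarrow> poly_to_field n V \<iota> p = \<Psi> p"
    "\<And>p. p \<in> polys_in {0..n} \<Longrightarrow> \<Psi> p = 0 \<longleftrightarrow> (\<forall>a\<in>V. meval a p = 0)"
    "\<And>y. \<exists>p\<in>polys_in {0..n}. \<exists>q\<in>polys_in {0..n}. \<Psi> q \<noteq> 0 \<and> y = \<Psi> p / \<Psi> q"
    by (rule fraction_field_evaluation[OF assms(5)]) blast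
  obtain addk mulk :: "nat \<Rightarrow> nat \<Rightarrow> nat"
    where num: "\<And>D. computable D (\<lambda>p. addk (fst p) (snd p))" "\<And>D. computable D (\<lambda>p. mulk (fst p) (snd p))"
    "\<And>i j. \<phi> (Suc (addk i j)) = \<phi> (Suc i) + \<phi> (Suc j)" "\<And>i j. \<phi> (Suc (mulk i j)) = \<phi> (Suc i) * \<phi> (Suc j)"
    "\<And>D. decidable D (\<lambda>p. \<phi> (Suc (fst p)) = \<phi> (Suc (snd p)))"
    "\<And>x. \<exists>i. \<phi> (Suc i) = x"
    by (rule computable_field_numbering[OF assms(1,2)]) blast
  have "variety n Fp \<Psi>"
    by (rule variety.intro) (fact assms(3) Fp \<Psi>[unfolded Fp(4)])+
  \<comment> \<open>Numbers name constants from \<open>0\<close> on, whereas the listing starts at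
    \<open>1\<close>.\<close>
  moreover have "numbered_field (\<lambda>i. \<phi> (Suc i)) addk mulk"
    by (rule numbered_field.intro) (fact num)+
  ultimately interpret scheme_copy n Fp \<Psi> "\<lambda>i. \<phi> (Suc i)" addk mulk
    by (intro scheme_copy.intro numbered_alg_closed.intro)
  have "\<phi> ` {0<..} = UNIV" using assms(2) by (simp add: computable_listing_def)
  note R_bar = R_bar_eq[OF \<Psi>(2) this]
  have member: "M \<in> scheme_class n V \<iota> \<phi>" if "isomorphic M (spec_structure (P.B (primes_of X)))" for M X
    unfolding scheme_class_def
    by (intro CollectI exI[of _ "{i. 0 < i \<and> \<phi> i \<in> remaining X}"]) (use that R_bar[of X] in auto)
  note degrees = degrees_of_isomorphism_types[of "\<lambda>X. spec_structure (P.B (primes_of X))",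
      OF copy_from_enumeration coding]
  show ?thesis using degrees member by blast
qed

end
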